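(* Let $n\ge1$ and $\lambda>n$. The operator $R_\lambda=S_\lambda^*U:L^2(\mathscr{S}_n,\widehat{v}_\lambda)\to L^2(\Omega_n)$ is a partial isometry with initial space $\mathcal{A}^2_\lambda(\mathscr{S}_n)$ and final space $L^2(\Omega_n)$. In particular, its adjoint $R_\lambda^*:L^2(\Omega_n)\to L^2(\mathscr{S}_n,\widehat{v}_\lambda)$ is an isometry onto $\mathcal{A}^2_\lambda(\mathscr{S}_n)$. Furthermore, \[ (R_\lambda^*(f))(Z)=\frac{1}{\Gamma_{\Omega_n}(\lambda)^{\frac12}}\int_{\Omega_n}f(\xi)\det(\xi)^{\frac{\lambda}{2}-\frac{n+1}{4}}e^{i\,\mathrm{tr}(\xi Z)}\,d\xi, \] for every $f\in L^2(\Omega_n)$ and $Z\in\mathscr{S}_n$.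
   Context: $\mathscr{S}_n=\{Z\in\mathrm{Symm}(n,\mathbb{C}) : \mathrm{Im}(Z)>0\}=\mathrm{Symm}(n,\mathbb{R})\oplus i\Omega_n$, where $\Omega_n$ is the cone of positive definite real symmetric $n\times n$ matrices. $\mathrm{Symm}(n,\mathbb{R})$ carries the inner product $\langle A,B\rangle=\mathrm{tr}(AB)$, and $dX,dY,d\xi$ denote the Lebesgue measure normalized with respect to it; $L^2(\Omega_n)$ is taken with respect to it. $\Gamma_{\Omega_n}(\lambda)=(2\pi)^{\frac{n(n-1)}{4}}\prod_{j=1}^n\Gamma\big(\lambda-\frac{j-1}{2}\big)$ for $\lambda>(n-1)/2$. For $\lambda>n$, with $Z=X+iY$, $d\widehat{v}_\lambda(Z)=C_{\lambda,n}\det(2Y)^{\lambda-n-1}dX\,dY$ on $\mathscr{S}_n$, $C_{\lambda,n}=\Gamma_{\Omega_n}(\lambda)\big/\big(\pi^{\frac{n(n+1)}{2}}\Gamma_{\Omega_n}(\lambda-\frac{n+1}{2})\big)$. $\mathcal{A}^2_\lambda(\mathscr{S}_n)$ is the closed subspace of holomorphic functions in $L^2(\mathscr{S}_n,\widehat{v}_\lambda)$. $U=\mathcal{F}\otimes I$ on $L^2(\mathscr{S}_n,\widehat{v}_\lambda)\simeq L^2(\mathrm{Symm}(n,\mathbb{R}),dX)\otimes L^2(\Omega_n,C_{\lambda,n}\det(2Y)^{\lambda-n-1}dY)$, where $\mathcal{F}$ is the unitary Fourier transform $(\mathcal{F}f)(X)=(2\pi)^{-\frac{n(n+1)}{4}}\int_{\mathrm{Symm}(n,\mathbb{R})}e^{-i\mathrm{tr}(X\xi)}f(\xi)\,d\xi$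 (for $f\in L^1\cap L^2$). $S_\lambda$ is the operator from $L^2(\Omega_n)$ to the same tensor product given by $(S_\lambda f)(X,Y)=\frac{(2\pi)^{n(n+1)/4}}{\Gamma_{\Omega_n}(\lambda)^{1/2}}\chi_{\Omega_n}(X)f(X)\det(X)^{\frac{\lambda}{2}-\frac{n+1}{4}}e^{-\mathrm{tr}(XY)}$, and $S_\lambda^*$ is its adjoint. *)

theory Defs
  imports "HOL-Analysis.Analysis"
begin

subsection \<open>The Euclidean space of real symmetric matrices\<close>

text \<open>
  A type of its own, with inner product tr(AB): \<open>lborel\<close> on a Euclidean space gives
  volume one to the unit cube on an orthonormal basis, hence is here the Lebesgue measure
  normalized with respect to tr(AB).
\<close>

typedef 'n symmat = "{A :: real^('n::finite)^'n. transpose A = A}"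
  morphisms mat_of Symmat
proof
  show "mat 0 \<in> {A :: real^'n^'n. transpose A = A}" by (simp add: vec_eq_iff transpose_def mat_def)
qed

lemma mat_of_sym: "transpose (mat_of A) = mat_of A"
  using mat_of[of A] by simp

lemma mat_of_nth_sym: "mat_of A $ i $ j = mat_of A $ j $ i"
proof -
  have "transpose (mat_of A) $ i $ j = mat_of A $ i $ j"
    by (simp only: mat_of_sym)
  then show ?thesis by (simp add: transpose_def)
qed

lemma mat_of_Symmat: "transpose A = A \<Longrightarrow> mat_of (Symmat A) = A"
  by (simp add: Symmat_inverse)

lemma symmat_eq_iff: "A = B \<longleftrightarrow> mat_of A = mat_of B"
  by (simp add: mat_of_inject)

instantiation symmat :: (finite) real_inner
begin

definition zero_symmat :: "'a symmat" where "0 = Symmat 0"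
definition plus_symmat :: "'a symmat \<Rightarrow> 'a symmat \<Rightarrow> 'a symmat"
  where "A + B = Symmat (mat_of A + mat_of B)"
definition minus_symmat :: "'a symmat \<Rightarrow> 'a symmat \<Rightarrow> 'a symmat"
  where "A - B = Symmat (mat_of A - mat_of B)"
definition uminus_symmat :: "'a symmat \<Rightarrow> 'a symmat"
  where "- A = Symmat (- mat_of A)"
definition scaleR_symmat :: "real \<Rightarrow> 'a symmat \<Rightarrow> 'a symmat"
  where "r *\<^sub>R A = Symmat (r *\<^sub>R mat_of A)"
definition inner_symmat :: "'a symmat \<Rightarrow> 'a symmat \<Rightarrow> real"
  where "inner A B = trace (mat_of A ** mat_of B)"
definition norm_symmat :: "'a symmat \<Rightarrow> real"
  where "norm (A :: 'a symmat) = sqrt (inner A A)"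
definition sgn_symmat :: "'a symmat \<Rightarrow> 'a symmat"
  where "sgn (A :: 'a symmat) = inverse (norm A) *\<^sub>R A"
definition dist_symmat :: "'a symmat \<Rightarrow> 'a symmat \<Rightarrow> real"
  where "dist (A :: 'a symmat) B = norm (A - B)"
definition uniformity_symmat :: "('a symmat \<times> 'a symmat) filter"
  where "uniformity = (INF e\<in>{0 <..}. principal {(x :: 'a symmat, y). dist x y < e})"
definition open_symmat :: "'a symmat set \<Rightarrow> bool"
  where "open (U :: 'a symmat set) \<longleftrightarrow> (\<forall>x\<in>U. \<forall>\<^sub>F (x', y) in uniformity. x' = x \<longrightarrow> y \<in> U)"

lemma mat_of_arith:
  "mat_of (0 :: 'a symmat) = 0"
  "mat_of (A + B) = mat_of A + mat_of B"
  "mat_of (A - B) = mat_of A - mat_of B"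
  "mat_of (- A) = - mat_of A"
  "mat_of (r *\<^sub>R A) = r *\<^sub>R mat_of A"
  for A B :: "'a symmat"
  unfolding zero_symmat_def plus_symmat_def minus_symmat_def uminus_symmat_def scaleR_symmat_def
  by (rule mat_of_Symmat, simp add: vec_eq_iff transpose_def mat_of_nth_sym)+

lemma inner_symmat_eq: "inner A B = inner (mat_of A) (mat_of B)" for A B :: "'a symmat"
proof -
  have "inner A B = (\<Sum>i\<in>UNIV. \<Sum>k\<in>UNIV. mat_of A $ i $ k * mat_of B $ k $ i)"
    by (simp add: inner_symmat_def trace_def matrix_matrix_mult_def)
  also have "\<dots> = (\<Sum>i\<in>UNIV. \<Sum>k\<in>UNIV. mat_of A $ i $ k * mat_of B $ i $ k)"
    by (intro sum.cong refl) (simp add: mat_of_nth_sym)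
  finally show ?thesis by (simp add: inner_vec_def)
qed

instance
proof
  fix A B C :: "'a symmat" and a b :: real
  show "A + B + C = A + (B + C)" "A + B = B + A" "0 + A = A" "- A + A = 0" "A - B = A + - B"
    "a *\<^sub>R (A + B) = a *\<^sub>R A + a *\<^sub>R B" "(a + b) *\<^sub>R A = a *\<^sub>R A + b *\<^sub>R A"
    "a *\<^sub>R b *\<^sub>R A = (a * b) *\<^sub>R A" "1 *\<^sub>R A = A"
    by (simp_all add: symmat_eq_iff mat_of_arith algebra_simps)
  show "inner A B = inner B A" "inner (A + B) C = inner A C + inner B C"
    "inner (a *\<^sub>R A) B = a * inner A B" "0 \<le> inner A A" "(inner A A = 0) = (A = 0)"
    by (simp_all add: inner_symmat_eq mat_of_arith inner_add_left symmat_eq_iff,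
        rule inner_commute)
qed (rule dist_symmat_def sgn_symmat_def norm_symmat_def uniformity_symmat_def open_symmat_def)+

end

definition symmat_unit :: "'n::finite \<Rightarrow> 'n \<Rightarrow> 'n symmat" where
  "symmat_unit i j =
     Symmat (if i = j then axis i (axis i 1)
             else (1 / sqrt 2) *\<^sub>R (axis i (axis j 1) + axis j (axis i 1)))"

lemma mat_of_symmat_unit:
  "mat_of (symmat_unit i j) =
     (if i = j then axis i (axis i 1)
      else (1 / sqrt 2) *\<^sub>R (axis i (axis j 1) + axis j (axis i 1)))"
  unfolding symmat_unit_def
  by (rule mat_of_Symmat) (auto simp: vec_eq_iff transpose_def axis_def)

lemma symmat_unit_commute: "symmat_unit i j = symmat_unit j i"
  by (auto simp: symmat_unit_def add.commute)

lemma inner_symmat_unit: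
  "inner A (symmat_unit i j) = (if i = j then 1 else sqrt 2) * mat_of A $ i $ j"
proof (cases "i = j")
  case True
  then show ?thesis by (simp add: inner_symmat_eq mat_of_symmat_unit inner_axis)
next
  case False
  have "mat_of A $ j $ i = mat_of A $ i $ j" by (rule mat_of_nth_sym)
  with False have "inner A (symmat_unit i j) = 2 / sqrt 2 * mat_of A $ i $ j"
    by (simp add: inner_symmat_eq mat_of_symmat_unit inner_add_right inner_axis)
  with False show ?thesis by (simp add: real_div_sqrt)
qed

instantiation symmat :: (finite) euclidean_space
begin

definition Basis_symmat :: "'a symmat set"
  where "Basis = range (\<lambda>(i, j). symmat_unit i j)"

instance
proof
  show "(Basis :: 'a symmat set) \<noteq> {}" "finite (Basis :: 'a symmat set)"
    by (simp_all add: Basis_symmat_def)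
next
  fix u v :: "'a symmat"
  assume "u \<in> Basis" "v \<in> Basis"
  then obtain i j k l where u: "u = symmat_unit i j" and v: "v = symmat_unit k l"
    by (auto simp: Basis_symmat_def)
  have *: "symmat_unit k l = symmat_unit i j" if "k = i \<and> l = j \<or> k = j \<and> l = i"
    using that symmat_unit_commute by blast
  have 1: "inner u u = 1"
    by (auto simp: u inner_symmat_unit mat_of_symmat_unit axis_def)
  show "inner u v = (if u = v then 1 else 0)"
  proof (cases "u = v")
    case False
    then have "\<not> (k = i \<and> l = j \<or> k = j \<and> l = i)"
      using * u v by auto
    then have "inner u v = 0"
      by (auto simp: u v inner_symmat_unit mat_of_symmat_unit axis_def)
    with False show ?thesis by simp
  qed (use 1 in simp)
next
  fix A :: "'a symmat"
  have "inner A (symmat_unit i j) = 0 \<longleftrightarrow> mat_of A $ i $ j = 0" for i j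
    by (simp add: inner_symmat_unit)
  then show "(\<forall>u\<in>Basis. inner A u = 0) \<longleftrightarrow> A = 0"
    by (simp add: Basis_symmat_def symmat_eq_iff mat_of_arith vec_eq_iff)
qed

end

subsection \<open>The cone, the Siegel domain and the measures\<close>

definition pos_def_mat :: "real^'n^'n \<Rightarrow> bool" where
  "pos_def_mat A \<longleftrightarrow> (\<forall>v. v \<noteq> 0 \<longrightarrow> 0 < v \<bullet> (A *v v))"

definition pos_cone :: "'n::finite symmat set" where
  "pos_cone = {A. pos_def_mat (mat_of A)}"

abbreviation sdet :: "'n::finite symmat \<Rightarrow> real" where
  "sdet A \<equiv> det (mat_of A)"

abbreviation cmat_of :: "'n::finite symmat \<Rightarrow> complex^'n^'n" where
  "cmat_of A \<equiv> (\<chi> i j. complex_of_real (mat_of A $ i $ j))"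

definition siegel_domain :: "(complex^'n^'n) set" where
  "siegel_domain = {Z. transpose Z = Z \<and> pos_def_mat (\<chi> i j. Im (Z $ i $ j))}"

definition siegel_point :: "'n::finite symmat \<Rightarrow> 'n symmat \<Rightarrow> complex^'n^'n" where
  "siegel_point X Y = (\<chi> i j. Complex (mat_of X $ i $ j) (mat_of Y $ i $ j))"

definition cone_Gamma :: "nat \<Rightarrow> real \<Rightarrow> real" where
  "cone_Gamma n l =
     (2 * pi) powr (real n * (real n - 1) / 4) * (\<Prod>j=1..n. Gamma (l - (real j - 1) / 2))"

definition siegel_const :: "nat \<Rightarrow> real \<Rightarrow> real" where
  "siegel_const n l = cone_Gamma n l /
     (pi powr (real n * (real n + 1) / 2) * cone_Gamma n (l - (real n + 1) / 2))"

definition cone_lborel :: "'n::finite symmat measure" where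
  "cone_lborel = restrict_space lborel pos_cone"

definition cone_weighted :: "real \<Rightarrow> 'n::finite symmat measure" where
  "cone_weighted l = density cone_lborel
     (\<lambda>Y. ennreal (siegel_const CARD('n) l * sdet (2 *\<^sub>R Y) powr (l - real CARD('n) - 1)))"

text \<open>The measure dX dY on the Siegel domain.\<close>

definition siegel_lborel :: "(complex^'n^'n::finite) measure" where
  "siegel_lborel = distr (lborel \<Otimes>\<^sub>M cone_lborel) (restrict_space borel siegel_domain)
     (\<lambda>(X, Y). siegel_point X Y)"

definition siegel_measure :: "real \<Rightarrow> (complex^'n^'n::finite) measure" where
  "siegel_measure l = density siegel_lborel
     (\<lambda>Z. ennreal (siegel_const CARD('n) l *
        det (2 *\<^sub>R (\<chi> i j. Im (Z $ i $ j)) :: real^'n^'n) powr (l - real CARD('n) - 1)))"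

subsection \<open>Square-integrable functions and operators between them\<close>

text \<open>
  Elements of an \<open>L\<^sup>2\<close> space are given by representatives. Equality in \<open>L\<^sup>2\<close> is equality almost
  everywhere, and operators act on representatives.
\<close>

definition L2 :: "'a measure \<Rightarrow> ('a \<Rightarrow> complex) set" where
  "L2 M = {f \<in> borel_measurable M. integrable M (\<lambda>x. (cmod (f x))\<^sup>2)}"

definition L2_inner :: "'a measure \<Rightarrow> ('a \<Rightarrow> complex) \<Rightarrow> ('a \<Rightarrow> complex) \<Rightarrow> complex" where
  "L2_inner M f g = (LINT x|M. f x * cnj (g x))"

definition L2_norm :: "'a measure \<Rightarrow> ('a \<Rightarrow> complex) \<Rightarrow> real" where
  "L2_norm M f = sqrt (LINT x|M. (cmod (f x))\<^sup>2)"

definition L2_operator ::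
  "'a measure \<Rightarrow> 'b measure \<Rightarrow> (('a \<Rightarrow> complex) \<Rightarrow> ('b \<Rightarrow> complex)) \<Rightarrow> bool" where
  "L2_operator M N T \<longleftrightarrow>
     (\<forall>f\<in>L2 M. T f \<in> L2 N) \<and>
     (\<forall>f\<in>L2 M. \<forall>g\<in>L2 M. \<forall>a b.
        AE y in N. T (\<lambda>x. a * f x + b * g x) y = a * T f y + b * T g y) \<and>
     (\<exists>K. \<forall>f\<in>L2 M. L2_norm N (T f) \<le> K * L2_norm M f)"

text \<open>The choice is unique up to equality almost everywhere.\<close>

definition L2_adjoint ::
  "'a measure \<Rightarrow> 'b measure \<Rightarrow> (('a \<Rightarrow> complex) \<Rightarrow> ('b \<Rightarrow> complex)) \<Rightarrow>
   (('b \<Rightarrow> complex) \<Rightarrow> ('a \<Rightarrow> complex))" where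
  "L2_adjoint M N T = (\<lambda>g. SOME h. h \<in> L2 M \<and> (\<forall>f\<in>L2 M. L2_inner N (T f) g = L2_inner M f h))"

definition L2_kernel ::
  "'a measure \<Rightarrow> 'b measure \<Rightarrow> (('a \<Rightarrow> complex) \<Rightarrow> ('b \<Rightarrow> complex)) \<Rightarrow> ('a \<Rightarrow> complex) set" where
  "L2_kernel M N T = {f \<in> L2 M. AE y in N. T f y = 0}"

definition L2_range ::
  "'a measure \<Rightarrow> 'b measure \<Rightarrow> (('a \<Rightarrow> complex) \<Rightarrow> ('b \<Rightarrow> complex)) \<Rightarrow> ('b \<Rightarrow> complex) set" where
  "L2_range M N T = {g \<in> L2 N. \<exists>f\<in>L2 M. AE y in N. g y = T f y}"

definition L2_orth :: "'a measure \<Rightarrow> ('a \<Rightarrow> complex) set \<Rightarrow> ('a \<Rightarrow> complex) set" where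
  "L2_orth M V = {f \<in> L2 M. \<forall>g\<in>V. L2_inner M f g = 0}"

definition L2_isometry ::
  "'a measure \<Rightarrow> 'b measure \<Rightarrow> (('a \<Rightarrow> complex) \<Rightarrow> ('b \<Rightarrow> complex)) \<Rightarrow> bool" where
  "L2_isometry M N T \<longleftrightarrow>
     L2_operator M N T \<and> (\<forall>f\<in>L2 M. L2_norm N (T f) = L2_norm M f)"

definition L2_partial_isometry ::
  "'a measure \<Rightarrow> 'b measure \<Rightarrow> (('a \<Rightarrow> complex) \<Rightarrow> ('b \<Rightarrow> complex)) \<Rightarrow>
   ('a \<Rightarrow> complex) set \<Rightarrow> ('b \<Rightarrow> complex) set \<Rightarrow> bool" where
  "L2_partial_isometry M N T I F \<longleftrightarrow>
     L2_operator M N T \<and>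
     (\<forall>f \<in> L2_orth M (L2_kernel M N T). L2_norm N (T f) = L2_norm M f) \<and>
     I = L2_orth M (L2_kernel M N T) \<and>
     F = L2_range M N T"

text \<open>
  The Hilbert space tensor product of the \<open>L\<^sup>2\<close> spaces of two \<open>\<sigma>\<close>-finite measures is \<open>L\<^sup>2\<close> of the
  product measure, and the tensor product of two bounded operators is the bounded operator
  determined (up to equality almost everywhere) by its values on elementary tensors.
\<close>

definition L2_tensor ::
  "'a measure \<Rightarrow> 'b measure \<Rightarrow> (('a \<Rightarrow> complex) \<Rightarrow> ('a \<Rightarrow> complex)) \<Rightarrow>
   (('b \<Rightarrow> complex) \<Rightarrow> ('b \<Rightarrow> complex)) \<Rightarrow> (('a \<times> 'b \<Rightarrow> complex) \<Rightarrow> ('a \<times> 'b \<Rightarrow> complex))" where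
  "L2_tensor M N S T = (SOME W.
     L2_operator (M \<Otimes>\<^sub>M N) (M \<Otimes>\<^sub>M N) W \<and>
     (\<forall>f\<in>L2 M. \<forall>g\<in>L2 N.
        AE z in M \<Otimes>\<^sub>M N. W (\<lambda>(x, y). f x * g y) z = S f (fst z) * T g (snd z)))"

subsection \<open>The weighted Bergman space\<close>

text \<open>
  For a subset of the complex symmetric matrices that is relatively open there (and so for the
  Siegel domain) this is complex differentiability at every point: only the restriction of the
  derivative to the symmetric matrices matters, and a complex linear map on these extends to all
  matrices.
\<close>

definition matrix_holomorphic_on ::
  "(complex^'n^'n::finite \<Rightarrow> complex) \<Rightarrow> (complex^'n^'n) set \<Rightarrow> bool" where
  "matrix_holomorphic_on f S \<longleftrightarrow>
     (\<forall>Z\<in>S. \<exists>D. (f has_derivative D) (at Z within S) \<and>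
        (\<forall>c W. D (\<chi> i j. c * W $ i $ j) = c * D W))"

definition bergman_space :: "real \<Rightarrow> (complex^'n^'n::finite \<Rightarrow> complex) set" where
  "bergman_space l = {f \<in> L2 (siegel_measure l).
     \<exists>h. matrix_holomorphic_on h siegel_domain \<and> (AE Z in siegel_measure l. f Z = h Z)}"

subsection \<open>The operators\<close>

definition fourier_integral :: "('n::finite symmat \<Rightarrow> complex) \<Rightarrow> ('n symmat \<Rightarrow> complex)" where
  "fourier_integral f X =
     of_real ((2 * pi) powr (- (real CARD('n) * (real CARD('n) + 1) / 4))) *
     (LINT \<xi>|lborel. exp (- \<i> * of_real (trace (mat_of X ** mat_of \<xi>))) * f \<xi>)"

text \<open>The bounded extension from \<open>L\<^sup>1 \<inter> L\<^sup>2\<close> to \<open>L\<^sup>2\<close>; unitarity is Plancherel's theorem.\<close>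

definition fourier_L2 :: "('n::finite symmat \<Rightarrow> complex) \<Rightarrow> ('n symmat \<Rightarrow> complex)" where
  "fourier_L2 = (SOME T. L2_operator lborel lborel T \<and>
     (\<forall>f\<in>L2 lborel. integrable lborel f \<longrightarrow> (AE X in lborel. T f X = fourier_integral f X)))"

text \<open>
  The identification of \<open>L\<^sup>2\<close> of the Siegel domain with the tensor product sends \<open>f\<close> to the
  function (X, Y) \<open>\<mapsto>\<close> f(X + iY).
\<close>

definition U_op ::
  "real \<Rightarrow> (complex^'n^'n::finite \<Rightarrow> complex) \<Rightarrow> ('n symmat \<times> 'n symmat \<Rightarrow> complex)" where
  "U_op l f = L2_tensor lborel (cone_weighted l) fourier_L2 (\<lambda>g. g)
     (\<lambda>(X, Y). f (siegel_point X Y))"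

definition S_op ::
  "real \<Rightarrow> ('n::finite symmat \<Rightarrow> complex) \<Rightarrow> ('n symmat \<times> 'n symmat \<Rightarrow> complex)" where
  "S_op l f = (\<lambda>(X, Y).
     of_real ((2 * pi) powr (real CARD('n) * (real CARD('n) + 1) / 4) /
              sqrt (cone_Gamma CARD('n) l)) *
     indicator pos_cone X * f X *
     of_real (sdet X powr (l / 2 - (real CARD('n) + 1) / 4) *
              exp (- trace (mat_of X ** mat_of Y))))"

definition R_op :: "real \<Rightarrow> (complex^'n^'n::finite \<Rightarrow> complex) \<Rightarrow> ('n symmat \<Rightarrow> complex)" where
  "R_op l f = L2_adjoint cone_lborel (lborel \<Otimes>\<^sub>M cone_weighted l) (S_op l) (U_op l f)"

definition R_adj :: "real \<Rightarrow> ('n::finite symmat \<Rightarrow> complex) \<Rightarrow> (complex^'n^'n \<Rightarrow> complex)" where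
  "R_adj l = L2_adjoint (siegel_measure l) cone_lborel (R_op l)"

definition R_adj_integrand ::
  "real \<Rightarrow> ('n::finite symmat \<Rightarrow> complex) \<Rightarrow> complex^'n^'n \<Rightarrow> 'n symmat \<Rightarrow> complex" where
  "R_adj_integrand l f Z \<xi> =
     f \<xi> * of_real (sdet \<xi> powr (l / 2 - (real CARD('n) + 1) / 4)) *
     exp (\<i> * trace (cmat_of \<xi> ** Z))"

definition R_adj_integral ::
  "real \<Rightarrow> ('n::finite symmat \<Rightarrow> complex) \<Rightarrow> complex^'n^'n \<Rightarrow> complex" where
  "R_adj_integral l f Z =
     of_real (1 / sqrt (cone_Gamma CARD('n) l)) * (LINT \<xi>|cone_lborel. R_adj_integrand l f Z \<xi>)"

end

theory Submission
  imports Defs "HOL-Probability.Probability" "HOL-Complex_Analysis.Complex_Analysis"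
begin

text \<open>
  Put \<open>Z = X + \<i> Y\<close>. For fixed \<open>Y\<close>, the integral in the theorem is the inverse Fourier transform in \<open>X\<close>
  of \<open>S\<^sub>\<lambda> f\<close>. The integral of \<open>exp (- 2 tr (\<xi> Y))\<close> against the weight in \<open>Y\<close>, computed by Gaussian
  elimination, is a multiple of a power of \<open>det \<xi>\<close> for \<open>\<xi>\<close> in the cone and infinite elsewhere. So \<open>S\<^sub>\<lambda>\<close>
  is isometric, and by Plancherel's theorem the integral defines an isometry \<open>J\<close> of which \<open>R\<^sub>\<lambda>\<close> is
  the adjoint. Hence \<open>R\<^sub>\<lambda>\<close> is a partial isometry whose initial space is the range of \<open>J\<close>, and \<open>J f\<close> is
  holomorphic by differentiation under the integral.

  Conversely, let \<open>f\<close> be holomorphic and square-integrable. The mean value inequality bounds \<open>f\<close> on a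
  tube around each \<open>Y\<close>, so the integral of \<open>f (X + \<i> Y) exp (- \<i> tr (Z \<xi>) - \<epsilon> tr (Z Z))\<close> over \<open>X\<close> does not
  depend on \<open>Y\<close>. As \<open>\<epsilon>\<close> tends to 0, the Fourier transforms of the slices of \<open>f\<close> turn out to be
  \<open>\<phi>(\<xi>) exp (- tr (\<xi> Y))\<close> for a single function \<open>\<phi>\<close>. Since \<open>f\<close> has finite norm and the integral above
  diverges off the cone, \<open>\<phi>\<close> vanishes there; so this function is \<open>S\<^sub>\<lambda> g\<close> for some \<open>g\<close>, and \<open>f = J g\<close>.
\<close>

section \<open>Square-integrable functions\<close>

text \<open>The operators of the statement are chosen functions: the Fourier transform on L2, the
  tensor product and the adjoints are each picked by \<open>SOME\<close>, act on representatives and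
  are determined only almost everywhere. So each choice first needs a witness, and after that only
  its characterising property may be used. This dictates the form of the lemmas. \<open>R_op\<close>
  is handled through its pairing with \<open>J\<close>, and the tensor product through its pairing
  with functions whose slices are integrable, for which the partial transform is an honest integral;
  the functions \<open>S_op l g\<close> are of this kind. For the transform itself the facts in use
  are isometry and the multiplication formula; accordingly \<open>f = J g\<close> is obtained by
  comparing norms with an inner product.

  In the converse, the bound on a tube gives no decay in \<open>X\<close>. The factor with
  \<epsilon> supplies it and is itself holomorphic in \<open>Z\<close>, so the contour may still be
  shifted. Computing with extended nonnegative integrals turns divergence off the cone into an
  equation (value \<open>top\<close>), from which the support condition is read off.\<close>

lemma borel_measurable_cnj [measurable (raw)]:
  "f \<in> borel_measurable M \<Longrightarrow> (\<lambda>x. cnj (f x)) \<in> borel_measurable M"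
  by (rule measurable_compose[OF _ borel_measurable_continuous_onI]) (auto intro: continuous_intros)

section \<open>Norm, inner product and convergence on representatives\<close>

lemma L2D:
  assumes "f \<in> L2 M"
  shows L2_measurable: "f \<in> borel_measurable M"
    and L2_integrable: "integrable M (\<lambda>x. (cmod (f x))\<^sup>2)"
  using assms by (auto simp: L2_def)

lemma L2_I_nn:
  assumes "f \<in> borel_measurable M" "(\<integral>\<^sup>+x. ennreal ((cmod (f x))\<^sup>2) \<partial>M) < \<infinity>"
  shows "f \<in> L2 M"
  using assms unfolding L2_def by (auto intro!: integrableI_nonneg)

lemma L2_norm_nonneg [simp]: "0 \<le> L2_norm M f"
  by (simp add: L2_norm_def)

lemma L2_norm_sq: "(L2_norm M f)\<^sup>2 = (LINT x|M. (cmod (f x))\<^sup>2)"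
  by (simp add: L2_norm_def)

lemma L2_nn_integral:
  assumes "f \<in> L2 M"
  shows "(\<integral>\<^sup>+x. ennreal ((cmod (f x))\<^sup>2) \<partial>M) = ennreal ((L2_norm M f)\<^sup>2)"
  unfolding L2_norm_sq using L2_integrable[OF assms] by (intro nn_integral_eq_integral) auto

lemma L2_I_nn_le:
  assumes "f \<in> borel_measurable M" "(\<integral>\<^sup>+x. ennreal ((cmod (f x))\<^sup>2) \<partial>M) \<le> ennreal (c\<^sup>2)" "0 \<le> c"
  shows "f \<in> L2 M" "L2_norm M f \<le> c"
proof -
  show f: "f \<in> L2 M"
    using assms by (intro L2_I_nn) (auto intro: order.strict_trans1)
  have "ennreal ((L2_norm M f)\<^sup>2) \<le> ennreal (c\<^sup>2)"
    using assms(2) L2_nn_integral[OF f] by simp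
  then have "(L2_norm M f)\<^sup>2 \<le> c\<^sup>2" by (simp add: ennreal_le_iff)
  then show "L2_norm M f \<le> c" using assms(3) by (rule power2_le_imp_le)
qed

lemma L2_cong_AE:
  assumes "f \<in> L2 M" "g \<in> borel_measurable M" "AE x in M. f x = g x"
  shows "g \<in> L2 M"
proof -
  have "(\<integral>\<^sup>+x. ennreal ((cmod (g x))\<^sup>2) \<partial>M) = (\<integral>\<^sup>+x. ennreal ((cmod (f x))\<^sup>2) \<partial>M)"
    using assms(3) by (intro nn_integral_cong_AE) auto
  then show ?thesis using assms L2_nn_integral[OF assms(1)] by (intro L2_I_nn) auto
qed

lemma L2_norm_cong_AE:
  assumes "f \<in> borel_measurable M" "g \<in> borel_measurable M" "AE x in M. f x = g x"
  shows "L2_norm M f = L2_norm M g"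
  unfolding L2_norm_def using assms
  by (intro arg_cong[where f=sqrt] integral_cong_AE) auto

lemma L2_inner_cong_AE:
  assumes "f \<in> borel_measurable M" "g \<in> borel_measurable M" "AE x in M. f x = g x" "h \<in> borel_measurable M"
  shows "L2_inner M f h = L2_inner M g h"
  unfolding L2_inner_def using assms by (intro integral_cong_AE) auto

lemma L2_mult_integrable:
  assumes "f \<in> L2 M" "g \<in> L2 M"
  shows "integrable M (\<lambda>x. f x * cnj (g x))"
proof (rule Bochner_Integration.integrable_bound)
  note [measurable] = L2_measurable[OF assms(1)] L2_measurable[OF assms(2)]
  show "integrable M (\<lambda>x. (cmod (f x))\<^sup>2 + (cmod (g x))\<^sup>2)"
    using assms[THEN L2_integrable] by simp
  show "(\<lambda>x. f x * cnj (g x)) \<in> borel_measurable M" by measurable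
  have "a * b \<le> a\<^sup>2 + b\<^sup>2" if "0 \<le> a" "0 \<le> b" for a b :: real
    using sum_squares_bound[of a b] that by (auto intro: order_trans[of _ "2*a*b"])
  then show "AE x in M. norm (f x * cnj (g x)) \<le> norm ((cmod (f x))\<^sup>2 + (cmod (g x))\<^sup>2)"
    by (auto simp: norm_mult)
qed

lemma L2_scale:
  assumes "f \<in> L2 M"
  shows "(\<lambda>x. a * f x) \<in> L2 M"
  using assms by (auto simp: L2_def norm_mult power_mult_distrib)

lemma L2_norm_scale: "L2_norm M (\<lambda>x. a * f x) = cmod a * L2_norm M f"
  by (simp add: L2_norm_def norm_mult power_mult_distrib real_sqrt_mult)

lemma L2_add:
  assumes "f \<in> L2 M" "g \<in> L2 M"
  shows "(\<lambda>x. f x + g x) \<in> L2 M"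
proof -
  note [measurable] = L2_measurable[OF assms(1)] L2_measurable[OF assms(2)]
  have *: "(cmod (u + v))\<^sup>2 \<le> 2 * (cmod u)\<^sup>2 + 2 * (cmod v)\<^sup>2" for u v
  proof -
    have "(cmod (u + v))\<^sup>2 \<le> (cmod u + cmod v)\<^sup>2" by (intro power_mono norm_triangle_ineq) simp
    also have "\<dots> \<le> 2 * (cmod u)\<^sup>2 + 2 * (cmod v)\<^sup>2"
      using sum_squares_bound[of "cmod u" "cmod v"] by (simp add: power2_sum)
    finally show ?thesis .
  qed
  have "integrable M (\<lambda>x. (cmod (f x + g x))\<^sup>2)"
    by (rule Bochner_Integration.integrable_bound[of _ "\<lambda>x. 2 * (cmod (f x))\<^sup>2 + 2 * (cmod (g x))\<^sup>2"])
      (use assms[THEN L2_integrable] * in auto)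
  then show ?thesis by (simp add: L2_def)
qed

lemma L2_lincomb:
  assumes "f \<in> L2 M" "g \<in> L2 M"
  shows "(\<lambda>x. a * f x + b * g x) \<in> L2 M"
  by (intro L2_add L2_scale assms)

lemma L2_diff:
  assumes "f \<in> L2 M" "g \<in> L2 M"
  shows "(\<lambda>x. f x - g x) \<in> L2 M"
  using L2_lincomb[OF assms, of 1 "-1"] by simp

lemma L2_zero [simp]: "(\<lambda>x. 0) \<in> L2 M"
  by (simp add: L2_def)

lemma L2_norm_zero [simp]: "L2_norm M (\<lambda>x. 0) = 0"
  by (simp add: L2_norm_def)

lemma L2_inner_commute: "L2_inner M g f = cnj (L2_inner M f g)"
  unfolding L2_inner_def by (subst Bochner_Integration.integral_cnj[symmetric]) (simp add: mult.commute)

lemma L2_inner_lincomb_left: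
  assumes "f \<in> L2 M" "g \<in> L2 M" "h \<in> L2 M"
  shows "L2_inner M (\<lambda>x. a * f x + b * g x) h = a * L2_inner M f h + b * L2_inner M g h"
proof -
  have "L2_inner M (\<lambda>x. a * f x + b * g x) h = (LINT x|M. a * (f x * cnj (h x)) + b * (g x * cnj (h x)))"
    by (simp add: L2_inner_def algebra_simps)
  then show ?thesis
    using L2_mult_integrable[OF assms(1,3)] L2_mult_integrable[OF assms(2,3)] by (simp add: L2_inner_def)
qed

lemma L2_inner_lincomb_right:
  assumes "f \<in> L2 M" "g \<in> L2 M" "h \<in> L2 M"
  shows "L2_inner M h (\<lambda>x. a * f x + b * g x) = cnj a * L2_inner M h f + cnj b * L2_inner M h g"
  unfolding L2_inner_commute[of M h] L2_inner_lincomb_left[OF assms]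
  by (simp add: L2_inner_commute[of M h])

lemma L2_inner_diff_left:
  assumes "f \<in> L2 M" "g \<in> L2 M" "h \<in> L2 M"
  shows "L2_inner M (\<lambda>x. f x - g x) h = L2_inner M f h - L2_inner M g h"
  using L2_inner_lincomb_left[OF assms, of 1 "-1"] by simp

lemma L2_inner_diff_right:
  assumes "f \<in> L2 M" "g \<in> L2 M" "h \<in> L2 M"
  shows "L2_inner M h (\<lambda>x. f x - g x) = L2_inner M h f - L2_inner M h g"
  using L2_inner_lincomb_right[OF assms, of 1 "-1"] by simp

lemma L2_inner_self: "L2_inner M f f = of_real ((L2_norm M f)\<^sup>2)"
  unfolding L2_inner_def L2_norm_sq integral_complex_of_real[symmetric]
  by (intro Bochner_Integration.integral_cong refl) (simp add: complex_norm_square[symmetric])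

lemma L2_norm_eq_0_iff:
  assumes "f \<in> L2 M"
  shows "L2_norm M f = 0 \<longleftrightarrow> (AE x in M. f x = 0)"
  using integral_nonneg_eq_0_iff_AE[OF L2_integrable[OF assms]] by (simp add: L2_norm_def)

lemma L2_AE_eq_iff:
  assumes "f \<in> L2 M" "g \<in> L2 M"
  shows "L2_norm M (\<lambda>x. f x - g x) = 0 \<longleftrightarrow> (AE x in M. f x = g x)"
  by (simp add: L2_norm_eq_0_iff[OF L2_diff[OF assms]])

lemma L2_Cauchy_Schwarz_abs:
  assumes "f \<in> L2 M" "g \<in> L2 M"
  shows "(LINT x|M. cmod (f x) * cmod (g x)) \<le> L2_norm M f * L2_norm M g"
proof (cases "L2_norm M f = 0 \<or> L2_norm M g = 0")
  case True
  then have "AE x in M. cmod (f x) * cmod (g x) = 0"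
    using L2_norm_eq_0_iff[OF assms(1)] L2_norm_eq_0_iff[OF assms(2)] by auto
  then have "(LINT x|M. cmod (f x) * cmod (g x)) = 0" by (rule integral_eq_zero_AE)
  then show ?thesis by simp
next
  case False
  define F G where "F = L2_norm M f" and "G = L2_norm M g"
  have pos: "F > 0" "G > 0"
    using False L2_norm_nonneg[of M f] L2_norm_nonneg[of M g] by (auto simp: F_def G_def less_le)
  have i: "integrable M (\<lambda>x. cmod (f x) * cmod (g x))"
    using integrable_norm[OF L2_mult_integrable[OF assms]] by (simp add: norm_mult)
  \<comment> \<open>AM-GM for \<open>a / F\<close> and \<open>b / G\<close>. Both normalised
    functions have squared norm 1, so integrating leaves \<open>F * G\<close>.\<close>
  have ineq: "a * b \<le> F * G / 2 * (a\<^sup>2 / F\<^sup>2 + b\<^sup>2 / G\<^sup>2)" for a b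
  proof -
    have "2 * (a / F) * (b / G) \<le> (a / F)\<^sup>2 + (b / G)\<^sup>2" by (rule sum_squares_bound)
    then have "F * G / 2 * (2 * (a / F) * (b / G)) \<le> F * G / 2 * ((a / F)\<^sup>2 + (b / G)\<^sup>2)"
      using pos by (intro mult_left_mono) auto
    then show ?thesis using pos by (simp add: power_divide)
  qed
  have "(LINT x|M. cmod (f x) * cmod (g x)) \<le>
      (LINT x|M. F * G / 2 * ((cmod (f x))\<^sup>2 / F\<^sup>2 + (cmod (g x))\<^sup>2 / G\<^sup>2))"
    using assms[THEN L2_integrable] i ineq by (intro integral_mono) auto
  also have "\<dots> = F * G / 2 * (F\<^sup>2 / F\<^sup>2 + G\<^sup>2 / G\<^sup>2)"
    using assms[THEN L2_integrable] by (simp add: F_def G_def L2_norm_sq)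
  also have "\<dots> = F * G" using pos by simp
  finally show ?thesis by (simp add: F_def G_def)
qed

lemma L2_Cauchy_Schwarz:
  assumes "f \<in> L2 M" "g \<in> L2 M"
  shows "cmod (L2_inner M f g) \<le> L2_norm M f * L2_norm M g"
proof -
  have "cmod (L2_inner M f g) \<le> (LINT x|M. cmod (f x * cnj (g x)))"
    unfolding L2_inner_def by (rule integral_norm_bound)
  also have "\<dots> \<le> L2_norm M f * L2_norm M g"
    using L2_Cauchy_Schwarz_abs[OF assms] by (simp add: norm_mult)
  finally show ?thesis .
qed

lemma L2_norm_add_sq:
  assumes "f \<in> L2 M" "g \<in> L2 M"
  shows "(L2_norm M (\<lambda>x. f x + g x))\<^sup>2 = (L2_norm M f)\<^sup>2 + (L2_norm M g)\<^sup>2 + 2 * Re (L2_inner M f g)"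
proof -
  have *: "(cmod (u + v))\<^sup>2 = (cmod u)\<^sup>2 + (cmod v)\<^sup>2 + 2 * Re (u * cnj v)" for u v
    unfolding cmod_power2 by (simp add: power2_eq_square algebra_simps)
  show ?thesis
    unfolding L2_norm_sq * using assms[THEN L2_integrable] L2_mult_integrable[OF assms]
    by (simp add: L2_inner_def del: times_complex.sel)
qed

lemma L2_norm_triangle:
  assumes "f \<in> L2 M" "g \<in> L2 M"
  shows "L2_norm M (\<lambda>x. f x + g x) \<le> L2_norm M f + L2_norm M g"
proof (rule power2_le_imp_le)
  have "Re (L2_inner M f g) \<le> L2_norm M f * L2_norm M g"
    using L2_Cauchy_Schwarz[OF assms] complex_Re_le_cmod order_trans by blast
  then show "(L2_norm M (\<lambda>x. f x + g x))\<^sup>2 \<le> (L2_norm M f + L2_norm M g)\<^sup>2"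
    by (simp add: L2_norm_add_sq[OF assms] power2_sum)
qed simp

lemma L2_norm_minus_commute: "L2_norm M (\<lambda>x. f x - g x) = L2_norm M (\<lambda>x. g x - f x)"
  by (simp add: L2_norm_def norm_minus_commute)

lemma L2_norm_triangle_diff:
  assumes "f \<in> L2 M" "g \<in> L2 M" "h \<in> L2 M"
  shows "L2_norm M (\<lambda>x. f x - h x) \<le> L2_norm M (\<lambda>x. f x - g x) + L2_norm M (\<lambda>x. g x - h x)"
  using L2_norm_triangle[OF L2_diff[OF assms(1,2)] L2_diff[OF assms(2,3)]] by simp

lemma L2_norm_diff_abs:
  assumes "f \<in> L2 M" "g \<in> L2 M"
  shows "\<bar>L2_norm M f - L2_norm M g\<bar> \<le> L2_norm M (\<lambda>x. f x - g x)"
proof -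
  have "L2_norm M (\<lambda>x. f x - 0) \<le> L2_norm M (\<lambda>x. f x - g x) + L2_norm M (\<lambda>x. g x - 0)"
    "L2_norm M (\<lambda>x. g x - 0) \<le> L2_norm M (\<lambda>x. g x - f x) + L2_norm M (\<lambda>x. f x - 0)"
    by (intro L2_norm_triangle_diff assms L2_zero)+
  then show ?thesis unfolding L2_norm_minus_commute[of M g f] by simp
qed

lemma L2_norm_tendsto:
  assumes "\<And>k. f k \<in> L2 M" "g \<in> L2 M" "(\<lambda>k. L2_norm M (\<lambda>x. f k x - g x)) \<longlonglongrightarrow> 0"
  shows "(\<lambda>k. L2_norm M (f k)) \<longlonglongrightarrow> L2_norm M g"
  by (rule LIM_zero_cancel, rule tendsto_0_le[OF assms(3), of _ 1])
    (use L2_norm_diff_abs[OF assms(1,2)] in auto)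

lemma L2_inner_tendsto:
  assumes "\<And>k. f k \<in> L2 M" "g \<in> L2 M" "(\<lambda>k. L2_norm M (\<lambda>x. f k x - g x)) \<longlonglongrightarrow> 0" "h \<in> L2 M"
  shows "(\<lambda>k. L2_inner M (f k) h) \<longlonglongrightarrow> L2_inner M g h"
proof (rule LIM_zero_cancel, rule tendsto_0_le[OF assms(3), of _ "L2_norm M h"])
  show "\<forall>\<^sub>F k in sequentially. norm (L2_inner M (f k) h - L2_inner M g h)
      \<le> norm (L2_norm M (\<lambda>x. f k x - g x)) * L2_norm M h"
    using L2_Cauchy_Schwarz[OF L2_diff[OF assms(1,2)] assms(4)]
    by (simp add: L2_inner_diff_left[OF assms(1,2,4), symmetric])
qed

text \<open>The substitute for uniqueness of limits: two representatives of one limit agree only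
  almost everywhere.\<close>

lemma L2_limit_unique:
  assumes "\<And>k. f k \<in> L2 M" "g \<in> L2 M" "h \<in> L2 M"
    "(\<lambda>k. L2_norm M (\<lambda>x. f k x - g x)) \<longlonglongrightarrow> 0" "(\<lambda>k. L2_norm M (\<lambda>x. f k x - h x)) \<longlonglongrightarrow> 0"
  shows "AE x in M. g x = h x"
proof -
  have "(\<lambda>k. L2_norm M (\<lambda>x. f k x - g x) + L2_norm M (\<lambda>x. f k x - h x)) \<longlonglongrightarrow> 0 + 0"
    by (intro tendsto_add assms)
  moreover have "L2_norm M (\<lambda>x. g x - h x) \<le> L2_norm M (\<lambda>x. f k x - g x) + L2_norm M (\<lambda>x. f k x - h x)" for k
    using L2_norm_triangle_diff[OF assms(2,1,3)] by (simp add: L2_norm_minus_commute[of M g])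
  ultimately have "L2_norm M (\<lambda>x. g x - h x) \<le> 0"
    by (intro LIMSEQ_le_const[where X="\<lambda>k. L2_norm M (\<lambda>x. f k x - g x) + L2_norm M (\<lambda>x. f k x - h x)"]) auto
  then have "L2_norm M (\<lambda>x. g x - h x) = 0" by (intro antisym) auto
  then show ?thesis using L2_AE_eq_iff[OF assms(2,3)] by simp
qed

text \<open>Both \<open>f k\<close> and the limit are bounded by \<open>w\<close>, so
  \<open>4 * (w x)\<^sup>2\<close> dominates the squared error and ordinary dominated convergence
  applies to it.\<close>

lemma L2_dominated_convergence:
  assumes [measurable]: "\<And>k. f k \<in> borel_measurable M" "g \<in> borel_measurable M"
    and w: "integrable M (\<lambda>x. (w x)\<^sup>2)"
    and b: "\<And>k. AE x in M. cmod (f k x) \<le> w x"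
    and l: "AE x in M. (\<lambda>k. f k x) \<longlonglongrightarrow> g x"
  shows "g \<in> L2 M" "(\<lambda>k. L2_norm M (\<lambda>x. f k x - g x)) \<longlonglongrightarrow> 0"
proof -
  have "AE x in M. \<forall>k. cmod (f k x) \<le> w x" using b by (simp add: AE_all_countable)
  then have gb: "AE x in M. cmod (g x) \<le> w x"
    using l by eventually_elim (rule LIMSEQ_le_const2, rule tendsto_norm, auto)
  show "g \<in> L2 M"
    unfolding L2_def using gb
    by (auto intro!: Bochner_Integration.integrable_bound[OF w] elim!: eventually_mono power_mono)
  have "(\<lambda>k. LINT x|M. (cmod (f k x - g x))\<^sup>2) \<longlonglongrightarrow> (LINT x|M. 0)"
  proof (rule integral_dominated_convergence[where w="\<lambda>x. 4 * (w x)\<^sup>2"])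
    show "AE x in M. (\<lambda>k. (cmod (f k x - g x))\<^sup>2) \<longlonglongrightarrow> 0"
      using l by eventually_elim (auto intro!: tendsto_eq_intros simp: LIM_zero)
    fix k
    show "AE x in M. norm ((cmod (f k x - g x))\<^sup>2) \<le> 4 * (w x)\<^sup>2"
      using gb b[of k]
    proof eventually_elim
      case (elim x)
      have "cmod (f k x - g x) \<le> cmod (f k x) + cmod (g x)" by (rule norm_triangle_ineq4)
      also have "\<dots> \<le> 2 * w x" using elim by simp
      finally have "(cmod (f k x - g x))\<^sup>2 \<le> (2 * w x)\<^sup>2" by (intro power_mono) auto
      then show ?case by (simp add: power_mult_distrib)
    qed
  qed (use w in auto)
  from tendsto_real_sqrt[OF this] show "(\<lambda>k. L2_norm M (\<lambda>x. f k x - g x)) \<longlonglongrightarrow> 0"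
    by (simp add: L2_norm_def)
qed

text \<open>Each term is at most a constant times a power of \<open>sqrt (1/2)\<close>. With this, a
  finite weighted sum of squares yields absolute convergence.\<close>

lemma summable_of_geometric_square_bound:
  fixes a :: "nat \<Rightarrow> real"
  assumes "\<And>k. 2 ^ k * (a k)\<^sup>2 \<le> C" "\<And>k. 0 \<le> a k"
  shows "summable a"
proof (rule summable_comparison_test')
  show "summable (\<lambda>k. sqrt C * sqrt (1/2) ^ k)"
    by (intro summable_mult summable_geometric) simp
  fix k :: nat
  have "(a k)\<^sup>2 \<le> C * (1/2) ^ k"
    using assms(1)[of k] by (simp add: power_one_over field_simps)
  then have "sqrt ((a k)\<^sup>2) \<le> sqrt (C * (1/2) ^ k)" by (rule real_sqrt_le_mono)
  also have "sqrt (C * (1/2) ^ k) = sqrt C * sqrt (1/2) ^ k"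
    by (simp only: real_sqrt_mult real_sqrt_power)
  finally show "norm (a k) \<le> sqrt C * sqrt (1/2) ^ k" by simp
qed

text \<open>Completeness for rapidly Cauchy sequences, to which an approximating sequence can always
  be thinned out. The weights \<open>2 ^ k\<close> keep the argument within integrals of squares:
  the weighted sum of squared differences has finite integral, hence is finite almost everywhere,
  and this forces pointwise convergence.\<close>

lemma Riesz_Fischer_fast:
  assumes f: "\<And>k. f k \<in> L2 M" and d: "\<And>k. L2_norm M (\<lambda>x. f (Suc k) x - f k x) \<le> (1/4) ^ k"
  shows "\<exists>g\<in>L2 M. (\<lambda>k. L2_norm M (\<lambda>x. f k x - g x)) \<longlonglongrightarrow> 0"
proof -
  note [measurable] = L2_measurable[OF f]
  define h where "h k x = cmod (f (Suc k) x - f k x)" for k x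
  have "(\<integral>\<^sup>+x. (\<Sum>k. ennreal (2 ^ k * (h k x)\<^sup>2)) \<partial>M) = (\<Sum>k. \<integral>\<^sup>+x. ennreal (2 ^ k * (h k x)\<^sup>2) \<partial>M)"
    by (intro nn_integral_suminf) (auto simp: h_def)
  also have "\<dots> \<le> (\<Sum>k. ennreal ((1/8) ^ k))"
  proof (intro suminf_le)
    fix k
    have "(\<integral>\<^sup>+x. ennreal (2 ^ k * (h k x)\<^sup>2) \<partial>M) = ennreal (2 ^ k) * (\<integral>\<^sup>+x. ennreal ((cmod (f (Suc k) x - f k x))\<^sup>2) \<partial>M)"
      by (subst nn_integral_cmult[symmetric]) (auto simp: h_def ennreal_mult)
    also have "\<dots> = ennreal (2 ^ k * (L2_norm M (\<lambda>x. f (Suc k) x - f k x))\<^sup>2)"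
      by (simp add: L2_nn_integral[OF L2_diff[OF f f]] ennreal_mult)
    also have "\<dots> \<le> ennreal (2 ^ k * ((1/4) ^ k)\<^sup>2)"
      using d[of k] by (intro ennreal_leI mult_left_mono power_mono) auto
    also have "2 ^ k * ((1/4) ^ k)\<^sup>2 = (1/8 :: real) ^ k"
      by (simp add: power2_eq_square flip: power_mult_distrib)
    finally show "(\<integral>\<^sup>+x. ennreal (2 ^ k * (h k x)\<^sup>2) \<partial>M) \<le> ennreal ((1/8) ^ k)" .
  qed auto
  also have "\<dots> < \<infinity>"
    by (simp add: suminf_ennreal2 summable_geometric)
  finally have fin: "(\<integral>\<^sup>+x. (\<Sum>k. ennreal (2 ^ k * (h k x)\<^sup>2)) \<partial>M) \<noteq> \<infinity>" by simp
  have "AE x in M. (\<Sum>k. ennreal (2 ^ k * (h k x)\<^sup>2)) \<noteq> \<infinity>"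
    by (rule nn_integral_PInf_AE[OF _ fin]) (unfold h_def, measurable)
  then have conv: "AE x in M. convergent (\<lambda>k. f k x)"
  proof eventually_elim
    case (elim x)
    obtain C where C: "0 \<le> C" "(\<Sum>k. ennreal (2 ^ k * (h k x)\<^sup>2)) = ennreal C"
      by (rule ennreal_cases[of "\<Sum>k. ennreal (2 ^ k * (h k x)\<^sup>2)"])
        (blast, use elim in \<open>simp only: infinity_ennreal_def\<close>)
    have "2 ^ k * (h k x)\<^sup>2 \<le> C" for k
    proof -
      have "F k \<le> suminf F" for F :: "nat \<Rightarrow> ennreal"
        using sum_le_suminf[of F "{k}"] by simp
      then have "ennreal (2 ^ k * (h k x)\<^sup>2) \<le> ennreal C"
        by (rule ord_le_eq_trans) (rule C(2))
      then show ?thesis using C(1) by (rule ennreal_le_iff[THEN iffD1, rotated])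
    qed
    then have "summable (\<lambda>k. h k x)"
      by (rule summable_of_geometric_square_bound) (simp add: h_def)
    then have "summable (\<lambda>k. f (Suc k) x - f k x)"
      unfolding h_def by (rule summable_norm_cancel)
    then have "convergent (\<lambda>n. \<Sum>k<n. f (Suc k) x - f k x)"
      by (rule summable_iff_convergent[THEN iffD1])
    then have "convergent (\<lambda>n. f n x - f 0 x)"
      by (simp add: sum_lessThan_telescope[of "\<lambda>n. f n x"])
    then have "convergent (\<lambda>n. (f n x - f 0 x) + f 0 x)"
      by (intro convergent_add convergent_const)
    then show "convergent (\<lambda>k. f k x)" by simp
  qed
  \<comment> \<open>Where the sequence diverges \<open>lim\<close> has an arbitrary value, but this
    happens on a null set and measurability is unaffected.\<close>
  define g where "g x = lim (\<lambda>k. f k x)" for x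
  have [measurable]: "g \<in> borel_measurable M"
    unfolding g_def by measurable
  have fg: "AE x in M. (\<lambda>k. f k x) \<longlonglongrightarrow> g x"
    using conv by eventually_elim (simp add: g_def convergent_LIMSEQ_iff)
  \<comment> \<open>A geometric sum in closed form, with 2 in place of 4/3 in the first term. The
    subtracted term is what makes the induction on \<open>j\<close> close.\<close>
  have far: "L2_norm M (\<lambda>x. f (k + j) x - f k x) \<le> 2 * (1/4) ^ k - 4/3 * (1/4) ^ (k + j)" for k j
  proof (induction j)
    case 0
    then show ?case by simp
  next
    case (Suc j)
    have "L2_norm M (\<lambda>x. f (k + Suc j) x - f k x) \<le>
        L2_norm M (\<lambda>x. f (Suc (k + j)) x - f (k + j) x) + L2_norm M (\<lambda>x. f (k + j) x - f k x)"
      using L2_norm_triangle_diff[OF f[of "Suc (k + j)"] f[of "k + j"] f[of k]] by simp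
    also have "\<dots> \<le> (1/4) ^ (k + j) + (2 * (1/4) ^ k - 4/3 * (1/4) ^ (k + j))"
      by (intro add_mono d Suc)
    also have "\<dots> = 2 * (1/4) ^ k - 4/3 * (1/4) ^ (k + Suc j)" by simp
    finally show ?case .
  qed
  have bd: "(\<lambda>x. f k x - g x) \<in> L2 M" "L2_norm M (\<lambda>x. f k x - g x) \<le> 2 * (1/4) ^ k" for k
  proof -
    have "(\<integral>\<^sup>+x. ennreal ((cmod (f k x - g x))\<^sup>2) \<partial>M) =
        (\<integral>\<^sup>+x. liminf (\<lambda>j. ennreal ((cmod (f (k + j) x - f k x))\<^sup>2)) \<partial>M)"
    proof (rule nn_integral_cong_AE, use fg in eventually_elim)
      case (elim x)
      have "(\<lambda>j. f (j + k) x) \<longlonglongrightarrow> g x" using elim by (rule LIMSEQ_ignore_initial_segment)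
      then have "(\<lambda>j. ennreal ((cmod (f (k + j) x - f k x))\<^sup>2)) \<longlonglongrightarrow> ennreal ((cmod (g x - f k x))\<^sup>2)"
        by (intro tendsto_intros) (simp add: add.commute)
      from lim_imp_Liminf[OF trivial_limit_sequentially this]
      show ?case by (simp only: norm_minus_commute[of "g x"])
    qed
    \<comment> \<open>Fatou's lemma carries the bound, which is uniform in \<open>j\<close>, to the
      limit.\<close>
    also have "\<dots> \<le> liminf (\<lambda>j. \<integral>\<^sup>+x. ennreal ((cmod (f (k + j) x - f k x))\<^sup>2) \<partial>M)"
      by (rule nn_integral_liminf) measurable
    also have "\<dots> \<le> liminf (\<lambda>j::nat. ennreal ((2 * (1/4) ^ k)\<^sup>2))"
    proof (rule Liminf_mono, rule always_eventually, rule allI)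
      fix j
      have "L2_norm M (\<lambda>x. f (k + j) x - f k x) \<le> 2 * (1/4) ^ k"
        by (rule order_trans[OF far]) simp
      then show "(\<integral>\<^sup>+x. ennreal ((cmod (f (k + j) x - f k x))\<^sup>2) \<partial>M) \<le> ennreal ((2 * (1/4) ^ k)\<^sup>2)"
        by (simp only: L2_nn_integral[OF L2_diff[OF f f]]) (intro ennreal_leI power_mono, auto)
    qed
    also have "\<dots> = ennreal ((2 * (1/4) ^ k)\<^sup>2)" by (simp add: Liminf_const)
    finally have *: "(\<integral>\<^sup>+x. ennreal ((cmod (f k x - g x))\<^sup>2) \<partial>M) \<le> ennreal ((2 * (1/4) ^ k)\<^sup>2)" .
    show "(\<lambda>x. f k x - g x) \<in> L2 M" "L2_norm M (\<lambda>x. f k x - g x) \<le> 2 * (1/4) ^ k"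
      by (rule L2_I_nn_le[OF _ *], measurable)+
  qed
  show ?thesis
  proof
    show "g \<in> L2 M" using L2_diff[OF f[of 0] bd(1)[of 0]] by simp
    show "(\<lambda>k. L2_norm M (\<lambda>x. f k x - g x)) \<longlonglongrightarrow> 0"
    proof (rule tendsto_sandwich[where f="\<lambda>_. 0"])
      have "(\<lambda>k. 2 * (1/4) ^ k) \<longlonglongrightarrow> 2 * (0::real)"
        by (intro tendsto_intros LIMSEQ_power_zero) simp
      then show "(\<lambda>k. 2 * (1/4) ^ k) \<longlonglongrightarrow> (0::real)" by simp
    qed (use bd in auto)
  qed
qed

section \<open>Bounded operators on representatives\<close>

lemma L2_operator_lincomb:
  assumes "L2_operator M N T" "f \<in> L2 M" "g \<in> L2 M"
  shows "AE y in N. T (\<lambda>x. a * f x + b * g x) y = a * T f y + b * T g y"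
  using assms unfolding L2_operator_def by blast

lemma L2_operator_L2: "L2_operator M N T \<Longrightarrow> f \<in> L2 M \<Longrightarrow> T f \<in> L2 N"
  unfolding L2_operator_def by blast

lemma L2_operator_bound:
  assumes "L2_operator M N T"
  obtains K where "K \<ge> 0" "\<And>f. f \<in> L2 M \<Longrightarrow> L2_norm N (T f) \<le> K * L2_norm M f"
proof -
  obtain K where K: "\<And>f. f \<in> L2 M \<Longrightarrow> L2_norm N (T f) \<le> K * L2_norm M f"
    using assms unfolding L2_operator_def by blast
  show ?thesis
  proof (rule that[of "max K 0"])
    fix f assume "f \<in> L2 M"
    then show "L2_norm N (T f) \<le> max K 0 * L2_norm M f"
      using K by (intro order_trans[OF K] mult_right_mono) auto
  qed simp
qed

lemma L2_operator_norm_diff: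
  assumes T: "L2_operator M N T" and "f \<in> L2 M" "g \<in> L2 M"
  shows "L2_norm N (\<lambda>y. T f y - T g y) = L2_norm N (T (\<lambda>x. f x - g x))"
proof -
  note [measurable] = L2_measurable[OF L2_operator_L2[OF T assms(2)]] L2_measurable[OF L2_operator_L2[OF T assms(3)]]
    L2_measurable[OF L2_operator_L2[OF T L2_diff[OF assms(2,3)]]]
  show ?thesis
    using L2_operator_lincomb[OF assms, of 1 "-1"] by (intro L2_norm_cong_AE) auto
qed

lemma L2_operator_tendsto:
  assumes T: "L2_operator M N T" and f: "\<And>k. f k \<in> L2 M" and g: "g \<in> L2 M"
    and l: "(\<lambda>k. L2_norm M (\<lambda>x. f k x - g x)) \<longlonglongrightarrow> 0"
  shows "(\<lambda>k. L2_norm N (\<lambda>y. T (f k) y - T g y)) \<longlonglongrightarrow> 0"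
proof -
  obtain K where K: "K \<ge> 0" "\<And>f. f \<in> L2 M \<Longrightarrow> L2_norm N (T f) \<le> K * L2_norm M f"
    using L2_operator_bound[OF T] by blast
  show ?thesis
    by (rule tendsto_0_le[OF l, of _ K])
      (use K(2)[OF L2_diff[OF f g]] in \<open>auto simp: L2_operator_norm_diff[OF T f g] mult.commute\<close>)
qed

text \<open>Boundedness applied to a difference of norm zero. An operator on representatives is not
  by definition a function of classes, so this has to be derived.\<close>

lemma L2_operator_cong_AE:
  assumes T: "L2_operator M N T" and f: "f \<in> L2 M" "g \<in> L2 M" and e: "AE x in M. f x = g x"
  shows "AE y in N. T f y = T g y"
proof -
  obtain K where K: "K \<ge> 0" "\<And>f. f \<in> L2 M \<Longrightarrow> L2_norm N (T f) \<le> K * L2_norm M f"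
    using L2_operator_bound[OF T] by blast
  have "L2_norm N (\<lambda>y. T f y - T g y) \<le> 0"
    using K(2)[OF L2_diff[OF f]] e L2_AE_eq_iff[OF f] by (simp add: L2_operator_norm_diff[OF T f])
  then have "L2_norm N (\<lambda>y. T f y - T g y) = 0" by (intro antisym) auto
  then show ?thesis using L2_AE_eq_iff[OF L2_operator_L2[OF T f(1)] L2_operator_L2[OF T f(2)]] by simp
qed

text \<open>Extension by continuity of a contraction from a dense subspace; it serves both the
  Fourier transform and its partial version. As values are representatives, each limit is selected
  by choice, and linearity and agreement with \<open>T0\<close> hold almost everywhere.\<close>

lemma L2_operator_extension:
  assumes D: "D \<subseteq> L2 M" "\<And>f g a b. f \<in> D \<Longrightarrow> g \<in> D \<Longrightarrow> (\<lambda>x. a * f x + b * g x) \<in> D"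
    and T0: "\<And>f. f \<in> D \<Longrightarrow> T0 f \<in> L2 N" "\<And>f. f \<in> D \<Longrightarrow> L2_norm N (T0 f) \<le> L2_norm M f"
    and lin: "\<And>f g a b. f \<in> D \<Longrightarrow> g \<in> D \<Longrightarrow>
      AE y in N. T0 (\<lambda>x. a * f x + b * g x) y = a * T0 f y + b * T0 g y"
    and dense: "\<And>f. f \<in> L2 M \<Longrightarrow> \<exists>d. (\<forall>k. d k \<in> D) \<and> (\<lambda>k. L2_norm M (\<lambda>x. d k x - f x)) \<longlonglongrightarrow> 0"
  shows "\<exists>T. L2_operator M N T \<and> (\<forall>f\<in>D. AE y in N. T f y = T0 f y)"
proof -
  have T0_diff: "L2_norm N (\<lambda>y. T0 f y - T0 g y) \<le> L2_norm M (\<lambda>x. f x - g x)" if "f \<in> D" "g \<in> D" for f g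
  proof -
    have fg: "(\<lambda>x. f x - g x) \<in> D" using D(2)[OF that, of 1 "-1"] by simp
    have "L2_norm N (\<lambda>y. T0 f y - T0 g y) = L2_norm N (T0 (\<lambda>x. f x - g x))"
      using lin[OF that, of 1 "-1"] L2_measurable[OF T0(1)[OF fg]] L2_measurable[OF T0(1)[OF that(1)]] L2_measurable[OF T0(1)[OF that(2)]]
      by (intro L2_norm_cong_AE) auto
    then show ?thesis using T0(2)[OF fg] by simp
  qed
  have ex: "\<exists>g\<in>L2 N. \<exists>d. (\<forall>k. d k \<in> D) \<and> (\<lambda>k. L2_norm M (\<lambda>x. d k x - f x)) \<longlonglongrightarrow> 0 \<and>
      (\<lambda>k. L2_norm N (\<lambda>y. T0 (d k) y - g y)) \<longlonglongrightarrow> 0" if f: "f \<in> L2 M" for f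
  proof -
    obtain c where c: "\<And>k. c k \<in> D" "(\<lambda>k. L2_norm M (\<lambda>x. c k x - f x)) \<longlonglongrightarrow> 0"
      using dense[OF f] by blast
    \<comment> \<open>Thinning out: distances of at most \<open>(1/4) ^ k / 2\<close> to
      \<open>f\<close> bring consecutive images close enough for
      \<open>Riesz_Fischer_fast\<close>.\<close>
    have "\<exists>j. L2_norm M (\<lambda>x. c j x - f x) \<le> (1/4) ^ k / 2" for k
    proof -
      have "\<forall>\<^sub>F j in sequentially. L2_norm M (\<lambda>x. c j x - f x) < (1/4) ^ k / 2"
        by (rule order_tendstoD(2)[OF c(2)]) simp
      then show ?thesis by (auto simp: eventually_sequentially intro: less_imp_le)
    qed
    then obtain j where j: "\<And>k. L2_norm M (\<lambda>x. c (j k) x - f x) \<le> (1/4) ^ k / 2" by metis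
    define d where "d k = c (j k)" for k
    have dD: "d k \<in> D" and dL: "d k \<in> L2 M" for k using c(1) D(1) by (auto simp: d_def)
    have df: "L2_norm M (\<lambda>x. d k x - f x) \<le> (1/4) ^ k / 2" for k using j by (simp add: d_def)
    have "\<exists>g\<in>L2 N. (\<lambda>k. L2_norm N (\<lambda>y. T0 (d k) y - g y)) \<longlonglongrightarrow> 0"
    proof (rule Riesz_Fischer_fast)
      fix k
      have "L2_norm N (\<lambda>y. T0 (d (Suc k)) y - T0 (d k) y) \<le> L2_norm M (\<lambda>x. d (Suc k) x - d k x)"
        by (rule T0_diff[OF dD dD])
      also have "\<dots> \<le> L2_norm M (\<lambda>x. d (Suc k) x - f x) + L2_norm M (\<lambda>x. f x - d k x)"
        by (rule L2_norm_triangle_diff[OF dL f dL])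
      also have "\<dots> \<le> (1/4) ^ Suc k / 2 + (1/4) ^ k / 2"
        using df unfolding L2_norm_minus_commute[of M f] by (intro add_mono)
      also have "\<dots> \<le> (1/4) ^ k" by simp
      finally show "L2_norm N (\<lambda>y. T0 (d (Suc k)) y - T0 (d k) y) \<le> (1/4) ^ k" .
    qed (rule T0(1)[OF dD])
    then obtain g where "g \<in> L2 N" "(\<lambda>k. L2_norm N (\<lambda>y. T0 (d k) y - g y)) \<longlonglongrightarrow> 0" by blast
    moreover have "(\<lambda>k. L2_norm M (\<lambda>x. d k x - f x)) \<longlonglongrightarrow> 0"
    proof (rule tendsto_sandwich[where f="\<lambda>_. 0"])
      have "(\<lambda>k. (1/4) ^ k / 2) \<longlonglongrightarrow> 0 / (2::real)"
        by (intro tendsto_intros LIMSEQ_power_zero) auto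
      then show "(\<lambda>k. (1/4) ^ k / 2) \<longlonglongrightarrow> (0::real)" by simp
    qed (use df in auto)
    ultimately show ?thesis using dD by blast
  qed
  \<comment> \<open>The relation ties the value to the sequence that produced it, so that one choice
    fixes both.\<close>
  define R where "R f p \<longleftrightarrow> fst p \<in> L2 N \<and> (\<forall>k. snd p k \<in> D) \<and> (\<lambda>k. L2_norm M (\<lambda>x. snd p k x - f x)) \<longlonglongrightarrow> 0 \<and>
      (\<lambda>k. L2_norm N (\<lambda>y. T0 (snd p k) y - fst p y)) \<longlonglongrightarrow> 0" for f p
  have "\<exists>p. R f p" if f: "f \<in> L2 M" for f
  proof -
    from ex[OF f] obtain g d where "R f (g, d)" unfolding R_def fst_conv snd_conv by blast
    then show ?thesis ..
  qed
  then have "\<forall>f\<in>L2 M. \<exists>p. R f p" ..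
  then obtain F where F: "\<forall>f\<in>L2 M. R f (F f)" by (rule bchoice[THEN exE])
  define T d where "T f = fst (F f)" and "d f = snd (F f)" for f
  have T: "\<And>f. f \<in> L2 M \<Longrightarrow> T f \<in> L2 N"
    and d: "\<And>f k. f \<in> L2 M \<Longrightarrow> d f k \<in> D"
    "\<And>f. f \<in> L2 M \<Longrightarrow> (\<lambda>k. L2_norm M (\<lambda>x. d f k x - f x)) \<longlonglongrightarrow> 0"
    "\<And>f. f \<in> L2 M \<Longrightarrow> (\<lambda>k. L2_norm N (\<lambda>y. T0 (d f k) y - T f y)) \<longlonglongrightarrow> 0"
    using F unfolding R_def T_def d_def by blast+
  have dL: "f \<in> L2 M \<Longrightarrow> d f k \<in> L2 M" for f k using d(1) D(1) by blast
  \<comment> \<open>The value does not depend on the approximating sequence, although it was defined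
    with a particular one. Linearity and agreement with \<open>T0\<close> both rest on this.\<close>
  have lim: "(\<lambda>k. L2_norm N (\<lambda>y. T0 (c k) y - T f y)) \<longlonglongrightarrow> 0"
    if f: "f \<in> L2 M" and c: "\<And>k. c k \<in> D" "(\<lambda>k. L2_norm M (\<lambda>x. c k x - f x)) \<longlonglongrightarrow> 0" for f c
  proof (rule tendsto_sandwich[where f="\<lambda>_. 0"])
    have cL: "c k \<in> L2 M" for k using c(1) D(1) by blast
    show "\<forall>\<^sub>F k in sequentially. L2_norm N (\<lambda>y. T0 (c k) y - T f y) \<le>
       (L2_norm M (\<lambda>x. c k x - f x) + L2_norm M (\<lambda>x. d f k x - f x)) + L2_norm N (\<lambda>y. T0 (d f k) y - T f y)"
    proof (rule always_eventually, rule allI)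
      fix k
      have "L2_norm N (\<lambda>y. T0 (c k) y - T f y) \<le> L2_norm N (\<lambda>y. T0 (c k) y - T0 (d f k) y) + L2_norm N (\<lambda>y. T0 (d f k) y - T f y)"
        by (intro L2_norm_triangle_diff T0 T c d f)
      moreover have "L2_norm N (\<lambda>y. T0 (c k) y - T0 (d f k) y) \<le> L2_norm M (\<lambda>x. c k x - d f k x)"
        by (intro T0_diff c d f)
      moreover have "L2_norm M (\<lambda>x. c k x - d f k x) \<le> L2_norm M (\<lambda>x. c k x - f x) + L2_norm M (\<lambda>x. f x - d f k x)"
        by (intro L2_norm_triangle_diff cL dL f)
      ultimately show "L2_norm N (\<lambda>y. T0 (c k) y - T f y) \<le>
       (L2_norm M (\<lambda>x. c k x - f x) + L2_norm M (\<lambda>x. d f k x - f x)) + L2_norm N (\<lambda>y. T0 (d f k) y - T f y)"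
        using L2_norm_minus_commute[of M f "d f k"] by linarith
    qed
    show "(\<lambda>k. (L2_norm M (\<lambda>x. c k x - f x) + L2_norm M (\<lambda>x. d f k x - f x)) + L2_norm N (\<lambda>y. T0 (d f k) y - T f y)) \<longlonglongrightarrow> 0"
      using tendsto_add[OF tendsto_add[OF c(2) d(2)[OF f]] d(3)[OF f]] by simp
  qed auto
  have "L2_operator M N T"
    unfolding L2_operator_def
  proof (intro conjI ballI allI)
    fix f assume "f \<in> L2 M" then show "T f \<in> L2 N" by (rule T)
  next
    fix f g a b assume f: "f \<in> L2 M" and g: "g \<in> L2 M"
    let ?c = "\<lambda>k x. a * d f k x + b * d g k x"
    let ?h = "\<lambda>x. a * f x + b * g x"
    have cD: "?c k \<in> D" for k by (rule D(2)[OF d(1)[OF f] d(1)[OF g]])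
    have cL: "?c k \<in> L2 M" for k by (rule subsetD[OF D(1) cD])
    have hL: "?h \<in> L2 M" by (rule L2_lincomb[OF f g])
    have tri: "L2_norm Q (\<lambda>x. (a * u x + b * v x) - (a * u' x + b * v' x)) \<le>
        cmod a * L2_norm Q (\<lambda>x. u x - u' x) + cmod b * L2_norm Q (\<lambda>x. v x - v' x)"
      if "u \<in> L2 Q" "u' \<in> L2 Q" "v \<in> L2 Q" "v' \<in> L2 Q" for u v u' v' and Q :: "'z measure"
      using L2_norm_triangle[OF L2_scale[OF L2_diff[OF that(1,2)], of a] L2_scale[OF L2_diff[OF that(3,4)], of b]]
      unfolding L2_norm_scale by (simp add: algebra_simps)
    have z: "(\<lambda>k. cmod a * A k + cmod b * B k) \<longlonglongrightarrow> 0" if "A \<longlonglongrightarrow> 0" "B \<longlonglongrightarrow> 0" for A B :: "nat \<Rightarrow> real"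
      using tendsto_add[OF tendsto_mult_left[OF that(1), of "cmod a"] tendsto_mult_left[OF that(2), of "cmod b"]] by simp
    have c1: "(\<lambda>k. L2_norm M (\<lambda>x. ?c k x - ?h x)) \<longlonglongrightarrow> 0"
      by (rule tendsto_sandwich[OF _ _ tendsto_const z[OF d(2)[OF f] d(2)[OF g]]])
        (rule always_eventually, simp, rule always_eventually, rule allI, rule tri[OF dL[OF f] f dL[OF g] g])
    have l1: "(\<lambda>k. L2_norm N (\<lambda>y. T0 (?c k) y - T ?h y)) \<longlonglongrightarrow> 0"
      by (rule lim[OF hL cD c1])
    have Tl: "(\<lambda>y. a * T f y + b * T g y) \<in> L2 N" by (intro L2_lincomb T f g)
    have eqn: "L2_norm N (\<lambda>y. T0 (?c k) y - (a * T f y + b * T g y)) =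
      L2_norm N (\<lambda>y. (a * T0 (d f k) y + b * T0 (d g k) y) - (a * T f y + b * T g y))" for k
      using lin[OF d(1)[OF f, of k] d(1)[OF g, of k], of a b]
        L2_measurable[OF L2_diff[OF T0(1)[OF cD] Tl]] L2_measurable[OF L2_diff[OF L2_lincomb[OF T0(1)[OF d(1)[OF f]] T0(1)[OF d(1)[OF g]]] Tl]]
      by (intro L2_norm_cong_AE) auto
    have l2: "(\<lambda>k. L2_norm N (\<lambda>y. T0 (?c k) y - (a * T f y + b * T g y))) \<longlonglongrightarrow> 0"
      unfolding eqn
      by (rule tendsto_sandwich[OF _ _ tendsto_const z[OF d(3)[OF f] d(3)[OF g]]])
        (rule always_eventually, simp, rule always_eventually, rule allI,
         rule tri[OF T0(1)[OF d(1)[OF f]] T[OF f] T0(1)[OF d(1)[OF g]] T[OF g]])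
    show "AE y in N. T ?h y = a * T f y + b * T g y"
      by (rule L2_limit_unique[OF T0(1)[OF cD] T[OF hL] Tl l1 l2])
  next
    have "L2_norm N (T f) \<le> 1 * L2_norm M f" if f: "f \<in> L2 M" for f
    proof (rule LIMSEQ_le)
      show "(\<lambda>k. L2_norm N (T0 (d f k))) \<longlonglongrightarrow> L2_norm N (T f)"
        by (rule L2_norm_tendsto[OF T0(1)[OF d(1)[OF f]] T[OF f] d(3)[OF f]])
      show "(\<lambda>k. L2_norm M (d f k)) \<longlonglongrightarrow> 1 * L2_norm M f"
        using L2_norm_tendsto[OF dL[OF f] f d(2)[OF f]] by simp
    qed (use T0(2)[OF d(1)[OF f]] in auto)
    then show "\<exists>K. \<forall>f\<in>L2 M. L2_norm N (T f) \<le> K * L2_norm M f" by blast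
  qed
  moreover have "AE y in N. T f y = T0 f y" if f: "f \<in> D" for f
  proof -
    have fL: "f \<in> L2 M" using f D by blast
    show ?thesis
      by (rule L2_limit_unique[OF T0(1)[OF f] T[OF fL] T0(1)[OF f] lim[OF fL, of "\<lambda>_. f"]]) (use f in simp_all)
  qed
  ultimately show ?thesis by blast
qed

section \<open>Truncation and induction over square-integrable functions\<close>

lemma L2_indicator:
  assumes "A \<in> sets M" "emeasure M A < \<infinity>"
  shows "(\<lambda>x. indicator A x) \<in> L2 M"
proof -
  have "(\<lambda>x. (cmod (indicator A x))\<^sup>2) = (\<lambda>x. indicator A x :: real)"
    by (auto simp: indicator_def)
  then show ?thesis using assms by (simp add: L2_def)
qed

lemma L2_times_indicator:
  assumes f: "f \<in> L2 M" and A: "A \<in> sets M"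
  shows "(\<lambda>x. f x * indicator A x) \<in> L2 M"
proof -
  note [measurable] = L2_measurable[OF f] A
  show ?thesis unfolding L2_def
    by (auto intro!: Bochner_Integration.integrable_bound[OF L2_integrable[OF f]] simp: indicator_def)
qed

lemma L2_times_indicator_tendsto:
  assumes f: "f \<in> L2 M" and E: "\<And>k. E k \<in> sets M" "\<And>x. x \<in> space M \<Longrightarrow> \<forall>\<^sub>F k in sequentially. x \<in> E k"
  shows "(\<lambda>k. L2_norm M (\<lambda>x. f x * indicator (E k) x - f x)) \<longlonglongrightarrow> 0"
proof (rule L2_dominated_convergence[where w="\<lambda>x. cmod (f x)"])
  note [measurable] = L2_measurable[OF f] E(1)
  show "f \<in> borel_measurable M" "integrable M (\<lambda>x. (cmod (f x))\<^sup>2)"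
    by (simp_all add: f L2_measurable L2_integrable)
  show "(\<lambda>x. f x * indicator (E k) x) \<in> borel_measurable M" for k by measurable
  show "AE x in M. cmod (f x * indicator (E k) x) \<le> cmod (f x)" for k
    by (auto simp: indicator_def)
  show "AE x in M. (\<lambda>k. f x * indicator (E k) x) \<longlonglongrightarrow> f x"
  proof (rule AE_I2)
    fix x assume "x \<in> space M"
    from E(2)[OF this] have "\<forall>\<^sub>F k in sequentially. f x * indicator (E k) x = f x"
      by eventually_elim simp
    then show "(\<lambda>k. f x * indicator (E k) x) \<longlonglongrightarrow> f x" by (rule tendsto_eventually)
  qed
qed

lemma L2_times_indicator_integrable:
  assumes f: "f \<in> L2 M" and E: "E \<in> sets M" "emeasure M E < \<infinity>"
  shows "integrable M (\<lambda>x. f x * indicator E x)"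
proof -
  have "cnj (indicator E x) = indicator E x" for x by (simp add: indicator_def)
  then show ?thesis using L2_mult_integrable[OF f L2_indicator[OF E]] by simp
qed

text \<open>A monotone class argument: indicators of sets of a \<pi>-system, then of all measurable
  sets, then simple functions and limits. The sets \<open>E k\<close> localise it, since a
  complement need not have finite measure.\<close>

lemma L2_induct [consumes 1, case_names int_stable subset generates finite exhaust basic lincomb limit]:
  assumes f: "f \<in> L2 M"
    and G: "Int_stable G" "G \<subseteq> Pow (space M)" "sets M = sigma_sets (space M) G"
    and fin: "\<And>A. A \<in> G \<Longrightarrow> emeasure M A < \<infinity>"
    and ex: "\<exists>E. (\<forall>k::nat. E k \<in> G) \<and> (\<forall>x\<in>space M. \<forall>\<^sub>F k in sequentially. x \<in> E k)"
    and basic: "\<And>A. A \<in> G \<Longrightarrow> Q (\<lambda>x. indicator A x)"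
    and lincomb: "\<And>f g a b. f \<in> L2 M \<Longrightarrow> g \<in> L2 M \<Longrightarrow> Q f \<Longrightarrow> Q g \<Longrightarrow> Q (\<lambda>x. a * f x + b * g x)"
    and limit: "\<And>f g. (\<And>k. f k \<in> L2 M) \<Longrightarrow> g \<in> L2 M \<Longrightarrow> (\<And>k::nat. Q (f k)) \<Longrightarrow>
      (\<lambda>k. L2_norm M (\<lambda>x. f k x - g x)) \<longlonglongrightarrow> 0 \<Longrightarrow> Q g"
  shows "Q (f :: 'a \<Rightarrow> complex)"
proof -
  obtain E :: "nat \<Rightarrow> 'a set" where E: "\<And>k. E k \<in> G" "\<And>x. x \<in> space M \<Longrightarrow> \<forall>\<^sub>F k in sequentially. x \<in> E k"
    using ex by blast
  have GM: "A \<in> sets M" if "A \<in> G" for A using G(3) that by auto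
  have iL: "(\<lambda>x. indicator (A \<inter> E k) x) \<in> L2 M" if "A \<in> sets M" for A k
  proof (rule L2_indicator)
    show "A \<inter> E k \<in> sets M" using that GM E by auto
    have "emeasure M (A \<inter> E k) \<le> emeasure M (E k)" by (rule emeasure_mono) (use GM E in auto)
    then show "emeasure M (A \<inter> E k) < \<infinity>" using fin[OF E(1)] by (rule le_less_trans)
  qed
  have zero: "Q (\<lambda>x. 0)"
    using lincomb[OF L2_indicator L2_indicator basic basic, of "E 0" "E 0" 0 0] E GM fin by simp
  have sets: "Q (\<lambda>x. indicator (A \<inter> E k) x)" if A: "A \<in> sets M" for A k
    using G(1,2) A[unfolded G(3)]
  proof (induction rule: sigma_sets_induct_disjoint)
    case (basic A)
    then have "A \<inter> E k \<in> G" using G(1) E(1) by (auto simp: Int_stable_def)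
    then show ?case by (rule assms(7))
  next
    case empty
    then show ?case using zero by simp
  next
    case (compl A)
    have A: "A \<in> sets M" using compl G(3) by auto
    have "Q (\<lambda>x. 1 * indicator (E k) x + (-1) * indicator (A \<inter> E k) x)"
      by (rule lincomb[OF L2_indicator[OF GM[OF E(1)] fin[OF E(1)]] iL[OF A] basic[OF E(1)] compl(2)])
    also have "(\<lambda>x. 1 * indicator (E k) x + (-1) * indicator (A \<inter> E k) x) = (\<lambda>x. indicator ((space M - A) \<inter> E k) x :: complex)"
      using G(2) E(1)[of k] by (auto simp: indicator_def fun_eq_iff)
    finally show ?case .
  next
    case (union A)
    have A: "A i \<in> sets M" for i using union G(3) by auto
    \<comment> \<open>Disjointness makes the indicators of partial unions linear combinations; the
      full union is their limit in norm.\<close>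
    have part: "Q (\<lambda>x. indicator ((\<Union>i<n. A i) \<inter> E k) x)" for n
    proof (induction n)
      case 0
      then show ?case using zero by simp
    next
      case (Suc n)
      have "Q (\<lambda>x. 1 * indicator ((\<Union>i<n. A i) \<inter> E k) x + 1 * indicator (A n \<inter> E k) x)"
        by (rule lincomb[OF iL iL Suc union(3)]) (use A in auto)
      also have "(\<lambda>x. 1 * indicator ((\<Union>i<n. A i) \<inter> E k) x + 1 * indicator (A n \<inter> E k) x) = (\<lambda>x. indicator ((\<Union>i<Suc n. A i) \<inter> E k) x :: complex)"
      proof
        fix x
        have "i = j" if "x \<in> A i" "x \<in> A j" for i j
          using union(1) that by (auto simp: disjoint_family_on_def)
        then have "x \<in> A n \<Longrightarrow> x \<notin> (\<Union>i<n. A i)" by blast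
        then show "1 * indicator ((\<Union>i<n. A i) \<inter> E k) x + 1 * indicator (A n \<inter> E k) x = (indicator ((\<Union>i<Suc n. A i) \<inter> E k) x :: complex)"
          by (cases "x \<in> A n"; cases "x \<in> E k") (simp_all add: indicator_def lessThan_Suc)
      qed
      finally show ?case .
    qed
    have UA: "(\<Union>i. A i) \<in> sets M" "(\<Union>i<n. A i) \<in> sets M" for n using A by auto
    show ?case
    proof (rule limit[OF iL iL part])
      show "(\<lambda>n. L2_norm M (\<lambda>x. indicator ((\<Union>i<n. A i) \<inter> E k) x - indicator ((\<Union>i. A i) \<inter> E k) x)) \<longlonglongrightarrow> 0"
      proof (rule L2_dominated_convergence[where w="\<lambda>x. cmod (indicator (E k) x)"])
        have "(\<lambda>x. indicator (E k) x) \<in> L2 M" by (intro L2_indicator GM fin E)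
        then show "integrable M (\<lambda>x. (cmod (indicator (E k) x))\<^sup>2)" by (rule L2_integrable)
        show "AE x in M. (\<lambda>n. indicator ((\<Union>i<n. A i) \<inter> E k) x :: complex) \<longlonglongrightarrow> indicator ((\<Union>i. A i) \<inter> E k) x"
        proof (rule AE_I2)
          fix x
          show "(\<lambda>n. indicator ((\<Union>i<n. A i) \<inter> E k) x :: complex) \<longlonglongrightarrow> indicator ((\<Union>i. A i) \<inter> E k) x"
          proof (cases "\<exists>i. x \<in> A i")
            case True
            then obtain i where i: "x \<in> A i" by blast
            show ?thesis
            proof (rule tendsto_eventually, rule eventually_sequentiallyI)
              fix n assume "Suc i \<le> n"
              then have "x \<in> (\<Union>i<n. A i)" using i by auto
              then show "(indicator ((\<Union>i<n. A i) \<inter> E k) x :: complex) = indicator ((\<Union>i. A i) \<inter> E k) x"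
                using i by (cases "x \<in> E k") (auto simp: indicator_def)
            qed
          next
            case False
            then show ?thesis by simp
          qed
        qed
        show "(\<lambda>x. indicator ((\<Union>i. A i) \<inter> E k) x :: complex) \<in> borel_measurable M"
          "(\<lambda>x. indicator ((\<Union>i<n. A i) \<inter> E k) x :: complex) \<in> borel_measurable M" for n
          using UA GM[OF E(1)] by (intro borel_measurable_indicator sets.Int; simp)+
        show "AE x in M. cmod (indicator ((\<Union>i<n. A i) \<inter> E k) x) \<le> cmod (indicator (E k) x)" for n
          by (intro AE_I2) (auto simp: indicator_def)
      qed
    qed (use UA in auto)
  qed
  have simple: "Q (\<lambda>x. s x * indicator (E k) x) \<and> (\<lambda>x. s x * indicator (E k) x) \<in> L2 M"
    if s: "simple_function M s" for s :: "'a \<Rightarrow> complex" and k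
  proof -
    have fin: "finite (s ` space M)" and pre: "s -` {y} \<inter> space M \<in> sets M" for y
      using simple_functionD[OF s] by auto
    have sum: "Q (\<lambda>x. \<Sum>y\<in>Y. y * indicator ((s -` {y} \<inter> space M) \<inter> E k) x)
        \<and> (\<lambda>x. \<Sum>y\<in>Y. y * indicator ((s -` {y} \<inter> space M) \<inter> E k) x) \<in> L2 M" if "finite Y" for Y
      using that
    proof (induction Y)
      case empty
      then show ?case using zero by simp
    next
      case (insert y Y)
      have "Q (\<lambda>x. y * indicator ((s -` {y} \<inter> space M) \<inter> E k) x + 1 * (\<Sum>y\<in>Y. y * indicator ((s -` {y} \<inter> space M) \<inter> E k) x))"
        by (rule lincomb[OF iL[OF pre] _ sets[OF pre]]) (use insert in auto)
      moreover have "(\<lambda>x. y * indicator ((s -` {y} \<inter> space M) \<inter> E k) x + 1 * (\<Sum>y\<in>Y. y * indicator ((s -` {y} \<inter> space M) \<inter> E k) x)) \<in> L2 M"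
        by (rule L2_lincomb[OF iL[OF pre]]) (use insert in auto)
      ultimately show ?case by (simp only: sum.insert[OF insert(1,2)] mult_1 simp_thms)
    qed
    have "(\<lambda>x. \<Sum>y\<in>s ` space M. y * indicator ((s -` {y} \<inter> space M) \<inter> E k) x) = (\<lambda>x. s x * indicator (E k) x)"
    proof
      fix x
      show "(\<Sum>y\<in>s ` space M. y * indicator ((s -` {y} \<inter> space M) \<inter> E k) x) = s x * indicator (E k) x"
      proof (cases "x \<in> E k")
        case True
        then have x: "x \<in> space M" using E(1) G(2) by blast
        have "(\<Sum>y\<in>s ` space M. y * indicator ((s -` {y} \<inter> space M) \<inter> E k) x) = (\<Sum>y\<in>s ` space M. if y = s x then y else 0)"
        proof (rule sum.cong[OF refl])
          fix y
          show "y * indicator ((s -` {y} \<inter> space M) \<inter> E k) x = (if y = s x then y else 0)"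
            using True x by (cases "y = s x") simp_all
        qed
        also have "\<dots> = s x" using fin x by (subst sum.delta) simp_all
        finally show ?thesis using True by simp
      qed simp
    qed
    then show ?thesis using sum[OF fin] by (simp only:)
  qed
  obtain F where F: "\<And>i. simple_function M (F i)" "\<And>x. x \<in> space M \<Longrightarrow> (\<lambda>i. F i x) \<longlonglongrightarrow> f x"
    "\<And>i x. x \<in> space M \<Longrightarrow> cmod (F i x) \<le> 2 * cmod (f x)"
    using borel_measurable_implies_sequence_metric[OF L2_measurable[OF f], of 0]
    unfolding dist_0_norm dist_commute[of _ "0::complex"] by blast
  note [measurable] = L2_measurable[OF f] borel_measurable_simple_function[OF F(1)] GM[OF E(1)]
  show ?thesis
  proof (rule limit)
    show "Q (\<lambda>x. F i x * indicator (E i) x)" "(\<lambda>x. F i x * indicator (E i) x) \<in> L2 M" for i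
      using simple[OF F(1)] by auto
    show "f \<in> L2 M" by fact
    show "(\<lambda>i. L2_norm M (\<lambda>x. F i x * indicator (E i) x - f x)) \<longlonglongrightarrow> 0"
    proof (rule L2_dominated_convergence[where w="\<lambda>x. 2 * cmod (f x)"])
      show "integrable M (\<lambda>x. (2 * cmod (f x))\<^sup>2)"
        using L2_integrable[OF f] by (simp add: power_mult_distrib)
      show "AE x in M. cmod (F i x * indicator (E i) x) \<le> 2 * cmod (f x)" for i
      proof (rule AE_I2)
        fix x assume "x \<in> space M"
        then show "cmod (F i x * indicator (E i) x) \<le> 2 * cmod (f x)"
          using F(3)[of x i] by (cases "x \<in> E i") simp_all
      qed
      show "AE x in M. (\<lambda>k. F k x * indicator (E k) x) \<longlonglongrightarrow> f x"
      proof (rule AE_I2)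
        fix x assume x: "x \<in> space M"
        have "(\<lambda>k. indicator (E k) x :: complex) \<longlonglongrightarrow> 1"
          using E(2)[OF x] by (intro tendsto_eventually) (auto elim: eventually_mono)
        from tendsto_mult[OF F(2)[OF x] this] show "(\<lambda>k. F k x * indicator (E k) x) \<longlonglongrightarrow> f x" by simp
      qed
    qed measurable
  qed
qed

section \<open>The Fourier transform on a Euclidean space\<close>

text \<open>The sign is a parameter because both directions occur: \<open>s = - 1\<close> is the
  transform of the statement (\<open>fourier_integral_eq_FT\<close>), and \<open>s = 1\<close> turns
  \<open>S_op l g\<close> into the integral of the theorem.\<close>

definition FT :: "real \<Rightarrow> ('a::euclidean_space \<Rightarrow> complex) \<Rightarrow> 'a \<Rightarrow> complex" where
  "FT s f x = of_real ((2 * pi) powr (- (real DIM('a) / 2))) * (LINT y|lborel. cis (s * (x \<bullet> y)) * f y)"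

lemma borel_measurable_cis [measurable (raw)]:
  "f \<in> borel_measurable M \<Longrightarrow> (\<lambda>x. cis (f x)) \<in> borel_measurable M"
  by (rule measurable_compose[OF _ borel_measurable_continuous_onI]) (auto intro: continuous_intros)

lemma borel_measurable_FT [measurable]:
  assumes [measurable]: "f \<in> borel_measurable borel"
  shows "FT s f \<in> borel_measurable borel"
proof -
  have "(\<lambda>x. LINT y|lborel. cis (s * (x \<bullet> y)) * f y) \<in> borel_measurable borel"
    by (rule lborel.borel_measurable_lebesgue_integral) measurable
  then show ?thesis unfolding FT_def by measurable
qed

lemma integrable_kernel:
  fixes f :: "'a \<Rightarrow> complex" and h :: "'b \<Rightarrow> complex"
  assumes M: "sigma_finite_measure M" and N: "sigma_finite_measure N"
    and f: "integrable M f" and h: "integrable N h"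
    and K: "K \<in> borel_measurable (M \<Otimes>\<^sub>M N)" "\<And>z. cmod (K z) \<le> c"
  shows "integrable (M \<Otimes>\<^sub>M N) (\<lambda>(x, y). K (x, y) * (f x * h y))"
proof (rule Bochner_Integration.integrable_bound)
  interpret pair_sigma_finite M N using M N by (rule pair_sigma_finite.intro)
  note [measurable] = borel_measurable_integrable[OF f] borel_measurable_integrable[OF h] K(1)
  have "integrable (M \<Otimes>\<^sub>M N) (\<lambda>(x, y). cmod (f x) * cmod (h y))"
    by (rule Fubini_integrable) (use f h in \<open>auto intro!: AE_I2\<close>)
  then show "integrable (M \<Otimes>\<^sub>M N) (\<lambda>z. c * (\<lambda>(x, y). cmod (f x) * cmod (h y)) z)" by simp
  show "(\<lambda>(x, y). K (x, y) * (f x * h y)) \<in> borel_measurable (M \<Otimes>\<^sub>M N)" by measurable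
  have "0 \<le> c" using K(2) norm_ge_zero order_trans by blast
  then show "AE z in M \<Otimes>\<^sub>M N. norm ((\<lambda>(x, y). K (x, y) * (f x * h y)) z) \<le> norm (c * (\<lambda>(x, y). cmod (f x) * cmod (h y)) z)"
    using K(2) by (auto simp: norm_mult abs_mult intro!: AE_I2 mult_right_mono)
qed

lemmas integral_mult_inward = integral_mult_left_zero[symmetric] integral_mult_right_zero[symmetric]

text \<open>Fubini, with a kernel symmetric in the two variables. This is the duality behind
  Plancherel's theorem and behind every later pairing with a transform.\<close>

lemma FT_multiplication_L1:
  fixes f h :: "'a::euclidean_space \<Rightarrow> complex"
  assumes f: "integrable lborel f" and h: "integrable lborel h"
  shows "(LINT x|lborel. FT s f x * h x) = (LINT y|lborel. f y * FT s h y)"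
proof -
  let ?C = "complex_of_real ((2 * pi) powr (- (real DIM('a) / 2)))"
  have i: "integrable (lborel \<Otimes>\<^sub>M lborel) (\<lambda>(x, y). cis (s * (x \<bullet> y)) * (h x * f y))"
    using integrable_kernel[OF lborel.sigma_finite_measure_axioms lborel.sigma_finite_measure_axioms h f,
        of "\<lambda>(x, y). cis (s * (x \<bullet> y))" 1] by (simp add: split_beta')
  have "(LINT x|lborel. FT s f x * h x) = ?C * (LINT x|lborel. LINT y|lborel. cis (s * (x \<bullet> y)) * (h x * f y))"
    unfolding FT_def by (simp only: integral_mult_inward mult_ac)
  also have "\<dots> = ?C * (LINT y|lborel. LINT x|lborel. cis (s * (x \<bullet> y)) * (h x * f y))"
    using lborel_pair.Fubini_integral[OF i] by simp
  also have "\<dots> = (LINT y|lborel. f y * FT s h y)"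
    unfolding FT_def by (simp only: integral_mult_inward mult_ac inner_commute)
  finally show ?thesis .
qed

section \<open>Gaussian integrals and the heat kernel\<close>

lemma gaussian_FT_real:
  fixes e b :: real
  assumes e: "e > 0"
  shows "(LINT t|lborel. of_real (exp (- e * t\<^sup>2 / 2)) * cis (t * b)) = complex_of_real (sqrt (2 * pi / e) * exp (- b\<^sup>2 / (2 * e)))"
    and "integrable lborel (\<lambda>t. complex_of_real (exp (- e * t\<^sup>2 / 2)) * cis (t * b))"
proof -
  define g where "g t = complex_of_real (exp (- t\<^sup>2 / 2)) * cis (t * (b / sqrt e))" for t
  have s: "sqrt e > 0" "(sqrt e)\<^sup>2 = e" using e by auto
  have "std_normal_density t *\<^sub>R iexp ((b / sqrt e) * t) = (1 / sqrt (2 * pi)) *\<^sub>R g t" for t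
    by (simp add: g_def std_normal_density_def cis_conv_exp scaleR_conv_of_real mult_ac)
  \<comment> \<open>The characteristic function of the standard normal law gives width 1; the
    general width follows from the substitution \<open>sqrt e * t\<close>.\<close>
  then have "char std_normal_distribution (b / sqrt e) = (LINT t|lborel. (1 / sqrt (2 * pi)) *\<^sub>R g t)"
    unfolding char_def by (subst integral_density) (auto simp: normal_density_nonneg)
  then have "(1 / sqrt (2 * pi)) *\<^sub>R (LINT t|lborel. g t) = of_real (exp (- (b / sqrt e)\<^sup>2 / 2))"
    by (simp add: char_std_normal_distribution)
  then have "sqrt (2 * pi) *\<^sub>R (1 / sqrt (2 * pi)) *\<^sub>R (LINT t|lborel. g t) = sqrt (2 * pi) *\<^sub>R of_real (exp (- (b / sqrt e)\<^sup>2 / 2))"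
    by (rule arg_cong)
  then have G: "(LINT t|lborel. g t) = of_real (sqrt (2 * pi) * exp (- b\<^sup>2 / (2 * e)))"
    using s by (simp add: power_divide scaleR_conv_of_real)
  have gi: "integrable lborel g"
  proof (rule Bochner_Integration.integrable_bound)
    have "integrable lborel (\<lambda>t. sqrt (2 * pi) * std_normal_density t)"
      by (intro integrable_mult_right integrable_normal_density) simp
    then show "integrable lborel (\<lambda>t::real. exp (- t\<^sup>2 / 2))" by (simp add: std_normal_density_def)
    show "g \<in> borel_measurable lborel" unfolding g_def by measurable
  qed (auto simp: g_def norm_mult)
  have eq: "g (0 + sqrt e * t) = of_real (exp (- e * t\<^sup>2 / 2)) * cis (t * b)" for t
    using s by (simp add: g_def power_mult_distrib mult_ac)
  have "of_real (sqrt (2 * pi) * exp (- b\<^sup>2 / (2 * e))) = sqrt e *\<^sub>R (LINT t|lborel. of_real (exp (- e * t\<^sup>2 / 2)) * cis (t * b))"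
    using lborel_integral_real_affine[of "sqrt e" g 0] G s unfolding eq by simp
  then have "(1 / sqrt e) *\<^sub>R complex_of_real (sqrt (2 * pi) * exp (- b\<^sup>2 / (2 * e))) = (1 / sqrt e) *\<^sub>R sqrt e *\<^sub>R (LINT t|lborel. of_real (exp (- e * t\<^sup>2 / 2)) * cis (t * b))"
    by (rule arg_cong)
  then show "(LINT t|lborel. of_real (exp (- e * t\<^sup>2 / 2)) * cis (t * b)) = complex_of_real (sqrt (2 * pi / e) * exp (- b\<^sup>2 / (2 * e)))"
    using s by (simp add: scaleR_conv_of_real real_sqrt_divide)
  show "integrable lborel (\<lambda>t. complex_of_real (exp (- e * t\<^sup>2 / 2)) * cis (t * b))"
    using lborel_integrable_real_affine[OF gi, of "sqrt e" 0] s unfolding eq by simp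
qed

text \<open>The measure \<open>lborel\<close> is the image of the product of the one-dimensional
  Lebesgue measures on the coordinates.\<close>

lemma lborel_prod_integral:
  fixes f :: "'a::euclidean_space \<Rightarrow> real \<Rightarrow> complex"
  assumes f: "\<And>b. b \<in> Basis \<Longrightarrow> integrable lborel (f b)"
  shows "(LINT x|lborel. (\<Prod>b\<in>Basis. f b (x \<bullet> b))) = (\<Prod>b\<in>Basis. LINT t|lborel. f b t)"
    and "integrable lborel (\<lambda>x. \<Prod>b\<in>Basis. f b (x \<bullet> b))"
proof -
  interpret product_sigma_finite "\<lambda>_::'a. lborel :: real measure" ..
  have [measurable]: "b \<in> Basis \<Longrightarrow> f b \<in> borel_measurable borel" for b
    using borel_measurable_integrable[OF f[of b]] by simp
  have m: "(\<lambda>w. \<Sum>b\<in>Basis. w b *\<^sub>R b) \<in> (\<Pi>\<^sub>M b\<in>(Basis::'a set). (lborel :: real measure)) \<rightarrow>\<^sub>M borel" by measurable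
  have m2: "(\<lambda>x::'a. \<Prod>b\<in>Basis. f b (x \<bullet> b)) \<in> borel_measurable borel" by measurable
  have eq: "(\<Prod>b\<in>Basis. f b ((\<Sum>c\<in>Basis. w c *\<^sub>R c) \<bullet> b)) = (\<Prod>b\<in>Basis. f b (w b))" for w :: "'a \<Rightarrow> real"
    by (intro prod.cong refl arg_cong2[where f=f]) (simp add: inner_sum_left_Basis)
  show "(LINT x|lborel. (\<Prod>b\<in>Basis. f b (x \<bullet> b))) = (\<Prod>b\<in>Basis. LINT t|lborel. f b t)"
    unfolding lborel_eq[where 'a='a] integral_distr[OF m m2] eq
    by (rule product_integral_prod) (use f in auto)
  show "integrable lborel (\<lambda>x. \<Prod>b\<in>Basis. f b (x \<bullet> b))"
    unfolding lborel_eq[where 'a='a] integrable_distr_eq[OF m m2] eq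
    by (rule product_integrable_prod) (use f in auto)
qed

lemma gaussian_FT:
  fixes z :: "'a::euclidean_space"
  assumes e: "e > 0"
  shows "(LINT x|lborel. of_real (exp (- e * (norm x)\<^sup>2 / 2)) * cis (x \<bullet> z)) =
      complex_of_real ((2 * pi / e) powr (real DIM('a) / 2) * exp (- (norm z)\<^sup>2 / (2 * e)))"
    and "integrable lborel (\<lambda>x. complex_of_real (exp (- e * (norm x)\<^sup>2 / 2)) * cis (x \<bullet> z))"
proof -
  have n: "(norm x)\<^sup>2 = (\<Sum>b\<in>Basis. (x \<bullet> b)\<^sup>2)" for x :: 'a
    unfolding power2_norm_eq_inner by (subst euclidean_inner) (simp add: power2_eq_square)
  have cis_sum: "cis (\<Sum>b\<in>B. g b) = (\<Prod>b\<in>B. cis (g b))" if "finite B" for g and B :: "'a set"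
    using that by (induction B) (auto simp: cis_mult[symmetric])
  have eq: "of_real (exp (- e * (norm x)\<^sup>2 / 2)) * cis (x \<bullet> z) =
      (\<Prod>b\<in>Basis. complex_of_real (exp (- e * (x \<bullet> b)\<^sup>2 / 2)) * cis ((x \<bullet> b) * (z \<bullet> b)))" for x :: 'a
  proof -
    have "exp (- e * (norm x)\<^sup>2 / 2) = (\<Prod>b\<in>Basis. exp (- e * (x \<bullet> b)\<^sup>2 / 2))"
      unfolding n by (subst exp_sum[symmetric]) (simp_all add: sum_distrib_left sum_negf sum_divide_distrib)
    moreover have "cis (x \<bullet> z) = (\<Prod>b\<in>Basis. cis ((x \<bullet> b) * (z \<bullet> b)))"
      by (subst euclidean_inner) (simp add: cis_sum)
    ultimately show ?thesis by (simp add: prod.distrib)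
  qed
  show "integrable lborel (\<lambda>x. complex_of_real (exp (- e * (norm x)\<^sup>2 / 2)) * cis (x \<bullet> z))"
    unfolding eq by (intro lborel_prod_integral(2) gaussian_FT_real e)
  have "(LINT x|lborel. of_real (exp (- e * (norm x)\<^sup>2 / 2)) * cis (x \<bullet> z)) =
      (\<Prod>b\<in>Basis. complex_of_real (sqrt (2 * pi / e) * exp (- (z \<bullet> b)\<^sup>2 / (2 * e))))"
    unfolding eq by (subst lborel_prod_integral(1)) (simp_all only: gaussian_FT_real[OF e])
  also have "\<dots> = of_real ((\<Prod>b\<in>(Basis::'a set). sqrt (2 * pi / e)) * (\<Prod>b\<in>Basis. exp (- (z \<bullet> b)\<^sup>2 / (2 * e))))"
    by (simp only: of_real_prod prod.distrib of_real_mult)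
  also have "(\<Prod>b\<in>Basis. exp (- (z \<bullet> b)\<^sup>2 / (2 * e))) = exp (- (norm z)\<^sup>2 / (2 * e))"
    unfolding n by (subst exp_sum[symmetric]) (simp_all add: sum_negf sum_divide_distrib)
  also have "(\<Prod>b\<in>(Basis::'a set). sqrt (2 * pi / e)) = (2 * pi / e) powr (real DIM('a) / 2)"
    using e by (simp add: powr_half_sqrt[symmetric] powr_realpow[symmetric] powr_powr)
  finally show "(LINT x|lborel. of_real (exp (- e * (norm x)\<^sup>2 / 2)) * cis (x \<bullet> z)) =
      complex_of_real ((2 * pi / e) powr (real DIM('a) / 2) * exp (- (norm z)\<^sup>2 / (2 * e)))" .
qed

text \<open>The Gaussian density with variance \<open>e\<close> in each coordinate. Up to
  normalisation it is the Fourier transform of the damping factor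
  \<open>exp (- e * (norm x)\<^sup>2 / 2)\<close>, and it is an approximate identity as
  \<open>e\<close> tends to 0.\<close>

definition heat_kernel :: "real \<Rightarrow> 'a::euclidean_space \<Rightarrow> real" where
  "heat_kernel e z = (2 * pi * e) powr (- (real DIM('a) / 2)) * exp (- (norm z)\<^sup>2 / (2 * e))"

lemma borel_measurable_heat_kernel [measurable]: "heat_kernel e \<in> borel_measurable borel"
  unfolding heat_kernel_def by measurable

lemma heat_kernel_nonneg [simp]: "0 \<le> heat_kernel e z"
  by (simp add: heat_kernel_def)

lemma heat_kernel_integral:
  assumes e: "e > 0"
  shows "integrable lborel (heat_kernel e :: 'a::euclidean_space \<Rightarrow> real)" "(LINT z|lborel. heat_kernel e (z::'a)) = 1"
proof -
  have i: "integrable lborel (\<lambda>x::'a. complex_of_real (exp (- (1/e) * (norm x)\<^sup>2 / 2)))"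
    using gaussian_FT(2)[of "1/e" "0::'a"] e by simp
  then have i': "integrable lborel (\<lambda>x::'a. exp (- (1/e) * (norm x)\<^sup>2 / 2))"
    by (simp only: complex_of_real_integrable_eq)
  then show "integrable lborel (heat_kernel e :: 'a \<Rightarrow> real)"
    unfolding heat_kernel_def by (simp add: mult.commute)
  have "complex_of_real (LINT x|lborel. exp (- (1/e) * (norm (x::'a))\<^sup>2 / 2)) = of_real ((2 * pi / (1/e)) powr (real DIM('a) / 2))"
    using gaussian_FT(1)[of "1/e" "0::'a"] e by (simp flip: integral_complex_of_real)
  then have "(LINT x|lborel. exp (- (1/e) * (norm (x::'a))\<^sup>2 / 2)) = (2 * pi * e) powr (real DIM('a) / 2)"
    by (simp only: of_real_eq_iff) simp
  then show "(LINT z|lborel. heat_kernel e (z::'a)) = 1"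
    unfolding heat_kernel_def using e by (simp add: powr_minus mult.commute)
qed

lemma heat_kernel_nn_integral:
  fixes y :: "'a::euclidean_space"
  assumes e: "e > 0"
  shows "(\<integral>\<^sup>+z. ennreal (heat_kernel e (z - y)) \<partial>lborel) = 1" "(\<integral>\<^sup>+z. ennreal (heat_kernel e (y - z)) \<partial>lborel) = 1"
proof -
  have 1: "(\<integral>\<^sup>+z. ennreal (heat_kernel e (z::'a)) \<partial>lborel) = 1"
    using heat_kernel_integral[OF e, where 'a='a] by (subst nn_integral_eq_integral) auto
  have "(\<integral>\<^sup>+z. ennreal (heat_kernel e z) \<partial>(distr lborel borel ((+) (- y)))) = 1"
    using 1 by (simp add: lborel_distr_plus)
  then show *: "(\<integral>\<^sup>+z. ennreal (heat_kernel e (z - y)) \<partial>lborel) = 1"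
    by (subst (asm) nn_integral_distr) auto
  show "(\<integral>\<^sup>+z. ennreal (heat_kernel e (y - z)) \<partial>lborel) = 1"
    using * by (simp add: heat_kernel_def norm_minus_commute)
qed

section \<open>Plancherel's theorem by Gaussian regularisation\<close>

lemma cnj_FT: "cnj (FT s f x) = FT (- s) (\<lambda>y. cnj (f y)) x"
  unfolding FT_def by (simp add: cis_cnj flip: Bochner_Integration.integral_cnj)

text \<open>The multiplication formula is used twice: to move the transform off \<open>f\<close>,
  and to compute the transform of the damped conjugate \<open>h\<close>, which comes out as a
  convolution with the heat kernel. The transform of \<open>f\<close> is bounded, so the damping
  makes \<open>h\<close> integrable.\<close>

lemma FT_gaussian_regularised:
  fixes f :: "'a::euclidean_space \<Rightarrow> complex"
  assumes f: "integrable lborel f" and s: "s\<^sup>2 = 1" and e: "e > 0"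
  shows "(LINT x|lborel. FT s f x * (cnj (FT s f x) * of_real (exp (- e * (norm x)\<^sup>2 / 2)))) =
     (LINT y|lborel. f y * (LINT y'|lborel. of_real (heat_kernel e (y - y')) * cnj (f y')))"
    and "integrable lborel (\<lambda>x. FT s f x * (cnj (FT s f x) * of_real (exp (- e * (norm x)\<^sup>2 / 2))))"
proof -
  define c where "c = (2 * pi) powr (- (real DIM('a) / 2))"
  have fc: "integrable lborel (\<lambda>y. cnj (f y))" using f by simp
  note [measurable] = borel_measurable_integrable[OF f, simplified]
  define h where "h x = cnj (FT s f x) * of_real (exp (- e * (norm x)\<^sup>2 / 2))" for x
  have bound: "cmod (FT s f x) \<le> c * (LINT y|lborel. cmod (f y))" for x
    unfolding FT_def norm_mult c_def
    by (intro mult_mono order_trans[OF integral_norm_bound]) (auto simp: norm_mult)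
  have gi: "integrable lborel (\<lambda>x::'a. complex_of_real (exp (- e * (norm x)\<^sup>2 / 2)))"
    using gaussian_FT(2)[OF e, of "0::'a"] by simp
  have hi: "integrable lborel h"
  proof (rule Bochner_Integration.integrable_bound)
    show "integrable lborel (\<lambda>x::'a. (c * (LINT y|lborel. cmod (f y))) * complex_of_real (exp (- e * (norm x)\<^sup>2 / 2)))"
      by (intro integrable_mult_right gi)
    show "h \<in> borel_measurable lborel" unfolding h_def by measurable
    have "0 \<le> c" by (simp add: c_def)
    then show "AE x in lborel. norm (h x) \<le> norm ((c * (LINT y|lborel. cmod (f y))) * complex_of_real (exp (- e * (norm x)\<^sup>2 / 2)))"
      using bound by (auto simp: h_def norm_mult abs_mult intro!: AE_I2 mult_right_mono)
  qed
  show "integrable lborel (\<lambda>x. FT s f x * (cnj (FT s f x) * of_real (exp (- e * (norm x)\<^sup>2 / 2))))"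
  proof (rule Bochner_Integration.integrable_bound)
    show "integrable lborel (\<lambda>x. (c * (LINT y|lborel. cmod (f y))) * h x)"
      by (intro integrable_mult_right hi)
    have "0 \<le> c" by (simp add: c_def)
    then show "AE x in lborel. norm (FT s f x * (cnj (FT s f x) * of_real (exp (- e * (norm x)\<^sup>2 / 2)))) \<le> norm ((c * (LINT y|lborel. cmod (f y))) * h x)"
      unfolding h_def[symmetric] using bound by (auto simp: norm_mult abs_mult intro!: AE_I2 mult_right_mono)
  qed measurable
  \<comment> \<open>The phase and the damping are gathered into \<open>g\<close>, a modulated
    Gaussian whose transform is a translated heat kernel; the multiplication formula for
    \<open>cnj\<close> of \<open>f\<close> then moves the transform onto it.\<close>
  have FTh: "FT s h y = (LINT y'|lborel. of_real (heat_kernel e (y - y')) * cnj (f y'))" for y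
  proof -
    define g where "g x = cis (s * (y \<bullet> x)) * complex_of_real (exp (- e * (norm x)\<^sup>2 / 2))" for x
    have gint: "integrable lborel g"
    proof (rule Bochner_Integration.integrable_bound[OF gi])
      show "g \<in> borel_measurable lborel" unfolding g_def by measurable
    qed (auto simp: g_def norm_mult)
    have FTg: "FT (- s) g y' * c = of_real (heat_kernel e (y - y'))" for y'
    proof -
      have "cis (- s * (y' \<bullet> x)) * g x = complex_of_real (exp (- e * (norm x)\<^sup>2 / 2)) * cis (x \<bullet> (s *\<^sub>R (y - y')))" for x
        by (simp add: g_def cis_mult algebra_simps inner_commute inner_diff_right mult.assoc[symmetric])
      then have "FT (- s) g y' = c * of_real ((2 * pi / e) powr (real DIM('a) / 2) * exp (- (norm (s *\<^sub>R (y - y')))\<^sup>2 / (2 * e)))"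
        unfolding FT_def c_def using gaussian_FT(1)[OF e, of "s *\<^sub>R (y - y')"] by simp
      then have F: "FT (- s) g y' * c = of_real ((c * (2 * pi / e) powr (real DIM('a) / 2) * c) * exp (- (norm (s *\<^sub>R (y - y')))\<^sup>2 / (2 * e)))"
        by (simp only: of_real_mult mult_ac of_real_eq_id id_apply)
      have n: "(norm (s *\<^sub>R (y - y')))\<^sup>2 = (norm (y - y'))\<^sup>2"
        using s by (simp add: power_mult_distrib)
      \<comment> \<open>Two normalisations of the transform and one Gaussian integral combine to the
        normalisation of the heat kernel.\<close>
      have p: "c * (2 * pi / e) powr (real DIM('a) / 2) * c = (2 * pi * e) powr (- (real DIM('a) / 2))"
        unfolding c_def using e by (simp add: powr_minus powr_divide powr_mult field_simps)
      show ?thesis unfolding F n p heat_kernel_def ..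
    qed
    have "FT s h y = c * (LINT x|lborel. FT (- s) (\<lambda>y. cnj (f y)) x * g x)"
      unfolding FT_def[of s h] h_def c_def cnj_FT g_def by (simp only: mult_ac)
    also have "\<dots> = c * (LINT y'|lborel. cnj (f y') * FT (- s) g y')"
      unfolding FT_multiplication_L1[OF fc gint] ..
    also have "\<dots> = (LINT y'|lborel. (FT (- s) g y' * c) * cnj (f y'))"
      by (simp only: integral_mult_inward mult_ac)
    finally show ?thesis unfolding FTg .
  qed
  have "(LINT x|lborel. FT s f x * h x) = (LINT y|lborel. f y * FT s h y)"
    by (rule FT_multiplication_L1[OF f hi])
  then show "(LINT x|lborel. FT s f x * (cnj (FT s f x) * of_real (exp (- e * (norm x)\<^sup>2 / 2)))) =
     (LINT y|lborel. f y * (LINT y'|lborel. of_real (heat_kernel e (y - y')) * cnj (f y')))"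
    unfolding FTh h_def .
qed

text \<open>If \<open>F\<close> is not integrable, its Bochner integral is 0 by convention, so the
  bound survives in that case too.\<close>

lemma norm_integral_le_nn_integral:
  fixes F :: "'a \<Rightarrow> complex"
  shows "ennreal (cmod (LINT x|M. F x)) \<le> (\<integral>\<^sup>+x. ennreal (cmod (F x)) \<partial>M)"
proof (cases "integrable M F")
  case True
  then show ?thesis by (rule integral_norm_bound_ennreal)
qed (simp add: not_integrable_integral_eq)

lemma FT_regularised_nn:
  fixes f :: "'a::euclidean_space \<Rightarrow> complex"
  assumes f: "integrable lborel f" and s: "s\<^sup>2 = 1" and e: "e > 0"
  shows "(\<integral>\<^sup>+x. ennreal ((cmod (FT s f x))\<^sup>2 * exp (- e * (norm x)\<^sup>2 / 2)) \<partial>lborel) =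
     ennreal (Re (LINT y|lborel. f y * (LINT y'|lborel. of_real (heat_kernel e (y - y')) * cnj (f y'))))"
proof -
  have eq: "FT s f x * (cnj (FT s f x) * of_real (exp (- e * (norm x)\<^sup>2 / 2))) =
      of_real ((cmod (FT s f x))\<^sup>2 * exp (- e * (norm x)\<^sup>2 / 2))" for x
    by (simp only: of_real_mult complex_norm_square mult.assoc)
  have i: "integrable lborel (\<lambda>x. (cmod (FT s f x))\<^sup>2 * exp (- e * (norm x)\<^sup>2 / 2))"
    using FT_gaussian_regularised(2)[OF f s e] unfolding eq by (simp only: complex_of_real_integrable_eq)
  have "of_real (LINT x|lborel. (cmod (FT s f x))\<^sup>2 * exp (- e * (norm x)\<^sup>2 / 2)) =
     (LINT y|lborel. f y * (LINT y'|lborel. of_real (heat_kernel e (y - y')) * cnj (f y')))"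
    using FT_gaussian_regularised(1)[OF f s e] unfolding eq integral_complex_of_real .
  then have "(LINT x|lborel. (cmod (FT s f x))\<^sup>2 * exp (- e * (norm x)\<^sup>2 / 2)) =
     Re (LINT y|lborel. f y * (LINT y'|lborel. of_real (heat_kernel e (y - y')) * cnj (f y')))"
    by (metis Re_complex_of_real)
  with i show ?thesis by (subst nn_integral_eq_integral) auto
qed

text \<open>Schur's test: the product of the two moduli is at most half the sum of their squares,
  and the kernel has mass one in each variable, so either half contributes half of the squared
  norm.\<close>

lemma heat_kernel_form_le:
  fixes f :: "'a::euclidean_space \<Rightarrow> complex"
  assumes f: "f \<in> L2 lborel" and e: "e > 0"
  shows "cmod (LINT y|lborel. f y * (LINT y'|lborel. of_real (heat_kernel e (y - y')) * cnj (f y'))) \<le> (L2_norm lborel f)\<^sup>2"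
proof -
  note [measurable] = L2_measurable[OF f, simplified]
  let ?k = "\<lambda>y y'. heat_kernel e (y - y')"
  have "ennreal (cmod (LINT y|lborel. f y * (LINT y'|lborel. of_real (?k y y') * cnj (f y')))) \<le>
      (\<integral>\<^sup>+y. ennreal (cmod (f y * (LINT y'|lborel. of_real (?k y y') * cnj (f y')))) \<partial>lborel)"
    by (rule norm_integral_le_nn_integral)
  also have "\<dots> \<le> (\<integral>\<^sup>+y. \<integral>\<^sup>+y'. ennreal (?k y y') * ennreal ((cmod (f y))\<^sup>2 / 2) + ennreal (?k y y') * ennreal ((cmod (f y'))\<^sup>2 / 2) \<partial>lborel \<partial>lborel)"
  proof (rule nn_integral_mono)
    fix y
    have "ennreal (cmod (f y * (LINT y'|lborel. of_real (?k y y') * cnj (f y')))) =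
        ennreal (cmod (LINT y'|lborel. f y * (of_real (?k y y') * cnj (f y'))))"
      by simp
    also have "\<dots> \<le> (\<integral>\<^sup>+y'. ennreal (cmod (f y * (of_real (?k y y') * cnj (f y')))) \<partial>lborel)"
      by (rule norm_integral_le_nn_integral)
    also have "\<dots> \<le> (\<integral>\<^sup>+y'. ennreal (?k y y') * ennreal ((cmod (f y))\<^sup>2 / 2) + ennreal (?k y y') * ennreal ((cmod (f y'))\<^sup>2 / 2) \<partial>lborel)"
    proof (rule nn_integral_mono)
      fix y'
      have "cmod (f y) * cmod (f y') \<le> (cmod (f y))\<^sup>2 / 2 + (cmod (f y'))\<^sup>2 / 2"
        using sum_squares_bound[of "cmod (f y)" "cmod (f y')"] by simp
      then have "?k y y' * (cmod (f y) * cmod (f y')) \<le> ?k y y' * ((cmod (f y))\<^sup>2 / 2 + (cmod (f y'))\<^sup>2 / 2)"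
        by (rule mult_left_mono) simp
      then show "ennreal (cmod (f y * (of_real (?k y y') * cnj (f y')))) \<le> ennreal (?k y y') * ennreal ((cmod (f y))\<^sup>2 / 2) + ennreal (?k y y') * ennreal ((cmod (f y'))\<^sup>2 / 2)"
        by (simp add: norm_mult mult_ac distrib_left flip: ennreal_mult ennreal_plus)
    qed
    finally show "ennreal (cmod (f y * (LINT y'|lborel. of_real (?k y y') * cnj (f y')))) \<le>
      (\<integral>\<^sup>+y'. ennreal (?k y y') * ennreal ((cmod (f y))\<^sup>2 / 2) + ennreal (?k y y') * ennreal ((cmod (f y'))\<^sup>2 / 2) \<partial>lborel)" .
  qed
  also have "\<dots> = (\<integral>\<^sup>+y. \<integral>\<^sup>+y'. ennreal (?k y y') * ennreal ((cmod (f y))\<^sup>2 / 2) \<partial>lborel \<partial>lborel) +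
      (\<integral>\<^sup>+y. \<integral>\<^sup>+y'. ennreal (?k y y') * ennreal ((cmod (f y'))\<^sup>2 / 2) \<partial>lborel \<partial>lborel)"
    by (subst nn_integral_add[symmetric], simp, simp, intro nn_integral_cong, subst nn_integral_add, auto)
  also have "(\<integral>\<^sup>+y. \<integral>\<^sup>+y'. ennreal (?k y y') * ennreal ((cmod (f y'))\<^sup>2 / 2) \<partial>lborel \<partial>lborel) =
      (\<integral>\<^sup>+y'. \<integral>\<^sup>+y. ennreal (?k y y') * ennreal ((cmod (f y'))\<^sup>2 / 2) \<partial>lborel \<partial>lborel)"
    by (rule lborel_pair.Fubini') measurable
  also have "(\<integral>\<^sup>+y. \<integral>\<^sup>+y'. ennreal (?k y y') * ennreal ((cmod (f y))\<^sup>2 / 2) \<partial>lborel \<partial>lborel) = (\<integral>\<^sup>+y. ennreal ((cmod (f y))\<^sup>2 / 2) \<partial>lborel)"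
    by (intro nn_integral_cong) (simp add: nn_integral_multc heat_kernel_nn_integral[OF e])
  also have "(\<integral>\<^sup>+y'. \<integral>\<^sup>+y. ennreal (?k y y') * ennreal ((cmod (f y'))\<^sup>2 / 2) \<partial>lborel \<partial>lborel) = (\<integral>\<^sup>+y. ennreal ((cmod (f y))\<^sup>2 / 2) \<partial>lborel)"
    by (intro nn_integral_cong) (simp add: nn_integral_multc heat_kernel_nn_integral[OF e])
  also have "(\<integral>\<^sup>+y. ennreal ((cmod (f y))\<^sup>2 / 2) \<partial>lborel) + (\<integral>\<^sup>+y. ennreal ((cmod (f y))\<^sup>2 / 2) \<partial>lborel) = (\<integral>\<^sup>+y. ennreal ((cmod (f y))\<^sup>2) \<partial>lborel)"
    by (subst nn_integral_add[symmetric]) (auto simp flip: ennreal_plus)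
  finally have "ennreal (cmod (LINT y|lborel. f y * (LINT y'|lborel. of_real (?k y y') * cnj (f y')))) \<le> ennreal ((L2_norm lborel f)\<^sup>2)"
    by (simp only: L2_nn_integral[OF f])
  then show ?thesis by (simp add: ennreal_le_iff)
qed

text \<open>Fatou's lemma as the damping parameter tends to 0. It yields an inequality for general
  \<open>f\<close>; equality starts from the indicators of open sets in
  \<open>FT_indicator_isometry\<close>.\<close>

lemma FT_contraction:
  fixes f :: "'a::euclidean_space \<Rightarrow> complex"
  assumes f: "f \<in> L2 lborel" "integrable lborel f" and s: "s\<^sup>2 = 1"
  shows "FT s f \<in> L2 lborel" "L2_norm lborel (FT s f) \<le> L2_norm lborel f"
proof -
  note [measurable] = L2_measurable[OF f(1), simplified]
  have "(\<integral>\<^sup>+x. ennreal ((cmod (FT s f x))\<^sup>2) \<partial>lborel) =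
      (\<integral>\<^sup>+x. liminf (\<lambda>k. ennreal ((cmod (FT s f x))\<^sup>2 * exp (- (1 / real (Suc k)) * (norm x)\<^sup>2 / 2))) \<partial>lborel)"
  proof (rule nn_integral_cong)
    fix x
    have "(\<lambda>k. (cmod (FT s f x))\<^sup>2 * exp (- (1 / real (Suc k)) * (norm x)\<^sup>2 / 2)) \<longlonglongrightarrow> (cmod (FT s f x))\<^sup>2 * exp (- 0 * (norm x)\<^sup>2 / 2)"
      by (intro tendsto_intros LIMSEQ_Suc[OF lim_1_over_n]) simp
    then have "(\<lambda>k. ennreal ((cmod (FT s f x))\<^sup>2 * exp (- (1 / real (Suc k)) * (norm x)\<^sup>2 / 2))) \<longlonglongrightarrow> ennreal ((cmod (FT s f x))\<^sup>2)"
      by (intro tendsto_ennrealI) simp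
    from lim_imp_Liminf[OF trivial_limit_sequentially this]
    show "ennreal ((cmod (FT s f x))\<^sup>2) = liminf (\<lambda>k. ennreal ((cmod (FT s f x))\<^sup>2 * exp (- (1 / real (Suc k)) * (norm x)\<^sup>2 / 2)))" by (rule sym)
  qed
  also have "\<dots> \<le> liminf (\<lambda>k. \<integral>\<^sup>+x. ennreal ((cmod (FT s f x))\<^sup>2 * exp (- (1 / real (Suc k)) * (norm x)\<^sup>2 / 2)) \<partial>lborel)"
    by (rule nn_integral_liminf) measurable
  also have "\<dots> \<le> liminf (\<lambda>k::nat. ennreal ((L2_norm lborel f)\<^sup>2))"
  proof (rule Liminf_mono, rule always_eventually, rule allI)
    fix k
    have e: "1 / real (Suc k) > 0" by simp
    show "(\<integral>\<^sup>+x. ennreal ((cmod (FT s f x))\<^sup>2 * exp (- (1 / real (Suc k)) * (norm x)\<^sup>2 / 2)) \<partial>lborel) \<le> ennreal ((L2_norm lborel f)\<^sup>2)"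
      unfolding FT_regularised_nn[OF f(2) s e]
      by (intro ennreal_leI order_trans[OF complex_Re_le_cmod] heat_kernel_form_le[OF f(1) e])
  qed
  also have "\<dots> = ennreal ((L2_norm lborel f)\<^sup>2)" by (simp add: Liminf_const)
  finally have *: "(\<integral>\<^sup>+x. ennreal ((cmod (FT s f x))\<^sup>2) \<partial>lborel) \<le> ennreal ((L2_norm lborel f)\<^sup>2)" .
  show "FT s f \<in> L2 lborel" "L2_norm lborel (FT s f) \<le> L2_norm lborel f"
    by (rule L2_I_nn_le[OF _ *]; simp)+
qed

text \<open>Outside the ball, half of the exponent gives the factor with \<open>r\<close>, and the
  other half is a heat kernel of twice the variance, again of mass one. The power of 2 is the
  quotient of the two normalisations.\<close>

lemma heat_kernel_tail:
  fixes y :: "'a::euclidean_space"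
  assumes e: "e > 0" and U: "open U" "ball y r \<subseteq> U" "r > 0"
  shows "1 - 2 powr (real DIM('a) / 2) * exp (- r\<^sup>2 / (4 * e)) \<le> (LINT z|lborel. heat_kernel e (y - z) * indicator U z)"
    and "(LINT z|lborel. heat_kernel e (y - z) * indicator U z) \<le> 1"
    and "integrable lborel (\<lambda>z. heat_kernel e (y - z) * indicator U z)"
proof -
  define C where "C = 2 powr (real DIM('a) / 2) * exp (- r\<^sup>2 / (4 * e))"
  have shift: "integrable lborel (\<lambda>z. heat_kernel d (y - z))" "(LINT z|lborel. heat_kernel d (y - z)) = 1" if "d > 0" for d
  proof -
    show "integrable lborel (\<lambda>z. heat_kernel d (y - z))"
      by (rule integrableI_nonneg) (use heat_kernel_nn_integral(2)[OF that, of y] in auto)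
    show "(LINT z|lborel. heat_kernel d (y - z)) = 1"
      by (subst integral_eq_nn_integral) (use heat_kernel_nn_integral(2)[OF that, of y] in auto)
  qed
  have [measurable]: "U \<in> sets borel" using U by simp
  show i: "integrable lborel (\<lambda>z. heat_kernel e (y - z) * indicator U z)"
    by (rule Bochner_Integration.integrable_bound[OF shift(1)[OF e]]) (auto simp: indicator_def)
  have "(LINT z|lborel. heat_kernel e (y - z) * indicator U z) \<le> (LINT z|lborel. heat_kernel e (y - z))"
    by (intro integral_mono i shift e) (auto simp: indicator_def)
  then show "(LINT z|lborel. heat_kernel e (y - z) * indicator U z) \<le> 1" by (simp add: shift e)
  have le: "heat_kernel e (y - z) \<le> heat_kernel e (y - z) * indicator U z + C * heat_kernel (2 * e) (y - z)" for z
  proof (cases "z \<in> U")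
    case True
    then show ?thesis by (simp add: C_def)
  next
    case False
    then have "z \<notin> ball y r" using U by blast
    then have r: "r\<^sup>2 \<le> (norm (y - z))\<^sup>2"
      using U(3) by (intro power_mono) (auto simp: dist_norm)
    have "exp (- (norm (y - z))\<^sup>2 / (2 * e)) = exp (- (norm (y - z))\<^sup>2 / (4 * e)) * exp (- (norm (y - z))\<^sup>2 / (4 * e))"
      by (simp flip: exp_add)
    also have "\<dots> \<le> exp (- r\<^sup>2 / (4 * e)) * exp (- (norm (y - z))\<^sup>2 / (4 * e))"
      using r e by (intro mult_right_mono) (auto simp: divide_right_mono)
    finally have "heat_kernel e (y - z) \<le> (2 * pi * e) powr (- (real DIM('a) / 2)) * (exp (- r\<^sup>2 / (4 * e)) * exp (- (norm (y - z))\<^sup>2 / (4 * e)))"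
      unfolding heat_kernel_def by (rule mult_left_mono) simp
    also have "(2 * pi * e) powr (- (real DIM('a) / 2)) = 2 powr (real DIM('a) / 2) * (2 * pi * (2 * e)) powr (- (real DIM('a) / 2))"
    proof -
      have "(2 * pi * (2 * e)) powr (- (real DIM('a) / 2)) = 2 powr (- (real DIM('a) / 2)) * (2 * pi * e) powr (- (real DIM('a) / 2))"
        using e powr_mult[of 2 "2 * pi * e" "- (real DIM('a) / 2)"] by (simp add: mult_ac)
      then show ?thesis by (simp add: powr_minus)
    qed
    finally show ?thesis using False by (simp add: heat_kernel_def C_def mult_ac)
  qed
  have e2: "2 * e > 0" using e by simp
  have "(LINT z|lborel. heat_kernel e (y - z)) \<le> (LINT z|lborel. heat_kernel e (y - z) * indicator U z + C * heat_kernel (2 * e) (y - z))"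
    by (rule integral_mono[OF shift(1)[OF e] _ le]) (intro Bochner_Integration.integrable_add i integrable_mult_right shift e2)
  also have "\<dots> = (LINT z|lborel. heat_kernel e (y - z) * indicator U z) + C"
    by (subst Bochner_Integration.integral_add) (simp_all add: i shift[OF e2])
  finally show "1 - 2 powr (real DIM('a) / 2) * exp (- r\<^sup>2 / (4 * e)) \<le> (LINT z|lborel. heat_kernel e (y - z) * indicator U z)"
    by (simp add: shift e C_def)
qed

text \<open>At every point of an open set the heat average of its indicator tends to 1, so the
  regularised squared norms tend to the measure of \<open>U\<close>. This is the inequality opposite
  to \<open>FT_contraction\<close>.\<close>

lemma FT_indicator_isometry:
  fixes U :: "'a::euclidean_space set"
  assumes U: "open U" "emeasure lborel U < \<infinity>" and s: "s\<^sup>2 = 1"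
  shows "L2_norm lborel (FT s (\<lambda>x. indicator U x)) = L2_norm lborel (\<lambda>x. indicator U x :: complex)"
proof (rule antisym)
  let ?f = "\<lambda>x. indicator U x :: complex"
  have [measurable]: "U \<in> sets borel" using U by simp
  have fL: "?f \<in> L2 lborel" by (rule L2_indicator) (use U in auto)
  have "(\<lambda>x. ?f x * cnj (?f x)) = ?f" by (auto simp: indicator_def fun_eq_iff)
  then have fI: "integrable lborel ?f" using L2_mult_integrable[OF fL fL] by simp
  note FL = FT_contraction(1)[OF fL fI s]
  show "L2_norm lborel (FT s ?f) \<le> L2_norm lborel ?f" by (rule FT_contraction(2)[OF fL fI s])
  \<comment> \<open>The integrand of the regularised quadratic form, squeezed between 0 and the
    indicator of \<open>U\<close>.\<close>
  define w where "w k y = indicator U y * (LINT z|lborel. heat_kernel (1 / real (Suc k)) (y - z) * indicator U z)" for k y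
  have e: "1 / real (Suc k) > 0" for k by simp
  have w: "0 \<le> w k y \<and> w k y \<le> indicator U y" for k y
  proof (cases "y \<in> U")
    case True
    then obtain r where "r > 0" "ball y r \<subseteq> U" using U(1) open_contains_ball by blast
    then show ?thesis using heat_kernel_tail(2)[OF e U(1), of y r k] True
      by (auto simp: w_def intro!: integral_nonneg)
  qed (simp add: w_def)
  have wm [measurable]: "w k \<in> borel_measurable borel" for k
  proof -
    have "(\<lambda>y. LINT z|lborel. heat_kernel (1 / real (Suc k)) (y - z) * indicator U z) \<in> borel_measurable borel"
      by (rule lborel.borel_measurable_lebesgue_integral) measurable
    then show ?thesis unfolding w_def by measurable
  qed
  have "(\<lambda>k. LINT y|lborel. w k y) \<longlonglongrightarrow> (LINT y|lborel. indicator U y)"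
  proof (rule integral_dominated_convergence[where w="\<lambda>y. indicator U y"])
    show "AE y in lborel. (\<lambda>k. w k y) \<longlonglongrightarrow> indicator U y"
    proof (rule AE_I2)
      fix y
      show "(\<lambda>k. w k y) \<longlonglongrightarrow> indicator U y"
      proof (cases "y \<in> U")
        case True
        then obtain r where r: "r > 0" "ball y r \<subseteq> U" using U(1) open_contains_ball by blast
        have lo: "1 - 2 powr (real DIM('a) / 2) * exp (- r\<^sup>2 / (4 * (1 / real (Suc k)))) \<le> w k y" for k
          using heat_kernel_tail(1)[OF e U(1) r(2,1), of k] True by (simp add: w_def)
        have "(\<lambda>k. exp (- r\<^sup>2 / 4) ^ Suc k) \<longlonglongrightarrow> 0"
          by (rule LIMSEQ_Suc, rule LIMSEQ_power_zero) (use r in simp)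
        then have "(\<lambda>k. 1 - 2 powr (real DIM('a) / 2) * exp (- r\<^sup>2 / 4) ^ Suc k) \<longlonglongrightarrow> 1 - 2 powr (real DIM('a) / 2) * 0"
          by (intro tendsto_intros)
        moreover have "exp (- r\<^sup>2 / (4 * (1 / real (Suc k)))) = exp (- r\<^sup>2 / 4) ^ Suc k" for k
          by (simp only: exp_of_nat_mult[symmetric]) (simp add: mult_ac)
        ultimately have "(\<lambda>k. 1 - 2 powr (real DIM('a) / 2) * exp (- r\<^sup>2 / (4 * (1 / real (Suc k))))) \<longlonglongrightarrow> 1" by simp
        then have "(\<lambda>k. w k y) \<longlonglongrightarrow> 1"
          by (rule tendsto_sandwich[rotated 2, OF _ tendsto_const]) (use lo w[of _ y] True in auto)
        then show ?thesis using True by simp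
      qed (simp add: w_def)
    qed
    show "AE y in lborel. norm (w k y) \<le> indicator U y" for k
      using w[of k] by (intro AE_I2) simp
    show "integrable lborel (\<lambda>y. indicator U y :: real)" using U by simp
  qed measurable
  moreover have "(LINT y|lborel. w k y) \<le> (L2_norm lborel (FT s ?f))\<^sup>2" for k
  proof -
    have "(LINT y|lborel. ?f y * (LINT y'|lborel. of_real (heat_kernel (1 / real (Suc k)) (y - y')) * cnj (?f y'))) = of_real (LINT y|lborel. w k y)"
    proof -
      have "of_real (heat_kernel (1 / real (Suc k)) (y - y')) * cnj (?f y') = of_real (heat_kernel (1 / real (Suc k)) (y - y') * indicator U y')" for y y'
        by (cases "y' \<in> U") simp_all
      moreover have "?f y * of_real c = of_real (indicator U y * c)" for y c by (cases "y \<in> U") simp_all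
      ultimately show ?thesis
        unfolding w_def by (simp only: integral_complex_of_real)
    qed
    then have "ennreal (LINT y|lborel. w k y) = (\<integral>\<^sup>+x. ennreal ((cmod (FT s ?f x))\<^sup>2 * exp (- (1 / real (Suc k)) * (norm x)\<^sup>2 / 2)) \<partial>lborel)"
      unfolding FT_regularised_nn[OF fI s e] by simp
    also have "\<dots> \<le> (\<integral>\<^sup>+x. ennreal ((cmod (FT s ?f x))\<^sup>2) \<partial>lborel)"
      by (intro nn_integral_mono ennreal_leI mult_left_le) auto
    also have "\<dots> = ennreal ((L2_norm lborel (FT s ?f))\<^sup>2)" by (rule L2_nn_integral[OF FL])
    finally show ?thesis by (simp add: ennreal_le_iff)
  qed
  ultimately have "(LINT y|lborel. indicator U y) \<le> (L2_norm lborel (FT s ?f))\<^sup>2"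
    by (intro LIMSEQ_le_const2) auto
  also have "(LINT y|lborel. indicator U y) = (L2_norm lborel ?f)\<^sup>2"
    unfolding L2_norm_sq by (intro Bochner_Integration.integral_cong) (auto simp: indicator_def)
  finally show "L2_norm lborel ?f \<le> L2_norm lborel (FT s ?f)"
    by (rule power2_le_imp_le) simp
qed

section \<open>The extension of the transform to L2\<close>

lemma L2_times_cball:
  fixes f :: "'a::euclidean_space \<Rightarrow> complex"
  assumes f: "f \<in> L2 lborel"
  shows "(\<lambda>x. f x * indicator (cball 0 r) x) \<in> L2 lborel" "integrable lborel (\<lambda>x. f x * indicator (cball 0 r) x)"
    "(\<lambda>k. L2_norm lborel (\<lambda>x. f x * indicator (cball 0 (real k)) x - f x)) \<longlonglongrightarrow> 0"
proof -
  have c: "cball 0 r \<in> sets lborel" "emeasure lborel (cball (0::'a) r) < \<infinity>" for r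
    using emeasure_bounded_finite[OF bounded_cball] by auto
  show "(\<lambda>x. f x * indicator (cball 0 r) x) \<in> L2 lborel" by (rule L2_times_indicator[OF f c(1)])
  show "integrable lborel (\<lambda>x. f x * indicator (cball 0 r) x)" by (rule L2_times_indicator_integrable[OF f c])
  show "(\<lambda>k. L2_norm lborel (\<lambda>x. f x * indicator (cball 0 (real k)) x - f x)) \<longlonglongrightarrow> 0"
  proof (rule L2_times_indicator_tendsto[OF f c(1)])
    fix x :: 'a
    show "\<forall>\<^sub>F k in sequentially. x \<in> cball 0 (real k)"
      using eventually_ge_at_top[of "nat \<lceil>norm x\<rceil>"] by eventually_elim (simp add: nat_ceiling_le_eq)
  qed
qed

lemma FT_lincomb:
  assumes "integrable lborel f" "integrable lborel g"
  shows "FT s (\<lambda>x. a * f x + b * g x) x = a * FT s f x + b * FT s g x"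
proof -
  have i: "integrable lborel (\<lambda>y. cis (s * (x \<bullet> y)) * h y)" if h: "integrable lborel h" for h :: "'a \<Rightarrow> complex"
  proof (rule Bochner_Integration.integrable_bound[OF h])
    note [measurable] = borel_measurable_integrable[OF h]
    show "(\<lambda>y. cis (s * (x \<bullet> y)) * h y) \<in> borel_measurable lborel" by measurable
  qed (simp add: norm_mult)
  have eq: "cis (s * (x \<bullet> y)) * (a * f y + b * g y) = a * (cis (s * (x \<bullet> y)) * f y) + b * (cis (s * (x \<bullet> y)) * g y)" for y
    by (simp add: algebra_simps)
  show ?thesis
    unfolding FT_def eq using i[OF assms(1)] i[OF assms(2)] by (simp add: algebra_simps)
qed

text \<open>Truncations to balls are integrable and dense, so the contraction extends. This is the
  witness for the choice in \<open>fourier_L2\<close>.\<close>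

lemma FT_extension_exists:
  assumes s: "s\<^sup>2 = 1"
  shows "\<exists>T. L2_operator lborel lborel T \<and>
    (\<forall>f\<in>L2 lborel. integrable lborel f \<longrightarrow> (AE x in lborel. T f x = FT s f (x::'a::euclidean_space)))"
proof -
  let ?D = "{f \<in> L2 lborel. integrable lborel (f :: 'a \<Rightarrow> complex)}"
  have "\<exists>T. L2_operator lborel lborel T \<and> (\<forall>f\<in>?D. AE x in lborel. T f x = FT s f x)"
  proof (rule L2_operator_extension)
    show "(\<lambda>x. a * f x + b * g x) \<in> ?D" if "f \<in> ?D" "g \<in> ?D" for f g a b
      using that by (simp add: L2_lincomb)
    show "\<exists>d. (\<forall>k. d k \<in> ?D) \<and> (\<lambda>k. L2_norm lborel (\<lambda>x. d k x - f x)) \<longlonglongrightarrow> 0" if "f \<in> L2 lborel" for f :: "'a \<Rightarrow> complex"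
      by (rule exI[of _ "\<lambda>k x. f x * indicator (cball 0 (real k)) x"]) (simp add: L2_times_cball[OF that])
  qed (auto intro: FT_contraction[OF _ _ s] simp: FT_lincomb)
  then show ?thesis by blast
qed

text \<open>Assumes about \<open>T\<close> what the choice of \<open>fourier_L2\<close> guarantees;
  the consequences are drawn from these properties alone.\<close>

locale FT_L2 =
  fixes s :: real and T :: "('a::euclidean_space \<Rightarrow> complex) \<Rightarrow> ('a \<Rightarrow> complex)"
  assumes sign: "s\<^sup>2 = 1"
    and op: "L2_operator lborel lborel T"
    and FT: "\<And>f. f \<in> L2 lborel \<Longrightarrow> integrable lborel f \<Longrightarrow> AE x in lborel. T f x = FT s f x"
begin

lemma norm_FT:
  assumes "f \<in> L2 lborel" "integrable lborel f"
  shows "L2_norm lborel (T f) = L2_norm lborel (FT s f)"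
  by (rule L2_norm_cong_AE)
    (use FT[OF assms] L2_measurable[OF L2_operator_L2[OF op assms(1)]] L2_measurable[OF FT_contraction(1)[OF assms sign]] in auto)

lemma contraction:
  assumes f: "f \<in> L2 lborel"
  shows "L2_norm lborel (T f) \<le> L2_norm lborel f"
proof (rule LIMSEQ_le)
  let ?f = "\<lambda>k x. f x * indicator (cball 0 (real k)) x"
  note c = L2_times_cball[OF f]
  show "(\<lambda>k. L2_norm lborel (T (?f k))) \<longlonglongrightarrow> L2_norm lborel (T f)"
    by (rule L2_norm_tendsto[OF L2_operator_L2[OF op c(1)] L2_operator_L2[OF op f] L2_operator_tendsto[OF op c(1) f c(3)]])
  show "(\<lambda>k. L2_norm lborel (?f k)) \<longlonglongrightarrow> L2_norm lborel f"
    by (rule L2_norm_tendsto[OF c(1) f c(3)])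
  show "\<exists>N. \<forall>k\<ge>N. L2_norm lborel (T (?f k)) \<le> L2_norm lborel (?f k)"
    using FT_contraction(2)[OF c(1,2) sign] norm_FT[OF c(1,2)] by auto
qed

text \<open>For a contraction, the vectors whose norm is preserved form a closed subspace, by the parallelogram law.\<close>

lemma isometry:
  assumes f: "f \<in> L2 lborel"
  shows "L2_norm lborel (T f) = L2_norm lborel f"
proof -
  let ?G = "{U :: 'a set. open U \<and> emeasure lborel U < \<infinity>}"
  have sub: "emeasure lborel (A \<inter> B) < \<infinity>" if "emeasure lborel A < \<infinity>" "open A" "open B" for A B :: "'a set"
    using that by (intro le_less_trans[OF emeasure_mono that(1)]) auto
  have ballfin: "emeasure lborel (ball (0::'a) r) < \<infinity>" for r
    using emeasure_bounded_finite[OF bounded_ball] by auto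
  have ex: "\<forall>\<^sub>F k in sequentially. x \<in> ball 0 (real k)" for x :: 'a
    using eventually_gt_at_top[of "nat \<lceil>norm x\<rceil>"]
  proof eventually_elim
    case (elim k)
    then show ?case by (simp add: nat_less_iff) linarith
  qed
  show ?thesis
    using f
  proof (induction rule: L2_induct[where G="?G"])
    case int_stable
    then show ?case using sub by (auto simp: Int_stable_def)
  next
    case generates
    \<comment> \<open>Intersecting with balls exhausts an open set by members of
      \<open>?G\<close>.\<close>
    have "sigma_sets UNIV ?G = sigma_sets UNIV {S :: 'a set. open S}"
    proof (rule sigma_sets_eqI)
      fix U :: "'a set" assume "U \<in> {S. open S}"
      then have "(\<Union>k. U \<inter> ball 0 (real k)) \<in> sigma_sets UNIV ?G"
        using sub[OF ballfin] by (intro sigma_sets.Union sigma_sets.Basic) (auto simp: Int_commute)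
      also have "(\<Union>k. U \<inter> ball 0 (real k)) = U"
        by (auto intro: reals_Archimedean2)
      finally show "U \<in> sigma_sets UNIV ?G" .
    qed auto
    then show ?case by (simp add: borel_def)
  next
    case exhaust
    show ?case using ballfin ex by (intro exI[of _ "\<lambda>k. ball 0 (real k)"]) auto
  next
    case (basic U)
    then have U: "open U" "emeasure lborel U < \<infinity>" by auto
    have fL: "(\<lambda>x. indicator U x :: complex) \<in> L2 lborel" by (rule L2_indicator) (use U in auto)
    have "(\<lambda>x. indicator U x * cnj (indicator U x)) = (\<lambda>x. indicator U x :: complex)" by (auto simp: indicator_def fun_eq_iff)
    then have fI: "integrable lborel (\<lambda>x. indicator U x :: complex)" using L2_mult_integrable[OF fL fL] by simp
    show ?case using norm_FT[OF fL fI] FT_indicator_isometry[OF U sign] by simp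
  next
    case (lincomb f g a b)
    let ?p = "\<lambda>x. a * f x + b * g x" and ?m = "\<lambda>x. a * f x + (- b) * g x"
    have plaw: "(L2_norm M (\<lambda>x. u x + v x))\<^sup>2 + (L2_norm M (\<lambda>x. u x - v x))\<^sup>2 = 2 * (L2_norm M u)\<^sup>2 + 2 * (L2_norm M v)\<^sup>2"
      if "u \<in> L2 M" "v \<in> L2 M" for u v and M :: "'a measure"
      using L2_norm_add_sq[OF that] L2_norm_add_sq[OF that(1) L2_scale[OF that(2), of "-1"]]
        L2_norm_scale[of M "-1" v] L2_inner_lincomb_right[OF that(2,2,1), of "-1" 0] by simp
    have Tf: "T f \<in> L2 lborel" "T g \<in> L2 lborel" by (intro L2_operator_L2[OF op] lincomb)+
    have pL: "?p \<in> L2 lborel" "?m \<in> L2 lborel" by (intro L2_lincomb lincomb)+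
    have n1: "L2_norm lborel (T ?p) = L2_norm lborel (\<lambda>x. a * T f x + b * T g x)"
      by (rule L2_norm_cong_AE[OF L2_measurable[OF L2_operator_L2[OF op pL(1)]] L2_measurable[OF L2_lincomb[OF Tf]]
        L2_operator_lincomb[OF op lincomb(1,2)]])
    have n2: "L2_norm lborel (T ?m) = L2_norm lborel (\<lambda>x. a * T f x + (- b) * T g x)"
      by (rule L2_norm_cong_AE[OF L2_measurable[OF L2_operator_L2[OF op pL(2)]] L2_measurable[OF L2_lincomb[OF Tf]]
        L2_operator_lincomb[OF op lincomb(1,2)]])
    have "(L2_norm lborel (T ?p))\<^sup>2 + (L2_norm lborel (T ?m))\<^sup>2 = (L2_norm lborel ?p)\<^sup>2 + (L2_norm lborel ?m)\<^sup>2"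
      unfolding n1 n2
      using plaw[OF L2_scale[OF Tf(1), of a] L2_scale[OF Tf(2), of b]]
        plaw[OF L2_scale[OF lincomb(1), of a] L2_scale[OF lincomb(2), of b]] lincomb(3,4)
      by (simp add: L2_norm_scale)
    \<comment> \<open>Neither summand on the left exceeds its counterpart on the right, so equality
      of the sums forces equality of the summands.\<close>
    moreover have "(L2_norm lborel (T ?p))\<^sup>2 \<le> (L2_norm lborel ?p)\<^sup>2" "(L2_norm lborel (T ?m))\<^sup>2 \<le> (L2_norm lborel ?m)\<^sup>2"
      by (intro power_mono contraction pL; simp)+
    ultimately have "(L2_norm lborel (T ?p))\<^sup>2 = (L2_norm lborel ?p)\<^sup>2" by linarith
    then show ?case by (rule power2_eq_imp_eq) auto
  next
    case (limit f g)
    have "(\<lambda>k. L2_norm lborel (T (f k))) \<longlonglongrightarrow> L2_norm lborel (T g)"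
      by (rule L2_norm_tendsto[OF L2_operator_L2[OF op limit(1)] L2_operator_L2[OF op limit(2)] L2_operator_tendsto[OF op limit(1,2,3)]])
    moreover have "(\<lambda>k. L2_norm lborel (T (f k))) \<longlonglongrightarrow> L2_norm lborel g"
      using L2_norm_tendsto[OF limit(1,2,3)] limit(4) by simp
    ultimately show ?case by (rule LIMSEQ_unique)
  qed auto
qed

text \<open>By approximation in the first argument. The second stays integrable, so that its
  transform is the integral \<open>FT\<close>, defined at every point.\<close>

lemma multiplication:
  assumes f: "f \<in> L2 lborel" and h: "h \<in> L2 lborel" "integrable lborel h"
  shows "L2_inner lborel (T f) h = L2_inner lborel f (FT (- s) h)"
proof -
  have s': "(- s)\<^sup>2 = 1" using sign by simp
  have hL: "FT (- s) h \<in> L2 lborel" by (rule FT_contraction(1)[OF h s'])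
  have L1: "L2_inner lborel (T u) h = L2_inner lborel u (FT (- s) h)" if u: "u \<in> L2 lborel" "integrable lborel u" for u
  proof -
    have "L2_inner lborel (T u) h = L2_inner lborel (FT s u) h"
      by (rule L2_inner_cong_AE[OF L2_measurable[OF L2_operator_L2[OF op u(1)]] L2_measurable[OF FT_contraction(1)[OF u sign]]
        FT[OF u] L2_measurable[OF h(1)]])
    also have "\<dots> = (LINT y|lborel. u y * FT s (\<lambda>x. cnj (h x)) y)"
      unfolding L2_inner_def by (rule FT_multiplication_L1) (use u h in auto)
    also have "\<dots> = L2_inner lborel u (FT (- s) h)"
      unfolding L2_inner_def cnj_FT by simp
    finally show ?thesis .
  qed
  let ?f = "\<lambda>k x. f x * indicator (cball 0 (real k)) x"
  note c = L2_times_cball[OF f]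
  have "(\<lambda>k. L2_inner lborel (T (?f k)) h) \<longlonglongrightarrow> L2_inner lborel (T f) h"
    by (rule L2_inner_tendsto[OF L2_operator_L2[OF op c(1)] L2_operator_L2[OF op f] L2_operator_tendsto[OF op c(1) f c(3)] h(1)])
  moreover have "(\<lambda>k. L2_inner lborel (T (?f k)) h) \<longlonglongrightarrow> L2_inner lborel f (FT (- s) h)"
    unfolding L1[OF c(1,2)] by (rule L2_inner_tendsto[OF c(1) f c(3) hL])
  ultimately show ?thesis by (rule LIMSEQ_unique)
qed

end

text \<open>Plancherel for the integral is read off from an extension \<open>T\<close>, since the
  induction over functions takes place on all of \<open>L2 lborel\<close>.\<close>

lemma FT_isometry:
  fixes f :: "'a::euclidean_space \<Rightarrow> complex"
  assumes f: "f \<in> L2 lborel" "integrable lborel f" and s: "s\<^sup>2 = 1"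
  shows "L2_norm lborel (FT s f) = L2_norm lborel f"
proof -
  obtain T where "L2_operator lborel lborel T"
    "\<forall>f\<in>L2 lborel. integrable lborel f \<longrightarrow> (AE x in lborel. T f x = FT s f (x::'a))"
    using FT_extension_exists[OF s] by blast
  then interpret FT_L2 s T using s by unfold_locales auto
  show ?thesis using norm_FT[OF f] isometry[OF f(1)] by simp
qed

subsection \<open>The partial Fourier transform\<close>

definition partial_FT :: "real \<Rightarrow> ('a::euclidean_space \<times> 'b \<Rightarrow> complex) \<Rightarrow> 'a \<times> 'b \<Rightarrow> complex" where
  "partial_FT s u z = FT s (\<lambda>x. u (x, snd z)) (fst z)"

locale lborel_pair_measure =
  fixes N :: "'b measure"
  assumes N: "sigma_finite_measure N"
begin

sublocale pair_sigma_finite "lborel :: 'a::euclidean_space measure" N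
  by (intro pair_sigma_finite.intro N lborel.sigma_finite_measure_axioms)

abbreviation P :: "('a::euclidean_space \<times> 'b) measure" where "P \<equiv> lborel \<Otimes>\<^sub>M N"

lemma AE_snd:
  assumes "AE y in N. R y"
  shows "AE z in P. R (snd z)"
proof -
  obtain B where B: "B \<in> null_sets N" "{y \<in> space N. \<not> R y} \<subseteq> B"
    using assms by (auto simp: eventually_ae_filter)
  have "emeasure P ((UNIV :: 'a::euclidean_space set) \<times> B) = emeasure lborel (UNIV :: 'a set) * emeasure N B"
    by (rule M2.emeasure_pair_measure_Times) (use B in auto)
  then have "(UNIV :: 'a set) \<times> B \<in> null_sets P" using B by auto
  then show "AE z in (P :: ('a \<times> 'b) measure). R (snd z)"
    by (rule AE_I') (use B in \<open>auto simp: space_pair_measure\<close>)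
qed

lemma measurable_partial_FT:
  assumes u [measurable]: "u \<in> borel_measurable P"
  shows "partial_FT s u \<in> borel_measurable P"
proof -
  have "(\<lambda>z. LINT x|lborel. cis (s * (fst z \<bullet> x)) * u (x, snd z)) \<in> borel_measurable P"
    by (rule lborel.borel_measurable_lebesgue_integral) measurable
  then show ?thesis unfolding partial_FT_def FT_def by measurable
qed

lemma L2_slice:
  assumes u: "u \<in> L2 P"
  shows "AE y in N. (\<lambda>x. u (x, y)) \<in> L2 lborel"
proof -
  note [measurable] = L2_measurable[OF u]
  have "(\<integral>\<^sup>+y. \<integral>\<^sup>+x. ennreal ((cmod (u (x, y)))\<^sup>2) \<partial>lborel \<partial>N) = (\<integral>\<^sup>+z. ennreal ((cmod (u z))\<^sup>2) \<partial>P)"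
    by (rule nn_integral_snd) measurable
  then have "(\<integral>\<^sup>+y. \<integral>\<^sup>+x. ennreal ((cmod (u (x, y)))\<^sup>2) \<partial>lborel \<partial>N) \<noteq> \<infinity>"
    by (simp add: L2_nn_integral[OF u])
  then have "AE y in N. (\<integral>\<^sup>+x. ennreal ((cmod (u (x, y)))\<^sup>2) \<partial>lborel) \<noteq> \<infinity>"
    by (rule nn_integral_PInf_AE[rotated]) measurable
  moreover have "AE y in N. (\<lambda>x. u (x, y)) \<in> borel_measurable lborel"
    by (rule AE_I2) measurable
  ultimately show ?thesis
    by eventually_elim (rule L2_I_nn, auto simp: less_top)
qed

lemma L2_inner_iterated:
  assumes u: "u \<in> L2 P" and v: "v \<in> L2 P"
  shows "L2_inner P u v = (LINT y|N. L2_inner lborel (\<lambda>x. u (x, y)) (\<lambda>x. v (x, y)))"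
  using integral_snd[of "\<lambda>x y. u (x, y) * cnj (v (x, y))"] L2_mult_integrable[OF u v]
  by (simp add: L2_inner_def split_beta')

text \<open>Plancherel on almost every slice, then Tonelli.\<close>

lemma partial_FT_isometry:
  assumes u: "u \<in> L2 P" "AE y in N. integrable lborel (\<lambda>x. u (x, y))" and s: "s\<^sup>2 = 1"
  shows "partial_FT s u \<in> L2 P" "L2_norm P (partial_FT s u) = L2_norm P u"
proof -
  note [measurable] = L2_measurable[OF u(1)] measurable_partial_FT[OF L2_measurable[OF u(1)], of s]
  have "(\<integral>\<^sup>+z. ennreal ((cmod (partial_FT s u z))\<^sup>2) \<partial>P) = (\<integral>\<^sup>+y. \<integral>\<^sup>+x. ennreal ((cmod (partial_FT s u (x, y)))\<^sup>2) \<partial>lborel \<partial>N)"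
    by (rule nn_integral_snd[symmetric]) measurable
  also have "\<dots> = (\<integral>\<^sup>+y. \<integral>\<^sup>+x. ennreal ((cmod (u (x, y)))\<^sup>2) \<partial>lborel \<partial>N)"
  proof (rule nn_integral_cong_AE)
    show "AE y in N. (\<integral>\<^sup>+x. ennreal ((cmod (partial_FT s u (x, y)))\<^sup>2) \<partial>lborel) = (\<integral>\<^sup>+x. ennreal ((cmod (u (x, y)))\<^sup>2) \<partial>lborel)"
      using L2_slice[OF u(1)] u(2)
    proof eventually_elim
      case (elim y)
      have "(\<integral>\<^sup>+x. ennreal ((cmod (FT s (\<lambda>x. u (x, y)) x))\<^sup>2) \<partial>lborel) = (\<integral>\<^sup>+x. ennreal ((cmod (u (x, y)))\<^sup>2) \<partial>lborel)"
        by (simp only: L2_nn_integral[OF elim(1)] L2_nn_integral[OF FT_contraction(1)[OF elim s]] FT_isometry[OF elim s])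
      then show ?case by (simp add: partial_FT_def)
    qed
  qed
  also have "\<dots> = (\<integral>\<^sup>+z. ennreal ((cmod (u z))\<^sup>2) \<partial>P)"
    by (rule nn_integral_snd) measurable
  also have "\<dots> = ennreal ((L2_norm P u)\<^sup>2)" by (rule L2_nn_integral[OF u(1)])
  finally have *: "(\<integral>\<^sup>+z. ennreal ((cmod (partial_FT s u z))\<^sup>2) \<partial>P) = ennreal ((L2_norm P u)\<^sup>2)" .
  show L: "partial_FT s u \<in> L2 P" by (rule L2_I_nn) (use * in auto)
  have "(L2_norm P (partial_FT s u))\<^sup>2 = (L2_norm P u)\<^sup>2"
    using * unfolding L2_nn_integral[OF L] by (subst (asm) ennreal_inj) auto
  then show "L2_norm P (partial_FT s u) = L2_norm P u" by (rule power2_eq_imp_eq) auto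
qed

lemma L2_tensor_product:
  assumes f: "f \<in> L2 lborel" and g: "g \<in> L2 N"
  shows "(\<lambda>(x, y). f x * g y) \<in> L2 P" "L2_norm P (\<lambda>(x, y). f x * g y) = L2_norm lborel f * L2_norm N g"
proof -
  note [measurable] = L2_measurable[OF f] L2_measurable[OF g]
  have m: "(\<lambda>(x, y). f x * g y) \<in> borel_measurable P" by measurable
  have "(\<integral>\<^sup>+z. ennreal ((cmod ((\<lambda>(x, y). f x * g y) z))\<^sup>2) \<partial>P) = (\<integral>\<^sup>+y. \<integral>\<^sup>+x. ennreal ((cmod (f x * g y))\<^sup>2) \<partial>lborel \<partial>N)"
    by (subst nn_integral_snd[symmetric]) simp_all
  also have "\<dots> = (\<integral>\<^sup>+y. ennreal ((L2_norm lborel f)\<^sup>2) * ennreal ((cmod (g y))\<^sup>2) \<partial>N)"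
    by (intro nn_integral_cong)
      (simp add: norm_mult power_mult_distrib ennreal_mult nn_integral_multc L2_nn_integral[OF f])
  also have "\<dots> = ennreal ((L2_norm lborel f * L2_norm N g)\<^sup>2)"
    by (simp add: nn_integral_cmult L2_nn_integral[OF g] power_mult_distrib ennreal_mult)
  finally have *: "(\<integral>\<^sup>+z. ennreal ((cmod ((\<lambda>(x, y). f x * g y) z))\<^sup>2) \<partial>P) = ennreal ((L2_norm lborel f * L2_norm N g)\<^sup>2)" .
  show L: "(\<lambda>(x, y). f x * g y) \<in> L2 P" by (rule L2_I_nn[OF m]) (use * in auto)
  have "(L2_norm P (\<lambda>(x, y). f x * g y))\<^sup>2 = (L2_norm lborel f * L2_norm N g)\<^sup>2"
    using * unfolding L2_nn_integral[OF L] by (subst (asm) ennreal_inj) auto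
  then show "L2_norm P (\<lambda>(x, y). f x * g y) = L2_norm lborel f * L2_norm N g" by (rule power2_eq_imp_eq) auto
qed

end

lemma emeasure_Int_finite:
  assumes "emeasure Q A < \<infinity>" "A \<in> sets Q"
  shows "emeasure Q (A \<inter> B) < \<infinity>"
  by (rule le_less_trans[OF emeasure_mono assms(1)]) (use assms in auto)

locale FT_tensor = FT_L2 s T + lborel_pair_measure N
  for s :: real and T :: "('a::euclidean_space \<Rightarrow> complex) \<Rightarrow> ('a \<Rightarrow> complex)" and N :: "'b measure"
begin

text \<open>The witness is the bounded extension of the partial transform from functions with
  integrable slices. If \<open>f\<close> is not integrable, the elementary tensor may lie outside
  that domain, so the product formula is first shown for truncations of \<open>f\<close>.\<close>

lemma tensor_extension_exists:
  "\<exists>W. L2_operator P P W \<and>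
     (\<forall>f\<in>L2 lborel. \<forall>g\<in>L2 N. AE z in P. W (\<lambda>(x, y). f x * g y) z = T f (fst z) * g (snd z))"
proof -
  let ?D = "{u \<in> L2 P. AE y in N. integrable lborel (\<lambda>x. u (x, y) :: complex)} :: ('a \<times> 'b \<Rightarrow> complex) set"
  let ?tr = "\<lambda>(u :: 'a \<times> 'b \<Rightarrow> complex) k z. u z * indicator (cball 0 (real k) \<times> space N) z"
  have trD: "?tr u k \<in> ?D" "(\<lambda>k. L2_norm P (\<lambda>z. ?tr u k z - u z)) \<longlonglongrightarrow> 0" if u: "u \<in> L2 P" for u k
  proof -
    have "?tr u k \<in> L2 P" by (rule L2_times_indicator[OF u]) auto
    moreover have "AE y in N. integrable lborel (\<lambda>x. ?tr u k (x, y))"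
      using L2_slice[OF u] AE_space
    proof eventually_elim
      case (elim y)
      have eq: "(\<lambda>x. ?tr u k (x, y)) = (\<lambda>x. u (x, y) * indicator (cball 0 (real k)) x)"
        using elim by (simp add: indicator_def fun_eq_iff)
      show ?case unfolding eq by (rule L2_times_cball(2)[OF elim(1)])
    qed
    ultimately show "?tr u k \<in> ?D" by blast
    show "(\<lambda>k. L2_norm P (\<lambda>z. ?tr u k z - u z)) \<longlonglongrightarrow> 0"
    proof (rule L2_times_indicator_tendsto[OF u])
      fix z :: "'a \<times> 'b" assume z: "z \<in> space P"
      show "\<forall>\<^sub>F k in sequentially. z \<in> cball 0 (real k) \<times> space N"
        using eventually_ge_at_top[of "nat \<lceil>norm (fst z)\<rceil>"]
        by eventually_elim (use z in \<open>auto simp: space_pair_measure nat_ceiling_le_eq\<close>)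
    qed auto
  qed
  have "\<exists>W. L2_operator P P W \<and> (\<forall>u\<in>?D. AE z in P. W u z = partial_FT s u z)"
  proof (rule L2_operator_extension)
    fix u v :: "'a \<times> 'b \<Rightarrow> complex" and a b assume u: "u \<in> ?D" and v: "v \<in> ?D"
    have "AE y in N. integrable lborel (\<lambda>x. a * u (x, y) + b * v (x, y))"
      using u v by (auto elim: eventually_elim2)
    then show "(\<lambda>z. a * u z + b * v z) \<in> ?D" using u v by (simp add: L2_lincomb)
    have "AE y in N. integrable lborel (\<lambda>x. u (x, y)) \<and> integrable lborel (\<lambda>x. v (x, y))" using u v by auto
    from AE_snd[OF this]
    show "AE z in P. partial_FT s (\<lambda>z. a * u z + b * v z) z = a * partial_FT s u z + b * partial_FT s v z"
      by eventually_elim (simp add: partial_FT_def FT_lincomb)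
  next
    fix u :: "'a \<times> 'b \<Rightarrow> complex" assume u: "u \<in> ?D"
    then show "partial_FT s u \<in> L2 P" "L2_norm P (partial_FT s u) \<le> L2_norm P u"
      using partial_FT_isometry[of u s, OF _ _ sign] by auto
  next
    fix u :: "'a \<times> 'b \<Rightarrow> complex" assume u: "u \<in> L2 P"
    show "\<exists>d. (\<forall>k. d k \<in> ?D) \<and> (\<lambda>k. L2_norm P (\<lambda>z. d k z - u z)) \<longlonglongrightarrow> 0"
      by (rule exI[of _ "?tr u"]) (use trD[OF u] in blast)
  qed blast
  then obtain W where W: "L2_operator P P W" "\<And>u. u \<in> ?D \<Longrightarrow> AE z in P. W u z = partial_FT s u z" by blast
  have "AE z in P. W (\<lambda>(x, y). f x * g y) z = T f (fst z) * g (snd z)" if f: "f \<in> L2 lborel" and g: "g \<in> L2 N" for f g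
  proof -
    let ?f = "\<lambda>k x. f x * indicator (cball 0 (real k)) x"
    let ?u = "\<lambda>(x, y). f x * g y" and ?uk = "\<lambda>k (x, y). ?f k x * g y"
    note c = L2_times_cball[OF f]
    have uL: "?u \<in> L2 P" and ukL: "?uk k \<in> L2 P" for k by (rule L2_tensor_product(1)[OF _ g], rule f c)+
    have TuL: "(\<lambda>(x, y). T f x * g y) \<in> L2 P" and TukL: "(\<lambda>(x, y). T (?f k) x * g y) \<in> L2 P" for k
      by (intro L2_tensor_product(1)[OF _ g] L2_operator_L2[OF op] f c)+
    have diff: "L2_norm P (\<lambda>z. (\<lambda>(x, y). p x * g y) z - (\<lambda>(x, y). q x * g y) z) = L2_norm lborel (\<lambda>x. p x - q x) * L2_norm N g"
      if "p \<in> L2 lborel" "q \<in> L2 lborel" for p q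
      using L2_tensor_product(2)[OF L2_diff[OF that] g] by (simp add: split_beta' algebra_simps)
    have ukD: "?uk k \<in> ?D" for k
      using ukL c(2) by (auto intro!: AE_I2)
    have Wuk: "AE z in P. W (?uk k) z = (\<lambda>(x, y). T (?f k) x * g y) z" for k
    proof -
      have "AE x in lborel. T (?f k) x = FT s (?f k) x" by (rule FT[OF c(1,2)])
      then have "AE z in P. T (?f k) (fst z) = FT s (?f k) (fst z)"
      proof -
        obtain B where B: "B \<in> null_sets lborel" "{x \<in> space lborel. T (?f k) x \<noteq> FT s (?f k) x} \<subseteq> B"
          using FT[OF c(1,2), of k] by (auto simp: eventually_ae_filter)
        have "emeasure P (B \<times> space N) = emeasure lborel B * emeasure N (space N)"
          by (rule M2.emeasure_pair_measure_Times) (use B in auto)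
        then have "B \<times> space N \<in> null_sets P" using B by auto
        then show ?thesis by (rule AE_I') (use B in \<open>auto simp: space_pair_measure\<close>)
      qed
      then show ?thesis using W(2)[OF ukD[of k]]
      proof eventually_elim
        case (elim z)
        have "partial_FT s (?uk k) z = FT s (?f k) (fst z) * g (snd z)"
          by (simp add: partial_FT_def FT_def mult.assoc[symmetric])
        then show ?case using elim by (simp add: split_beta')
      qed
    qed
    have "(\<lambda>k. L2_norm P (\<lambda>z. W (?uk k) z - W ?u z)) \<longlonglongrightarrow> 0"
    proof (rule L2_operator_tendsto[OF W(1) ukL uL])
      show "(\<lambda>k. L2_norm P (\<lambda>z. ?uk k z - ?u z)) \<longlonglongrightarrow> 0"
        unfolding diff[OF c(1) f] using tendsto_mult_right[OF c(3), of "L2_norm N g"] by simp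
    qed
    moreover have "(\<lambda>k. L2_norm P (\<lambda>z. W (?uk k) z - (\<lambda>(x, y). T f x * g y) z)) \<longlonglongrightarrow> 0"
    proof -
      have "L2_norm P (\<lambda>z. W (?uk k) z - (\<lambda>(x, y). T f x * g y) z) = L2_norm P (\<lambda>z. (\<lambda>(x, y). T (?f k) x * g y) z - (\<lambda>(x, y). T f x * g y) z)" for k
        by (rule L2_norm_cong_AE[OF L2_measurable[OF L2_diff[OF L2_operator_L2[OF W(1) ukL] TuL]] L2_measurable[OF L2_diff[OF TukL TuL]]])
          (use Wuk[of k] in eventually_elim, simp)
      also have "\<dots> k = L2_norm lborel (\<lambda>x. T (?f k) x - T f x) * L2_norm N g" for k
        by (rule diff[OF L2_operator_L2[OF op c(1)] L2_operator_L2[OF op f]])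
      finally have "L2_norm P (\<lambda>z. W (?uk k) z - (\<lambda>(x, y). T f x * g y) z) = L2_norm lborel (\<lambda>x. T (?f k) x - T f x) * L2_norm N g" for k .
      then show ?thesis
        using tendsto_mult_right[OF L2_operator_tendsto[OF op c(1) f c(3)], of "L2_norm N g"] by simp
    qed
    ultimately have "AE z in P. W ?u z = (\<lambda>(x, y). T f x * g y) z"
      by (rule L2_limit_unique[OF L2_operator_L2[OF W(1) ukL] L2_operator_L2[OF W(1) uL] TuL])
    then show ?thesis by (simp add: split_beta')
  qed
  with W(1) show ?thesis by blast
qed

text \<open>\<open>W\<close> is known on elementary tensors only, hence the induction over
  rectangles. Integrability of the slices of \<open>v\<close> lets \<open>multiplication\<close> be
  applied slice by slice and makes the right-hand side a concrete integral transform.\<close>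

lemma tensor_extension_inner:
  assumes W: "L2_operator P P W"
    and tensor: "\<And>f g. f \<in> L2 lborel \<Longrightarrow> g \<in> L2 N \<Longrightarrow> AE z in P. W (\<lambda>(x, y). f x * g y) z = T f (fst z) * g (snd z)"
    and u: "u \<in> L2 P" and v: "v \<in> L2 P" "AE y in N. integrable lborel (\<lambda>x. v (x, y))"
  shows "L2_inner P (W u) v = L2_inner P u (partial_FT (- s) v)"
proof -
  have s': "(- s)\<^sup>2 = 1" using sign by simp
  note VL = partial_FT_isometry(1)[OF v s']
  \<comment> \<open>Both sides have finite measure, as indicators have to be square-integrable;
    \<sigma>-finiteness of \<open>N\<close> provides an exhaustion by such rectangles.\<close>
  let ?G = "{A \<times> B |A B. A \<in> sets (lborel :: 'a measure) \<and> B \<in> sets N \<and> emeasure lborel A < \<infinity> \<and> emeasure N B < \<infinity>}"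
  obtain E :: "nat \<Rightarrow> 'b set" where E: "range E \<subseteq> sets N" "(\<Union>i. E i) = space N" "\<And>i. emeasure N (E i) \<noteq> \<infinity>" "incseq E"
    using M2.sigma_finite_incseq by blast
  have E': "E k \<in> sets N" "emeasure N (E k) < \<infinity>" for k using E by (auto simp: less_top)
  have C': "cball 0 r \<in> sets lborel" "emeasure lborel (cball (0::'a) r) < \<infinity>" for r
    using emeasure_bounded_finite[OF bounded_cball] by auto
  have ev: "\<forall>\<^sub>F k in sequentially. z \<in> cball 0 (real k) \<times> E k" if z: "z \<in> space P" for z :: "'a \<times> 'b"
  proof -
    have "snd z \<in> (\<Union>i. E i)" unfolding E(2) using z by (auto simp: space_pair_measure)
    then obtain i where i: "snd z \<in> E i" by blast
    show ?thesis
      using eventually_ge_at_top[of "nat \<lceil>norm (fst z)\<rceil>"] eventually_ge_at_top[of i]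
    proof eventually_elim
      case (elim k)
      then have "snd z \<in> E k" using i E(4) by (auto simp: incseq_def)
      with elim show ?case by (cases z) (auto simp: nat_ceiling_le_eq)
    qed
  qed
  show ?thesis
    using u
  proof (induction rule: L2_induct[where G="?G"])
    case int_stable
    show ?case
    proof (rule Int_stableI)
      fix R R' assume "R \<in> ?G" "R' \<in> ?G"
      then obtain A B A' B' where "R = A \<times> B" "R' = A' \<times> B'" and
        AB: "A \<in> sets lborel" "B \<in> sets N" "emeasure lborel A < \<infinity>" "emeasure N B < \<infinity>" "A' \<in> sets lborel" "B' \<in> sets N"
        by blast
      then have "R \<inter> R' = (A \<inter> A') \<times> (B \<inter> B')" by auto
      moreover have "emeasure lborel (A \<inter> A') < \<infinity>" "emeasure N (B \<inter> B') < \<infinity>"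
        by (intro emeasure_Int_finite AB)+
      ultimately show "R \<inter> R' \<in> ?G" using AB by blast
    qed
  next
    case subset
    show ?case using sets.sets_into_space by (auto simp: space_pair_measure)
  next
    case generates
    have "sigma_sets (UNIV \<times> space N) ?G = sigma_sets (UNIV \<times> space N) {a \<times> b |a b. a \<in> sets (lborel :: 'a measure) \<and> b \<in> sets N}"
    proof (rule sigma_sets_eqI)
      fix R assume "R \<in> {a \<times> b |a b. a \<in> sets (lborel :: 'a measure) \<and> b \<in> sets N}"
      then obtain A B where R: "R = A \<times> B" "A \<in> sets (lborel :: 'a measure)" "B \<in> sets N" by blast
      have "(\<Union>k. (cball 0 (real k) \<inter> A) \<times> (E k \<inter> B)) \<in> sigma_sets (UNIV \<times> space N) ?G"
      proof (intro sigma_sets.Union sigma_sets.Basic)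
        fix k
        have "emeasure lborel (cball 0 (real k) \<inter> A) < \<infinity>" "emeasure N (E k \<inter> B) < \<infinity>"
          by (intro emeasure_Int_finite C' E')+
        moreover have "cball 0 (real k) \<inter> A \<in> sets lborel" "E k \<inter> B \<in> sets N" using R E' by auto
        ultimately show "(cball 0 (real k) \<inter> A) \<times> (E k \<inter> B) \<in> ?G" by blast
      qed
      also have "(\<Union>k. (cball 0 (real k) \<inter> A) \<times> (E k \<inter> B)) = R"
      proof (intro equalityI subsetI)
        fix z assume z: "z \<in> R"
        then have "z \<in> space P" using R sets.sets_into_space by (auto simp: space_pair_measure)
        from ev[OF this] obtain k where "z \<in> cball 0 (real k) \<times> E k"
          by (auto simp: eventually_sequentially)
        with z R show "z \<in> (\<Union>k. (cball 0 (real k) \<inter> A) \<times> (E k \<inter> B))" by blast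
      qed (use R in auto)
      finally show "R \<in> sigma_sets (UNIV \<times> space N) ?G" .
    qed blast
    then show ?case by (simp add: sets_pair_measure space_pair_measure)
  next
    case (finite R)
    then show ?case by (auto simp: M2.emeasure_pair_measure_Times ennreal_mult_less_top)
  next
    case exhaust
    show ?case
    proof (rule exI[of _ "\<lambda>k. cball 0 (real k) \<times> E k"], intro conjI allI ballI)
      fix k show "cball 0 (real k) \<times> E k \<in> ?G"
        by (rule CollectI, rule exI[of _ "cball 0 (real k)"], rule exI[of _ "E k"], intro conjI refl C' E')
    qed (rule ev)
  next
    case (basic R)
    then obtain A B where R: "R = A \<times> B" and AB: "A \<in> sets lborel" "B \<in> sets N" "emeasure lborel A < \<infinity>" "emeasure N B < \<infinity>"
      by blast
    let ?f = "\<lambda>x. indicator A x :: complex" and ?g = "\<lambda>y. indicator B y :: complex"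
    have f: "?f \<in> L2 lborel" and g: "?g \<in> L2 N" by (intro L2_indicator AB)+
    have eq: "(\<lambda>z. indicator R z) = (\<lambda>(x, y). ?f x * ?g y)" by (auto simp: R indicator_def fun_eq_iff)
    have TL: "(\<lambda>(x, y). T ?f x * ?g y) \<in> L2 P" by (rule L2_tensor_product(1)[OF L2_operator_L2[OF op f] g])
    have uL: "(\<lambda>(x, y). ?f x * ?g y) \<in> L2 P" by (rule L2_tensor_product(1)[OF f g])
    have scale: "L2_inner Q (\<lambda>x. p x * c) q = c * L2_inner Q p q" for Q :: "'a measure" and p q c
      unfolding L2_inner_def by (simp only: integral_mult_inward mult_ac)
    have "L2_inner P (W (\<lambda>(x, y). ?f x * ?g y)) v = L2_inner P (\<lambda>(x, y). T ?f x * ?g y) v"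
      using tensor[OF f g]
      by (intro L2_inner_cong_AE[OF L2_measurable[OF L2_operator_L2[OF W uL]] L2_measurable[OF TL] _ L2_measurable[OF v(1)]])
        (simp add: split_beta')
    also have "\<dots> = (LINT y|N. L2_inner lborel (\<lambda>x. T ?f x * ?g y) (\<lambda>x. v (x, y)))"
      using L2_inner_iterated[OF TL v(1)] by simp
    also have "\<dots> = (LINT y|N. L2_inner lborel (\<lambda>x. ?f x * ?g y) (\<lambda>x. partial_FT (- s) v (x, y)))"
    proof (rule integral_cong_AE)
      note [measurable] = L2_measurable[OF v(1)] L2_measurable[OF VL] L2_measurable[OF L2_operator_L2[OF op f]] AB(1,2)
      show "(\<lambda>y. L2_inner lborel (\<lambda>x. T ?f x * ?g y) (\<lambda>x. v (x, y))) \<in> borel_measurable N"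
        "(\<lambda>y. L2_inner lborel (\<lambda>x. ?f x * ?g y) (\<lambda>x. partial_FT (- s) v (x, y))) \<in> borel_measurable N"
        unfolding L2_inner_def by (rule lborel.borel_measurable_lebesgue_integral, measurable)+
      show "AE y in N. L2_inner lborel (\<lambda>x. T ?f x * ?g y) (\<lambda>x. v (x, y)) = L2_inner lborel (\<lambda>x. ?f x * ?g y) (\<lambda>x. partial_FT (- s) v (x, y))"
        using L2_slice[OF v(1)] v(2)
        by eventually_elim (simp only: scale multiplication[OF f] partial_FT_def fst_conv snd_conv)
    qed
    also have "\<dots> = L2_inner P (\<lambda>(x, y). ?f x * ?g y) (partial_FT (- s) v)"
      using L2_inner_iterated[OF uL VL] by simp
    finally show ?case unfolding eq .
  next
    case (lincomb f g a b)
    have "L2_inner P (W (\<lambda>x. a * f x + b * g x)) v = L2_inner P (\<lambda>x. a * W f x + b * W g x) v"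
      by (rule L2_inner_cong_AE[OF L2_measurable[OF L2_operator_L2[OF W L2_lincomb[OF lincomb(1,2)]]]
        L2_measurable[OF L2_lincomb[OF L2_operator_L2[OF W lincomb(1)] L2_operator_L2[OF W lincomb(2)]]]
        L2_operator_lincomb[OF W lincomb(1,2)] L2_measurable[OF v(1)]])
    then show ?case
      using lincomb L2_inner_lincomb_left[OF L2_operator_L2[OF W lincomb(1)] L2_operator_L2[OF W lincomb(2)] v(1)]
        L2_inner_lincomb_left[OF lincomb(1,2) VL] by simp
  next
    case (limit f g)
    have "(\<lambda>k. L2_inner P (W (f k)) v) \<longlonglongrightarrow> L2_inner P (W g) v"
      by (rule L2_inner_tendsto[OF L2_operator_L2[OF W limit(1)] L2_operator_L2[OF W limit(2)] L2_operator_tendsto[OF W limit(1,2,3)] v(1)])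
    moreover have "(\<lambda>k. L2_inner P (W (f k)) v) \<longlonglongrightarrow> L2_inner P g (partial_FT (- s) v)"
      unfolding limit(4) by (rule L2_inner_tendsto[OF limit(1,2,3) VL])
    ultimately show ?case by (rule LIMSEQ_unique)
  qed
qed

end

section \<open>The Gamma function of the cone\<close>

subsection \<open>Iterated integrals over coordinates\<close>

text \<open>Integrals over one variable at a time, so that variables can be eliminated singly and in
  a chosen order; the head of the list is the outermost integral. The state \<open>x\<close> holds
  the coordinates that are not integrated.\<close>

primrec iter_nn :: "'b list \<Rightarrow> (('b \<Rightarrow> real) \<Rightarrow> ennreal) \<Rightarrow> ('b \<Rightarrow> real) \<Rightarrow> ennreal" where
  "iter_nn [] f x = f x"
| "iter_nn (b # bs) f x = (\<integral>\<^sup>+t. iter_nn bs f (x(b := t)) \<partial>lborel)"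

abbreviation coords :: "('b \<Rightarrow> real) measure" where
  "coords \<equiv> Pi\<^sub>M UNIV (\<lambda>_. borel)"

lemma measurable_coords_upd:
  assumes f: "f \<in> borel_measurable coords"
  shows "(\<lambda>(x, t). f (x(b := t))) \<in> borel_measurable (coords \<Otimes>\<^sub>M lborel)"
proof -
  have "(\<lambda>z. (fst z)(b := snd z)) \<in> coords \<Otimes>\<^sub>M lborel \<rightarrow>\<^sub>M coords"
    by (rule measurable_fun_upd[where J=UNIV]) auto
  from measurable_compose[OF this f] show ?thesis by (simp only: split_beta')
qed

lemma measurable_iter_nn:
  assumes f: "f \<in> borel_measurable coords"
  shows "iter_nn bs f \<in> borel_measurable coords"
proof (induction bs)
  case Nil
  have "iter_nn [] f = f" by (simp add: fun_eq_iff)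
  then show ?case using f by simp
next
  case (Cons b bs)
  have "(\<lambda>x. \<integral>\<^sup>+t. iter_nn bs f (x(b := t)) \<partial>lborel) \<in> borel_measurable coords"
    by (rule lborel.borel_measurable_nn_integral[OF measurable_coords_upd[OF Cons]])
  moreover have "iter_nn (b # bs) f = (\<lambda>x. \<integral>\<^sup>+t. iter_nn bs f (x(b := t)) \<partial>lborel)" by (simp add: fun_eq_iff)
  ultimately show ?case by simp
qed

lemma measurable_coords_upd1:
  assumes f: "f \<in> borel_measurable coords"
  shows "(\<lambda>t. f (x(b := t))) \<in> borel_measurable borel"
proof (rule measurable_compose[OF _ f])
  show "(\<lambda>t. x(b := t)) \<in> borel \<rightarrow>\<^sub>M coords"
    by (rule measurable_fun_upd[where J=UNIV]) (auto simp: space_PiM)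
qed

lemma iter_nn_append: "iter_nn (as @ bs) f x = iter_nn as (iter_nn bs f) x"
  by (induction as arbitrary: x) auto

text \<open>Agreement is required only at states that coincide with \<open>x\<close> off the list:
  inside the integral the other coordinates count as constants.\<close>

lemma iter_nn_cong:
  assumes "\<And>y. (\<And>b. b \<notin> set bs \<Longrightarrow> y b = x b) \<Longrightarrow> f y = g y"
  shows "iter_nn bs f x = iter_nn bs g x"
  using assms
proof (induction bs arbitrary: x)
  case Nil
  then show ?case by simp
next
  case (Cons b bs)
  have "iter_nn bs f (x(b := t)) = iter_nn bs g (x(b := t))" for t
    by (rule Cons.IH, rule Cons.prems) auto
  then show ?case by simp
qed

lemma iter_nn_indep:
  assumes "\<And>b. b \<notin> set bs \<Longrightarrow> x b = y b"
  shows "iter_nn bs f x = iter_nn bs f y"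
  using assms
proof (induction bs arbitrary: x y)
  case Nil
  then have "x = y" by (simp add: fun_eq_iff)
  then show ?case by simp
next
  case (Cons b bs)
  have "iter_nn bs f (x(b := t)) = iter_nn bs f (y(b := t))" for t
    by (rule Cons.IH) (use Cons.prems in auto)
  then show ?case by simp
qed

lemma iter_nn_cmult:
  assumes f: "f \<in> borel_measurable coords"
  shows "iter_nn bs (\<lambda>y. c * f y) x = c * iter_nn bs f x"
proof (induction bs arbitrary: x)
  case (Cons b bs)
  have m: "(\<lambda>t. iter_nn bs f (x(b := t))) \<in> borel_measurable lborel"
    using measurable_coords_upd1[OF measurable_iter_nn[OF f]] by simp
  show ?case unfolding iter_nn.simps Cons.IH by (rule nn_integral_cmult[OF m])
qed simp

lemma iter_nn_shift:
  assumes f: "f \<in> borel_measurable coords"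
  shows "iter_nn bs (\<lambda>y. f (\<lambda>b. y b + c b)) x = iter_nn bs f (\<lambda>b. x b + c b)"
proof (induction bs arbitrary: x)
  case (Cons b bs)
  have upd: "(\<lambda>b'. (x(b := t)) b' + c b') = (\<lambda>b. x b + c b)(b := c b + 1 * t)" for t
    by (auto simp: fun_eq_iff)
  have "(\<integral>\<^sup>+t. iter_nn bs f ((\<lambda>b. x b + c b)(b := t)) \<partial>lborel) =
      (\<integral>\<^sup>+t. iter_nn bs f ((\<lambda>b. x b + c b)(b := c b + 1 * t)) \<partial>lborel)"
    by (subst nn_integral_real_affine[where c=1 and t="c b"])
      (auto intro: measurable_coords_upd1[OF measurable_iter_nn[OF f]])
  then show ?case unfolding iter_nn.simps Cons.IH upd by (rule sym)
qed simp

text \<open>Translation invariance of each one-dimensional integral; the coordinates that are not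
  integrated must stay put.\<close>

lemma iter_nn_translate:
  assumes f: "f \<in> borel_measurable coords" and c: "\<And>b. b \<notin> set bs \<Longrightarrow> c b = 0"
  shows "iter_nn bs (\<lambda>y. f (\<lambda>b. y b + c b)) x = iter_nn bs f x"
  unfolding iter_nn_shift[OF f] by (rule iter_nn_indep) (simp add: c)

lemma iter_nn_top: "iter_nn bs (\<lambda>_. top) x = top"
  by (induction bs arbitrary: x) (auto simp: ennreal_top_mult)

lemma iter_nn_zero: "iter_nn bs (\<lambda>_. 0) x = 0"
  by (induction bs arbitrary: x) auto

lemma iter_nn_fun_upd:
  assumes "b \<notin> set bs"
  shows "iter_nn bs (\<lambda>x. f (x(b := t))) u = iter_nn bs f (u(b := t))"
  using assms
proof (induction bs arbitrary: u)
  case (Cons c cs)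
  then have "u(c := s, b := t) = u(b := t, c := s)" for s by (auto simp: fun_eq_iff)
  moreover have nb: "b \<notin> set cs" using Cons.prems by simp
  ultimately show ?case by (simp only: iter_nn.simps Cons.IH[OF nb])
qed simp

text \<open>The initial state is \<open>undefined\<close> because the functions in a product space
  take this value off the index set.\<close>

lemma nn_integral_PiM_iter_nn:
  assumes "distinct bs" "f \<in> borel_measurable (Pi\<^sub>M (set bs) (\<lambda>_. lborel))"
  shows "(\<integral>\<^sup>+x. f x \<partial>(Pi\<^sub>M (set bs) (\<lambda>_. lborel))) = iter_nn bs f (\<lambda>_. undefined)"
proof -
  interpret product_sigma_finite "\<lambda>_. lborel :: real measure" ..
  show ?thesis
    using assms
  proof (induction bs arbitrary: f)
    case Nil
    then show ?case by (simp add: PiM_empty nn_integral_count_space_finite)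
  next
    case (Cons b bs)
    have m: "(\<lambda>x. f (x(b := t))) \<in> borel_measurable (Pi\<^sub>M (set bs) (\<lambda>_. lborel))" for t
      by (rule measurable_compose[OF _ Cons.prems(2)]) (rule measurable_fun_upd[where J="set bs"], auto)
    have "(\<integral>\<^sup>+x. f x \<partial>(Pi\<^sub>M (set (b # bs)) (\<lambda>_. lborel))) = (\<integral>\<^sup>+t. \<integral>\<^sup>+x. f (x(b := t)) \<partial>(Pi\<^sub>M (set bs) (\<lambda>_. lborel)) \<partial>lborel)"
      using Cons.prems by (simp add: product_nn_integral_insert_rev)
    also have "\<dots> = (\<integral>\<^sup>+t. iter_nn bs f ((\<lambda>_. undefined)(b := t)) \<partial>lborel)"
    proof -
      have d: "distinct bs" "b \<notin> set bs" using Cons.prems(1) by auto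
      show ?thesis by (simp only: Cons.IH[OF d(1) m] iter_nn_fun_upd[OF d(2)])
    qed
    finally show ?case by simp
  qed
qed

subsection \<open>Pivots of a symmetric matrix\<close>

text \<open>The lists below give the order in which the variables are eliminated.\<close>

definition schur :: "'n \<Rightarrow> ('n \<Rightarrow> 'n \<Rightarrow> real) \<Rightarrow> 'n \<Rightarrow> 'n \<Rightarrow> real" where
  "schur k X i j = X i j - X i k * X k j / X k k"

text \<open>For symmetric \<open>X\<close> and distinct indices this is positive definiteness of the
  block on the listed indices (\<open>piv_pos_iff_quad\<close>).\<close>

primrec piv_pos :: "'n list \<Rightarrow> ('n \<Rightarrow> 'n \<Rightarrow> real) \<Rightarrow> bool" where
  "piv_pos [] X = True"
| "piv_pos (k # ks) X = (0 < X k k \<and> piv_pos ks (schur k X))"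

text \<open>When the pivots are positive and the indices distinct, this is the determinant of the
  block (\<open>piv_prod_eq_det\<close>).\<close>

primrec piv_prod :: "'n list \<Rightarrow> ('n \<Rightarrow> 'n \<Rightarrow> real) \<Rightarrow> real" where
  "piv_prod [] X = 1"
| "piv_prod (k # ks) X = X k k * piv_prod ks (schur k X)"

text \<open>What is left of the matrix after the listed indices are eliminated; its diagonal entry
  at another index is the next pivot there.\<close>

primrec schurs :: "'n list \<Rightarrow> ('n \<Rightarrow> 'n \<Rightarrow> real) \<Rightarrow> 'n \<Rightarrow> 'n \<Rightarrow> real" where
  "schurs [] X = X"
| "schurs (k # ks) X = schurs ks (schur k X)"

definition quad :: "'n set \<Rightarrow> ('n \<Rightarrow> 'n \<Rightarrow> real) \<Rightarrow> ('n \<Rightarrow> real) \<Rightarrow> real" where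
  "quad S A v = (\<Sum>i\<in>S. \<Sum>j\<in>S. A i j * v i * v j)"

lemma schur_sym: "(\<And>i j. X i j = X j i) \<Longrightarrow> schur k X i j = schur k X j i"
  by (simp add: schur_def mult.commute)

lemma piv_pos_cong:
  assumes "\<And>i j. i \<in> set ks \<Longrightarrow> j \<in> set ks \<Longrightarrow> X i j = Y i j"
  shows "piv_pos ks X = piv_pos ks Y" "piv_prod ks X = piv_prod ks Y"
proof -
  have "piv_pos ks X = piv_pos ks Y \<and> piv_prod ks X = piv_prod ks Y"
    using assms
  proof (induction ks arbitrary: X Y)
    case (Cons k ks)
    have "piv_pos ks (schur k X) = piv_pos ks (schur k Y) \<and> piv_prod ks (schur k X) = piv_prod ks (schur k Y)"
      by (rule Cons.IH) (use Cons.prems in \<open>simp add: schur_def\<close>)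
    then show ?case using Cons.prems by simp
  qed simp
  then show "piv_pos ks X = piv_pos ks Y" "piv_prod ks X = piv_prod ks Y" by auto
qed

lemma piv_prod_pos: "piv_pos ks X \<Longrightarrow> 0 < piv_prod ks X"
  by (induction ks arbitrary: X) auto

lemma piv_append:
  "piv_pos (ks @ ls) X \<longleftrightarrow> piv_pos ks X \<and> piv_pos ls (schurs ks X)"
  "piv_prod (ks @ ls) X = piv_prod ks X * piv_prod ls (schurs ks X)"
  by (induction ks arbitrary: X) (auto simp: mult.assoc)

lemma measurable_piv:
  assumes "\<And>i j. (\<lambda>x. X x i j) \<in> borel_measurable M"
  shows "Measurable.pred M (\<lambda>x. piv_pos ks (X x))" "(\<lambda>x. piv_prod ks (X x)) \<in> borel_measurable M"
proof -
  have "Measurable.pred M (\<lambda>x. piv_pos ks (X x)) \<and> (\<lambda>x. piv_prod ks (X x)) \<in> borel_measurable M"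
    using assms
  proof (induction ks arbitrary: X)
    case (Cons k ks)
    note [measurable] = Cons.prems
    have "(\<lambda>x. schur k (X x) i j) \<in> borel_measurable M" for i j unfolding schur_def by measurable
    from Cons.IH[OF this] have [measurable]: "Measurable.pred M (\<lambda>x. piv_pos ks (schur k (X x)))" "(\<lambda>x. piv_prod ks (schur k (X x))) \<in> borel_measurable M" by auto
    show ?case by simp
  qed simp
  then show "Measurable.pred M (\<lambda>x. piv_pos ks (X x))" "(\<lambda>x. piv_prod ks (X x)) \<in> borel_measurable M" by auto
qed

text \<open>Completing the square in \<open>v j\<close>. The remainder is the form of the Schur
  complement, which is how pivots enter Gaussian integrals.\<close>

lemma quad_insert:
  assumes S: "finite S" "j \<notin> S" and sym: "\<And>i k. A i k = A k i" and nz: "A j j \<noteq> 0"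
  shows "quad (insert j S) A v = A j j * (v j + (\<Sum>i\<in>S. A j i * v i) / A j j)\<^sup>2 + quad S (schur j A) v"
proof -
  define b where "b = (\<Sum>i\<in>S. A j i * v i)"
  have 1: "(\<Sum>i\<in>S. A j i * v j * v i) = v j * b"
    unfolding b_def sum_distrib_left by (intro sum.cong refl) (simp only: mult_ac)
  have 2: "(\<Sum>i\<in>S. A i j * v i * v j) = v j * b"
    unfolding b_def sum_distrib_left
  proof (intro sum.cong refl)
    fix i show "A i j * v i * v j = v j * (A j i * v i)"
      using sym[of i j] by simp
  qed
  have "quad (insert j S) A v = (A j j * v j * v j + (\<Sum>i\<in>S. A j i * v j * v i)) +
      ((\<Sum>i\<in>S. A i j * v i * v j) + (\<Sum>i\<in>S. \<Sum>k\<in>S. A i k * v i * v k))"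
    unfolding quad_def sum.insert[OF S] sum.distrib by (simp only: add_ac)
  then have "quad (insert j S) A v = A j j * v j * v j + 2 * v j * b + quad S A v"
    unfolding 1 2 quad_def by simp
  moreover have "quad S (schur j A) v = quad S A v - b\<^sup>2 / A j j"
  proof -
    have "b\<^sup>2 / A j j = (\<Sum>i\<in>S. \<Sum>k\<in>S. A i j * A j k / A j j * v i * v k)"
      unfolding power2_eq_square b_def sum_product sum_divide_distrib
    proof (intro sum.cong refl)
      fix i k show "A j i * v i * (A j k * v k) / A j j = A i j * A j k / A j j * v i * v k"
        using sym[of i j] by simp
    qed
    then show ?thesis
      by (simp only: quad_def schur_def left_diff_distrib sum_subtractf)
  qed
  moreover have "A j j * (v j + b / A j j)\<^sup>2 = A j j * v j * v j + 2 * v j * b + b\<^sup>2 / A j j"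
    using nz by (simp add: power2_eq_square field_simps)
  ultimately show ?thesis by (simp add: b_def)
qed

subsection \<open>Gaussian integrals\<close>

lemma gaussian_nn:
  assumes a: "a > 0" and s: "s > 0"
  shows "(\<integral>\<^sup>+t. ennreal (exp (- a * (s * t + c)\<^sup>2)) \<partial>lborel) = ennreal (sqrt (pi / a) / s)"
proof -
  \<comment> \<open>Chosen with \<open>1 / (2 * e) = a * s\<^sup>2\<close>, so that the integrand is
    a multiple of a translated heat kernel.\<close>
  define e where "e = 1 / (2 * a * s\<^sup>2)"
  have e: "e > 0" using a s by (simp add: e_def)
  have "exp (- a * (s * t + c)\<^sup>2) = sqrt (2 * pi * e) * heat_kernel e (t - (- c / s))" for t :: real
  proof -
    have "s * t + c = s * (t - (- c / s))" using s by (simp add: field_simps)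
    then have "- a * (s * t + c)\<^sup>2 = - (norm (t - (- c / s)))\<^sup>2 / (2 * e)"
      using a s by (simp add: e_def power_mult_distrib)
    then show ?thesis
      using e by (simp add: heat_kernel_def powr_minus powr_half_sqrt)
  qed
  then have "(\<integral>\<^sup>+t. ennreal (exp (- a * (s * t + c)\<^sup>2)) \<partial>lborel) = (\<integral>\<^sup>+t. ennreal (sqrt (2 * pi * e)) * ennreal (heat_kernel e (t - (- c / s))) \<partial>lborel)"
    using e by (simp add: ennreal_mult')
  also have "\<dots> = ennreal (sqrt (2 * pi * e))"
    by (subst nn_integral_cmult) (measurable, simp only: heat_kernel_nn_integral(1)[OF e] mult_1_right)
  also have "sqrt (2 * pi * e) = sqrt (pi / a) / s"
    using a s by (simp add: e_def real_sqrt_divide real_sqrt_mult)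
  finally show ?thesis .
qed

text \<open>One square is completed per variable: each integration contributes a pivot under the
  root, and the coordinate of \<open>k\<close>, frozen at 1, retains the entry of the Schur
  complement. The list is reversed because the last entry of an iterated integral is innermost and
  so the first to be eliminated.\<close>

lemma gaussian_iter_nn:
  fixes e :: "'n \<Rightarrow> 'b"
  assumes "distinct ls" "k \<notin> set ls" "inj_on e (set ls)" "piv_pos ls A" "\<And>i j. A i j = A j i" "a > 0" "s > 0"
  shows "iter_nn (rev (map e ls)) (\<lambda>y. ennreal (exp (- a * quad (insert k (set ls)) A (\<lambda>i. if i = k then 1 else s * y (e i))))) x =
     ennreal ((sqrt (pi / a) / s) ^ length ls / sqrt (piv_prod ls A) * exp (- a * schurs ls A k k))"
  using assms
proof (induction ls arbitrary: A)
  case Nil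
  then show ?case by (simp add: quad_def)
next
  case (Cons j ls)
  have sym: "\<And>i j. A i j = A j i" by (rule Cons.prems)
  have Ajj: "A j j > 0" and pos: "piv_pos ls (schur j A)" using Cons.prems by auto
  have jk: "j \<noteq> k" "j \<notin> insert k (set ls)" using Cons.prems by auto
  let ?v = "\<lambda>y i. if i = k then 1 else s * y (e i)"
  let ?S = "insert k (set ls)"
  have m: "(\<lambda>y. ennreal (exp (- a * quad ?S (schur j A) (?v y)))) \<in> borel_measurable coords"
    unfolding quad_def by measurable
  have step: "iter_nn [e j] (\<lambda>y. ennreal (exp (- a * quad (insert k (set (j # ls))) A (?v y)))) y =
      ennreal (sqrt (pi / (a * A j j)) / s) * ennreal (exp (- a * quad ?S (schur j A) (?v y)))" for y
  proof -
    have v: "?v (y(e j := t)) i = ?v y i" if "i \<in> ?S" for t i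
    proof -
      have "e i \<noteq> e j" if "i \<in> set ls"
        using Cons.prems(1,3) that by (auto simp: inj_on_def)
      then show ?thesis using \<open>i \<in> ?S\<close> by auto
    qed
    define b where "b = (\<Sum>i\<in>?S. A j i * ?v y i) / A j j"
    have q: "quad (insert k (set (j # ls))) A (?v (y(e j := t))) = A j j * (s * t + b)\<^sup>2 + quad ?S (schur j A) (?v y)" for t
    proof -
      have "insert k (set (j # ls)) = insert j ?S" by auto
      moreover have "quad ?S (schur j A) (?v (y(e j := t))) = quad ?S (schur j A) (?v y)"
        unfolding quad_def by (intro sum.cong refl) (simp only: v)
      moreover have "(\<Sum>i\<in>?S. A j i * ?v (y(e j := t)) i) = (\<Sum>i\<in>?S. A j i * ?v y i)"
        by (intro sum.cong refl) (simp only: v)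
      ultimately show ?thesis
        using quad_insert[of ?S j A "?v (y(e j := t))", OF _ jk(2) sym] Ajj jk(1) by (simp add: b_def)
    qed
    have "iter_nn [e j] (\<lambda>y. ennreal (exp (- a * quad (insert k (set (j # ls))) A (?v y)))) y =
        (\<integral>\<^sup>+t. ennreal (exp (- a * (A j j * (s * t + b)\<^sup>2 + quad ?S (schur j A) (?v y)))) \<partial>lborel)"
      by (simp only: iter_nn.simps q)
    also have "\<dots> = (\<integral>\<^sup>+t. ennreal (exp (- a * quad ?S (schur j A) (?v y))) * ennreal (exp (- (a * A j j) * (s * t + b)\<^sup>2)) \<partial>lborel)"
      by (intro nn_integral_cong) (simp add: algebra_simps flip: ennreal_mult exp_add)
    also have "\<dots> = ennreal (exp (- a * quad ?S (schur j A) (?v y))) * (\<integral>\<^sup>+t. ennreal (exp (- (a * A j j) * (s * t + b)\<^sup>2)) \<partial>lborel)"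
      by (rule nn_integral_cmult) measurable
    also have "(\<integral>\<^sup>+t. ennreal (exp (- (a * A j j) * (s * t + b)\<^sup>2)) \<partial>lborel) = ennreal (sqrt (pi / (a * A j j)) / s)"
      by (rule gaussian_nn) (use Ajj Cons.prems in auto)
    finally show ?thesis by (simp only: mult.commute)
  qed
  have "iter_nn (rev (map e (j # ls))) (\<lambda>y. ennreal (exp (- a * quad (insert k (set (j # ls))) A (?v y)))) x =
      iter_nn (rev (map e ls)) (iter_nn [e j] (\<lambda>y. ennreal (exp (- a * quad (insert k (set (j # ls))) A (?v y))))) x"
    by (simp only: list.map rev.simps iter_nn_append)
  also have "\<dots> = iter_nn (rev (map e ls)) (\<lambda>y. ennreal (sqrt (pi / (a * A j j)) / s) * ennreal (exp (- a * quad ?S (schur j A) (?v y)))) x"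
    by (rule iter_nn_cong) (rule step)
  also have "\<dots> = ennreal (sqrt (pi / (a * A j j)) / s) * iter_nn (rev (map e ls)) (\<lambda>y. ennreal (exp (- a * quad ?S (schur j A) (?v y)))) x"
    by (rule iter_nn_cmult[OF m])
  also have "iter_nn (rev (map e ls)) (\<lambda>y. ennreal (exp (- a * quad ?S (schur j A) (?v y)))) x =
      ennreal ((sqrt (pi / a) / s) ^ length ls / sqrt (piv_prod ls (schur j A)) * exp (- a * schurs ls (schur j A) k k))"
    by (rule Cons.IH) (use Cons.prems pos schur_sym[of A, OF sym] in auto)
  also have "ennreal (sqrt (pi / (a * A j j)) / s) * \<dots> =
      ennreal ((sqrt (pi / a) / s) ^ length (j # ls) / sqrt (piv_prod (j # ls) A) * exp (- a * schurs (j # ls) A k k))"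
    using Cons.prems(6,7) Ajj piv_prod_pos[OF pos]
    by (simp add: real_sqrt_mult real_sqrt_divide mult_ac flip: ennreal_mult)
  finally show ?case .
qed

subsection \<open>The Gamma integral over the cone in coordinates\<close>

lemma Gamma_nn_integral:
  assumes m: "\<mu> > 0" and S: "S > 0"
  shows "(\<integral>\<^sup>+t. (if 0 < t then ennreal (t powr (\<mu> - 1) * exp (- t * S)) else 0) \<partial>lborel) = ennreal (Gamma \<mu> * S powr (- \<mu>))"
proof -
  define f where "f x = ennreal (indicator {0..} x * x powr (\<mu> - 1) / exp x)" for x :: real
  have fm: "f \<in> borel_measurable borel" unfolding f_def by measurable
  have G: "ennreal (Gamma \<mu>) = (\<integral>\<^sup>+x. f x \<partial>lborel)"
    unfolding f_def using Gamma_conv_nn_integral_real[OF m] by simp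
  have "ennreal (Gamma \<mu>) = ennreal S * (\<integral>\<^sup>+t. f (0 + S * t) \<partial>lborel)"
    unfolding G using nn_integral_real_affine[of f S 0] fm S by simp
  also have "(\<integral>\<^sup>+t. f (0 + S * t) \<partial>lborel) = (\<integral>\<^sup>+t. ennreal (S powr (\<mu> - 1)) * (if 0 < t then ennreal (t powr (\<mu> - 1) * exp (- t * S)) else 0) \<partial>lborel)"
  proof (rule nn_integral_cong)
    fix t :: real
    show "f (0 + S * t) = ennreal (S powr (\<mu> - 1)) * (if 0 < t then ennreal (t powr (\<mu> - 1) * exp (- t * S)) else 0)"
    proof (cases "0 < t")
      case True
      then have "f (0 + S * t) = ennreal (S powr (\<mu> - 1) * (t powr (\<mu> - 1) * exp (- t * S)))"
        using S by (simp add: f_def powr_mult exp_minus field_simps)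
      then show ?thesis using True by (simp add: ennreal_mult)
    next
      case False
      then have "S * t \<le> 0" using S by (simp add: mult_nonneg_nonpos)
      then have "f (0 + S * t) = 0" by (cases "S * t = 0") (auto simp: f_def)
      then show ?thesis using False by simp
    qed
  qed
  also have "\<dots> = ennreal (S powr (\<mu> - 1)) * (\<integral>\<^sup>+t. (if 0 < t then ennreal (t powr (\<mu> - 1) * exp (- t * S)) else 0) \<partial>lborel)"
    by (rule nn_integral_cmult) measurable
  also have "ennreal S * \<dots> = ennreal (S powr \<mu>) * (\<integral>\<^sup>+t. (if 0 < t then ennreal (t powr (\<mu> - 1) * exp (- t * S)) else 0) \<partial>lborel)"
    using S by (simp add: mult.assoc[symmetric] powr_diff flip: ennreal_mult)
  finally have e: "ennreal (Gamma \<mu>) = ennreal (S powr \<mu>) * (\<integral>\<^sup>+t. (if 0 < t then ennreal (t powr (\<mu> - 1) * exp (- t * S)) else 0) \<partial>lborel)" .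
  have "ennreal (S powr (- \<mu>)) * ennreal (Gamma \<mu>) = ennreal (S powr (- \<mu>) * S powr \<mu>) * (\<integral>\<^sup>+t. (if 0 < t then ennreal (t powr (\<mu> - 1) * exp (- t * S)) else 0) \<partial>lborel)"
    unfolding e by (simp add: mult.assoc[symmetric] ennreal_mult)
  also have "S powr (- \<mu>) * S powr \<mu> = 1" using S by (simp flip: powr_add)
  finally show ?thesis using Gamma_real_pos[OF m] by (simp add: mult.commute ennreal_mult less_imp_le)
qed

text \<open>For \<open>S \<le> 0\<close> the integrand dominates the one with any
  \<open>e > 0\<close>, whose integral \<open>Gamma \<mu> * e powr (- \<mu>)\<close> is unbounded as
  \<open>e\<close> tends to 0.\<close>

lemma Gamma_nn_integral_top:
  assumes m: "\<mu> > 0" and S: "S \<le> 0"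
  shows "(\<integral>\<^sup>+t. (if 0 < t then ennreal (t powr (\<mu> - 1) * exp (- t * S)) else 0) \<partial>lborel) = top"
proof (rule ccontr)
  define I where "I = (\<integral>\<^sup>+t. (if 0 < t then ennreal (t powr (\<mu> - 1) * exp (- t * S)) else 0) \<partial>lborel)"
  assume "\<not> ?thesis"
  then have "I \<noteq> top" unfolding I_def .
  then obtain r where r: "0 \<le> r" "(\<integral>\<^sup>+t. (if 0 < t then ennreal (t powr (\<mu> - 1) * exp (- t * S)) else 0) \<partial>lborel) = ennreal r"
    unfolding I_def[symmetric] by (cases I) auto
  \<comment> \<open>Makes the value of the smaller integral equal to \<open>r + 1\<close>.\<close>
  define e where "e = ((r + 1) / Gamma \<mu>) powr (- 1 / \<mu>)"
  have G: "Gamma \<mu> > 0" using m by (rule Gamma_real_pos)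
  have e: "e > 0" using r G by (simp add: e_def)
  have "ennreal (Gamma \<mu> * e powr (- \<mu>)) = (\<integral>\<^sup>+t. (if 0 < t then ennreal (t powr (\<mu> - 1) * exp (- t * e)) else 0) \<partial>lborel)"
    by (rule Gamma_nn_integral[OF m e, symmetric])
  also have "\<dots> \<le> ennreal r"
    unfolding r(2)[symmetric]
  proof (rule nn_integral_mono)
    fix t :: real
    have "t * S \<le> t * e" if "0 < t" using that S e by (intro mult_left_mono) auto
    then show "(if 0 < t then ennreal (t powr (\<mu> - 1) * exp (- t * e)) else 0) \<le> (if 0 < t then ennreal (t powr (\<mu> - 1) * exp (- t * S)) else 0)"
      by (auto intro!: ennreal_leI mult_left_mono)
  qed
  also have "e powr (- \<mu>) = (r + 1) / Gamma \<mu>"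
    using m r G by (simp add: e_def powr_powr)
  finally show False using r G by (simp add: ennreal_le_iff)
qed

section \<open>Elimination in orthonormal coordinates of symmetric matrices\<close>

lemma symmat_unit_eq_iff:
  "symmat_unit i j = symmat_unit k l \<longleftrightarrow> (i = k \<and> j = l) \<or> (i = l \<and> j = k)"
proof
  assume eq: "symmat_unit i j = symmat_unit k l"
  have "mat_of (symmat_unit i j) $ i $ j \<noteq> 0"
    by (auto simp: mat_of_symmat_unit axis_def)
  then have "mat_of (symmat_unit k l) $ i $ j \<noteq> 0" by (simp add: eq)
  then show "(i = k \<and> j = l) \<or> (i = l \<and> j = k)"
    by (auto simp: mat_of_symmat_unit axis_def split: if_splits)
qed (auto simp: symmat_unit_commute)

text \<open>The factor \<open>1 / sqrt 2\<close> is the off-diagonal entry of a normalised basis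
  matrix.\<close>

definition mat_co :: "('n::finite symmat \<Rightarrow> real) \<Rightarrow> 'n \<Rightarrow> 'n \<Rightarrow> real" where
  "mat_co x i j = (if i = j then 1 else 1 / sqrt 2) * x (symmat_unit i j)"

lemma mat_co_sym: "mat_co x i j = mat_co x j i"
  by (simp add: mat_co_def symmat_unit_commute[of i j])

lemma measurable_mat_co: "(\<lambda>x. mat_co x i j) \<in> borel_measurable coords"
  unfolding mat_co_def by measurable

text \<open>An order of integration: the block of the remaining indices is innermost, then come the
  off-diagonal entries in the row of \<open>k\<close>, and its diagonal entry is outermost. For
  distinct indices every basis matrix of the block occurs once.\<close>

primrec sym_coords :: "'n::finite list \<Rightarrow> 'n symmat list" where
  "sym_coords [] = []"
| "sym_coords (k # ks) = symmat_unit k k # map (symmat_unit k) ks @ sym_coords ks"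

lemma set_sym_coords: "set (sym_coords ks) = {symmat_unit i j |i j. i \<in> set ks \<and> j \<in> set ks}"
proof (induction ks)
  case (Cons k ks)
  show ?case
  proof (intro equalityI subsetI)
    fix b assume "b \<in> {symmat_unit i j |i j. i \<in> set (k # ks) \<and> j \<in> set (k # ks)}"
    then obtain i j where b: "b = symmat_unit i j" "i \<in> set (k # ks)" "j \<in> set (k # ks)" by blast
    consider "i = k" | "j = k" | "i \<in> set ks" "j \<in> set ks" using b by auto
    then show "b \<in> set (sym_coords (k # ks))"
    proof cases
      case 2
      then have "b = symmat_unit k i" using b(1) symmat_unit_commute by simp
      then show ?thesis using b(2) by auto
    qed (use b in \<open>auto simp: Cons\<close>)
  next
    fix b assume "b \<in> set (sym_coords (k # ks))"
    then show "b \<in> {symmat_unit i j |i j. i \<in> set (k # ks) \<and> j \<in> set (k # ks)}"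
      by (auto simp: Cons)
  qed
qed simp

lemma distinct_sym_coords: "distinct ks \<Longrightarrow> distinct (sym_coords ks)"
  by (induction ks) (auto simp: set_sym_coords distinct_map inj_on_def symmat_unit_eq_iff)

lemma length_sym_coords: "2 * length (sym_coords ks) = length ks * (length ks + 1)"
  by (induction ks) auto

text \<open>The integrand of the Gamma integral, cut down to a block. The determinant is replaced by
  the product of pivots, so that the recursion from block to block can be followed.\<close>

definition cone_density :: "'n::finite list \<Rightarrow> ('n \<Rightarrow> 'n \<Rightarrow> real) \<Rightarrow> real \<Rightarrow> ('n symmat \<Rightarrow> real) \<Rightarrow> ennreal" where
  "cone_density ks A p x = (if piv_pos ks (mat_co x) then
     ennreal (piv_prod ks (mat_co x) powr p * exp (- (\<Sum>i\<in>set ks. \<Sum>j\<in>set ks. mat_co x i j * A i j))) else 0)"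

lemma measurable_cone_density: "cone_density ks A p \<in> borel_measurable coords"
proof -
  note [measurable] = measurable_piv[where X=mat_co, OF measurable_mat_co] measurable_mat_co
  show ?thesis unfolding cone_density_def by measurable
qed

text \<open>With the row of \<open>k\<close> fixed, the matrix is a rank-one matrix with the same
  row plus its Schur complement. Translating the block by the rank-one part turns it into the Schur
  complement without changing the integral, and pivots, cone condition and trace all split
  accordingly.\<close>

lemma cone_density_pivot:
  assumes k: "distinct (k # ks)" and sym: "\<And>i j. A i j = A j i"
  shows "iter_nn (sym_coords ks) (cone_density (k # ks) A p) y =
    (if 0 < y (symmat_unit k k) then
      ennreal (y (symmat_unit k k) powr p * exp (- y (symmat_unit k k) *
         quad (insert k (set ks)) A (\<lambda>i. if i = k then 1 else 1 / (sqrt 2 * y (symmat_unit k k)) * y (symmat_unit k i))))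
       * iter_nn (sym_coords ks) (cone_density ks A p) y else 0)"
proof -
  have kk: "symmat_unit k i \<notin> set (sym_coords ks)" for i
    using k by (auto simp: set_sym_coords symmat_unit_eq_iff)
  define t where "t = y (symmat_unit k k)"
  show ?thesis
  proof (cases "0 < t")
    case False
    have "iter_nn (sym_coords ks) (cone_density (k # ks) A p) y = iter_nn (sym_coords ks) (\<lambda>_. 0) y"
    proof (rule iter_nn_cong)
      fix z assume z: "\<And>b. b \<notin> set (sym_coords ks) \<Longrightarrow> z b = y b"
      then have "mat_co z k k = t" using kk by (simp add: mat_co_def t_def)
      then show "cone_density (k # ks) A p z = 0" using False by (simp add: cone_density_def)
    qed
    then show ?thesis using False by (simp add: iter_nn_zero t_def)
  next
    case t: True
    \<comment> \<open>The row of \<open>k\<close> divided by its pivot; \<open>sqrt 2\<close>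
      converts the coordinate to a matrix entry.\<close>
    define V where "V i = (if i = k then 1 else 1 / (sqrt 2 * t) * y (symmat_unit k i))" for i
    \<comment> \<open>The coordinates of the rank-one part, set to 0 off the block so that the row
      and the pivot are not moved.\<close>
    define c where "c b = (if b \<in> set (sym_coords ks) then inner (Symmat (\<chi> i j. t * V i * V j)) b else 0)" for b
    have M0: "mat_of (Symmat (\<chi> i j. t * V i * V j)) = (\<chi> i j. t * V i * V j)"
      by (rule mat_of_Symmat) (simp add: vec_eq_iff transpose_def mult_ac)
    have key: "cone_density (k # ks) A p (\<lambda>b. z b + c b) = ennreal (t powr p * exp (- t * quad (insert k (set ks)) A V)) * cone_density ks A p z"
      if z: "\<And>b. b \<notin> set (sym_coords ks) \<Longrightarrow> z b = y b" for z
    proof -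
      let ?X = "mat_co (\<lambda>b. z b + c b)"
      have in_ks: "?X i j = t * V i * V j + mat_co z i j" if "i \<in> set ks" "j \<in> set ks" for i j
      proof -
        have "symmat_unit i j \<in> set (sym_coords ks)" using that by (auto simp: set_sym_coords)
        then show ?thesis
          by (simp add: mat_co_def c_def inner_symmat_unit M0) (simp add: field_simps)
      qed
      have row: "?X k i = t * V k * V i" for i
      proof -
        have "z (symmat_unit k i) + c (symmat_unit k i) = y (symmat_unit k i)"
          using kk z by (simp add: c_def)
        then show ?thesis using t by (cases "i = k") (simp_all add: mat_co_def V_def t_def)
      qed
      have Vk: "V k = 1" by (simp add: V_def)
      have Xk: "?X k k = t" using row[of k] Vk by simp
      have sch: "schur k ?X i j = mat_co z i j" if "i \<in> set ks" "j \<in> set ks" for i j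
        using in_ks[OF that] row[of i] row[of j] mat_co_sym[of _ i k] t Vk Xk by (simp add: schur_def)
      have nk: "k \<notin> set ks" using k by simp
      \<comment> \<open>The row and the column of \<open>k\<close> belong entirely to the rank-one
        part; the Schur complement contributes on the block only.\<close>
      have "(\<Sum>i\<in>insert k (set ks). \<Sum>j\<in>insert k (set ks). ?X i j * A i j) =
          (\<Sum>i\<in>insert k (set ks). \<Sum>j\<in>insert k (set ks). t * (A i j * V i * V j) + (if i = k \<or> j = k then 0 else mat_co z i j * A i j))"
      proof (intro sum.cong refl)
        fix i j assume "i \<in> insert k (set ks)" "j \<in> insert k (set ks)"
        then show "?X i j * A i j = t * (A i j * V i * V j) + (if i = k \<or> j = k then 0 else mat_co z i j * A i j)"
          using in_ks[of i j] row[of i] row[of j] mat_co_sym[of "\<lambda>b. z b + c b" i k]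
          by (cases "i = k"; cases "j = k") (simp_all add: algebra_simps)
      qed
      also have "\<dots> = t * quad (insert k (set ks)) A V + (\<Sum>i\<in>insert k (set ks). \<Sum>j\<in>insert k (set ks). (if i = k \<or> j = k then 0 else mat_co z i j * A i j))"
        by (simp only: quad_def sum.distrib sum_distrib_left)
      also have "(\<Sum>i\<in>insert k (set ks). \<Sum>j\<in>insert k (set ks). (if i = k \<or> j = k then 0 else mat_co z i j * A i j)) = (\<Sum>i\<in>set ks. \<Sum>j\<in>set ks. mat_co z i j * A i j)"
      proof -
        have "(\<Sum>j\<in>set ks. (if i = k \<or> j = k then 0 else mat_co z i j * A i j)) = (\<Sum>j\<in>set ks. mat_co z i j * A i j)" if "i \<in> set ks" for i
          using that nk by (intro sum.cong refl) auto
        then show ?thesis using nk by simp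
      qed
      finally have tr: "(\<Sum>i\<in>set (k # ks). \<Sum>j\<in>set (k # ks). ?X i j * A i j) = t * quad (insert k (set ks)) A V + (\<Sum>i\<in>set ks. \<Sum>j\<in>set ks. mat_co z i j * A i j)"
        by simp
      show ?thesis
      proof (cases "piv_pos ks (mat_co z)")
        case True
        then have pp: "0 < piv_prod ks (mat_co z)" by (rule piv_prod_pos)
        have "piv_prod (k # ks) ?X = t * piv_prod ks (mat_co z)" "piv_pos (k # ks) ?X"
          using piv_pos_cong[of ks "schur k ?X" "mat_co z", OF sch] Xk t True by simp_all
        then have "cone_density (k # ks) A p (\<lambda>b. z b + c b) = ennreal ((t powr p * exp (- t * quad (insert k (set ks)) A V)) *
            (piv_prod ks (mat_co z) powr p * exp (- (\<Sum>i\<in>set ks. \<Sum>j\<in>set ks. mat_co z i j * A i j))))"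
          unfolding cone_density_def tr using pp t by (simp add: powr_mult exp_add exp_minus mult_ac exp_diff field_simps)
        also have "\<dots> = ennreal (t powr p * exp (- t * quad (insert k (set ks)) A V)) * cone_density ks A p z"
          unfolding cone_density_def using True by (simp add: ennreal_mult)
        finally show ?thesis .
      next
        case False
        then have "\<not> piv_pos (k # ks) ?X"
          using piv_pos_cong(1)[of ks "schur k ?X" "mat_co z", OF sch] by simp
        then show ?thesis using False by (simp only: cone_density_def if_False mult_zero_right)
      qed
    qed
    have "iter_nn (sym_coords ks) (cone_density (k # ks) A p) y = iter_nn (sym_coords ks) (\<lambda>z. cone_density (k # ks) A p (\<lambda>b. z b + c b)) y"
      by (rule iter_nn_translate[OF measurable_cone_density, symmetric]) (simp add: c_def)
    also have "\<dots> = iter_nn (sym_coords ks) (\<lambda>z. ennreal (t powr p * exp (- t * quad (insert k (set ks)) A V)) * cone_density ks A p z) y"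
      by (rule iter_nn_cong) (rule key)
    also have "\<dots> = ennreal (t powr p * exp (- t * quad (insert k (set ks)) A V)) * iter_nn (sym_coords ks) (cone_density ks A p) y"
      by (rule iter_nn_cmult[OF measurable_cone_density])
    finally show ?thesis using t by (simp only: t_def[symmetric] V_def[abs_def] if_True)
  qed
qed

text \<open>Matches one step of the elimination: the power of \<open>2 * pi\<close> stems from the
  Gaussian integral over a row of length \<open>m\<close>, and \<open>Gamma \<mu>\<close> from the
  Euler integral over the diagonal entry.\<close>

lemma cone_Gamma_Suc:
  "cone_Gamma (Suc m) \<mu> = (2 * pi) powr (real m / 2) * Gamma \<mu> * cone_Gamma m (\<mu> - 1/2)"
proof -
  have "(\<Prod>j=1..Suc m. Gamma (\<mu> - (real j - 1) / 2)) = Gamma \<mu> * (\<Prod>j=1..m. Gamma (\<mu> - 1/2 - (real j - 1) / 2))"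
  proof -
    let ?g = "\<lambda>j. Gamma (\<mu> - (real j - 1) / 2)"
    have "(\<Prod>j=1..Suc m. ?g j) = ?g 1 * (\<Prod>j=Suc 1..Suc m. ?g j)"
      by (rule prod.atLeast_Suc_atMost) simp
    also have "(\<Prod>j=Suc 1..Suc m. ?g j) = (\<Prod>j=1..m. ?g (Suc j))"
      by (rule prod.shift_bounds_cl_Suc_ivl)
    also have "\<dots> = (\<Prod>j=1..m. Gamma (\<mu> - 1/2 - (real j - 1) / 2))"
      by (intro prod.cong refl arg_cong[where f=Gamma]) (simp add: field_simps)
    finally show ?thesis by simp
  qed
  moreover have "(2 * pi) powr (real (Suc m) * (real (Suc m) - 1) / 4) = (2 * pi) powr (real m / 2) * (2 * pi) powr (real m * (real m - 1) / 4)"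
    by (simp add: field_simps flip: powr_add)
  ultimately show ?thesis by (simp add: cone_Gamma_def)
qed

lemma cone_Gamma_pos: "\<mu> > (real m - 1) / 2 \<Longrightarrow> 0 < cone_Gamma m \<mu>"
  unfolding cone_Gamma_def by (intro mult_pos_pos prod_pos Gamma_real_pos ballI) auto

text \<open>Integrating out the row of the first pivot gives a Gaussian integral, and then its diagonal entry an Euler integral.\<close>

lemma cone_integral_coords:
  assumes "distinct ks" "\<And>i j. A i j = A j i" "\<mu> > (real (length ks) - 1) / 2"
  shows "iter_nn (sym_coords ks) (cone_density ks A (\<mu> - (real (length ks) + 1) / 2)) x =
    (if piv_pos (rev ks) A then ennreal (cone_Gamma (length ks) \<mu> * piv_prod (rev ks) A powr (- \<mu>)) else top)"
  using assms
proof (induction ks arbitrary: \<mu> x)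
  case Nil
  then show ?case by (simp add: cone_density_def cone_Gamma_def)
next
  case (Cons k ks)
  define m p t0 where "m = length ks" and "p = \<mu> - (real (length (k # ks)) + 1) / 2" and "t0 = symmat_unit k k"
  define D where "D = piv_prod (rev ks) A"
  \<comment> \<open>The recursion treats the block of \<open>ks\<close> before \<open>k\<close>, so
    for \<open>A\<close> the index \<open>k\<close> is the last to be eliminated; hence
    \<open>rev ks\<close> in the statement.\<close>
  define S where "S = schurs (rev ks) A k k"
  have mu: "\<mu> > real m / 2" using Cons.prems(3) by (simp add: m_def)
  \<comment> \<open>Passing to the smaller block lowers \<mu> by 1/2 and keeps the exponent
    \<open>p\<close> fixed.\<close>
  have p: "p = (\<mu> - 1/2) - (real (length ks) + 1) / 2" by (simp add: p_def field_simps)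
  have IH: "iter_nn (sym_coords ks) (cone_density ks A p) y =
    (if piv_pos (rev ks) A then ennreal (cone_Gamma m (\<mu> - 1/2) * D powr (- (\<mu> - 1/2))) else top)" for y
    unfolding p m_def D_def by (rule Cons.IH) (use Cons.prems mu in \<open>auto simp: m_def\<close>)
  let ?row = "map (symmat_unit k) ks"
  let ?q = "\<lambda>t y. quad (insert k (set ks)) A (\<lambda>i. if i = k then 1 else 1 / (sqrt 2 * t) * y (symmat_unit k i))"
  have t0: "t0 \<notin> set ?row" using Cons.prems(1) by (auto simp: t0_def symmat_unit_eq_iff)
  have inner: "iter_nn (sym_coords ks) (cone_density (k # ks) A p) y =
      (if 0 < t then ennreal (t powr p * exp (- t * ?q t y)) * (if piv_pos (rev ks) A then ennreal (cone_Gamma m (\<mu> - 1/2) * D powr (- (\<mu> - 1/2))) else top) else 0)"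
    if y: "\<And>b. b \<notin> set ?row \<Longrightarrow> y b = (x(t0 := t)) b" for y t
  proof -
    have yk: "y (symmat_unit k k) = t" using y[OF t0] by (simp add: t0_def)
    show ?thesis
      using cone_density_pivot[of k ks A p y, OF Cons.prems(1,2)] unfolding IH yk .
  qed
  have all: "iter_nn (sym_coords (k # ks)) (cone_density (k # ks) A p) x =
      (\<integral>\<^sup>+t. iter_nn ?row (iter_nn (sym_coords ks) (cone_density (k # ks) A p)) (x(t0 := t)) \<partial>lborel)"
    by (simp only: sym_coords.simps iter_nn.simps iter_nn_append t0_def)
  show ?case
  proof (cases "piv_pos (rev ks) A")
    case False
    \<comment> \<open>The block integral is already infinite for every \<open>t > 0\<close>.\<close>
    have "iter_nn ?row (iter_nn (sym_coords ks) (cone_density (k # ks) A p)) (x(t0 := t)) = (if 0 < t then top else 0)" for t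
    proof -
      have "iter_nn ?row (iter_nn (sym_coords ks) (cone_density (k # ks) A p)) (x(t0 := t)) = iter_nn ?row (\<lambda>_. if 0 < t then top else 0) (x(t0 := t))"
        by (rule iter_nn_cong, subst inner) (use False in \<open>auto simp: ennreal_mult_top\<close>)
      then show ?thesis by (cases "0 < t") (simp_all only: iter_nn_top iter_nn_zero if_True if_False)
    qed
    then have "iter_nn (sym_coords (k # ks)) (cone_density (k # ks) A p) x = (\<integral>\<^sup>+t. top * indicator {0<..} (t::real) \<partial>lborel)"
      unfolding all by (intro nn_integral_cong) (simp add: indicator_def)
    also have "\<dots> = top * emeasure lborel {(0::real)<..}"
      by (rule nn_integral_cmult_indicator) simp
    also have "\<dots> = top"
    proof -
      have "emeasure lborel {(0::real)<..<1} \<le> emeasure lborel {(0::real)<..}" by (rule emeasure_mono) auto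
      then have "emeasure lborel {(0::real)<..} \<noteq> 0" by auto
      then show ?thesis by (simp add: ennreal_top_mult)
    qed
    finally show ?thesis using False by (simp add: p_def piv_append)
  next
    case True
    have Dpos: "D > 0" using piv_prod_pos[OF True] by (simp add: D_def)
    define c where "c = cone_Gamma m (\<mu> - 1/2) * D powr (- (\<mu> - 1/2))"
    have c: "c > 0" unfolding c_def using cone_Gamma_pos[of m "\<mu> - 1/2"] mu Dpos by (auto simp: field_simps)
    define C where "C = c * (2 * pi) powr (real m / 2) / sqrt D"
    have C: "C > 0" using c Dpos by (simp add: C_def)
    have "iter_nn ?row (iter_nn (sym_coords ks) (cone_density (k # ks) A p)) (x(t0 := t)) =
        ennreal C * (if 0 < t then ennreal (t powr (\<mu> - 1) * exp (- t * S)) else 0)" for t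
    proof (cases "0 < t")
      case t: True
      have "iter_nn ?row (iter_nn (sym_coords ks) (cone_density (k # ks) A p)) (x(t0 := t)) =
          iter_nn ?row (\<lambda>y. ennreal (t powr p * c) * ennreal (exp (- t * ?q t y))) (x(t0 := t))"
        by (rule iter_nn_cong, subst inner) (use True t c in \<open>auto simp: c_def mult_ac simp flip: ennreal_mult\<close>)
      also have "\<dots> = ennreal (t powr p * c) * iter_nn ?row (\<lambda>y. ennreal (exp (- t * ?q t y))) (x(t0 := t))"
        by (rule iter_nn_cmult) (unfold quad_def, measurable)
      also have "iter_nn ?row (\<lambda>y. ennreal (exp (- t * ?q t y))) (x(t0 := t)) =
          ennreal ((sqrt (pi / t) / (1 / (sqrt 2 * t))) ^ m / sqrt D * exp (- t * S))"
        using gaussian_iter_nn[of "rev ks" k "symmat_unit k" A t "1 / (sqrt 2 * t)" "x(t0 := t)"] Cons.prems(1,2) True t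
        by (simp add: m_def D_def S_def rev_map inj_on_def symmat_unit_eq_iff)
      also have "sqrt (pi / t) / (1 / (sqrt 2 * t)) = sqrt (2 * pi * t)"
      proof -
        have "sqrt (pi / t) / (1 / (sqrt 2 * t)) = sqrt (pi / t) * sqrt 2 * sqrt (t * t)" using t by simp
        also have "\<dots> = sqrt (pi / t * 2 * (t * t))" by (simp only: real_sqrt_mult)
        finally show ?thesis using t by (simp add: mult_ac)
      qed
      \<comment> \<open>The \<open>m\<close> Gaussian integrals contribute a power of
        \<open>t\<close> that raises the exponent \<open>p\<close> to
        \<open>\<mu> - 1\<close>.\<close>
      also have "sqrt (2 * pi * t) ^ m = (2 * pi) powr (real m / 2) * t powr (real m / 2)"
        using t by (simp add: powr_half_sqrt[symmetric] powr_realpow[symmetric] powr_powr powr_mult)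
      also have "ennreal (t powr p * c) * ennreal ((2 * pi) powr (real m / 2) * t powr (real m / 2) / sqrt D * exp (- t * S)) =
          ennreal (C * ((t powr p * t powr (real m / 2)) * exp (- t * S)))"
        by (subst ennreal_mult[symmetric]) (use c Dpos in \<open>auto simp: C_def mult_ac\<close>)
      also have "t powr p * t powr (real m / 2) = t powr (\<mu> - 1)"
      proof -
        have "p + real m / 2 = \<mu> - 1" by (simp add: p_def m_def field_simps)
        then show ?thesis by (metis powr_add)
      qed
      also have "ennreal (C * (t powr (\<mu> - 1) * exp (- t * S))) = ennreal C * (if 0 < t then ennreal (t powr (\<mu> - 1) * exp (- t * S)) else 0)"
        using t C by (simp add: ennreal_mult)
      finally show ?thesis .
    next
      case False
      have "iter_nn ?row (iter_nn (sym_coords ks) (cone_density (k # ks) A p)) (x(t0 := t)) = iter_nn ?row (\<lambda>_. 0) (x(t0 := t))"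
        by (rule iter_nn_cong, subst inner) (use False in auto)
      also have "\<dots> = ennreal C * (if 0 < t then ennreal (t powr (\<mu> - 1) * exp (- t * S)) else 0)"
        using False by (simp add: iter_nn_zero)
      finally show ?thesis .
    qed
    then have E: "iter_nn (sym_coords (k # ks)) (cone_density (k # ks) A p) x =
        ennreal C * (\<integral>\<^sup>+t. (if 0 < t then ennreal (t powr (\<mu> - 1) * exp (- t * S)) else 0) \<partial>lborel)"
      unfolding all by (simp only:) (rule nn_integral_cmult, measurable)
    have mu0: "\<mu> > 0" using mu by (rule le_less_trans[rotated]) simp
    show ?thesis
    proof (cases "S > 0")
      case S: True
      have "C * (Gamma \<mu> * S powr (- \<mu>)) = cone_Gamma (Suc m) \<mu> * (D * S) powr (- \<mu>)"
      proof -
        have "D powr (- (\<mu> - 1/2)) / sqrt D = D powr (- \<mu>)"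
          using Dpos by (simp add: powr_half_sqrt[symmetric] flip: powr_diff)
        moreover have "C = cone_Gamma m (\<mu> - 1/2) * (2 * pi) powr (real m / 2) * (D powr (- (\<mu> - 1/2)) / sqrt D)"
          by (simp add: C_def c_def)
        ultimately have "C = cone_Gamma m (\<mu> - 1/2) * (2 * pi) powr (real m / 2) * D powr (- \<mu>)"
          by (simp only:)
        then show ?thesis using Dpos S by (simp add: cone_Gamma_Suc powr_mult)
      qed
      moreover have "ennreal C * ennreal (Gamma \<mu> * S powr (- \<mu>)) = ennreal (C * (Gamma \<mu> * S powr (- \<mu>)))"
        by (rule ennreal_mult[symmetric]) (use C Gamma_real_pos[OF mu0] in auto)
      ultimately have "ennreal C * ennreal (Gamma \<mu> * S powr (- \<mu>)) = ennreal (cone_Gamma (Suc m) \<mu> * (D * S) powr (- \<mu>))"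
        by (simp only:)
      moreover have "piv_pos (rev (k # ks)) A" "piv_prod (rev (k # ks)) A = D * S"
        using True S by (simp_all add: piv_append D_def S_def)
      ultimately show ?thesis
        using E Gamma_nn_integral[OF mu0 S] by (simp add: p_def m_def)
    next
      \<comment> \<open>A last pivot that is not positive makes the Euler integral diverge.\<close>
      case S: False
      then have "\<not> piv_pos (rev (k # ks)) A" by (simp add: piv_append S_def)
      moreover have "ennreal C * top = top" using C by (simp add: ennreal_mult_top)
      ultimately show ?thesis
        using E Gamma_nn_integral_top[OF mu0, of S] S by (simp add: p_def)
    qed
  qed
qed

subsection \<open>Positive definiteness and determinants by elimination\<close>

lemma quad_cong: "(\<And>i. i \<in> S \<Longrightarrow> v i = w i) \<Longrightarrow> quad S A v = quad S A w"
  by (simp add: quad_def)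

text \<open>By completing squares with \<open>quad_insert\<close>. Conversely, the first pivot is
  the value of the form at a coordinate vector, and for the remaining ones the entry at
  \<open>k\<close> is chosen so as to kill the square.\<close>

lemma piv_pos_iff_quad:
  fixes X :: "'n \<Rightarrow> 'n \<Rightarrow> real"
  assumes "distinct ks" "\<And>i j. X i j = X j i"
  shows "piv_pos ks X \<longleftrightarrow> (\<forall>v. (\<exists>i\<in>set ks. v i \<noteq> 0) \<longrightarrow> 0 < quad (set ks) X v)"
  using assms
proof (induction ks arbitrary: X)
  case Nil
  then show ?case by simp
next
  case (Cons k ks)
  let ?Y = "schur k X"
  have nk: "k \<notin> set ks" and d: "distinct ks" using Cons.prems by auto
  note sym = Cons.prems(2)
  have IH: "piv_pos ks ?Y \<longleftrightarrow> (\<forall>v. (\<exists>i\<in>set ks. v i \<noteq> 0) \<longrightarrow> 0 < quad (set ks) ?Y v)"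
    by (rule Cons.IH[of ?Y, OF d]) (rule schur_sym[of X, OF sym])
  define b where "b v = (\<Sum>i\<in>set ks. X k i * v i)" for v
  have q: "quad (set (k # ks)) X v = X k k * (v k + b v / X k k)\<^sup>2 + quad (set ks) ?Y v" if "X k k \<noteq> 0" for v
    using quad_insert[of "set ks" k X v, OF finite_set nk sym that] by (simp add: b_def)
  show ?case
  proof
    assume P: "piv_pos (k # ks) X"
    then have Xk: "X k k > 0" and Y: "\<And>v. (\<exists>i\<in>set ks. v i \<noteq> 0) \<Longrightarrow> 0 < quad (set ks) ?Y v" using IH by auto
    show "\<forall>v. (\<exists>i\<in>set (k # ks). v i \<noteq> 0) \<longrightarrow> 0 < quad (set (k # ks)) X v"
    proof (intro allI impI)
      fix v :: "'n \<Rightarrow> real" assume v: "\<exists>i\<in>set (k # ks). v i \<noteq> 0"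
      show "0 < quad (set (k # ks)) X v"
      proof (cases "\<exists>i\<in>set ks. v i \<noteq> 0")
        case True
        then show ?thesis using q[of v] Y[OF True] Xk by (simp add: add_nonneg_pos)
      next
        case False
        then have "b v = 0" "quad (set ks) ?Y v = 0" "v k \<noteq> 0" using v by (auto simp: b_def quad_def)
        then show ?thesis using q[of v] Xk by simp
      qed
    qed
  next
    assume R: "\<forall>v. (\<exists>i\<in>set (k # ks). v i \<noteq> 0) \<longrightarrow> 0 < quad (set (k # ks)) X v"
    have d: "(\<Sum>j\<in>set (k # ks). a j * (if j = k then 1 else 0)) = a k" for a :: "'n \<Rightarrow> real"
    proof -
      have "(\<Sum>j\<in>set (k # ks). a j * (if j = k then 1 else 0)) = (\<Sum>j\<in>set (k # ks). if j = k then a j else 0)"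
        by (intro sum.cong) auto
      also have "\<dots> = a k" by (subst sum.delta) auto
      finally show ?thesis .
    qed
    have "quad (set (k # ks)) X (\<lambda>i. if i = k then 1 else 0) = X k k"
      unfolding quad_def by (simp only: d)
    then have Xk: "X k k > 0" using R[rule_format, of "\<lambda>i. if i = k then 1 else 0"] by auto
    have "0 < quad (set ks) ?Y v" if v: "\<exists>i\<in>set ks. v i \<noteq> 0" for v :: "'n \<Rightarrow> real"
    proof -
      define w where "w = v(k := - b v / X k k)"
      have w: "w i = v i" if "i \<in> set ks" for i using that nk by (auto simp: w_def)
      have bw: "b w = b v" unfolding b_def using w by (intro sum.cong) auto
      have qw: "quad (set ks) ?Y w = quad (set ks) ?Y v" by (rule quad_cong) (rule w)
      have "0 < quad (set (k # ks)) X w" using R v w by auto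
      then show ?thesis using q[of w] Xk bw qw by (simp add: w_def)
    qed
    then show "piv_pos (k # ks) X" using Xk IH by simp
  qed
qed

lemma det_row_operations:
  fixes A :: "real^'n::finite^'n"
  assumes "finite F" "k \<notin> F"
  shows "det (\<chi> i. if i \<in> F then row i A + c i *s row k A else row i A) = det A"
  using assms
proof (induction F)
  case empty
  have "(\<chi> i. row i A) = A" by (simp add: vec_eq_iff row_def)
  then show ?case by simp
next
  case (insert j F)
  define B where "B = (\<chi> i. if i \<in> F then row i A + c i *s row k A else row i A)"
  have rk: "row k B = row k A" and rj: "row j B = row j A" using insert by (simp_all add: B_def row_def vec_eq_iff)
  have "det (\<chi> i. if i = j then row j B + c j *s row k B else row i B) = det B"
    by (rule det_row_operation) (use insert in auto)
  moreover have "(\<chi> i. if i = j then row j B + c j *s row k B else row i B) =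
      (\<chi> i. if i \<in> insert j F then row i A + c i *s row k A else row i A)"
    unfolding rk rj using insert by (auto simp: vec_eq_iff B_def row_def)
  ultimately show ?case using insert by (simp add: B_def)
qed

text \<open>Padding with the identity expresses the determinant of a block as the determinant of a
  matrix of the full type.\<close>

definition emb :: "'n set \<Rightarrow> ('n \<Rightarrow> 'n \<Rightarrow> real) \<Rightarrow> real^'n::finite^'n" where
  "emb S X = (\<chi> i j. if i \<in> S \<and> j \<in> S then X i j else if i = j then 1 else 0)"

text \<open>Row operations clear the column of \<open>k\<close>, analogous operations on the
  transpose clear its row, and \<open>X k k\<close> is left alone on the diagonal.\<close>

lemma det_emb_pivot:
  assumes k: "k \<notin> S" and nz: "X k k \<noteq> 0"
  shows "det (emb (insert k S) X) = X k k * det (emb S (schur k X))"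
proof -
  let ?M = "emb (insert k S) X"
  define M1 where "M1 = (\<chi> i. if i \<in> S then row i ?M + (- X i k / X k k) *s row k ?M else row i ?M)"
  have e1: "det M1 = det ?M" unfolding M1_def by (rule det_row_operations) (use k in auto)
  have M1: "M1 $ i $ j = (if i \<in> S \<and> j \<in> S then schur k X i j else if i = k \<and> j \<in> insert k S then X k j else if i = j then 1 else 0)" for i j
    using k nz by (auto simp: M1_def emb_def row_def schur_def)
  define M2 where "M2 = (\<chi> i. if i \<in> S then row i (transpose M1) + (- X k i / X k k) *s row k (transpose M1) else row i (transpose M1))"
  have e2: "det M2 = det (transpose M1)" unfolding M2_def by (rule det_row_operations) (use k in auto)
  define a where "a = (\<chi> j. if j = k then 1 else (0::real))"
  have "transpose M2 = (\<chi> i. if i = k then X k k *s a else row i (emb S (schur k X)))"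
    using k nz by (auto simp: vec_eq_iff M2_def transpose_def row_def M1 a_def emb_def)
  then have "det (transpose M2) = X k k * det (\<chi> i. if i = k then a else row i (emb S (schur k X)))"
    by (simp add: det_row_mul)
  also have "(\<chi> i. if i = k then a else row i (emb S (schur k X))) = emb S (schur k X)"
    using k by (auto simp: vec_eq_iff emb_def row_def a_def)
  finally show ?thesis using e1 e2 by (simp add: det_transpose)
qed

lemma piv_prod_eq_det:
  assumes "distinct ks" "piv_pos ks X"
  shows "piv_prod ks X = det (emb (set ks) X)"
  using assms
proof (induction ks arbitrary: X)
  case Nil
  have "emb {} X = (mat 1 :: real^'a^'a)" by (simp add: emb_def mat_def)
  then show ?case by simp
next
  case (Cons k ks)
  then show ?case using det_emb_pivot[of k "set ks" X] by simp
qed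

section \<open>The cone of positive definite matrices\<close>

text \<open>Pairing with this rank-one matrix evaluates the quadratic form, so the cone is cut out
  by linear inequalities in \<open>A\<close>.\<close>

definition outer :: "real^'n::finite \<Rightarrow> 'n symmat" where
  "outer v = Symmat (\<chi> i j. v $ i * v $ j)"

lemma mat_of_outer: "mat_of (outer v) = (\<chi> i j. v $ i * v $ j)"
  unfolding outer_def by (rule mat_of_Symmat) (simp add: vec_eq_iff transpose_def mult.commute)

lemma inner_outer: "inner A (outer v) = v \<bullet> (mat_of A *v v)"
  by (simp add: inner_symmat_eq mat_of_outer inner_vec_def matrix_vector_mult_def sum_distrib_left mult_ac)

lemma inner_outer_quad: "inner A (outer v) = quad UNIV (\<lambda>i j. mat_of A $ i $ j) (($) v)"
  by (simp add: inner_symmat_eq mat_of_outer inner_vec_def quad_def mult_ac)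

lemma norm_outer: "norm (outer v) = (norm v)\<^sup>2"
proof -
  have "inner (outer v) (outer v) = (\<Sum>i\<in>UNIV. \<Sum>j\<in>UNIV. (v $ i * v $ i) * (v $ j * v $ j))"
    by (simp add: inner_symmat_eq mat_of_outer inner_vec_def mult_ac)
  also have "\<dots> = (v \<bullet> v) * (v \<bullet> v)" by (simp add: inner_vec_def sum_product)
  also have "\<dots> = ((norm v)\<^sup>2)\<^sup>2" by (simp only: power2_norm_eq_inner power2_eq_square[of "v \<bullet> v"])
  finally have "norm (outer v) = sqrt (((norm v)\<^sup>2)\<^sup>2)" by (simp only: norm_eq_sqrt_inner[of "outer v"])
  then show ?thesis unfolding real_sqrt_abs by simp
qed

lemma pos_cone_iff: "A \<in> pos_cone \<longleftrightarrow> (\<forall>v. v \<noteq> 0 \<longrightarrow> 0 < inner A (outer v))"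
  by (simp add: pos_cone_def pos_def_mat_def inner_outer)

lemma mat_of_entry_le_norm: "\<bar>mat_of A $ i $ j\<bar> \<le> norm A"
proof -
  have "norm A = norm (mat_of A)" by (simp add: norm_eq_sqrt_inner inner_symmat_eq)
  moreover have "\<bar>mat_of A $ i $ j\<bar> \<le> norm (mat_of A $ i)" by (rule component_le_norm_cart)
  moreover have "norm (mat_of A $ i) \<le> norm (mat_of A)" by (rule Finite_Cartesian_Product.norm_nth_le)
  ultimately show ?thesis by simp
qed

lemma bounded_linear_mat_of_entry: "bounded_linear (\<lambda>A. mat_of A $ i $ j)"
  by (rule bounded_linear_intro[of _ 1]) (use mat_of_entry_le_norm in \<open>auto simp: mat_of_arith\<close>)

lemma continuous_on_mat_of_entry [continuous_intros]:
  "continuous_on S f \<Longrightarrow> continuous_on S (\<lambda>x. mat_of (f x) $ i $ j)"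
  by (rule bounded_linear.continuous_on[OF bounded_linear_mat_of_entry])

lemma continuous_on_sdet: "continuous_on S sdet"
  unfolding det_def by (intro continuous_intros)

text \<open>The minimum over the unit sphere, extended by homogeneity. This uniform margin makes the
  cone open.\<close>

lemma pos_cone_lower_bound:
  fixes A :: "'n::finite symmat"
  assumes A: "A \<in> pos_cone"
  shows "\<exists>c>0. \<forall>v. c * (norm v)\<^sup>2 \<le> inner A (outer v)"
proof -
  have "compact (sphere (0::real^'n) 1)" by simp
  moreover have "sphere (0::real^'n) 1 \<noteq> {}" by simp
  moreover have "continuous_on (sphere 0 1) (\<lambda>v. inner A (outer v))"
    unfolding inner_outer_quad quad_def by (intro continuous_intros)
  ultimately obtain v0 where v0: "v0 \<in> sphere 0 1" "\<And>v. v \<in> sphere 0 1 \<Longrightarrow> inner A (outer v0) \<le> inner A (outer v)"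
    using continuous_attains_inf[of "sphere 0 1" "\<lambda>v. inner A (outer v)"] by auto
  have "v0 \<noteq> 0" using v0(1) by auto
  then have pos: "inner A (outer v0) > 0" using A by (simp add: pos_cone_iff)
  show ?thesis
  proof (intro exI conjI allI, rule pos)
    fix v :: "real^'n"
    show "inner A (outer v0) * (norm v)\<^sup>2 \<le> inner A (outer v)"
    proof (cases "v = 0")
      case True
      then show ?thesis by (simp add: inner_outer)
    next
      case False
      let ?u = "(1 / norm v) *\<^sub>R v"
      have "inner A (outer v0) \<le> inner A (outer ?u)" by (rule v0(2)) (use False in simp)
      also have "inner A (outer ?u) = inner A (outer v) / (norm v)\<^sup>2"
        by (simp add: inner_outer matrix_vector_mult_scaleR power2_eq_square)
      finally show ?thesis using False by (simp add: pos_le_divide_eq)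
    qed
  qed
qed

lemma open_pos_cone: "open (pos_cone :: 'n::finite symmat set)"
  unfolding open_dist
proof
  fix A :: "'n symmat" assume "A \<in> pos_cone"
  from pos_cone_lower_bound[OF this] obtain c where c: "c > 0" "\<And>v. c * (norm v)\<^sup>2 \<le> inner A (outer v)" by blast
  show "\<exists>e>0. \<forall>B. dist B A < e \<longrightarrow> B \<in> pos_cone"
  proof (intro exI conjI allI impI)
    fix B assume B: "dist B A < c"
    show "B \<in> pos_cone"
      unfolding pos_cone_iff
    proof (intro allI impI)
      fix v :: "real^'n" assume v: "v \<noteq> 0"
      have "\<bar>inner (B - A) (outer v)\<bar> \<le> norm (B - A) * norm (outer v)" by (rule Cauchy_Schwarz_ineq2)
      also have "\<dots> < c * (norm v)\<^sup>2"
        using B v by (auto simp: dist_norm norm_outer intro!: mult_strict_right_mono)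
      finally show "0 < inner B (outer v)" using c(2)[of v] by (simp add: inner_diff_left)
    qed
  qed (rule c)
qed

lemma pos_cone_borel [measurable]: "pos_cone \<in> sets borel"
  by (rule borel_open[OF open_pos_cone])

lemma borel_measurable_sdet [measurable]: "sdet \<in> borel_measurable borel"
  by (rule borel_measurable_continuous_onI[OF continuous_on_sdet])

lemma pos_cone_iff_pivots:
  assumes "distinct ks" "set ks = UNIV"
  shows "A \<in> pos_cone \<longleftrightarrow> piv_pos ks (\<lambda>i j. mat_of A $ i $ j)"
    and "A \<in> pos_cone \<Longrightarrow> piv_prod ks (\<lambda>i j. mat_of A $ i $ j) = sdet A"
proof -
  have iff: "piv_pos ks (\<lambda>i j. mat_of A $ i $ j) \<longleftrightarrow> (\<forall>v. (\<exists>i\<in>set ks. v i \<noteq> 0) \<longrightarrow> 0 < quad (set ks) (\<lambda>i j. mat_of A $ i $ j) v)"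
    by (rule piv_pos_iff_quad[OF assms(1)]) (rule mat_of_nth_sym)
  show *: "A \<in> pos_cone \<longleftrightarrow> piv_pos ks (\<lambda>i j. mat_of A $ i $ j)"
    unfolding iff pos_cone_iff inner_outer_quad assms(2)
  proof (intro iffI allI impI)
    fix v :: "'a \<Rightarrow> real" assume R: "\<forall>v. v \<noteq> 0 \<longrightarrow> 0 < quad UNIV (\<lambda>i j. mat_of A $ i $ j) (($) v)" and v: "\<exists>i\<in>UNIV. v i \<noteq> 0"
    have "(\<chi> i. v i) \<noteq> 0" using v by (auto simp: vec_eq_iff)
    from R[rule_format, OF this] show "0 < quad UNIV (\<lambda>i j. mat_of A $ i $ j) v" by (simp add: quad_def)
  next
    fix v :: "real^'a" assume R: "\<forall>v. (\<exists>i\<in>UNIV. v i \<noteq> 0) \<longrightarrow> 0 < quad UNIV (\<lambda>i j. mat_of A $ i $ j) v" and v: "v \<noteq> 0"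
    then show "0 < quad UNIV (\<lambda>i j. mat_of A $ i $ j) (($) v)" by (auto simp: vec_eq_iff)
  qed
  show "piv_prod ks (\<lambda>i j. mat_of A $ i $ j) = sdet A" if "A \<in> pos_cone"
  proof -
    have "emb (set ks) (\<lambda>i j. mat_of A $ i $ j) = mat_of A" by (simp add: emb_def assms(2) vec_eq_iff)
    then show ?thesis using piv_prod_eq_det[OF assms(1)] * that by simp
  qed
qed

lemma sdet_pos:
  fixes A :: "'n::finite symmat"
  assumes A: "A \<in> pos_cone"
  shows "0 < sdet A"
proof -
  obtain ks where ks: "set ks = (UNIV :: 'n set)" "distinct ks" using finite_distinct_list[OF finite] by blast
  have "piv_pos ks (\<lambda>i j. mat_of A $ i $ j)" using pos_cone_iff_pivots(1)[OF ks(2,1)] A by simp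
  then show ?thesis using piv_prod_pos pos_cone_iff_pivots(2)[OF ks(2,1) A] by fastforce
qed

lemma Basis_eq_sym_coords:
  assumes "set ks = (UNIV :: 'n::finite set)"
  shows "set (sym_coords ks) = (Basis :: 'n symmat set)"
  unfolding set_sym_coords Basis_symmat_def assms by auto

lemma DIM_symmat: "real DIM('n::finite symmat) = real CARD('n) * (real CARD('n) + 1) / 2"
proof -
  obtain ks where ks: "set ks = (UNIV :: 'n set)" "distinct ks" using finite_distinct_list[OF finite] by blast
  have "DIM('n symmat) = length (sym_coords ks)"
    using distinct_card[OF distinct_sym_coords[OF ks(2)]] Basis_eq_sym_coords[OF ks(1)] by simp
  moreover have "length ks = CARD('n)" using distinct_card[OF ks(2)] ks(1) by simp
  ultimately have "2 * DIM('n symmat) = CARD('n) * (CARD('n) + 1)" using length_sym_coords[of ks] by simp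
  then have "real (2 * DIM('n symmat)) = real (CARD('n) * (CARD('n) + 1))" by (simp only:)
  then show ?thesis by (simp add: algebra_simps)
qed

text \<open>The Gamma integral of the cone, transported to orthonormal coordinates. It gives the
  Laplace transform of the weight, square-integrability of the kernel in \<xi> and, through the
  value \<open>top\<close>, the vanishing of \<phi> off the cone.\<close>

lemma cone_integral:
  fixes B :: "'n::finite symmat"
  assumes mu: "\<mu> > (real CARD('n) - 1) / 2"
  shows "(\<integral>\<^sup>+Y. (if Y \<in> pos_cone then ennreal (sdet Y powr (\<mu> - (real CARD('n) + 1) / 2) * exp (- inner Y B)) else 0) \<partial>lborel) =
    (if B \<in> pos_cone then ennreal (cone_Gamma CARD('n) \<mu> * sdet B powr (- \<mu>)) else top)"
proof -
  obtain ks where ks: "set ks = (UNIV :: 'n set)" "distinct ks" using finite_distinct_list[OF finite] by blast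
  have len: "length ks = CARD('n)" using distinct_card[OF ks(2)] ks(1) by simp
  let ?A = "\<lambda>i j. mat_of B $ i $ j" and ?p = "\<mu> - (real CARD('n) + 1) / 2"
  define F where "F Y = (if Y \<in> pos_cone then ennreal (sdet Y powr ?p * exp (- inner Y B)) else 0)" for Y
  have Fm: "F \<in> borel_measurable borel" unfolding F_def by measurable
  let ?h = "\<lambda>x :: 'n symmat \<Rightarrow> real. \<Sum>b\<in>Basis. x b *\<^sub>R b"
  have mo: "mat_of (?h x) $ i $ j = mat_co x i j" for x i j
  proof -
    have "inner (?h x) (symmat_unit i j) = x (symmat_unit i j)"
      by (rule inner_sum_left_Basis) (auto simp: Basis_symmat_def)
    then show ?thesis by (auto simp: inner_symmat_unit mat_co_def field_simps)
  qed
  have F: "F (?h x) = cone_density ks ?A ?p x" for x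
  proof -
    have "inner (?h x) B = (\<Sum>i\<in>set ks. \<Sum>j\<in>set ks. mat_co x i j * mat_of B $ i $ j)"
      by (simp only: inner_symmat_eq inner_vec_def inner_real_def mo ks(1))
    then show ?thesis
      using pos_cone_iff_pivots[OF ks(2,1), of "?h x"] unfolding mo by (simp add: F_def cone_density_def)
  qed
  have hm: "?h \<in> (\<Pi>\<^sub>M b\<in>Basis. lborel) \<rightarrow>\<^sub>M borel" by measurable
  have "(\<integral>\<^sup>+Y. F Y \<partial>lborel) = (\<integral>\<^sup>+x. F (?h x) \<partial>(\<Pi>\<^sub>M b\<in>Basis. lborel))"
    unfolding lborel_eq[where 'a="'n symmat"] by (rule nn_integral_distr[OF hm]) (use Fm in simp)
  also have "\<dots> = (\<integral>\<^sup>+x. F (?h x) \<partial>(\<Pi>\<^sub>M b\<in>set (sym_coords ks). lborel))"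
    by (simp only: Basis_eq_sym_coords[OF ks(1)])
  also have "\<dots> = iter_nn (sym_coords ks) (\<lambda>x. F (?h x)) (\<lambda>_. undefined)"
    by (rule nn_integral_PiM_iter_nn[OF distinct_sym_coords[OF ks(2)]])
      (use measurable_compose[OF hm Fm] Basis_eq_sym_coords[OF ks(1)] in simp)
  also have "\<dots> = (if piv_pos (rev ks) ?A then ennreal (cone_Gamma (length ks) \<mu> * piv_prod (rev ks) ?A powr (- \<mu>)) else top)"
    unfolding F using cone_integral_coords[of ks ?A \<mu>, OF ks(2) mat_of_nth_sym] mu len by simp
  \<comment> \<open>The reversed list also runs through all indices, so its pivots detect the cone
    and multiply to the determinant as well.\<close>
  also have "\<dots> = (if B \<in> pos_cone then ennreal (cone_Gamma CARD('n) \<mu> * sdet B powr (- \<mu>)) else top)"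
    using pos_cone_iff_pivots[of "rev ks" B] ks len by auto
  finally show ?thesis by (simp only: F_def)
qed

section \<open>The operators on the Siegel domain\<close>

definition S_kernel :: "real \<Rightarrow> 'n::finite symmat \<Rightarrow> 'n symmat \<Rightarrow> real" where
  "S_kernel l \<xi> Y = (2 * pi) powr (real CARD('n) * (real CARD('n) + 1) / 4) / sqrt (cone_Gamma CARD('n) l) *
     (sdet \<xi> powr (l / 2 - (real CARD('n) + 1) / 4) * exp (- inner \<xi> Y))"

lemma S_op_eq: "S_op l f z = indicator pos_cone (fst z) * f (fst z) * of_real (S_kernel l (fst z) (snd z))"
  by (cases z) (simp add: S_op_def S_kernel_def inner_symmat_def)

lemma S_kernel_nonneg: "0 < cone_Gamma CARD('n) l \<Longrightarrow> 0 \<le> S_kernel l (\<xi> :: 'n::finite symmat) Y"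
  by (simp add: S_kernel_def)

lemma S_kernel_measurable [measurable]:
  "(\<lambda>z. S_kernel l (fst z) (snd z)) \<in> borel_measurable (borel \<Otimes>\<^sub>M borel)"
  unfolding S_kernel_def by measurable

lemma S_kernel_sq:
  assumes "0 < cone_Gamma CARD('n) l"
  shows "(S_kernel l (\<xi> :: 'n::finite symmat) Y)\<^sup>2 =
    (2 * pi) powr (real CARD('n) * (real CARD('n) + 1) / 2) / cone_Gamma CARD('n) l *
     (sdet \<xi> powr (l - (real CARD('n) + 1) / 2) * exp (- inner \<xi> (2 *\<^sub>R Y)))"
proof -
  have p: "(x powr a)\<^sup>2 = x powr (2 * a)" for x a :: real
    by (simp add: power2_eq_square flip: powr_add)
  have e: "(exp (- inner \<xi> Y))\<^sup>2 = exp (- inner \<xi> (2 *\<^sub>R Y))"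
    by (simp add: power2_eq_square flip: exp_add)
  have 1: "2 * (real CARD('n) * (real CARD('n) + 1) / 4) = real CARD('n) * (real CARD('n) + 1) / 2"
    and 2: "2 * (l / 2 - (real CARD('n) + 1) / 4) = l - (real CARD('n) + 1) / 2" by auto
  show ?thesis
    unfolding S_kernel_def power_mult_distrib power_divide p e 1 2 using assms by simp
qed

lemma sdet_scaleR: "sdet (r *\<^sub>R A) = r ^ CARD('n) * sdet (A :: 'n::finite symmat)"
proof -
  have "mat_of (r *\<^sub>R A) = (\<chi> i. r *s (mat_of A $ i))" by (simp add: mat_of_arith vec_eq_iff)
  then show ?thesis
    using det_rows_mul[of "\<lambda>_. r" "\<lambda>i. mat_of A $ i"] by simp
qed

lemma pos_cone_scaleR: "r > 0 \<Longrightarrow> r *\<^sub>R A \<in> pos_cone \<longleftrightarrow> A \<in> pos_cone"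
  by (simp add: pos_cone_iff zero_less_mult_iff)

lemma measurable_cone_lborel_fst: "f \<in> borel_measurable borel \<Longrightarrow> f \<in> borel_measurable cone_lborel"
  unfolding cone_lborel_def by (rule measurable_restrict_space1) simp

lemma space_cone_weighted: "space (cone_weighted l) = pos_cone"
  by (simp add: cone_weighted_def cone_lborel_def space_restrict_space)

lemma measurable_cone_weighted: "f \<in> borel \<rightarrow>\<^sub>M M \<Longrightarrow> f \<in> cone_weighted l \<rightarrow>\<^sub>M M"
  unfolding cone_weighted_def cone_lborel_def
  by (simp add: measurable_restrict_space1 measurable_density_eq2 cong: measurable_cong_sets)

lemma L2_cone_lborel_iff:
  "f \<in> L2 cone_lborel \<longleftrightarrow> (\<lambda>x. indicator pos_cone x * f x) \<in> L2 lborel"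
  "L2_norm cone_lborel f = L2_norm lborel (\<lambda>x. indicator pos_cone x * f x)"
proof -
  have c: "pos_cone \<inter> space lborel \<in> sets lborel" by simp
  have e: "(cmod (indicator pos_cone x * f x))\<^sup>2 = indicator pos_cone x *\<^sub>R (cmod (f x))\<^sup>2" for x
    by (auto simp: indicator_def)
  have e2: "(\<lambda>x. indicator pos_cone x *\<^sub>R f x) = (\<lambda>x. indicator pos_cone x * f x)"
    by (auto simp: indicator_def fun_eq_iff)
  show "f \<in> L2 cone_lborel \<longleftrightarrow> (\<lambda>x. indicator pos_cone x * f x) \<in> L2 lborel"
    unfolding L2_def cone_lborel_def mem_Collect_eq e borel_measurable_restrict_space_iff[OF c] integrable_restrict_space[OF c] e2 ..
  show "L2_norm cone_lborel f = L2_norm lborel (\<lambda>x. indicator pos_cone x * f x)"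
    unfolding L2_norm_def cone_lborel_def e integral_restrict_space[OF c] ..
qed

lemma L2_inner_cone_lborel: "L2_inner cone_lborel f g = L2_inner lborel (\<lambda>x. indicator pos_cone x * f x) g"
proof -
  have c: "pos_cone \<inter> space lborel \<in> sets lborel" by simp
  show ?thesis
    unfolding L2_inner_def cone_lborel_def integral_restrict_space[OF c]
    by (intro Bochner_Integration.integral_cong) (auto simp: indicator_def)
qed

section \<open>The Laplace transform of the weight and the isometry \<open>S_op\<close>\<close>

locale siegel =
  fixes l :: real and n :: "'n::finite itself"
  assumes l: "l > real CARD('n)"
begin

abbreviation N :: "'n symmat measure" where "N \<equiv> cone_weighted l"

lemma Gamma_pos: "0 < cone_Gamma CARD('n) l" "0 < cone_Gamma CARD('n) (l - (real CARD('n) + 1) / 2)"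
  by (rule cone_Gamma_pos, use l in simp)+ (use l in \<open>simp add: field_simps\<close>)

lemma siegel_const_pos: "0 < siegel_const CARD('n) l"
  unfolding siegel_const_def using Gamma_pos by (intro divide_pos_pos mult_pos_pos) auto

lemma nn_integral_N:
  assumes [measurable]: "F \<in> borel_measurable borel"
  shows "(\<integral>\<^sup>+Y. F Y \<partial>N) = (\<integral>\<^sup>+Y. (if Y \<in> pos_cone then
     ennreal (siegel_const CARD('n) l * sdet (2 *\<^sub>R Y) powr (l - real CARD('n) - 1)) * F Y else 0) \<partial>lborel)"
proof -
  have w: "(\<lambda>Y :: 'n symmat. ennreal (siegel_const CARD('n) l * sdet (2 *\<^sub>R Y) powr (l - real CARD('n) - 1))) \<in> borel_measurable cone_lborel"
    by (rule measurable_cone_lborel_fst) measurable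
  have "(\<integral>\<^sup>+Y. F Y \<partial>N) = (\<integral>\<^sup>+Y. ennreal (siegel_const CARD('n) l * sdet (2 *\<^sub>R Y) powr (l - real CARD('n) - 1)) * F Y \<partial>cone_lborel)"
    unfolding cone_weighted_def by (rule nn_integral_density[OF w measurable_cone_lborel_fst]) measurable
  also have "\<dots> = (\<integral>\<^sup>+Y. (if Y \<in> pos_cone then
     ennreal (siegel_const CARD('n) l * sdet (2 *\<^sub>R Y) powr (l - real CARD('n) - 1)) * F Y else 0) \<partial>lborel)"
    unfolding cone_lborel_def
    by (subst nn_integral_restrict_space) (auto intro!: nn_integral_cong simp: indicator_def)
  finally show ?thesis .
qed

lemma sigma_finite_N: "sigma_finite_measure N"
proof -
  have s: "sigma_finite_measure (cone_lborel :: 'n symmat measure)"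
    unfolding cone_lborel_def by (rule sigma_finite_measure_restrict_space[OF lborel.sigma_finite_measure_axioms]) simp
  have w: "(\<lambda>Y :: 'n symmat. ennreal (siegel_const CARD('n) l * sdet (2 *\<^sub>R Y) powr (l - real CARD('n) - 1))) \<in> borel_measurable cone_lborel"
    by (rule measurable_cone_lborel_fst) measurable
  show ?thesis
    unfolding cone_weighted_def sigma_finite_measure.sigma_finite_iff_density_finite[OF s w] by simp
qed

sublocale lborel_pair_measure N
  by (rule lborel_pair_measure.intro, rule sigma_finite_N)

abbreviation PN :: "('n symmat \<times> 'n symmat) measure" where "PN \<equiv> lborel \<Otimes>\<^sub>M N"

lemma borel_pair_PN: "f \<in> borel_measurable (borel \<Otimes>\<^sub>M borel) \<Longrightarrow> f \<in> borel_measurable PN"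
proof -
  assume f: "f \<in> borel_measurable (borel \<Otimes>\<^sub>M borel)"
  have "(\<lambda>Y. Y) \<in> N \<rightarrow>\<^sub>M borel" by (rule measurable_cone_weighted) simp
  from measurable_compose[OF measurable_snd this]
  have "(\<lambda>z. (fst z, snd z)) \<in> PN \<rightarrow>\<^sub>M borel \<Otimes>\<^sub>M borel" by (intro measurable_Pair) (auto intro: measurable_fst'')
  from measurable_compose[OF this f] show ?thesis by simp
qed

text \<open>The integral of \<open>cone_integral\<close> at the parameter
  \<open>l - (n + 1) / 2\<close> and the matrix \<open>2 *\<^sub>R \<xi>\<close>; the hypothesis
  \<open>l > n\<close> is exactly its convergence condition. The factor 2 inside both determinants
  and the constant \<open>siegel_const\<close> combine to the power of
  \<open>2 * pi\<close>.\<close>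

lemma laplace_N:
  fixes \<xi> :: "'n symmat"
  shows "(\<integral>\<^sup>+Y. ennreal (exp (- inner \<xi> (2 *\<^sub>R Y))) \<partial>N) =
    (if \<xi> \<in> pos_cone then ennreal (cone_Gamma CARD('n) l * (2 * pi) powr (- (real CARD('n) * (real CARD('n) + 1) / 2)) *
       sdet \<xi> powr (- (l - (real CARD('n) + 1) / 2))) else top)"
proof -
  define \<mu> q m where "\<mu> = l - (real CARD('n) + 1) / 2" and "q = l - real CARD('n) - 1" and "m = real CARD('n)"
  define D where "D = m * (m + 1) / 2"
  have q: "q = \<mu> - (m + 1) / 2" by (simp add: q_def \<mu>_def m_def field_simps)
  have D: "m * \<mu> - m * q = D" by (simp add: q D_def field_simps)
  have mu: "\<mu> > (real CARD('n) - 1) / 2" using l by (simp add: \<mu>_def field_simps)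
  have pw: "(2 ^ CARD('n) * x) powr p = 2 powr (m * p) * x powr p" if "x > 0" for x p :: real
    using that by (simp add: powr_mult m_def powr_powr flip: powr_realpow)
  have C: "siegel_const CARD('n) l * 2 powr (m * q) \<ge> 0" using siegel_const_pos by simp
  have "(\<integral>\<^sup>+Y. ennreal (exp (- inner \<xi> (2 *\<^sub>R Y))) \<partial>N) = (\<integral>\<^sup>+Y. (if Y \<in> pos_cone then
      ennreal (siegel_const CARD('n) l * sdet (2 *\<^sub>R Y) powr (l - real CARD('n) - 1)) * ennreal (exp (- inner \<xi> (2 *\<^sub>R Y))) else 0) \<partial>lborel)"
    by (rule nn_integral_N) measurable
  also have "\<dots> = (\<integral>\<^sup>+Y. ennreal (siegel_const CARD('n) l * 2 powr (m * q)) *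
        (if Y \<in> pos_cone then ennreal (sdet Y powr q * exp (- inner Y (2 *\<^sub>R \<xi>))) else 0) \<partial>lborel)"
  proof (rule nn_integral_cong)
    fix Y :: "'n symmat"
    show "(if Y \<in> pos_cone then ennreal (siegel_const CARD('n) l * sdet (2 *\<^sub>R Y) powr (l - real CARD('n) - 1)) * ennreal (exp (- inner \<xi> (2 *\<^sub>R Y))) else 0) =
      ennreal (siegel_const CARD('n) l * 2 powr (m * q)) * (if Y \<in> pos_cone then ennreal (sdet Y powr q * exp (- inner Y (2 *\<^sub>R \<xi>))) else 0)"
    proof (cases "Y \<in> pos_cone")
      case True
      have "siegel_const CARD('n) l * sdet (2 *\<^sub>R Y) powr q * exp (- inner \<xi> (2 *\<^sub>R Y)) =
          siegel_const CARD('n) l * 2 powr (m * q) * (sdet Y powr q * exp (- inner Y (2 *\<^sub>R \<xi>)))"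
        unfolding sdet_scaleR pw[OF sdet_pos[OF True]] by (simp add: inner_commute)
      then show ?thesis
        using True siegel_const_pos by (simp add: q_def flip: ennreal_mult)
    qed simp
  qed
  also have "\<dots> = ennreal (siegel_const CARD('n) l * 2 powr (m * q)) *
        (\<integral>\<^sup>+Y. (if Y \<in> pos_cone then ennreal (sdet Y powr q * exp (- inner Y (2 *\<^sub>R \<xi>))) else 0) \<partial>lborel)"
    by (rule nn_integral_cmult) measurable
  also have "(\<integral>\<^sup>+Y. (if Y \<in> pos_cone then ennreal (sdet Y powr q * exp (- inner Y (2 *\<^sub>R \<xi>))) else 0) \<partial>lborel) =
      (if \<xi> \<in> pos_cone then ennreal (cone_Gamma CARD('n) \<mu> * sdet (2 *\<^sub>R \<xi>) powr (- \<mu>)) else top)"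
    using cone_integral[OF mu, of "2 *\<^sub>R \<xi>"] by (simp only: q m_def pos_cone_scaleR[of 2] zero_less_numeral)
  also have "ennreal (siegel_const CARD('n) l * 2 powr (m * q)) * \<dots> =
      (if \<xi> \<in> pos_cone then ennreal (cone_Gamma CARD('n) l * (2 * pi) powr (- D) * sdet \<xi> powr (- \<mu>)) else top)"
  proof (cases "\<xi> \<in> pos_cone")
    case True
    have "siegel_const CARD('n) l = cone_Gamma CARD('n) l / (pi powr D * cone_Gamma CARD('n) \<mu>)"
      by (simp add: siegel_const_def D_def m_def \<mu>_def)
    moreover have "2 powr (m * q) * 2 powr (m * (- \<mu>)) = 2 powr (- D)"
      using D by (simp add: algebra_simps flip: powr_add)
    moreover have "(2 * pi) powr (- D) = 2 powr (- D) / pi powr D" by (simp add: powr_mult powr_minus_divide)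
    moreover have "cone_Gamma CARD('n) \<mu> > 0" using Gamma_pos(2) by (simp add: \<mu>_def)
    moreover have "sdet (2 *\<^sub>R \<xi>) powr (- \<mu>) = 2 powr (m * (- \<mu>)) * sdet \<xi> powr (- \<mu>)"
      unfolding sdet_scaleR by (rule pw[OF sdet_pos[OF True]])
    ultimately have e: "siegel_const CARD('n) l * cone_Gamma CARD('n) \<mu> = cone_Gamma CARD('n) l / pi powr D"
      "2 powr (m * q) * 2 powr (m * (- \<mu>)) = 2 powr (- D)" "(2 * pi) powr (- D) = 2 powr (- D) / pi powr D"
      "sdet (2 *\<^sub>R \<xi>) powr (- \<mu>) = 2 powr (m * (- \<mu>)) * sdet \<xi> powr (- \<mu>)"
      by simp_all
    have "siegel_const CARD('n) l * 2 powr (m * q) * (cone_Gamma CARD('n) \<mu> * sdet (2 *\<^sub>R \<xi>) powr (- \<mu>)) =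
        (siegel_const CARD('n) l * cone_Gamma CARD('n) \<mu>) * (2 powr (m * q) * 2 powr (m * (- \<mu>))) * sdet \<xi> powr (- \<mu>)"
      unfolding e(4) by (simp only: mult_ac)
    also have "\<dots> = cone_Gamma CARD('n) l * (2 * pi) powr (- D) * sdet \<xi> powr (- \<mu>)"
      unfolding e(1-3) by simp
    finally have "siegel_const CARD('n) l * 2 powr (m * q) * (cone_Gamma CARD('n) \<mu> * sdet (2 *\<^sub>R \<xi>) powr (- \<mu>)) =
        cone_Gamma CARD('n) l * (2 * pi) powr (- D) * sdet \<xi> powr (- \<mu>)" .
    then show ?thesis using True by (simp only: if_True ennreal_mult'[OF C, symmetric])
  next
    case False
    have "siegel_const CARD('n) l * 2 powr (m * q) > 0" using siegel_const_pos by simp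
    then show ?thesis using False siegel_const_pos by (simp add: ennreal_mult_top)
  qed
  finally show ?thesis by (simp only: D_def m_def \<mu>_def)
qed

text \<open>The constants in the measure and in \<open>S_op\<close> are made for this value 1: it
  turns \<open>S_op l\<close> into an isometry, fibre by fibre in \<xi>.\<close>

lemma S_kernel_integral_N:
  fixes \<xi> :: "'n symmat"
  assumes "\<xi> \<in> pos_cone"
  shows "(\<integral>\<^sup>+Y. ennreal ((S_kernel l \<xi> Y)\<^sup>2) \<partial>N) = 1"
proof -
  define c where "c = (2 * pi) powr (real CARD('n) * (real CARD('n) + 1) / 2) / cone_Gamma CARD('n) l * sdet \<xi> powr (l - (real CARD('n) + 1) / 2)"
  have c: "c \<ge> 0" using Gamma_pos by (simp add: c_def)
  have "(\<integral>\<^sup>+Y. ennreal ((S_kernel l \<xi> Y)\<^sup>2) \<partial>N) = (\<integral>\<^sup>+Y. ennreal c * ennreal (exp (- inner \<xi> (2 *\<^sub>R Y))) \<partial>N)"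
    unfolding S_kernel_sq[OF Gamma_pos(1)] using c by (simp only: c_def mult.assoc[symmetric] flip: ennreal_mult[OF _ exp_ge_zero])
  also have "\<dots> = ennreal c * (\<integral>\<^sup>+Y. ennreal (exp (- inner \<xi> (2 *\<^sub>R Y))) \<partial>N)"
    by (rule nn_integral_cmult, rule measurable_cone_weighted) measurable
  also have "\<dots> = ennreal (c * (cone_Gamma CARD('n) l * (2 * pi) powr (- (real CARD('n) * (real CARD('n) + 1) / 2)) *
       sdet \<xi> powr (- (l - (real CARD('n) + 1) / 2))))"
    unfolding laplace_N using assms c Gamma_pos by (simp add: ennreal_mult)
  also have "c * (cone_Gamma CARD('n) l * (2 * pi) powr (- (real CARD('n) * (real CARD('n) + 1) / 2)) *
       sdet \<xi> powr (- (l - (real CARD('n) + 1) / 2))) = 1"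
    using Gamma_pos sdet_pos[OF assms] unfolding c_def by (simp add: powr_minus field_simps)
  finally show ?thesis by simp
qed

text \<open>The Gamma integral with the roles exchanged: now \<xi> is integrated, and
  \<open>2 *\<^sub>R Y\<close> is the parameter.\<close>

lemma S_kernel_integral_cone:
  fixes Y :: "'n symmat"
  assumes "Y \<in> pos_cone"
  shows "(\<lambda>\<xi>. of_real (indicator pos_cone \<xi> * S_kernel l \<xi> Y) :: complex) \<in> L2 lborel"
proof (rule L2_I_nn)
  have "(\<lambda>\<xi>. S_kernel l \<xi> Y) \<in> borel_measurable borel"
    unfolding S_kernel_def by measurable
  then have "(\<lambda>\<xi>. indicator pos_cone \<xi> * S_kernel l \<xi> Y) \<in> borel_measurable borel"
    by (intro borel_measurable_times borel_measurable_indicator pos_cone_borel)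
  from measurable_compose[OF this, of complex_of_real borel]
  show "(\<lambda>\<xi>. of_real (indicator pos_cone \<xi> * S_kernel l \<xi> Y) :: complex) \<in> borel_measurable lborel"
    using borel_measurable_continuous_onI[OF continuous_on_of_real_id] by simp
  define c where "c = (2 * pi) powr (real CARD('n) * (real CARD('n) + 1) / 2) / cone_Gamma CARD('n) l"
  have c: "c \<ge> 0" using Gamma_pos by (simp add: c_def)
  have mu: "l > (real CARD('n) - 1) / 2" using l by simp
  have "(\<integral>\<^sup>+\<xi>. ennreal ((cmod (of_real (indicator pos_cone \<xi> * S_kernel l \<xi> Y)))\<^sup>2) \<partial>lborel) =
      (\<integral>\<^sup>+\<xi>. ennreal c * (if \<xi> \<in> pos_cone then ennreal (sdet \<xi> powr (l - (real CARD('n) + 1) / 2) * exp (- inner \<xi> (2 *\<^sub>R Y))) else 0) \<partial>lborel)"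
  proof (rule nn_integral_cong)
    fix \<xi> :: "'n symmat"
    show "ennreal ((cmod (of_real (indicator pos_cone \<xi> * S_kernel l \<xi> Y)))\<^sup>2) =
      ennreal c * (if \<xi> \<in> pos_cone then ennreal (sdet \<xi> powr (l - (real CARD('n) + 1) / 2) * exp (- inner \<xi> (2 *\<^sub>R Y))) else 0)"
    proof (cases "\<xi> \<in> pos_cone")
      case True
      then have "(cmod (of_real (indicator pos_cone \<xi> * S_kernel l \<xi> Y)))\<^sup>2 = (S_kernel l \<xi> Y)\<^sup>2" by simp
      then show ?thesis unfolding S_kernel_sq[OF Gamma_pos(1)] using True c by (simp only: c_def[symmetric] if_True) (rule ennreal_mult, auto)
    qed simp
  qed
  also have "\<dots> = ennreal c * (\<integral>\<^sup>+\<xi>. (if \<xi> \<in> pos_cone then ennreal (sdet \<xi> powr (l - (real CARD('n) + 1) / 2) * exp (- inner \<xi> (2 *\<^sub>R Y))) else 0) \<partial>lborel)"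
    by (rule nn_integral_cmult) measurable
  also have "\<dots> < \<infinity>"
    unfolding cone_integral[OF mu] using assms by (simp add: pos_cone_scaleR ennreal_mult_less_top)
  finally show "(\<integral>\<^sup>+\<xi>. ennreal ((cmod (of_real (indicator pos_cone \<xi> * S_kernel l \<xi> Y)))\<^sup>2) \<partial>lborel) < \<infinity>" .
qed

lemma S_op_L2:
  assumes g: "g \<in> L2 (cone_lborel :: 'n symmat measure)"
  shows "S_op l g \<in> L2 PN" "L2_norm PN (S_op l g) = L2_norm cone_lborel g"
proof -
  let ?g = "\<lambda>x. indicator pos_cone x * g x"
  have gL: "?g \<in> L2 lborel" using g L2_cone_lborel_iff(1) by blast
  note [measurable] = L2_measurable[OF gL] borel_pair_PN[OF S_kernel_measurable, of l]
  have m: "S_op l g \<in> borel_measurable PN" unfolding S_op_eq by measurable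
  have "(\<integral>\<^sup>+z. ennreal ((cmod (S_op l g z))\<^sup>2) \<partial>PN) = (\<integral>\<^sup>+\<xi>. \<integral>\<^sup>+Y. ennreal ((cmod (S_op l g (\<xi>, Y)))\<^sup>2) \<partial>N \<partial>lborel)"
    by (rule M2.nn_integral_fst[symmetric]) (use m in measurable)
  also have "\<dots> = (\<integral>\<^sup>+\<xi>. ennreal ((cmod (?g \<xi>))\<^sup>2) \<partial>lborel)"
  proof (rule nn_integral_cong)
    fix \<xi> :: "'n symmat"
    have [measurable]: "(\<lambda>Y. S_kernel l \<xi> Y) \<in> borel_measurable N"
      by (rule measurable_cone_weighted) (unfold S_kernel_def, measurable)
    have "(\<integral>\<^sup>+Y. ennreal ((cmod (S_op l g (\<xi>, Y)))\<^sup>2) \<partial>N) = (\<integral>\<^sup>+Y. ennreal ((cmod (?g \<xi>))\<^sup>2) * ennreal ((S_kernel l \<xi> Y)\<^sup>2) \<partial>N)"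
      by (intro nn_integral_cong) (simp add: S_op_eq norm_mult power_mult_distrib ennreal_mult)
    also have "\<dots> = ennreal ((cmod (?g \<xi>))\<^sup>2) * (\<integral>\<^sup>+Y. ennreal ((S_kernel l \<xi> Y)\<^sup>2) \<partial>N)"
      by (rule nn_integral_cmult) measurable
    also have "\<dots> = ennreal ((cmod (?g \<xi>))\<^sup>2)"
      using S_kernel_integral_N[of \<xi>] by (cases "\<xi> \<in> pos_cone") simp_all
    finally show "(\<integral>\<^sup>+Y. ennreal ((cmod (S_op l g (\<xi>, Y)))\<^sup>2) \<partial>N) = ennreal ((cmod (?g \<xi>))\<^sup>2)" .
  qed
  also have "\<dots> = ennreal ((L2_norm cone_lborel g)\<^sup>2)"
    unfolding L2_cone_lborel_iff(2) by (rule L2_nn_integral[OF gL])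
  finally have *: "(\<integral>\<^sup>+z. ennreal ((cmod (S_op l g z))\<^sup>2) \<partial>PN) = ennreal ((L2_norm cone_lborel g)\<^sup>2)" .
  show L: "S_op l g \<in> L2 PN" by (rule L2_I_nn[OF m]) (use * in auto)
  have "(L2_norm PN (S_op l g))\<^sup>2 = (L2_norm cone_lborel g)\<^sup>2"
    using * unfolding L2_nn_integral[OF L] by (subst (asm) ennreal_inj) auto
  then show "L2_norm PN (S_op l g) = L2_norm cone_lborel g" by (rule power2_eq_imp_eq) auto
qed

text \<open>Cauchy-Schwarz against the kernel. It holds at every \<open>Y\<close> in the cone, so
  the integral of the theorem converges at every point of the domain.\<close>

lemma S_op_slice_integrable:
  assumes g: "g \<in> L2 (cone_lborel :: 'n symmat measure)" and Y: "Y \<in> pos_cone"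
  shows "integrable lborel (\<lambda>\<xi>. S_op l g (\<xi>, Y))"
proof -
  have "(\<lambda>x. indicator pos_cone x * g x) \<in> L2 lborel" using g L2_cone_lborel_iff(1) by blast
  from L2_mult_integrable[OF this S_kernel_integral_cone[OF Y]]
  have "integrable lborel (\<lambda>x. indicator pos_cone x * g x * cnj (of_real (indicator pos_cone x * S_kernel l x Y)))" .
  also have "(\<lambda>x. indicator pos_cone x * g x * cnj (of_real (indicator pos_cone x * S_kernel l x Y))) = (\<lambda>\<xi>. S_op l g (\<xi>, Y))"
    by (auto simp: S_op_eq indicator_def fun_eq_iff)
  finally show ?thesis .
qed

subsection \<open>Transfer between the Siegel domain and the product\<close>

abbreviation spt :: "'n symmat \<times> 'n symmat \<Rightarrow> complex^'n^'n" where "spt \<equiv> \<lambda>(X, Y). siegel_point X Y"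

lemma continuous_on_siegel_point: "continuous_on A (\<lambda>z. siegel_point (fst z) (snd z))"
  unfolding siegel_point_def Complex_eq by (intro continuous_intros)

lemma spt_in_domain: "snd z \<in> pos_cone \<Longrightarrow> spt z \<in> siegel_domain"
  by (cases z) (simp add: siegel_domain_def siegel_point_def pos_cone_def transpose_def vec_eq_iff mat_of_nth_sym)

lemma siegel_domain_cases:
  assumes "Z \<in> siegel_domain"
  obtains X Y where "Z = siegel_point X Y" "Y \<in> (pos_cone :: 'n symmat set)"
proof -
  have sym: "Z $ i $ j = Z $ j $ i" for i j
    using assms by (auto simp: siegel_domain_def transpose_def vec_eq_iff)
  have X: "mat_of (Symmat (\<chi> i j. Re (Z $ i $ j))) = (\<chi> i j. Re (Z $ i $ j))"
    and Y: "mat_of (Symmat (\<chi> i j. Im (Z $ i $ j))) = (\<chi> i j. Im (Z $ i $ j))"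
    by (simp_all add: mat_of_Symmat vec_eq_iff transpose_def sym[THEN arg_cong])
  show ?thesis
    by (rule that[of "Symmat (\<chi> i j. Re (Z $ i $ j))" "Symmat (\<chi> i j. Im (Z $ i $ j))"])
      (use assms in \<open>simp_all add: siegel_point_def X Y pos_cone_def siegel_domain_def vec_eq_iff\<close>)
qed

lemma measurable_spt: "spt \<in> PN \<rightarrow>\<^sub>M restrict_space borel siegel_domain"
proof (rule measurable_restrict_space2)
  show "spt \<in> space PN \<rightarrow> siegel_domain"
    using spt_in_domain by (auto simp: space_pair_measure space_cone_weighted)
  have "(\<lambda>z. siegel_point (fst z) (snd z)) \<in> (borel :: ('n symmat \<times> 'n symmat) measure) \<rightarrow>\<^sub>M borel"
    by (rule borel_measurable_continuous_onI[OF continuous_on_siegel_point])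
  then have "(\<lambda>z. siegel_point (fst z) (snd z)) \<in> (borel :: 'n symmat measure) \<Otimes>\<^sub>M (borel :: 'n symmat measure) \<rightarrow>\<^sub>M borel"
    by (simp only: borel_prod)
  from borel_pair_PN[OF this] show "spt \<in> borel_measurable PN" by (simp only: split_beta')
qed

text \<open>The weight depends on \<open>Z\<close> through its imaginary part, so it can be moved to
  the second factor. Passing between the domain and the product then is composition with
  \<open>spt\<close>.\<close>

lemma siegel_measure_eq: "siegel_measure l = distr PN (restrict_space borel siegel_domain) spt"
proof -
  define w where "w Z = ennreal (siegel_const CARD('n) l * det (2 *\<^sub>R (\<chi> i j. Im (Z $ i $ j)) :: real^'n^'n) powr (l - real CARD('n) - 1))"
    for Z :: "complex^'n^'n"
  define v where "v Y = ennreal (siegel_const CARD('n) l * sdet (2 *\<^sub>R Y) powr (l - real CARD('n) - 1))" for Y :: "'n symmat"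
  have s: "sigma_finite_measure (cone_lborel :: 'n symmat measure)"
    unfolding cone_lborel_def by (rule sigma_finite_measure_restrict_space[OF lborel.sigma_finite_measure_axioms]) simp
  have vm: "v \<in> borel_measurable cone_lborel" unfolding v_def by (rule measurable_cone_lborel_fst) measurable
  have "continuous_on UNIV (\<lambda>Z :: complex^'n^'n. det (2 *\<^sub>R (\<chi> i j. Im (Z $ i $ j)) :: real^'n^'n))"
    unfolding det_def by (intro continuous_intros)
  then have "(\<lambda>Z :: complex^'n^'n. det (2 *\<^sub>R (\<chi> i j. Im (Z $ i $ j)) :: real^'n^'n)) \<in> borel_measurable borel"
    by (rule borel_measurable_continuous_onI)
  then have "w \<in> borel_measurable borel" unfolding w_def by measurable
  then have wm: "w \<in> borel_measurable (restrict_space borel siegel_domain)" by (rule measurable_restrict_space1)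
  have ms: "spt \<in> lborel \<Otimes>\<^sub>M cone_lborel \<rightarrow>\<^sub>M restrict_space borel siegel_domain"
    using measurable_spt by (simp add: cone_weighted_def cong: measurable_cong_sets sets_pair_measure_cong)
  have N: "N = density cone_lborel v" unfolding cone_weighted_def v_def ..
  have ws: "w (siegel_point X Y) = v Y" for X Y
    by (simp add: w_def v_def siegel_point_def mat_of_arith vec_lambda_unique)
  have "density (lborel \<Otimes>\<^sub>M cone_lborel) (\<lambda>z. w (spt z)) = PN"
  proof -
    have "density (lborel :: 'n symmat measure) (\<lambda>_. 1) \<Otimes>\<^sub>M density cone_lborel v = density (lborel \<Otimes>\<^sub>M cone_lborel) (\<lambda>(x, y). 1 * v y)"
      by (rule pair_measure_density[OF _ vm s]) (use sigma_finite_N in \<open>simp_all add: N\<close>)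
    then show ?thesis by (simp add: density_1 N ws split_beta')
  qed
  then show ?thesis
    unfolding siegel_measure_def siegel_lborel_def w_def[symmetric] density_distr[OF wm ms] by simp
qed

lemma sets_siegel_measure: "sets (siegel_measure l :: (complex^'n^'n) measure) = sets (restrict_space borel siegel_domain)"
  by (simp add: siegel_measure_eq)

lemma space_siegel_measure: "space (siegel_measure l :: (complex^'n^'n) measure) = siegel_domain"
  by (simp add: siegel_measure_eq space_restrict_space)

lemma borel_measurable_siegel_iff:
  "f \<in> borel_measurable (siegel_measure l :: (complex^'n^'n) measure) \<longleftrightarrow> f \<in> borel_measurable (restrict_space borel siegel_domain)"
  by (simp cong: measurable_cong_sets add: sets_siegel_measure)

lemma L2_siegel:
  assumes f: "f \<in> borel_measurable (restrict_space borel siegel_domain)"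
  shows "f \<in> L2 (siegel_measure l) \<longleftrightarrow> (\<lambda>z. f (spt z)) \<in> L2 PN"
    and "L2_norm (siegel_measure l) f = L2_norm PN (\<lambda>z. f (spt z))"
proof -
  have m: "(\<lambda>z. f (spt z)) \<in> borel_measurable PN" by (rule measurable_compose[OF measurable_spt f])
  have m2: "(\<lambda>z. (cmod (f z))\<^sup>2) \<in> borel_measurable (restrict_space borel siegel_domain)" using f by measurable
  show "f \<in> L2 (siegel_measure l) \<longleftrightarrow> (\<lambda>z. f (spt z)) \<in> L2 PN"
    unfolding L2_def mem_Collect_eq siegel_measure_eq integrable_distr_eq[OF measurable_spt m2]
    by (simp only: measurable_distr_eq1 f m simp_thms)
  show "L2_norm (siegel_measure l) f = L2_norm PN (\<lambda>z. f (spt z))"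
    unfolding L2_norm_def siegel_measure_eq integral_distr[OF measurable_spt m2] ..
qed

lemma L2_inner_siegel:
  assumes "f \<in> borel_measurable (restrict_space borel siegel_domain)" "g \<in> borel_measurable (restrict_space borel siegel_domain)"
  shows "L2_inner (siegel_measure l) f g = L2_inner PN (\<lambda>z. f (spt z)) (\<lambda>z. g (spt z))"
proof -
  have m: "(\<lambda>z. f z * cnj (g z)) \<in> borel_measurable (restrict_space borel siegel_domain)" using assms by measurable
  show ?thesis unfolding L2_inner_def siegel_measure_eq integral_distr[OF measurable_spt m] ..
qed

end

subsection \<open>The operator and its formal adjoint\<close>

lemma fourier_integral_eq_FT: "fourier_integral f X = FT (- 1) f X"
  for X :: "'n::finite symmat"
proof -
  have "exp (- \<i> * of_real (trace (mat_of X ** mat_of \<xi>))) = cis (- 1 * inner X \<xi>)" for \<xi>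
    by (simp add: cis_conv_exp inner_symmat_def)
  moreover have "- (real CARD('n) * (real CARD('n) + 1) / 4) = - (real DIM('n symmat) / 2)"
    by (simp add: DIM_symmat)
  ultimately show ?thesis by (simp only: fourier_integral_def FT_def)
qed

text \<open>The choice in \<open>fourier_L2\<close> has a witness, hence it satisfies the
  assumptions of the locale.\<close>

lemma FT_L2_fourier_L2: "FT_L2 (- 1) (fourier_L2 :: ('n::finite symmat \<Rightarrow> complex) \<Rightarrow> _)"
proof -
  have "\<exists>T. L2_operator lborel lborel T \<and>
     (\<forall>f\<in>L2 lborel. integrable lborel f \<longrightarrow> (AE X in lborel. T f X = fourier_integral f (X :: 'n symmat)))"
    unfolding fourier_integral_eq_FT by (rule FT_extension_exists) simp
  from someI_ex[OF this, folded fourier_L2_def] show ?thesis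
    by unfold_locales (auto simp: fourier_integral_eq_FT)
qed

context siegel
begin

sublocale FT: FT_tensor "- 1" "fourier_L2 :: ('n symmat \<Rightarrow> complex) \<Rightarrow> _" N
  by (intro FT_tensor.intro FT_L2_fourier_L2 lborel_pair_measure_axioms)

abbreviation W :: "('n symmat \<times> 'n symmat \<Rightarrow> complex) \<Rightarrow> ('n symmat \<times> 'n symmat \<Rightarrow> complex)" where
  "W \<equiv> L2_tensor lborel N fourier_L2 (\<lambda>g. g)"

lemma W: "L2_operator PN PN W"
  "\<And>f g. f \<in> L2 lborel \<Longrightarrow> g \<in> L2 N \<Longrightarrow> AE z in PN. W (\<lambda>(x, y). f x * g y) z = fourier_L2 f (fst z) * g (snd z)"
  using someI_ex[OF FT.tensor_extension_exists] unfolding L2_tensor_def by blast+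

text \<open>A formula for the adjoint of \<open>S_op l\<close>. It is the witness that the choice in
  \<open>L2_adjoint\<close> needs.\<close>

definition S_star :: "('n symmat \<times> 'n symmat \<Rightarrow> complex) \<Rightarrow> 'n symmat \<Rightarrow> complex" where
  "S_star v \<xi> = (LINT Y|N. of_real (S_kernel l \<xi> Y) * v (\<xi>, Y))"

lemma of_real_borel: "complex_of_real \<in> borel_measurable borel"
  by (rule borel_measurable_continuous_onI) (intro continuous_intros)

text \<open>Cauchy-Schwarz in \<open>Y\<close>, where the kernel has norm one by
  \<open>S_kernel_integral_N\<close>, bounds \<open>S_star v\<close>; Fubini gives the
  pairing.\<close>

lemma S_star:
  assumes v: "v \<in> L2 PN"
  shows "S_star v \<in> L2 cone_lborel"
    and "g \<in> L2 cone_lborel \<Longrightarrow> L2_inner PN (S_op l g) v = L2_inner cone_lborel g (S_star v)"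
proof -
  note [measurable] = L2_measurable[OF v] borel_pair_PN[OF S_kernel_measurable, of l]
  have km: "(\<lambda>z. of_real (S_kernel l (fst z) (snd z)) * v z) \<in> borel_measurable PN" by measurable
  have "(\<lambda>\<xi>. LINT Y|N. of_real (S_kernel l \<xi> Y) * v (\<xi>, Y)) \<in> borel_measurable lborel"
    by (rule M2.borel_measurable_lebesgue_integral) (use km in \<open>simp add: split_beta'\<close>)
  then have Sm: "S_star v \<in> borel_measurable borel" unfolding S_star_def[abs_def] by simp
  have Sm': "(\<lambda>\<xi>. indicator pos_cone \<xi> * S_star v \<xi>) \<in> borel_measurable lborel"
    using Sm by (intro borel_measurable_times borel_measurable_indicator) auto
  have "(\<integral>\<^sup>+\<xi>. ennreal ((cmod (indicator pos_cone \<xi> * S_star v \<xi>))\<^sup>2) \<partial>lborel) \<le> (\<integral>\<^sup>+\<xi>. \<integral>\<^sup>+Y. ennreal ((cmod (v (\<xi>, Y)))\<^sup>2) \<partial>N \<partial>lborel)"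
  proof (rule nn_integral_mono)
    fix \<xi> :: "'n symmat"
    show "ennreal ((cmod (indicator pos_cone \<xi> * S_star v \<xi>))\<^sup>2) \<le> (\<integral>\<^sup>+Y. ennreal ((cmod (v (\<xi>, Y)))\<^sup>2) \<partial>N)"
    proof (cases "\<xi> \<in> pos_cone")
      case True
      have k [measurable]: "(\<lambda>Y. ennreal (S_kernel l \<xi> Y)) \<in> borel_measurable N"
        by (rule measurable_cone_weighted) (unfold S_kernel_def, measurable)
      have vm [measurable]: "(\<lambda>Y. v (\<xi>, Y)) \<in> borel_measurable N" by (rule measurable_compose[OF measurable_Pair1' L2_measurable[OF v]]) simp
      have "ennreal (cmod (S_star v \<xi>)) \<le> (\<integral>\<^sup>+Y. ennreal (cmod (of_real (S_kernel l \<xi> Y) * v (\<xi>, Y))) \<partial>N)"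
        unfolding S_star_def by (rule norm_integral_le_nn_integral)
      also have "\<dots> = (\<integral>\<^sup>+Y. ennreal (S_kernel l \<xi> Y) * ennreal (cmod (v (\<xi>, Y))) \<partial>N)"
        using S_kernel_nonneg[OF Gamma_pos(1)] by (intro nn_integral_cong) (simp add: norm_mult ennreal_mult)
      finally have "(ennreal (cmod (S_star v \<xi>)))\<^sup>2 \<le> (\<integral>\<^sup>+Y. ennreal (S_kernel l \<xi> Y) * ennreal (cmod (v (\<xi>, Y))) \<partial>N)\<^sup>2"
        by (rule power_mono) simp
      also have "\<dots> \<le> (\<integral>\<^sup>+Y. (ennreal (S_kernel l \<xi> Y))\<^sup>2 \<partial>N) * (\<integral>\<^sup>+Y. (ennreal (cmod (v (\<xi>, Y))))\<^sup>2 \<partial>N)"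
        by (rule Cauchy_Schwarz_nn_integral) measurable
      also have "\<dots> = (\<integral>\<^sup>+Y. ennreal ((cmod (v (\<xi>, Y)))\<^sup>2) \<partial>N)"
        using S_kernel_integral_N[OF True] S_kernel_nonneg[OF Gamma_pos(1)] by (simp add: ennreal_power)
      finally show ?thesis using True by (simp add: ennreal_power)
    qed simp
  qed
  also have "\<dots> = (\<integral>\<^sup>+z. ennreal ((cmod (v z))\<^sup>2) \<partial>PN)" by (rule M2.nn_integral_fst) measurable
  also have "\<dots> < \<infinity>" by (simp add: L2_nn_integral[OF v])
  finally have "(\<lambda>\<xi>. indicator pos_cone \<xi> * S_star v \<xi>) \<in> L2 lborel" by (rule L2_I_nn[OF Sm'])
  then show "S_star v \<in> L2 cone_lborel" using L2_cone_lborel_iff(1) by blast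
  assume g: "g \<in> L2 cone_lborel"
  have "L2_inner PN (S_op l g) v = (LINT \<xi>|lborel. LINT Y|N. S_op l g (\<xi>, Y) * cnj (v (\<xi>, Y)))"
    unfolding L2_inner_def by (rule integral_fst'[symmetric]) (rule L2_mult_integrable[OF S_op_L2(1)[OF g] v])
  also have "\<dots> = (LINT \<xi>|lborel. (indicator pos_cone \<xi> * g \<xi>) * cnj (S_star v \<xi>))"
  proof (rule Bochner_Integration.integral_cong[OF refl])
    fix \<xi> :: "'n symmat"
    have "S_op l g (\<xi>, Y) * cnj (v (\<xi>, Y)) = (indicator pos_cone \<xi> * g \<xi>) * cnj (of_real (S_kernel l \<xi> Y) * v (\<xi>, Y))" for Y
      by (simp add: S_op_eq)
    then show "(LINT Y|N. S_op l g (\<xi>, Y) * cnj (v (\<xi>, Y))) = (indicator pos_cone \<xi> * g \<xi>) * cnj (S_star v \<xi>)"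
      by (simp only: S_star_def integral_mult_right_zero Bochner_Integration.integral_cnj)
  qed
  also have "\<dots> = L2_inner cone_lborel g (S_star v)" unfolding L2_inner_cone_lborel by (simp add: L2_inner_def)
  finally show "L2_inner PN (S_op l g) v = L2_inner cone_lborel g (S_star v)" .
qed

lemma R_op:
  assumes f: "f \<in> L2 (siegel_measure l)"
  shows "R_op l f \<in> L2 (cone_lborel :: 'n symmat measure)"
    and "g \<in> L2 cone_lborel \<Longrightarrow> L2_inner PN (S_op l g) (W (\<lambda>z. f (spt z))) = L2_inner cone_lborel g (R_op l f)"
proof -
  have fm: "f \<in> borel_measurable (restrict_space borel siegel_domain)"
    using L2_measurable[OF f] by (simp only: borel_measurable_siegel_iff)
  have uL: "(\<lambda>z. f (spt z)) \<in> L2 PN" using L2_siegel(1)[OF fm] f by simp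
  have U: "U_op l f = W (\<lambda>z. f (spt z))" by (simp only: U_op_def split_beta')
  have "\<exists>h. h \<in> L2 cone_lborel \<and> (\<forall>g\<in>L2 cone_lborel. L2_inner PN (S_op l g) (U_op l f) = L2_inner cone_lborel g h)"
    using S_star[OF L2_operator_L2[OF W(1) uL]] unfolding U by blast
  from someI_ex[OF this] have *: "R_op l f \<in> L2 cone_lborel \<and> (\<forall>g\<in>L2 cone_lborel. L2_inner PN (S_op l g) (U_op l f) = L2_inner cone_lborel g (R_op l f))"
    unfolding R_op_def L2_adjoint_def .
  then show "R_op l f \<in> L2 (cone_lborel :: 'n symmat measure)" by blast
  show "L2_inner PN (S_op l g) (W (\<lambda>z. f (spt z))) = L2_inner cone_lborel g (R_op l f)" if "g \<in> L2 cone_lborel"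
    using * that unfolding U by blast
qed

lemma trace_siegel_point: "trace (cmat_of \<xi> ** siegel_point X Y) = of_real (inner \<xi> X) + \<i> * of_real (inner \<xi> Y)"
proof -
  have "trace (cmat_of \<xi> ** siegel_point X Y) = (\<Sum>i\<in>UNIV. \<Sum>k\<in>UNIV. of_real (mat_of \<xi> $ i $ k * mat_of X $ k $ i) + \<i> * of_real (mat_of \<xi> $ i $ k * mat_of Y $ k $ i))"
    by (simp add: trace_def matrix_matrix_mult_def siegel_point_def Complex_eq algebra_simps)
  then show ?thesis
    by (simp add: inner_symmat_def trace_def matrix_matrix_mult_def sum.distrib sum_distrib_left)
qed

text \<open>The powers of \<open>2 * pi\<close> in the Fourier transform and in \<open>S_op\<close>
  cancel, since the space of matrices has dimension n(n+1)/2.\<close>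

lemma R_adj_integrand_spt:
  fixes \<xi> :: "'n symmat"
  assumes "\<xi> \<in> pos_cone"
  shows "of_real (1 / sqrt (cone_Gamma CARD('n) l)) * R_adj_integrand l g (siegel_point X Y) \<xi> =
    of_real ((2 * pi) powr (- (real DIM('n symmat) / 2))) * (cis (1 * inner X \<xi>) * S_op l g (\<xi>, Y))"
proof -
  have "exp (\<i> * trace (cmat_of \<xi> ** siegel_point X Y)) = cis (inner X \<xi>) * of_real (exp (- inner \<xi> Y))"
    unfolding trace_siegel_point
    by (simp add: cis_conv_exp exp_of_real[symmetric] distrib_left inner_commute mult.assoc[symmetric] flip: exp_add)
  moreover have "(2 * pi) powr (- (real DIM('n symmat) / 2)) * (2 * pi) powr (real CARD('n) * (real CARD('n) + 1) / 4) = 1"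
    by (simp add: DIM_symmat flip: powr_add)
  then have "complex_of_real ((2 * pi) powr (- (real DIM('n symmat) / 2))) * of_real ((2 * pi) powr (real CARD('n) * (real CARD('n) + 1) / 4)) = 1"
    by (simp only: of_real_mult[symmetric] of_real_1)
  moreover define d e where "d = complex_of_real ((2 * pi) powr (- (real DIM('n symmat) / 2)))"
    and "e = complex_of_real ((2 * pi) powr (real CARD('n) * (real CARD('n) + 1) / 4))"
  moreover have "d * (cis (1 * inner X \<xi>) * S_op l g (\<xi>, Y)) = (d * e) *
      (g \<xi> * of_real (sdet \<xi> powr (l / 2 - (real CARD('n) + 1) / 4)) *
      (cis (inner X \<xi>) * of_real (exp (- inner \<xi> Y))) / of_real (sqrt (cone_Gamma CARD('n) l)))"
    using assms by (simp add: S_op_eq S_kernel_def e_def)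
  ultimately show ?thesis
    by (simp add: R_adj_integrand_def)
qed

lemma R_adj_integral_spt:
  assumes Y: "Y \<in> pos_cone" and g: "g \<in> L2 (cone_lborel :: 'n symmat measure)"
  shows "R_adj_integral l g (siegel_point X Y) = partial_FT 1 (S_op l g) (X, Y)"
    and "integrable cone_lborel (R_adj_integrand l g (siegel_point X Y))"
proof -
  let ?c = "complex_of_real (1 / sqrt (cone_Gamma CARD('n) l))"
  let ?d = "complex_of_real ((2 * pi) powr (- (real DIM('n symmat) / 2)))"
  have c0: "?c \<noteq> 0" using Gamma_pos by simp
  have c: "pos_cone \<inter> space lborel \<in> sets lborel" by simp
  have eq: "indicator pos_cone \<xi> *\<^sub>R (?c * R_adj_integrand l g (siegel_point X Y) \<xi>) = ?d * (cis (1 * inner X \<xi>) * S_op l g (\<xi>, Y))" for \<xi>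
    using R_adj_integrand_spt[of \<xi> g X Y] by (cases "\<xi> \<in> pos_cone") (simp_all add: S_op_eq)
  have "R_adj_integral l g (siegel_point X Y) = (LINT \<xi>|cone_lborel. ?c * R_adj_integrand l g (siegel_point X Y) \<xi>)"
    unfolding R_adj_integral_def by (rule integral_mult_right_zero[symmetric])
  also have "\<dots> = (LINT \<xi>|lborel. ?d * (cis (1 * inner X \<xi>) * S_op l g (\<xi>, Y)))"
    unfolding cone_lborel_def integral_restrict_space[OF c] eq ..
  also have "\<dots> = partial_FT 1 (S_op l g) (X, Y)"
    unfolding integral_mult_right_zero by (simp only: partial_FT_def FT_def fst_conv snd_conv)
  finally show "R_adj_integral l g (siegel_point X Y) = partial_FT 1 (S_op l g) (X, Y)" .
  have i: "integrable lborel (\<lambda>\<xi>. S_op l g (\<xi>, Y))" by (rule S_op_slice_integrable[OF g Y])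
  have "integrable lborel (\<lambda>\<xi>. cis (1 * inner X \<xi>) * S_op l g (\<xi>, Y))"
  proof (rule Bochner_Integration.integrable_bound[OF i])
    note [measurable] = borel_measurable_integrable[OF i]
    show "(\<lambda>\<xi>. cis (1 * inner X \<xi>) * S_op l g (\<xi>, Y)) \<in> borel_measurable lborel" by measurable
  qed (simp add: norm_mult)
  then have "integrable lborel (\<lambda>\<xi>. ?d * (cis (1 * inner X \<xi>) * S_op l g (\<xi>, Y)))" by (rule integrable_mult_right)
  then have "integrable cone_lborel (\<lambda>\<xi>. ?c * R_adj_integrand l g (siegel_point X Y) \<xi>)"
    unfolding cone_lborel_def integrable_restrict_space[OF c] eq .
  from integrable_mult_right[OF this, of "inverse ?c"]
  show "integrable cone_lborel (R_adj_integrand l g (siegel_point X Y))"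
    by (simp only: mult.assoc[symmetric] left_inverse[OF c0] mult_1_left)
qed

subsection \<open>Holomorphy\<close>

text \<open>The exponential gain comes from moving \<open>Y\<close> a little in the directions of the basis, which stays inside the open cone.\<close>

lemma exponential_decay:
  assumes Y: "Y \<in> (pos_cone :: 'n symmat set)" and g: "g \<in> L2 cone_lborel"
  shows "\<exists>t>0. integrable lborel (\<lambda>\<xi>. exp (t * norm \<xi>) * cmod (S_op l g (\<xi>, Y)))"
proof -
  obtain r where r: "r > 0" "ball Y r \<subseteq> pos_cone" using open_pos_cone Y open_contains_ball by blast
  define s where "s = r / 2"
  have s: "s > 0" using r by (simp add: s_def)
  have near: "Y + c *\<^sub>R b \<in> pos_cone" if "b \<in> Basis" "\<bar>c\<bar> = s" for b c
    by (rule subsetD[OF r(2)]) (use that r in \<open>simp add: dist_norm s_def\<close>)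
  \<comment> \<open>The divisor comes from \<open>norm_le_l1\<close>: the norm is at most the
    dimension times the largest coordinate.\<close>
  define t where "t = s / real DIM('n symmat)"
  have t: "t > 0" using s by (simp add: t_def)
  \<comment> \<open>Moving \<open>Y\<close> by \<open>c *\<^sub>R b\<close> multiplies the kernel by
    an exponential in the coordinate along \<open>b\<close>; both signs together dominate
    \<open>exp (s * \<bar>inner \<xi> b\<bar>)\<close>.\<close>
  have shift: "exp (- c * inner \<xi> b) * cmod (S_op l g (\<xi>, Y)) = cmod (S_op l g (\<xi>, Y + c *\<^sub>R b))" for c b \<xi>
    using S_kernel_nonneg[OF Gamma_pos(1)]
    by (simp add: S_op_eq norm_mult) (simp add: S_kernel_def inner_add_right exp_diff exp_minus field_simps)
  have bound: "exp (t * norm \<xi>) \<le> (\<Sum>b\<in>Basis. exp (- (- s) * inner \<xi> b) + exp (- s * inner \<xi> b))" for \<xi> :: "'n symmat"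
  proof -
    define M where "M = Max ((\<lambda>b. \<bar>inner \<xi> b\<bar>) ` (Basis :: 'n symmat set))"
    have fin: "finite ((\<lambda>b. \<bar>inner \<xi> b\<bar>) ` (Basis :: 'n symmat set))" "(\<lambda>b. \<bar>inner \<xi> b\<bar>) ` (Basis :: 'n symmat set) \<noteq> {}" by auto
    obtain b where b: "b \<in> Basis" "M = \<bar>inner \<xi> b\<bar>" using Max_in[OF fin] unfolding M_def[symmetric] by blast
    have "norm \<xi> \<le> (\<Sum>b\<in>Basis. \<bar>inner \<xi> b\<bar>)" by (rule norm_le_l1)
    also have "\<dots> \<le> real DIM('n symmat) * M"
      by (rule sum_bounded_above) (use fin in \<open>auto simp: M_def intro: Max_ge\<close>)
    finally have "t * norm \<xi> \<le> s * M"
      using s by (simp add: t_def field_simps)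
    then have "exp (t * norm \<xi>) \<le> exp (s * \<bar>inner \<xi> b\<bar>)" by (simp add: b)
    also have "\<dots> \<le> exp (- (- s) * inner \<xi> b) + exp (- s * inner \<xi> b)"
      by (cases "inner \<xi> b \<ge> 0") (simp_all add: add_increasing add_increasing2)
    also have "\<dots> \<le> (\<Sum>b\<in>Basis. exp (- (- s) * inner \<xi> b) + exp (- s * inner \<xi> b))"
      by (rule member_le_sum) (use b in \<open>auto simp: add_nonneg_nonneg\<close>)
    finally show ?thesis .
  qed
  have "integrable lborel (\<lambda>\<xi>. \<Sum>b\<in>Basis. cmod (S_op l g (\<xi>, Y + (- s) *\<^sub>R b)) + cmod (S_op l g (\<xi>, Y + s *\<^sub>R b)))"
    by (intro Bochner_Integration.integrable_sum Bochner_Integration.integrable_add integrable_norm S_op_slice_integrable[OF g] near) (use s in auto)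
  then have "integrable lborel (\<lambda>\<xi>. exp (t * norm \<xi>) * cmod (S_op l g (\<xi>, Y)))"
  proof (rule Bochner_Integration.integrable_bound)
    note [measurable] = borel_measurable_integrable[OF S_op_slice_integrable[OF g Y]]
    show "(\<lambda>\<xi>. exp (t * norm \<xi>) * cmod (S_op l g (\<xi>, Y))) \<in> borel_measurable lborel" by measurable
    have "exp (t * norm \<xi>) * cmod (S_op l g (\<xi>, Y)) \<le> (\<Sum>b\<in>Basis. cmod (S_op l g (\<xi>, Y + (- s) *\<^sub>R b)) + cmod (S_op l g (\<xi>, Y + s *\<^sub>R b)))" for \<xi>
      unfolding shift[symmetric] using mult_right_mono[OF bound[of \<xi>], of "cmod (S_op l g (\<xi>, Y))"]
      by (simp only: sum_distrib_right distrib_right norm_ge_zero)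
    then show "AE \<xi> in lborel. norm (exp (t * norm \<xi>) * cmod (S_op l g (\<xi>, Y))) \<le>
        norm (\<Sum>b\<in>Basis. cmod (S_op l g (\<xi>, Y + (- s) *\<^sub>R b)) + cmod (S_op l g (\<xi>, Y + s *\<^sub>R b)))"
      by (intro AE_I2) (auto intro: order_trans[OF _ abs_ge_self])
  qed
  with t show ?thesis by blast
qed

end

lemma norm_trace_cmat_le:
  fixes W :: "complex^'n::finite^'n"
  shows "cmod (trace (cmat_of \<xi> ** W)) \<le> (real CARD('n))\<^sup>2 * norm \<xi> * norm W"
proof -
  have "cmod (trace (cmat_of \<xi> ** W)) \<le> (\<Sum>i\<in>UNIV. \<Sum>k\<in>UNIV. cmod (of_real (mat_of \<xi> $ i $ k) * W $ k $ i))"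
    unfolding trace_def matrix_matrix_mult_def by (simp, intro order_trans[OF norm_sum] sum_mono norm_sum)
  also have "\<dots> \<le> (\<Sum>i\<in>(UNIV::'n set). \<Sum>k\<in>(UNIV::'n set). norm \<xi> * norm W)"
  proof (intro sum_mono)
    fix i k
    have "cmod (W $ k $ i) \<le> norm (W $ k)" "norm (W $ k) \<le> norm W" by (rule Finite_Cartesian_Product.norm_nth_le)+
    then show "cmod (of_real (mat_of \<xi> $ i $ k) * W $ k $ i) \<le> norm \<xi> * norm W"
      unfolding norm_mult norm_of_real by (intro mult_mono mat_of_entry_le_norm) auto
  qed
  also have "\<dots> = (real CARD('n))\<^sup>2 * norm \<xi> * norm W" by (simp add: power2_eq_square)
  finally show ?thesis .
qed

lemma trace_cmat_linear:
  "trace (cmat_of \<xi> ** (V + W)) = trace (cmat_of \<xi> ** V) + trace (cmat_of \<xi> ** W)"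
  "trace (cmat_of \<xi> ** (\<chi> i j. c * W $ i $ j)) = c * trace (cmat_of \<xi> ** W)"
  "trace (cmat_of \<xi> ** (r *\<^sub>R W)) = of_real r * trace (cmat_of \<xi> ** W)"
proof -
  show "trace (cmat_of \<xi> ** (V + W)) = trace (cmat_of \<xi> ** V) + trace (cmat_of \<xi> ** W)"
    "trace (cmat_of \<xi> ** (\<chi> i j. c * W $ i $ j)) = c * trace (cmat_of \<xi> ** W)"
    by (simp_all add: trace_def matrix_matrix_mult_def sum.distrib sum_distrib_left algebra_simps)
  show "trace (cmat_of \<xi> ** (r *\<^sub>R W)) = of_real r * trace (cmat_of \<xi> ** W)"
    by (simp add: trace_def matrix_matrix_mult_def sum_distrib_left) (simp add: scaleR_conv_of_real mult_ac)
qed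

lemma cmod_exp_remainder: "cmod (exp z - 1 - z) \<le> exp (cmod z) * (cmod z)\<^sup>2"
proof -
  have "cmod (exp z - (\<Sum>k\<le>1. z ^ k / fact k)) \<le> exp \<bar>Re z\<bar> * cmod z ^ Suc 1 / fact 1"
    by (rule Taylor_exp)
  also have "\<dots> \<le> exp (cmod z) * (cmod z)\<^sup>2"
    using abs_Re_le_cmod[of z] by (simp add: power2_eq_square mult_right_mono)
  finally show ?thesis by (simp add: algebra_simps)
qed

context siegel
begin

text \<open>Differentiability is shown in the full matrix space, as the integrand is defined and
  entire in \<open>Z\<close> there. The derivative is the integral of the linear term of
  \<open>exp\<close>, and the remainder is of second order in the increment.\<close>

lemma R_adj_integral_has_derivative:
  assumes Z: "Z \<in> (siegel_domain :: (complex^'n^'n) set)" and g: "g \<in> L2 (cone_lborel :: 'n symmat measure)"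
  shows "\<exists>D. (R_adj_integral l g has_derivative D) (at Z) \<and> (\<forall>c W. D (\<chi> i j. c * W $ i $ j) = c * D W)"
proof -
  obtain X Y where XY: "Z = siegel_point X Y" "Y \<in> (pos_cone :: 'n symmat set)" by (rule siegel_domain_cases[OF Z])
  obtain t where t: "t > 0" and int: "integrable lborel (\<lambda>\<xi>. exp (t * norm \<xi>) * cmod (S_op l g (\<xi>, Y)))"
    using exponential_decay[OF XY(2) g] by blast
  define H where "H = (\<lambda>\<xi> :: 'n symmat. exp (t * norm \<xi>) * cmod (S_op l g (\<xi>, Y)))"
  have H: "integrable lborel H" using int by (simp add: H_def)
  define d where "d = complex_of_real ((2 * pi) powr (- (real DIM('n symmat) / 2)))"
  define F where "F \<xi> = d * (cis (1 * inner X \<xi>) * S_op l g (\<xi>, Y))" for \<xi>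
  note Sm = borel_measurable_integrable[OF S_op_slice_integrable[OF g XY(2)]]
  have Fm [measurable]: "F \<in> borel_measurable lborel"
  proof -
    note [measurable] = Sm
    show ?thesis unfolding F_def by measurable
  qed
  have Fn: "cmod (F \<xi>) = cmod d * cmod (S_op l g (\<xi>, Y))" for \<xi> by (simp add: F_def norm_mult)
  define \<phi> where "\<phi> W \<xi> = \<i> * trace (cmat_of \<xi> ** W)" for W :: "complex^'n^'n" and \<xi>
  have \<phi>m [measurable]: "\<phi> W \<in> borel_measurable borel" for W
  proof -
    have "continuous_on UNIV (\<lambda>\<xi>. \<i> * (\<Sum>i\<in>UNIV. \<Sum>k\<in>UNIV. complex_of_real (mat_of \<xi> $ i $ k) * W $ k $ i))"
      by (intro continuous_intros)
    from borel_measurable_continuous_onI[OF this] show ?thesis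
      by (simp add: \<phi>_def[abs_def] trace_def matrix_matrix_mult_def)
  qed
  define K where "K = (real CARD('n))\<^sup>2"
  have K: "K > 0" by (simp add: K_def)
  have \<phi>_le: "cmod (\<phi> W \<xi>) \<le> K * norm \<xi> * norm W" for W \<xi>
    using norm_trace_cmat_le[of \<xi> W] by (simp add: \<phi>_def norm_mult K_def)
  have \<phi>_lin: "\<phi> (V + W) \<xi> = \<phi> V \<xi> + \<phi> W \<xi>" "\<phi> (\<chi> i j. c * W $ i $ j) \<xi> = c * \<phi> W \<xi>" "\<phi> (r *\<^sub>R W) \<xi> = of_real r * \<phi> W \<xi>" for V W \<xi> c r
    by (simp_all only: \<phi>_def trace_cmat_linear distrib_left mult_ac)
  text \<open>Polynomial factors are absorbed by the exponential gain.\<close>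
  have poly: "norm \<xi> \<le> (1 / t) * exp (t * norm \<xi>)" "(norm \<xi>)\<^sup>2 \<le> (8 / t\<^sup>2) * exp (t / 2 * norm \<xi>)" for \<xi> :: "'n symmat"
  proof -
    have "t * norm \<xi> \<le> exp (t * norm \<xi>)" using exp_ge_add_one_self[of "t * norm \<xi>"] by linarith
    then show "norm \<xi> \<le> (1 / t) * exp (t * norm \<xi>)" using t by (simp add: field_simps)
    have "1 + t / 2 * norm \<xi> + (t / 2 * norm \<xi>)\<^sup>2 / 2 \<le> exp (t / 2 * norm \<xi>)"
      by (rule exp_lower_Taylor_quadratic) (use t in simp)
    then have "(t / 2 * norm \<xi>)\<^sup>2 / 2 \<le> exp (t / 2 * norm \<xi>)"
      using t by (smt (verit) mult_nonneg_nonneg norm_ge_zero divide_nonneg_nonneg)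
    then show "(norm \<xi>)\<^sup>2 \<le> (8 / t\<^sup>2) * exp (t / 2 * norm \<xi>)" using t by (simp add: power_mult_distrib field_simps)
  qed
  have Fi: "integrable lborel (\<lambda>\<xi>. F \<xi> * \<phi> W \<xi>)" for W
  proof (rule Bochner_Integration.integrable_bound)
    show "integrable lborel (\<lambda>\<xi>. (cmod d * (K / t) * norm W) * H \<xi>)" by (intro integrable_mult_right H)
    have "cmod (F \<xi> * \<phi> W \<xi>) \<le> (cmod d * (K / t) * norm W) * H \<xi>" for \<xi>
    proof -
      have "cmod (\<phi> W \<xi>) \<le> K * ((1 / t) * exp (t * norm \<xi>)) * norm W"
        using K by (intro order_trans[OF \<phi>_le] mult_right_mono mult_left_mono poly) auto
      then have "cmod d * cmod (S_op l g (\<xi>, Y)) * cmod (\<phi> W \<xi>) \<le> cmod d * cmod (S_op l g (\<xi>, Y)) * (K * ((1 / t) * exp (t * norm \<xi>)) * norm W)"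
        by (rule mult_left_mono) simp
      then show ?thesis by (simp add: norm_mult Fn H_def mult_ac)
    qed
    then show "AE \<xi> in lborel. norm (F \<xi> * \<phi> W \<xi>) \<le> norm ((cmod d * (K / t) * norm W) * H \<xi>)"
      by (intro AE_I2) (unfold real_norm_def, rule order_trans[OF _ abs_ge_self])
  qed measurable
  define D where "D W = (LINT \<xi>|lborel. F \<xi> * \<phi> W \<xi>)" for W
  have D_lin: "D (V + W) = D V + D W" "D (\<chi> i j. c * W $ i $ j) = c * D W" "D (r *\<^sub>R W) = r *\<^sub>R D W" for V W c r
    unfolding D_def \<phi>_lin using Fi by (simp_all add: distrib_left mult.left_commute[of "F _"] scaleR_conv_of_real)
  have D_bound: "norm (D W) \<le> norm W * (cmod d * (K / t) * (LINT \<xi>|lborel. H \<xi>))" for W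
  proof -
    have "norm (D W) \<le> (LINT \<xi>|lborel. cmod (F \<xi> * \<phi> W \<xi>))" unfolding D_def by (rule integral_norm_bound)
    also have "\<dots> \<le> (LINT \<xi>|lborel. (cmod d * (K / t) * norm W) * H \<xi>)"
    proof (rule integral_mono)
      show "integrable lborel (\<lambda>\<xi>. cmod (F \<xi> * \<phi> W \<xi>))" using Fi[of W] by (rule integrable_norm)
      show "integrable lborel (\<lambda>\<xi>. (cmod d * (K / t) * norm W) * H \<xi>)" by (intro integrable_mult_right H)
      fix \<xi> :: "'n symmat"
      have "cmod (\<phi> W \<xi>) \<le> K * ((1 / t) * exp (t * norm \<xi>)) * norm W"
        using K by (intro order_trans[OF \<phi>_le] mult_right_mono mult_left_mono poly) auto
      then have "cmod d * cmod (S_op l g (\<xi>, Y)) * cmod (\<phi> W \<xi>) \<le> cmod d * cmod (S_op l g (\<xi>, Y)) * (K * ((1 / t) * exp (t * norm \<xi>)) * norm W)"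
        by (rule mult_left_mono) simp
      then show "cmod (F \<xi> * \<phi> W \<xi>) \<le> (cmod d * (K / t) * norm W) * H \<xi>" by (simp add: norm_mult Fn H_def mult_ac)
    qed
    also have "\<dots> = norm W * (cmod d * (K / t) * (LINT \<xi>|lborel. H \<xi>))" by simp
    finally show ?thesis .
  qed
  have bl: "bounded_linear D" by (rule bounded_linear_intro[OF D_lin(1) D_lin(3) D_bound])
  have c: "pos_cone \<inter> space lborel \<in> sets lborel" by simp
  \<comment> \<open>Adding \<open>W\<close> multiplies the integrand by
    \<open>exp (\<phi> W \<xi>)\<close>, so everything reduces to the expansion of this
    factor.\<close>
  have J: "R_adj_integral l g (Z + W) = (LINT \<xi>|lborel. F \<xi> * exp (\<phi> W \<xi>))" for W
  proof -
    have "R_adj_integral l g (Z + W) = (LINT \<xi>|cone_lborel. of_real (1 / sqrt (cone_Gamma CARD('n) l)) * R_adj_integrand l g (Z + W) \<xi>)"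
      unfolding R_adj_integral_def by (rule integral_mult_right_zero[symmetric])
    also have "\<dots> = (LINT \<xi>|lborel. F \<xi> * exp (\<phi> W \<xi>))"
      unfolding cone_lborel_def integral_restrict_space[OF c]
    proof (rule Bochner_Integration.integral_cong[OF refl])
      fix \<xi> :: "'n symmat"
      show "indicator pos_cone \<xi> *\<^sub>R (of_real (1 / sqrt (cone_Gamma CARD('n) l)) * R_adj_integrand l g (Z + W) \<xi>) = F \<xi> * exp (\<phi> W \<xi>)"
      proof (cases "\<xi> \<in> pos_cone")
        case True
        have "R_adj_integrand l g (Z + W) \<xi> = R_adj_integrand l g Z \<xi> * exp (\<phi> W \<xi>)"
          by (simp only: R_adj_integrand_def trace_cmat_linear distrib_left exp_add \<phi>_def mult.assoc)
        then show ?thesis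
          using True R_adj_integrand_spt[OF True, of g X Y] by (simp add: F_def d_def XY(1) mult.assoc[symmetric])
      qed (simp add: F_def S_op_eq)
    qed
    finally show ?thesis .
  qed
  \<comment> \<open>Half of the exponential gain pays for the exponential of the increment, the
    other half absorbs the quadratic factor in \<xi>.\<close>
  define r where "r = t / (2 * K)"
  have r: "r > 0" using t K by (simp add: r_def)
  have rem: "cmod (F \<xi> * (exp (\<phi> W \<xi>) - 1 - \<phi> W \<xi>)) \<le> (cmod d * (8 * K\<^sup>2 / t\<^sup>2) * (norm W)\<^sup>2) * H \<xi>" if W: "norm W \<le> r" for W \<xi>
  proof -
    have "K * norm \<xi> * norm W \<le> K * norm \<xi> * r" using W K by (intro mult_left_mono) auto
    also have "\<dots> = t / 2 * norm \<xi>" using K by (simp add: r_def)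
    finally have e: "cmod (\<phi> W \<xi>) \<le> t / 2 * norm \<xi>" using \<phi>_le[of W \<xi>] by linarith
    have "cmod (exp (\<phi> W \<xi>) - 1 - \<phi> W \<xi>) \<le> exp (cmod (\<phi> W \<xi>)) * (cmod (\<phi> W \<xi>))\<^sup>2" by (rule cmod_exp_remainder)
    also have "\<dots> \<le> exp (t / 2 * norm \<xi>) * (K * norm \<xi> * norm W)\<^sup>2"
      using e \<phi>_le[of W \<xi>] by (intro mult_mono power_mono) auto
    also have "\<dots> = exp (t / 2 * norm \<xi>) * ((K * norm W)\<^sup>2 * (norm \<xi>)\<^sup>2)" by (simp add: power_mult_distrib mult_ac)
    also have "\<dots> \<le> exp (t / 2 * norm \<xi>) * ((K * norm W)\<^sup>2 * ((8 / t\<^sup>2) * exp (t / 2 * norm \<xi>)))"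
      by (intro mult_left_mono poly) auto
    also have "\<dots> = (8 * K\<^sup>2 / t\<^sup>2) * (norm W)\<^sup>2 * (exp (t / 2 * norm \<xi>) * exp (t / 2 * norm \<xi>))"
      by (simp add: power_mult_distrib mult_ac)
    also have "exp (t / 2 * norm \<xi>) * exp (t / 2 * norm \<xi>) = exp (t * norm \<xi>)" by (simp flip: exp_add)
    finally have "cmod d * cmod (S_op l g (\<xi>, Y)) * cmod (exp (\<phi> W \<xi>) - 1 - \<phi> W \<xi>) \<le>
        cmod d * cmod (S_op l g (\<xi>, Y)) * ((8 * K\<^sup>2 / t\<^sup>2) * (norm W)\<^sup>2 * exp (t * norm \<xi>))"
      by (rule mult_left_mono) simp
    then show ?thesis by (simp add: norm_mult Fn H_def mult_ac)
  qed
  have F0: "integrable lborel F"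
  proof -
    have "cmod (F \<xi>) \<le> cmod d * H \<xi>" for \<xi>
      using t by (simp add: Fn H_def mult_left_mono mult_le_cancel_right1)
    then show ?thesis
      by (intro Bochner_Integration.integrable_bound[OF integrable_mult_right[OF H, of "cmod d"] Fm] AE_I2)
        (unfold real_norm_def, rule order_trans[OF _ abs_ge_self])
  qed
  have main: "cmod (R_adj_integral l g (Z + W) - R_adj_integral l g Z - D W) \<le> (cmod d * (8 * K\<^sup>2 / t\<^sup>2) * (LINT \<xi>|lborel. H \<xi>)) * (norm W)\<^sup>2"
    if W: "norm W \<le> r" for W
  proof -
    let ?q = "\<lambda>\<xi>. F \<xi> * (exp (\<phi> W \<xi>) - 1 - \<phi> W \<xi>)"
    have qi: "integrable lborel ?q"
    proof (rule Bochner_Integration.integrable_bound)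
      show "integrable lborel (\<lambda>\<xi>. (cmod d * (8 * K\<^sup>2 / t\<^sup>2) * (norm W)\<^sup>2) * H \<xi>)" by (intro integrable_mult_right H)
      show "AE \<xi> in lborel. norm (?q \<xi>) \<le> norm ((cmod d * (8 * K\<^sup>2 / t\<^sup>2) * (norm W)\<^sup>2) * H \<xi>)"
        by (intro AE_I2) (unfold real_norm_def, rule order_trans[OF rem[OF W] abs_ge_self])
    qed measurable
    have ei: "F \<xi> * exp (\<phi> W \<xi>) = ?q \<xi> + F \<xi> + F \<xi> * \<phi> W \<xi>" for \<xi> by (simp add: algebra_simps)
    have "R_adj_integral l g (Z + W) = (LINT \<xi>|lborel. ?q \<xi>) + (LINT \<xi>|lborel. F \<xi>) + D W"
      unfolding J ei D_def using qi F0 Fi[of W] by simp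
    moreover have "R_adj_integral l g Z = (LINT \<xi>|lborel. F \<xi>)"
      using J[of 0] \<phi>_lin(3)[of 0 0] by simp
    ultimately have "R_adj_integral l g (Z + W) - R_adj_integral l g Z - D W = (LINT \<xi>|lborel. ?q \<xi>)" by simp
    also have "cmod \<dots> \<le> (LINT \<xi>|lborel. cmod (?q \<xi>))" by (rule integral_norm_bound)
    also have "\<dots> \<le> (LINT \<xi>|lborel. (cmod d * (8 * K\<^sup>2 / t\<^sup>2) * (norm W)\<^sup>2) * H \<xi>)"
      by (rule integral_mono[OF integrable_norm[OF qi] _ rem[OF W]]) (intro integrable_mult_right H)
    also have "\<dots> = (cmod d * (8 * K\<^sup>2 / t\<^sup>2) * (LINT \<xi>|lborel. H \<xi>)) * (norm W)\<^sup>2" by simp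
    finally show ?thesis .
  qed
  define C where "C = cmod d * (8 * K\<^sup>2 / t\<^sup>2) * (LINT \<xi>|lborel. H \<xi>)"
  have "(R_adj_integral l g has_derivative D) (at Z)"
  proof (rule has_derivativeI_sandwich[OF r bl])
    fix V assume V: "V \<in> UNIV" "V \<noteq> Z" "dist V Z < r"
    have "cmod (R_adj_integral l g V - R_adj_integral l g Z - D (V - Z)) \<le> C * (norm (V - Z))\<^sup>2"
      using main[of "V - Z"] V by (simp add: C_def dist_norm)
    then show "norm (R_adj_integral l g V - R_adj_integral l g Z - D (V - Z)) / norm (V - Z) \<le> C * norm (V - Z)"
      using V by (simp add: pos_divide_le_eq power2_eq_square mult.assoc)
  next
    have "((\<lambda>V. C * norm (V - Z)) \<longlongrightarrow> C * norm (Z - Z)) (at Z)" by (intro tendsto_intros)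
    then show "((\<lambda>V. C * norm (V - Z)) \<longlongrightarrow> 0) (at Z)" by simp
  qed
  then show ?thesis using D_lin(2) by blast
qed

lemma R_adj_integral_holomorphic:
  assumes g: "g \<in> L2 (cone_lborel :: 'n symmat measure)"
  shows "matrix_holomorphic_on (R_adj_integral l g) siegel_domain"
  unfolding matrix_holomorphic_on_def
proof
  fix Z :: "complex^'n^'n" assume "Z \<in> siegel_domain"
  from R_adj_integral_has_derivative[OF this g] obtain D where
    D: "(R_adj_integral l g has_derivative D) (at Z)" "\<forall>c W. D (\<chi> i j. c * W $ i $ j) = c * D W" by blast
  show "\<exists>D. (R_adj_integral l g has_derivative D) (at Z within siegel_domain) \<and> (\<forall>c W. D (\<chi> i j. c * W $ i $ j) = c * D W)"
    by (rule exI[of _ D], rule conjI, rule has_derivative_at_withinI, rule D(1), rule D(2))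
qed

lemma matrix_holomorphic_measurable:
  assumes "matrix_holomorphic_on h S"
  shows "continuous_on S h" "h \<in> borel_measurable (restrict_space borel S)"
proof -
  show c: "continuous_on S h"
    unfolding continuous_on_eq_continuous_within
  proof
    fix Z assume "Z \<in> S"
    then obtain D where "(h has_derivative D) (at Z within S)" using assms unfolding matrix_holomorphic_on_def by blast
    then show "continuous (at Z within S) h" by (rule has_derivative_continuous)
  qed
  show "h \<in> borel_measurable (restrict_space borel S)" by (rule borel_measurable_continuous_on_restrict[OF c])
qed

section \<open>The integral as an isometry paired with \<open>R_op\<close>\<close>

lemma R_adj_integral_L2:
  assumes g: "g \<in> L2 (cone_lborel :: 'n symmat measure)"
  shows "R_adj_integral l g \<in> L2 (siegel_measure l)"
    and "L2_norm (siegel_measure l) (R_adj_integral l g) = L2_norm cone_lborel g"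
    and "f \<in> L2 (siegel_measure l) \<Longrightarrow> L2_inner (siegel_measure l) (R_adj_integral l g) f = L2_inner cone_lborel g (R_op l f)"
proof -
  let ?J = "R_adj_integral l g" and ?V = "partial_FT 1 (S_op l g)"
  have Jm: "?J \<in> borel_measurable (restrict_space borel siegel_domain)"
    by (rule matrix_holomorphic_measurable(2)[OF R_adj_integral_holomorphic[OF g]])
  have sl: "AE y in N. integrable lborel (\<lambda>x. S_op l g (x, y))"
    by (rule AE_I2, rule S_op_slice_integrable[OF g]) (simp only: space_cone_weighted)
  note V = partial_FT_isometry[OF S_op_L2(1)[OF g] sl, of 1, simplified]
  have eq: "?J (spt z) = ?V z" if "z \<in> space PN" for z
    using that R_adj_integral_spt(1)[OF _ g] by (cases z) (simp add: space_pair_measure space_cone_weighted)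
  have AEeq: "AE z in PN. ?V z = ?J (spt z)" using eq by (intro AE_I2) simp
  have Jm': "(\<lambda>z. ?J (spt z)) \<in> borel_measurable PN" by (rule measurable_compose[OF measurable_spt Jm])
  have J2: "(\<lambda>z. ?J (spt z)) \<in> L2 PN" by (rule L2_cong_AE[OF V(1) Jm' AEeq])
  show JL: "?J \<in> L2 (siegel_measure l)" using L2_siegel(1)[OF Jm] J2 by blast
  have "L2_norm PN (\<lambda>z. ?J (spt z)) = L2_norm PN ?V"
    by (rule L2_norm_cong_AE[OF L2_measurable[OF V(1)] Jm' AEeq, symmetric])
  then show "L2_norm (siegel_measure l) ?J = L2_norm cone_lborel g"
    unfolding L2_siegel(2)[OF Jm] V(2) S_op_L2(2)[OF g] .
  assume f: "f \<in> L2 (siegel_measure l)"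
  have fm: "f \<in> borel_measurable (restrict_space borel siegel_domain)"
    using L2_measurable[OF f] by (simp only: borel_measurable_siegel_iff)
  have uL: "(\<lambda>z. f (spt z)) \<in> L2 PN" using L2_siegel(1)[OF fm] f by simp
  have "L2_inner (siegel_measure l) ?J f = L2_inner PN (\<lambda>z. ?J (spt z)) (\<lambda>z. f (spt z))"
    by (rule L2_inner_siegel[OF Jm fm])
  also have "\<dots> = L2_inner PN ?V (\<lambda>z. f (spt z))"
    by (rule L2_inner_cong_AE[OF L2_measurable[OF V(1)] Jm' AEeq L2_measurable[OF uL], symmetric])
  also have "\<dots> = cnj (L2_inner PN (\<lambda>z. f (spt z)) ?V)" by (rule L2_inner_commute)
  \<comment> \<open>\<open>W\<close> carries the sign \<open>- 1\<close>, so the partial transform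
    on the other side of the pairing has sign 1.\<close>
  also have "L2_inner PN (\<lambda>z. f (spt z)) ?V = L2_inner PN (W (\<lambda>z. f (spt z))) (S_op l g)"
    using FT.tensor_extension_inner[OF W uL S_op_L2(1)[OF g] sl] by simp
  also have "cnj \<dots> = L2_inner PN (S_op l g) (W (\<lambda>z. f (spt z)))" by (rule L2_inner_commute[symmetric])
  also have "\<dots> = L2_inner cone_lborel g (R_op l f)" by (rule R_op(2)[OF f g])
  finally show "L2_inner (siegel_measure l) ?J f = L2_inner cone_lborel g (R_op l f)" .
qed

lemma R_adj_integral_lincomb:
  assumes "f \<in> L2 (cone_lborel :: 'n symmat measure)" "g \<in> L2 cone_lborel" "Z \<in> siegel_domain"
  shows "R_adj_integral l (\<lambda>x. a * f x + b * g x) Z = a * R_adj_integral l f Z + b * R_adj_integral l g Z"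
proof -
  obtain X Y where XY: "Z = siegel_point X Y" "Y \<in> (pos_cone :: 'n symmat set)" by (rule siegel_domain_cases[OF assms(3)])
  have i: "integrable cone_lborel (R_adj_integrand l h Z)" if "h \<in> L2 (cone_lborel :: 'n symmat measure)" for h
    unfolding XY(1) by (rule R_adj_integral_spt(2)[OF XY(2) that])
  have e: "R_adj_integrand l (\<lambda>x. a * f x + b * g x) Z \<xi> = a * R_adj_integrand l f Z \<xi> + b * R_adj_integrand l g Z \<xi>" for \<xi>
    by (simp add: R_adj_integrand_def algebra_simps)
  show ?thesis
    unfolding R_adj_integral_def e using i[OF assms(1)] i[OF assms(2)] by (simp add: algebra_simps)
qed

end

subsection \<open>Partial isometries with an isometric adjoint\<close>

lemma L2_eq_AE_of_inner:
  assumes f: "f \<in> L2 M" "g \<in> L2 M" and e: "\<And>h. h \<in> L2 M \<Longrightarrow> L2_inner M h f = L2_inner M h g"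
  shows "AE x in M. f x = g x"
proof -
  let ?h = "\<lambda>x. f x - g x"
  have h: "?h \<in> L2 M" by (rule L2_diff[OF f])
  have "L2_inner M ?h ?h = 0" using L2_inner_diff_right[OF f h] e[OF h] by simp
  then have "L2_norm M ?h = 0" unfolding L2_inner_self by simp
  then show ?thesis using L2_AE_eq_iff[OF f] by simp
qed

text \<open>Polarisation: comparing the norms of \<open>a * f x + g x\<close> gives the real parts,
  and \<open>a = 1\<close> and \<open>a = \<i>\<close> together give the inner product.\<close>

lemma L2_isometry_inner:
  assumes J: "\<And>g. g \<in> L2 N \<Longrightarrow> J g \<in> L2 M" "\<And>g. g \<in> L2 N \<Longrightarrow> L2_norm M (J g) = L2_norm N g"
    and lin: "\<And>f g a b. f \<in> L2 N \<Longrightarrow> g \<in> L2 N \<Longrightarrow> AE x in M. J (\<lambda>x. a * f x + b * g x) x = a * J f x + b * J g x"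
    and f: "f \<in> L2 N" and g: "g \<in> L2 N"
  shows "L2_inner M (J f) (J g) = L2_inner N f g"
proof -
  have re: "Re (a * L2_inner M (J f) (J g)) = Re (a * L2_inner N f g)" for a
  proof -
    have s: "(\<lambda>x. a * f x + 1 * g x) \<in> L2 N" by (rule L2_lincomb[OF f g])
    have "L2_norm N (\<lambda>x. a * f x + 1 * g x) = L2_norm M (\<lambda>x. a * J f x + 1 * J g x)"
      unfolding J(2)[OF s, symmetric]
      by (rule L2_norm_cong_AE[OF L2_measurable[OF J(1)[OF s]] L2_measurable[OF L2_lincomb[OF J(1)[OF f] J(1)[OF g]]] lin[OF f g]])
    then have "(L2_norm N (\<lambda>x. a * f x + g x))\<^sup>2 = (L2_norm M (\<lambda>x. a * J f x + J g x))\<^sup>2" by simp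
    then have "Re (L2_inner M (\<lambda>x. a * J f x) (J g)) = Re (L2_inner N (\<lambda>x. a * f x) g)"
      unfolding L2_norm_add_sq[OF L2_scale[OF f] g] L2_norm_add_sq[OF L2_scale[OF J(1)[OF f]] J(1)[OF g]] L2_norm_scale J(2)[OF f] J(2)[OF g]
      by simp
    then show ?thesis
      using L2_inner_lincomb_left[OF f f g, of a 0] L2_inner_lincomb_left[OF J(1)[OF f] J(1)[OF f] J(1)[OF g], of a 0] by simp
  qed
  from re[of 1] re[of \<i>] show ?thesis by (simp add: complex_eq_iff)
qed

text \<open>Here \<open>R\<close> is the adjoint of the isometry \<open>J\<close>, so
  \<open>R\<close> after \<open>J\<close> is the identity and \<open>J\<close> after
  \<open>R\<close> the projection onto the range of \<open>J\<close>. Linearity and boundedness of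
  \<open>R\<close> are derived from the pairing, because \<open>R\<close> may have been picked
  separately for every function.\<close>

lemma partial_isometry_of_isometric_adjoint:
  assumes J: "\<And>g. g \<in> L2 N \<Longrightarrow> J g \<in> L2 M" "\<And>g. g \<in> L2 N \<Longrightarrow> L2_norm M (J g) = L2_norm N g"
    and lin: "\<And>f g a b. f \<in> L2 N \<Longrightarrow> g \<in> L2 N \<Longrightarrow> AE x in M. J (\<lambda>x. a * f x + b * g x) x = a * J f x + b * J g x"
    and R: "\<And>f. f \<in> L2 M \<Longrightarrow> R f \<in> L2 N"
    and adj: "\<And>f g. f \<in> L2 M \<Longrightarrow> g \<in> L2 N \<Longrightarrow> L2_inner M (J g) f = L2_inner N g (R f)"
    and B: "B = {f \<in> L2 M. \<exists>g\<in>L2 N. AE x in M. f x = J g x}"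
  shows "L2_partial_isometry M N R B (L2 N)" "L2_isometry N M (L2_adjoint M N R)"
    "L2_range N M (L2_adjoint M N R) = B" "\<And>g. g \<in> L2 N \<Longrightarrow> AE x in M. L2_adjoint M N R g x = J g x"
proof -
  have Jinner: "L2_inner M (J f) (J g) = L2_inner N f g" if "f \<in> L2 N" "g \<in> L2 N" for f g
  proof (rule L2_isometry_inner[OF _ _ _ that])
    show "AE x in M. J (\<lambda>x. a * f x + b * g x) x = a * J f x + b * J g x" if "f \<in> L2 N" "g \<in> L2 N" for f g a b
      by (rule lin[OF that])
  qed (fact J)+
  have RJ: "AE y in N. R (J g) y = g y" if g: "g \<in> L2 N" for g
    by (rule L2_eq_AE_of_inner[OF R[OF J(1)[OF g]] g]) (simp add: adj[OF J(1)[OF g], symmetric] Jinner g)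
  have Rlin: "AE y in N. R (\<lambda>x. a * f x + b * g x) y = a * R f y + b * R g y" if f: "f \<in> L2 M" and g: "g \<in> L2 M" for f g a b
  proof (rule L2_eq_AE_of_inner[OF R[OF L2_lincomb[OF f g]] L2_lincomb[OF R[OF f] R[OF g]]])
    fix h assume h: "h \<in> L2 N"
    show "L2_inner N h (R (\<lambda>x. a * f x + b * g x)) = L2_inner N h (\<lambda>x. a * R f x + b * R g x)"
      unfolding adj[OF L2_lincomb[OF f g] h, symmetric] L2_inner_lincomb_right[OF f g J(1)[OF h]]
        L2_inner_lincomb_right[OF R[OF f] R[OF g] h] adj[OF f h] adj[OF g h] ..
  qed
  have Rle: "L2_norm N (R f) \<le> L2_norm M f" if f: "f \<in> L2 M" for f
  proof (cases "L2_norm N (R f) = 0")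
    case False
    have "(L2_norm N (R f))\<^sup>2 = cmod (L2_inner M (J (R f)) f)"
      unfolding adj[OF f R[OF f]] L2_inner_self norm_of_real by simp
    also have "\<dots> \<le> L2_norm N (R f) * L2_norm M f"
      using L2_Cauchy_Schwarz[OF J(1)[OF R[OF f]] f] J(2)[OF R[OF f]] by simp
    finally show ?thesis using False L2_norm_nonneg[of N "R f"] by (simp add: power2_eq_square)
  qed simp
  have Rop: "L2_operator M N R"
    unfolding L2_operator_def using R Rlin Rle by (intro conjI ballI allI exI[of _ 1]) auto
  have ker_iff: "f \<in> L2_kernel M N R \<longleftrightarrow> f \<in> L2 M \<and> (\<forall>g\<in>L2 N. L2_inner M (J g) f = 0)" for f
  proof
    assume "f \<in> L2_kernel M N R"
    then have f: "f \<in> L2 M" and z: "AE y in N. R f y = 0" by (auto simp: L2_kernel_def)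
    have "L2_inner M (J g) f = 0" if g: "g \<in> L2 N" for g
    proof -
      have "AE y in N. g y * cnj (R f y) = 0" using z by eventually_elim simp
      then have "L2_inner N g (R f) = 0" unfolding L2_inner_def by (rule integral_eq_zero_AE)
      then show ?thesis using adj[OF f g] by simp
    qed
    with f show "f \<in> L2 M \<and> (\<forall>g\<in>L2 N. L2_inner M (J g) f = 0)" by blast
  next
    assume "f \<in> L2 M \<and> (\<forall>g\<in>L2 N. L2_inner M (J g) f = 0)"
    then have f: "f \<in> L2 M" and z: "\<And>g. g \<in> L2 N \<Longrightarrow> L2_inner M (J g) f = 0" by blast+
    have "L2_inner N (R f) (R f) = 0" using z[OF R[OF f]] adj[OF f R[OF f]] by simp
    then have "L2_norm N (R f) = 0" unfolding L2_inner_self by simp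
    then show "f \<in> L2_kernel M N R" using f L2_norm_eq_0_iff[OF R[OF f]] by (simp add: L2_kernel_def)
  qed
  have BO: "B = L2_orth M (L2_kernel M N R)"
  proof (intro equalityI subsetI)
    fix f assume "f \<in> B"
    then obtain g where f: "f \<in> L2 M" and g: "g \<in> L2 N" and e: "AE x in M. f x = J g x" unfolding B by blast
    have "L2_inner M f k = 0" if k: "k \<in> L2_kernel M N R" for k
    proof -
      have kL: "k \<in> L2 M" using k ker_iff by blast
      have "L2_inner M f k = L2_inner M (J g) k"
        by (rule L2_inner_cong_AE[OF L2_measurable[OF f] L2_measurable[OF J(1)[OF g]] e L2_measurable[OF kL]])
      also have "\<dots> = 0" using k g ker_iff by blast
      finally show ?thesis .
    qed
    then show "f \<in> L2_orth M (L2_kernel M N R)" using f by (simp add: L2_orth_def)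
  next
    \<comment> \<open>A function orthogonal to the kernel differs from \<open>J (R f)\<close> by an
      element of the kernel that is orthogonal to itself.\<close>
    fix f assume "f \<in> L2_orth M (L2_kernel M N R)"
    then have f: "f \<in> L2 M" and o: "\<And>k. k \<in> L2_kernel M N R \<Longrightarrow> L2_inner M f k = 0" by (auto simp: L2_orth_def)
    let ?p = "J (R f)" and ?k = "\<lambda>x. f x - J (R f) x"
    have p: "?p \<in> L2 M" by (rule J(1)[OF R[OF f]])
    have k: "?k \<in> L2 M" by (rule L2_diff[OF f p])
    have Jk: "L2_inner M (J g) ?k = 0" if g: "g \<in> L2 N" for g
      using L2_inner_diff_right[OF f p J(1)[OF g]] adj[OF f g] Jinner[OF g R[OF f]] by simp
    then have "?k \<in> L2_kernel M N R" using k ker_iff by blast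
    then have "L2_inner M ?k ?k = 0" using o Jk[OF R[OF f]] L2_inner_diff_left[OF f p k] by simp
    then have "L2_norm M ?k = 0" unfolding L2_inner_self by simp
    then show "f \<in> B" unfolding B using f R[OF f] L2_AE_eq_iff[OF f p] by blast
  qed
  have iso: "L2_norm N (R f) = L2_norm M f" if fB: "f \<in> B" for f
  proof -
    obtain g where f: "f \<in> L2 M" and g: "g \<in> L2 N" and e: "AE x in M. f x = J g x" using fB unfolding B by blast
    have "AE y in N. R f y = g y"
      using L2_operator_cong_AE[OF Rop f J(1)[OF g] e] RJ[OF g] by eventually_elim simp
    then have "L2_norm N (R f) = L2_norm N g"
      by (rule L2_norm_cong_AE[OF L2_measurable[OF R[OF f]] L2_measurable[OF g]])
    also have "\<dots> = L2_norm M f"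
      unfolding J(2)[OF g, symmetric] using e
      by (intro L2_norm_cong_AE[OF L2_measurable[OF J(1)[OF g]] L2_measurable[OF f]]) (auto elim: eventually_mono)
    finally show ?thesis .
  qed
  have "L2_range M N R = L2 N"
  proof (intro equalityI subsetI)
    fix g assume g: "g \<in> L2 N"
    have "AE y in N. g y = R (J g) y" using RJ[OF g] by eventually_elim simp
    then show "g \<in> L2_range M N R" unfolding L2_range_def using g J(1)[OF g] by blast
  qed (simp add: L2_range_def)
  then show "L2_partial_isometry M N R B (L2 N)"
    unfolding L2_partial_isometry_def using Rop iso BO by simp
  let ?A = "L2_adjoint M N R"
  \<comment> \<open>\<open>J g\<close> is a witness for the choice; the pairing forces every other
    choice to agree with it almost everywhere.\<close>
  have A: "?A g \<in> L2 M \<and> (\<forall>f\<in>L2 M. L2_inner N (R f) g = L2_inner M f (?A g))" if g: "g \<in> L2 N" for g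
    unfolding L2_adjoint_def
  proof (rule someI[of _ "J g"], intro conjI ballI)
    fix f assume f: "f \<in> L2 M"
    show "L2_inner N (R f) g = L2_inner M f (J g)"
      using adj[OF f g] by (simp add: L2_inner_commute[of N "R f"] L2_inner_commute[of M f])
  qed (rule J(1)[OF g])
  show AJ: "AE x in M. ?A g x = J g x" if g: "g \<in> L2 N" for g
  proof (rule L2_eq_AE_of_inner)
    show "?A g \<in> L2 M" "J g \<in> L2 M" using A[OF g] J(1)[OF g] by auto
    fix h assume h: "h \<in> L2 M"
    have "L2_inner M h (?A g) = L2_inner N (R h) g" using A[OF g] h by simp
    also have "\<dots> = L2_inner M h (J g)"
      using adj[OF h g] by (simp add: L2_inner_commute[of N "R h"] L2_inner_commute[of M h])
    finally show "L2_inner M h (?A g) = L2_inner M h (J g)" .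
  qed
  have AL: "?A g \<in> L2 M" if "g \<in> L2 N" for g using A[OF that] by blast
  have An: "L2_norm M (?A g) = L2_norm N g" if g: "g \<in> L2 N" for g
    unfolding J(2)[OF g, symmetric] by (rule L2_norm_cong_AE[OF L2_measurable[OF AL[OF g]] L2_measurable[OF J(1)[OF g]] AJ[OF g]])
  have Alin: "AE x in M. ?A (\<lambda>x. a * f x + b * g x) x = a * ?A f x + b * ?A g x" if f: "f \<in> L2 N" and g: "g \<in> L2 N" for f g a b
    using AJ[OF L2_lincomb[OF f g, of a b]] AJ[OF f] AJ[OF g] lin[OF f g, of a b] by eventually_elim simp
  show "L2_isometry N M ?A"
    unfolding L2_isometry_def L2_operator_def using AL Alin An by (auto intro!: exI[of _ 1])
  show "L2_range N M ?A = B"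
  proof -
    have "(AE x in M. f x = ?A g x) \<longleftrightarrow> (AE x in M. f x = J g x)" if "g \<in> L2 N" for f g
      using AJ[OF that] by (auto elim!: eventually_elim2)
    then show ?thesis unfolding L2_range_def B by auto
  qed
qed

section \<open>Holomorphic functions on the tube\<close>

subsection \<open>The local mean value inequality\<close>

text \<open>Cauchy's formula for the square of \<open>F\<close>, which is again holomorphic, so the
  bound comes out for the squared modulus directly.\<close>

lemma mean_value_circle:
  assumes F: "F holomorphic_on S" and S: "open S" "cball 0 1 \<subseteq> S"
  shows "ennreal ((cmod (F 0))\<^sup>2) \<le> (\<integral>\<^sup>+x. indicator {0..1} x * ennreal ((cmod (F (cis (2 * pi * x))))\<^sup>2) \<partial>lborel)"
proof -
  let ?G = "\<lambda>u. (F u)\<^sup>2"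
  have G: "?G holomorphic_on cball 0 1" using F S by (intro holomorphic_intros) (rule holomorphic_on_subset)
  have "((\<lambda>u. ?G u / (u - 0)) has_contour_integral (2 * of_real pi * \<i> * ?G 0)) (circlepath 0 1)"
    by (rule Cauchy_integral_circlepath_simple[OF G]) simp
  then have "((\<lambda>x. (?G (circlepath 0 1 x) / (circlepath 0 1 x - 0)) * vector_derivative (circlepath 0 1) (at x within {0..1})) has_integral (2 * of_real pi * \<i> * ?G 0)) {0..1}"
    unfolding has_contour_integral_def .
  moreover have "(?G (circlepath 0 1 x) / (circlepath 0 1 x - 0)) * vector_derivative (circlepath 0 1) (at x within {0..1}) = (2 * of_real pi * \<i>) * ?G (cis (2 * pi * x))"
    if "x \<in> {0..1}" for x
  proof -
    have e: "circlepath 0 1 x = cis (2 * pi * x)" by (simp add: circlepath cis_conv_exp mult_ac)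
    have "vector_derivative (circlepath 0 1) (at x within {0..1}) = 2 * pi * \<i> * cis (2 * pi * x)"
      using vector_derivative_circlepath01[of x 0 1] that by (simp add: cis_conv_exp mult_ac)
    then show ?thesis unfolding e by (simp add: cis_neq_zero)
  qed
  ultimately have "((\<lambda>x. (2 * of_real pi * \<i>) * ?G (cis (2 * pi * x))) has_integral (2 * of_real pi * \<i> * ?G 0)) {0..1}"
    by (subst (asm) has_integral_cong) auto
  moreover define c where "c = 2 * of_real pi * \<i>"
  ultimately have "((\<lambda>x. c * ?G (cis (2 * pi * x))) has_integral c * ?G 0) {0..1}" by (simp only:)
  moreover have c0: "c \<noteq> 0" by (simp add: c_def)
  ultimately have h: "((\<lambda>x. ?G (cis (2 * pi * x))) has_integral ?G 0) {0..1}"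
    using has_integral_mult_right[of "\<lambda>x. c * ?G (cis (2 * pi * x))" "c * ?G 0" "{0..1}" "inverse c"]
    by (simp only: mult.assoc[symmetric] left_inverse[OF c0] mult_1_left)
  have cont: "continuous_on {0..1} (\<lambda>x. ?G (cis (2 * pi * x)))"
  proof (rule continuous_on_compose2[OF holomorphic_on_imp_continuous_on[OF G], of "{0..1}" "\<lambda>x. cis (2 * pi * x)"])
    show "continuous_on {0..1} (\<lambda>x. cis (2 * pi * x))" by (intro continuous_intros)
  qed auto
  have si: "set_integrable lborel {0..1} (\<lambda>x. ?G (cis (2 * pi * x)))"
    unfolding set_integrable_def by (rule borel_integrable_compact[OF compact_Icc cont])
  have "?G 0 = (LINT x|lborel. indicator {0..1} x *\<^sub>R ?G (cis (2 * pi * x)))"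
    using set_borel_integral_eq_integral(2)[OF si] integral_unique[OF h] by (simp add: set_lebesgue_integral_def)
  then have "ennreal (cmod (?G 0)) \<le> (\<integral>\<^sup>+x. ennreal (cmod (indicator {0..1} x *\<^sub>R ?G (cis (2 * pi * x)))) \<partial>lborel)"
    using norm_integral_le_nn_integral[where M=lborel and F="\<lambda>x. indicator {0..1} x *\<^sub>R ?G (cis (2 * pi * x))"]
    by (simp only:)
  also have "\<dots> = (\<integral>\<^sup>+x. indicator {0..1} x * ennreal ((cmod (F (cis (2 * pi * x))))\<^sup>2) \<partial>lborel)"
    by (intro nn_integral_cong) (auto simp: indicator_def norm_power)
  finally show ?thesis by (simp add: norm_power)
qed

section \<open>Rotations of the plane and averages over balls\<close>

lemma nn_integral_translate:
  fixes g :: "'a::euclidean_space \<Rightarrow> ennreal"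
  assumes [measurable]: "g \<in> borel_measurable borel"
  shows "(\<integral>\<^sup>+x. g (x + v) \<partial>lborel) = (\<integral>\<^sup>+x. g x \<partial>lborel)"
proof -
  have "(\<integral>\<^sup>+x. g x \<partial>(distr lborel borel ((+) v))) = (\<integral>\<^sup>+x. g (v + x) \<partial>lborel)"
    by (rule nn_integral_distr) auto
  then show ?thesis by (simp add: lborel_distr_plus add.commute)
qed

abbreviation plane :: "('a::euclidean_space \<times> 'a) measure" where "plane \<equiv> lborel \<Otimes>\<^sub>M lborel"

lemma shear_invariant:
  fixes G :: "'a::euclidean_space \<times> 'a \<Rightarrow> ennreal"
  assumes G [measurable]: "G \<in> borel_measurable (borel \<Otimes>\<^sub>M borel)"
  shows "(\<integral>\<^sup>+z. G (fst z + t *\<^sub>R snd z, snd z) \<partial>plane) = (\<integral>\<^sup>+z. G z \<partial>plane)"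
    and "(\<integral>\<^sup>+z. G (fst z, snd z + t *\<^sub>R fst z) \<partial>plane) = (\<integral>\<^sup>+z. G z \<partial>plane)"
proof -
  have "(\<integral>\<^sup>+z. G (fst z + t *\<^sub>R snd z, snd z) \<partial>plane) = (\<integral>\<^sup>+B. \<integral>\<^sup>+A. G (A + t *\<^sub>R B, B) \<partial>lborel \<partial>lborel)"
    by (subst lborel_pair.nn_integral_snd[symmetric]) simp_all
  also have "\<dots> = (\<integral>\<^sup>+B. \<integral>\<^sup>+A. G (A, B) \<partial>lborel \<partial>lborel)"
    by (intro nn_integral_cong nn_integral_translate[where g="\<lambda>A. G (A, _)"]) measurable
  also have "\<dots> = (\<integral>\<^sup>+z. G z \<partial>plane)" by (rule lborel_pair.nn_integral_snd) simp
  finally show "(\<integral>\<^sup>+z. G (fst z + t *\<^sub>R snd z, snd z) \<partial>plane) = (\<integral>\<^sup>+z. G z \<partial>plane)" .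
  have "(\<integral>\<^sup>+z. G (fst z, snd z + t *\<^sub>R fst z) \<partial>plane) = (\<integral>\<^sup>+A. \<integral>\<^sup>+B. G (A, B + t *\<^sub>R A) \<partial>lborel \<partial>lborel)"
    by (subst lborel.nn_integral_fst[symmetric]) simp_all
  also have "\<dots> = (\<integral>\<^sup>+A. \<integral>\<^sup>+B. G (A, B) \<partial>lborel \<partial>lborel)"
    by (intro nn_integral_cong nn_integral_translate[where g="\<lambda>B. G (_, B)"]) measurable
  also have "\<dots> = (\<integral>\<^sup>+z. G z \<partial>plane)" by (rule lborel.nn_integral_fst) simp
  finally show "(\<integral>\<^sup>+z. G (fst z, snd z + t *\<^sub>R fst z) \<partial>plane) = (\<integral>\<^sup>+z. G z \<partial>plane)" .
qed

text \<open>Multiplication of \<open>A + \<i> B\<close> by \<open>c + \<i> s\<close>.\<close>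

definition rot :: "real \<Rightarrow> real \<Rightarrow> 'a::real_vector \<times> 'a \<Rightarrow> 'a \<times> 'a" where
  "rot c s z = (c *\<^sub>R fst z - s *\<^sub>R snd z, s *\<^sub>R fst z + c *\<^sub>R snd z)"

lemma measurable_rot [measurable]:
  "rot c s \<in> (borel :: 'a::euclidean_space measure) \<Otimes>\<^sub>M borel \<rightarrow>\<^sub>M borel \<Otimes>\<^sub>M borel"
  unfolding rot_def[abs_def] by measurable

text \<open>A rotation other than the half turn is a product of three shears.\<close>

lemma rot_invariant:
  fixes G :: "'a::euclidean_space \<times> 'a \<Rightarrow> ennreal"
  assumes G: "G \<in> borel_measurable (borel \<Otimes>\<^sub>M borel)" and cs: "c\<^sup>2 + s\<^sup>2 = 1"
  shows "(\<integral>\<^sup>+z. G (rot c s z) \<partial>plane) = (\<integral>\<^sup>+z. G z \<partial>plane)"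
proof -
  have main: "(\<integral>\<^sup>+z. G (rot c s z) \<partial>plane) = (\<integral>\<^sup>+z. G z \<partial>plane)"
    if G [measurable]: "G \<in> borel_measurable (borel \<Otimes>\<^sub>M borel)" and cs: "c\<^sup>2 + s\<^sup>2 = 1" "c \<noteq> - 1" for G :: "'a \<times> 'a \<Rightarrow> ennreal" and c s
  proof -
    \<comment> \<open>Minus the tangent of half the angle; this is where the half turn has to be
      excluded.\<close>
    define a where "a = - s / (1 + c)"
    have c1: "1 + c \<noteq> 0" using cs(2) by auto
    have s2: "s * s = (1 + c) * (1 - c)" using cs(1) by (simp add: power2_eq_square algebra_simps)
    have 1: "1 + a * s = c"
    proof -
      have "a * s = - (s * s) / (1 + c)" by (simp add: a_def)
      also have "\<dots> = c - 1" unfolding s2 using c1 by (simp add: field_simps)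
      finally show ?thesis by simp
    qed
    have "a * (1 + c) = - s" using c1 by (simp add: a_def)
    then have 2: "a + a * c = - s" by (simp add: algebra_simps)
    define P Q where "P z = (fst z + a *\<^sub>R snd z, snd z)" and "Q z = (fst z, snd z + s *\<^sub>R fst z)" for z :: "'a \<times> 'a"
    have [measurable]: "P \<in> borel \<Otimes>\<^sub>M borel \<rightarrow>\<^sub>M borel \<Otimes>\<^sub>M borel" "Q \<in> borel \<Otimes>\<^sub>M borel \<rightarrow>\<^sub>M borel \<Otimes>\<^sub>M borel"
      unfolding P_def[abs_def] Q_def[abs_def] by measurable
    have "rot c s z = P (Q (P z))" for z
    proof -
      have f: "fst z + a *\<^sub>R snd z + a *\<^sub>R (snd z + s *\<^sub>R (fst z + a *\<^sub>R snd z)) = (1 + a * s) *\<^sub>R fst z + (a + a * (1 + a * s)) *\<^sub>R snd z"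
        by (simp only: scaleR_add_right scaleR_add_left scaleR_scaleR scaleR_one distrib_left mult_1_right mult_1_left add_ac mult_ac)
      have g: "snd z + s *\<^sub>R (fst z + a *\<^sub>R snd z) = s *\<^sub>R fst z + (1 + a * s) *\<^sub>R snd z"
        by (simp only: scaleR_add_right scaleR_add_left scaleR_scaleR scaleR_one distrib_left mult_1_right mult_1_left add_ac mult_ac)
      show ?thesis
        unfolding P_def Q_def fst_conv snd_conv f unfolding g 1 2 by (simp add: rot_def)
    qed
    then have "(\<integral>\<^sup>+z. G (rot c s z) \<partial>plane) = (\<integral>\<^sup>+z. G (P (Q (P z))) \<partial>plane)" by simp
    also have "\<dots> = (\<integral>\<^sup>+z. G (P (Q z)) \<partial>plane)"
      using shear_invariant(1)[of "\<lambda>z. G (P (Q z))" a] by (simp add: P_def)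
    also have "\<dots> = (\<integral>\<^sup>+z. G (P z) \<partial>plane)"
      using shear_invariant(2)[of "\<lambda>z. G (P z)" s] by (simp add: Q_def)
    also have "\<dots> = (\<integral>\<^sup>+z. G z \<partial>plane)"
      using shear_invariant(1)[of G a] by (simp add: P_def)
    finally show ?thesis .
  qed
  show ?thesis
  proof (cases "c = - 1")
    case False
    then show ?thesis by (rule main[OF G cs])
  next
    case True
    then have "s = 0" using cs by simp
    \<comment> \<open>The half turn is two quarter turns.\<close>
    then have "rot c s z = rot 0 1 (rot 0 1 z)" for z :: "'a \<times> 'a" using True by (simp add: rot_def)
    moreover have m: "(\<lambda>z. G (rot 0 1 z)) \<in> borel_measurable (borel \<Otimes>\<^sub>M borel)" by (rule measurable_compose[OF measurable_rot G])
    ultimately show ?thesis using main[OF m, of 0 1] main[OF G, of 0 1] by simp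
  qed
qed

lemma norm_rot: "c\<^sup>2 + s\<^sup>2 = 1 \<Longrightarrow> norm (rot c s z) = norm (z :: 'a::real_inner \<times> 'a)"
proof -
  assume cs: "c\<^sup>2 + s\<^sup>2 = 1"
  have "inner (rot c s z) (rot c s z) = (c\<^sup>2 + s\<^sup>2) * inner z z"
    by (cases z) (simp add: rot_def inner_diff_left inner_diff_right inner_add_left inner_add_right inner_commute power2_eq_square algebra_simps)
  then show ?thesis using cs by (simp add: norm_eq_sqrt_inner)
qed

context siegel
begin

text \<open>The complex line through \<open>X + \<i> Y\<close> in the direction
  \<open>A + \<i> B\<close>, split into real and imaginary part so that the condition of lying over
  the cone is visible.\<close>

definition spl :: "'n symmat \<Rightarrow> 'n symmat \<Rightarrow> 'n symmat \<Rightarrow> 'n symmat \<Rightarrow> complex \<Rightarrow> complex^'n^'n" where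
  "spl X Y A B z = siegel_point (X + (Re z *\<^sub>R A - Im z *\<^sub>R B)) (Y + (Re z *\<^sub>R B + Im z *\<^sub>R A))"

lemma spl_eq: "spl X Y A B z = siegel_point X Y + (\<chi> i j. z * siegel_point A B $ i $ j)"
  by (simp add: spl_def siegel_point_def vec_eq_iff mat_of_arith complex_eq_iff)

lemma open_line: "open {z. Y + (Re z *\<^sub>R B + Im z *\<^sub>R A) \<in> (pos_cone :: 'n symmat set)}"
  using open_pos_cone by (intro open_Collect_positive continuous_open_vimage[unfolded vimage_def]) (auto intro!: continuous_intros)

text \<open>Complex linearity of the derivative \<open>D\<close> makes its restriction to the line
  multiplication by a number.\<close>

lemma holomorphic_on_line:
  assumes f: "matrix_holomorphic_on f siegel_domain"
  shows "(\<lambda>z. f (spl X Y A B z)) holomorphic_on {z. Y + (Re z *\<^sub>R B + Im z *\<^sub>R A) \<in> (pos_cone :: 'n symmat set)}"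
  unfolding holomorphic_on_def
proof
  let ?S = "{z. Y + (Re z *\<^sub>R B + Im z *\<^sub>R A) \<in> (pos_cone :: 'n symmat set)}"
  let ?W = "siegel_point A B :: complex^'n^'n"
  fix z assume z: "z \<in> ?S"
  have dom: "spl X Y A B w \<in> siegel_domain" if "w \<in> ?S" for w
    using spt_in_domain[of "(X + (Re w *\<^sub>R A - Im w *\<^sub>R B), Y + (Re w *\<^sub>R B + Im w *\<^sub>R A))"] that by (simp add: spl_def)
  obtain D where D: "(f has_derivative D) (at (spl X Y A B z) within siegel_domain)" "\<And>c W. D (\<chi> i j. c * W $ i $ j) = c * D W"
    using f dom[OF z] unfolding matrix_holomorphic_on_def by blast
  have lin: "bounded_linear (\<lambda>h. \<chi> i j. h * ?W $ i $ j)"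
  proof (rule linear_conv_bounded_linear[THEN iffD1], rule linearI)
    show "(\<chi> i j. (h + k) * ?W $ i $ j) = (\<chi> i j. h * ?W $ i $ j) + (\<chi> i j. k * ?W $ i $ j)" for h k
      by (simp add: vec_eq_iff distrib_right)
    show "(\<chi> i j. (r *\<^sub>R h) * ?W $ i $ j) = r *\<^sub>R (\<chi> i j. h * ?W $ i $ j)" for r h
      by (simp add: vec_eq_iff)
  qed
  have L: "(spl X Y A B has_derivative (\<lambda>h. \<chi> i j. h * ?W $ i $ j)) (at z within ?S)"
    unfolding spl_eq[abs_def]
    using has_derivative_add[OF has_derivative_const bounded_linear_imp_has_derivative[OF lin]] by simp
  have "(f has_derivative D) (at (spl X Y A B z) within spl X Y A B ` ?S)"
    by (rule has_derivative_subset[OF D(1)]) (use dom in auto)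
  from has_derivative_in_compose[OF L this]
  have "((\<lambda>x. f (spl X Y A B x)) has_derivative (\<lambda>h. D (\<chi> i j. h * ?W $ i $ j))) (at z within ?S)" .
  moreover have "(\<lambda>h. D (\<chi> i j. h * ?W $ i $ j)) = (*) (D ?W)"
    unfolding D(2) by (simp add: fun_eq_iff mult.commute)
  ultimately have "((\<lambda>x. f (spl X Y A B x)) has_field_derivative D ?W) (at z within ?S)"
    unfolding has_field_derivative_def by (simp only:)
  then show "(\<lambda>z. f (spl X Y A B z)) field_differentiable at z within ?S"
    unfolding field_differentiable_def by blast
qed

lemma continuous_on_tube:
  assumes f: "matrix_holomorphic_on f siegel_domain" and S: "\<And>z. z \<in> S \<Longrightarrow> snd z \<in> (pos_cone :: 'n symmat set)"
  shows "continuous_on S (\<lambda>z. f (siegel_point (fst z) (snd z)))"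
proof (rule continuous_on_compose2[OF matrix_holomorphic_measurable(1)[OF f] continuous_on_siegel_point])
  show "(\<lambda>z. siegel_point (fst z) (snd z)) ` S \<subseteq> siegel_domain"
    using S spt_in_domain by (auto simp: split_beta')
qed

text \<open>Average the mean value inequality over the circles through the points of the ball. The
  circles are orbits of rotations, which preserve the ball and the measure, so one complex variable
  yields the estimate in all of them.\<close>

lemma mean_value_ball:
  assumes f: "matrix_holomorphic_on f siegel_domain" and Y: "ball Y r \<subseteq> (pos_cone :: 'n symmat set)" and r: "r > 0"
  shows "ennreal ((cmod (f (siegel_point X Y)))\<^sup>2) * emeasure plane (ball (0 :: 'n symmat \<times> 'n symmat) r) \<le>
    (\<integral>\<^sup>+z. indicator (ball 0 r) z * ennreal ((cmod (f (siegel_point (X + fst z) (Y + snd z))))\<^sup>2) \<partial>plane)"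
proof -
  define Q where "Q z = indicator (ball 0 r) z * ennreal ((cmod (f (siegel_point (X + fst z) (Y + snd z))))\<^sup>2)" for z :: "'n symmat \<times> 'n symmat"
  have snd_le: "norm (snd z) \<le> norm z" for z :: "'n symmat \<times> 'n symmat"
    by (metis norm_snd_le prod.collapse)
  have in_cone: "Y + snd z \<in> pos_cone" if "z \<in> ball 0 r" for z :: "'n symmat \<times> 'n symmat"
    by (rule subsetD[OF Y]) (use that snd_le[of z] in \<open>simp add: dist_norm\<close>)
  note in_cone' = in_cone[of "(A, B)" for A B, simplified]
  have "ball (0 :: 'n symmat \<times> 'n symmat) r \<in> sets borel" by simp
  then have bs: "ball (0 :: 'n symmat \<times> 'n symmat) r \<in> sets plane"
    by (simp only: borel_prod[symmetric] sets_pair_measure_cong[OF sets_lborel sets_lborel])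
  have "continuous_on (ball 0 r) (\<lambda>z. f (siegel_point (fst (X + fst z, Y + snd z)) (snd (X + fst z, Y + snd z))))"
    by (rule continuous_on_compose2[OF continuous_on_tube[OF f, of "{z. snd z \<in> pos_cone}"], of _ "\<lambda>z. (X + fst z, Y + snd z)"])
      (auto intro!: continuous_intros in_cone')
  then have "(\<lambda>z. indicator (ball 0 r) z *\<^sub>R f (siegel_point (X + fst z) (Y + snd z))) \<in> borel_measurable borel"
    by (intro borel_measurable_continuous_on_indicator) auto
  then have "(\<lambda>z. indicator (ball 0 r) z *\<^sub>R f (siegel_point (X + fst z) (Y + snd z))) \<in> borel_measurable (borel \<Otimes>\<^sub>M borel)"
    by (simp only: borel_prod)
  then have "(\<lambda>z. ennreal ((cmod (indicator (ball 0 r) z *\<^sub>R f (siegel_point (X + fst z) (Y + snd z))))\<^sup>2)) \<in> borel_measurable (borel \<Otimes>\<^sub>M borel)"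
    by measurable
  also have "(\<lambda>z. ennreal ((cmod (indicator (ball 0 r) z *\<^sub>R f (siegel_point (X + fst z) (Y + snd z))))\<^sup>2)) = Q"
    by (auto simp: Q_def fun_eq_iff indicator_def)
  finally have Qm: "Q \<in> borel_measurable (borel \<Otimes>\<^sub>M borel)" .
  let ?rot = "\<lambda>x. rot (cos (2 * pi * x)) (sin (2 * pi * x))"
  have cs: "(cos (2 * pi * x))\<^sup>2 + (sin (2 * pi * x))\<^sup>2 = 1" for x :: real by simp
  have pt: "indicator (ball 0 r) z * ennreal ((cmod (f (siegel_point X Y)))\<^sup>2) \<le> (\<integral>\<^sup>+x. indicator {0..1::real} x * Q (?rot x z) \<partial>lborel)" for z
  proof (cases "z \<in> ball 0 r")
    case True
    let ?S = "{w. Y + (Re w *\<^sub>R snd z + Im w *\<^sub>R fst z) \<in> pos_cone}"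
    let ?F = "\<lambda>w. f (spl X Y (fst z) (snd z) w)"
    have sub: "cball 0 1 \<subseteq> ?S"
    proof
      fix w :: complex assume w: "w \<in> cball 0 1"
      \<comment> \<open>By Cauchy-Schwarz the imaginary displacement along the disc is no longer
        than \<open>norm z\<close>, so the disc stays over the cone.\<close>
      have "norm (Re w *\<^sub>R snd z + Im w *\<^sub>R fst z) \<le> cmod w * norm z"
      proof (rule power2_le_imp_le)
        have "norm (Re w *\<^sub>R snd z + Im w *\<^sub>R fst z) \<le> \<bar>Re w\<bar> * norm (snd z) + \<bar>Im w\<bar> * norm (fst z)"
          by (rule order_trans[OF norm_triangle_ineq]) simp
        then have "(norm (Re w *\<^sub>R snd z + Im w *\<^sub>R fst z))\<^sup>2 \<le> (\<bar>Re w\<bar> * norm (snd z) + \<bar>Im w\<bar> * norm (fst z))\<^sup>2"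
          by (rule power_mono) simp
        also have "\<dots> \<le> ((Re w)\<^sup>2 + (Im w)\<^sup>2) * ((norm (snd z))\<^sup>2 + (norm (fst z))\<^sup>2)"
        proof -
          have "0 \<le> (\<bar>Re w\<bar> * norm (fst z) - \<bar>Im w\<bar> * norm (snd z))\<^sup>2" by simp
          then show ?thesis by (simp add: power2_sum power2_diff power_mult_distrib algebra_simps)
        qed
        also have "\<dots> = (cmod w * norm z)\<^sup>2"
          by (simp add: power_mult_distrib cmod_power2 norm_prod_def add.commute)
        finally show "(norm (Re w *\<^sub>R snd z + Im w *\<^sub>R fst z))\<^sup>2 \<le> (cmod w * norm z)\<^sup>2" .
      qed simp
      also have "\<dots> \<le> 1 * norm z" using w by (intro mult_right_mono) auto
      also have "\<dots> < r" using True by simp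
      finally have "Y + (Re w *\<^sub>R snd z + Im w *\<^sub>R fst z) \<in> ball Y r"
        by (simp only: mem_ball dist_norm norm_minus_commute[of Y] add_diff_cancel_left')
      then show "w \<in> ?S" using Y by blast
    qed
    have "ennreal ((cmod (?F 0))\<^sup>2) \<le> (\<integral>\<^sup>+x. indicator {0..1::real} x * ennreal ((cmod (?F (cis (2 * pi * x))))\<^sup>2) \<partial>lborel)"
      by (rule mean_value_circle[OF holomorphic_on_line[OF f] open_line sub])
    also have "\<dots> = (\<integral>\<^sup>+x. indicator {0..1::real} x * Q (?rot x z) \<partial>lborel)"
    proof (intro nn_integral_cong arg_cong2[where f="(*)"] refl)
      fix x :: real
      have "?rot x z \<in> ball 0 r" using norm_rot[OF cs, of x z] True by simp
      then show "ennreal ((cmod (?F (cis (2 * pi * x))))\<^sup>2) = Q (?rot x z)"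
        by (simp add: Q_def spl_def rot_def add.commute[of "sin (2 * pi * x) *\<^sub>R fst z"])
    qed
    finally show ?thesis using True by (simp add: spl_def)
  qed simp
  have Qrm: "(\<lambda>(z, x). indicator {0..1::real} x * Q (?rot x z)) \<in> borel_measurable (plane \<Otimes>\<^sub>M lborel)"
  proof -
    have "(\<lambda>p. ?rot (snd p) (fst p)) \<in> plane \<Otimes>\<^sub>M lborel \<rightarrow>\<^sub>M borel \<Otimes>\<^sub>M borel"
      unfolding rot_def by measurable
    from measurable_compose[OF this Qm] have [measurable]: "(\<lambda>p. Q (?rot (snd p) (fst p))) \<in> borel_measurable (plane \<Otimes>\<^sub>M lborel)" .
    show ?thesis by (simp add: split_beta') measurable
  qed
  interpret T: pair_sigma_finite "plane :: ('n symmat \<times> 'n symmat) measure" "lborel :: real measure"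
    by (intro pair_sigma_finite.intro lborel.sigma_finite_measure_axioms) (simp add: lborel_prod lborel.sigma_finite_measure_axioms)
  have "ennreal ((cmod (f (siegel_point X Y)))\<^sup>2) * emeasure plane (ball (0 :: 'n symmat \<times> 'n symmat) r) = (\<integral>\<^sup>+z. ennreal ((cmod (f (siegel_point X Y)))\<^sup>2) * indicator (ball (0 :: 'n symmat \<times> 'n symmat) r) z \<partial>plane)"
    by (rule nn_integral_cmult_indicator[OF bs, symmetric])
  also have "\<dots> \<le> (\<integral>\<^sup>+z. \<integral>\<^sup>+x. indicator {0..1::real} x * Q (?rot x z) \<partial>lborel \<partial>plane)"
    using pt by (intro nn_integral_mono) (simp add: mult.commute)
  also have "\<dots> = (\<integral>\<^sup>+x. \<integral>\<^sup>+z. indicator {0..1::real} x * Q (?rot x z) \<partial>plane \<partial>lborel)"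
    by (rule T.Fubini'[OF Qrm, symmetric])
  also have "\<dots> = (\<integral>\<^sup>+x. indicator {0..1::real} x * (\<integral>\<^sup>+z. Q z \<partial>plane) \<partial>lborel)"
  proof (rule nn_integral_cong)
    fix x :: real
    have "(\<lambda>z. Q (?rot x z)) \<in> borel_measurable (borel \<Otimes>\<^sub>M borel)" by (rule measurable_compose[OF measurable_rot Qm])
    then have m: "(\<lambda>z. Q (?rot x z)) \<in> borel_measurable plane" by (simp cong: measurable_cong_sets sets_pair_measure_cong)
    show "(\<integral>\<^sup>+z. indicator {0..1::real} x * Q (?rot x z) \<partial>plane) = indicator {0..1::real} x * (\<integral>\<^sup>+z. Q z \<partial>plane)"
      unfolding nn_integral_cmult[OF m] rot_invariant[OF Qm cs] ..
  qed
  also have "\<dots> = (\<integral>\<^sup>+z. Q z \<partial>plane)"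
    by (simp add: nn_integral_multc)
  finally show ?thesis unfolding Q_def .
qed

end

text \<open>The increment in the imaginary direction is \<i> times the real one up to second order.
  The constant is linear in \<open>M\<close>, so the bound can later be integrated over
  \<open>X\<close>.\<close>

lemma cauchy_riemann_estimate:
  assumes F: "F holomorphic_on ball 0 r" and r: "r > 0" and M: "M > 0" "\<And>z. cmod z < r \<Longrightarrow> cmod (F z) \<le> M"
    and d: "\<bar>\<delta>\<bar> < r / 2"
  shows "cmod (F (\<i> * of_real \<delta>) - F 0 - \<i> * (F (of_real \<delta>) - F 0)) \<le> 128 * M / r\<^sup>2 * \<delta>\<^sup>2"
proof -
  \<comment> \<open>Cauchy's estimate on discs of radius \<open>r / 4\<close>. The doubled bound
    \<open>2 * M\<close> puts the values into an open ball, and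
    \<open>2 * (2 * M) / (r / 4)\<^sup>2\<close> is the stated constant.\<close>
  have bound: "cmod ((deriv ^^ 2) F x) \<le> 64 * M / r\<^sup>2" if x: "x \<in> ball 0 (r / 2)" for x
  proof -
    have sub: "cmod w < r" if "w \<in> cball x (r / 4)" for w
    proof -
      have "cmod w \<le> cmod x + cmod (w - x)" using norm_triangle_ineq[of x "w - x"] by simp
      moreover have "cmod (w - x) \<le> r / 4" using that by (simp add: dist_norm norm_minus_commute)
      ultimately show ?thesis using x r by simp
    qed
    have hol: "F holomorphic_on cball x (r / 4)" by (rule holomorphic_on_subset[OF F]) (use sub in auto)
    have "cmod ((deriv ^^ 2) F x) \<le> fact 2 * (2 * M) / (r / 4) ^ 2"
    proof (rule Cauchy_higher_deriv_bound)
      show "F holomorphic_on ball x (r / 4)" by (rule holomorphic_on_subset[OF hol]) auto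
      show "continuous_on (cball x (r / 4)) F" by (rule holomorphic_on_imp_continuous_on[OF hol])
      show "F w \<in> ball 0 (2 * M)" if "w \<in> ball x (r / 4)" for w
        using M(2)[OF sub[of w]] M(1) that by simp
    qed (use r in auto)
    then show ?thesis by (simp add: power_divide fact_numeral)
  qed
  define G where "G z = F z - (\<Sum>i\<le>1. (deriv ^^ i) F 0 * (z - 0) ^ i / fact i)" for z
  have G: "cmod (G z) \<le> 64 * M / r\<^sup>2 * (cmod z)\<^sup>2" if z: "cmod z < r / 2" for z
  proof -
    have "cmod ((deriv ^^ 0) F z - (\<Sum>i\<le>1. (deriv ^^ i) F 0 * (z - 0) ^ i / fact i)) \<le> 64 * M / r\<^sup>2 * cmod (z - 0) ^ Suc 1 / fact 1"
    proof (rule complex_Taylor[where S="ball 0 (r / 2)"])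
      fix i :: nat and x :: complex assume x: "x \<in> ball 0 (r / 2)"
      have "(deriv ^^ i) F holomorphic_on ball 0 r" by (rule holomorphic_higher_deriv[OF F open_ball])
      then have "((deriv ^^ i) F has_field_derivative deriv ((deriv ^^ i) F) x) (at x within ball 0 (r / 2))"
        by (rule holomorphic_derivI) (use x r in auto)
      then show "((deriv ^^ i) F has_field_derivative (deriv ^^ Suc i) F x) (at x within ball 0 (r / 2))" by simp
    next
      fix x :: complex assume "x \<in> ball 0 (r / 2)"
      then show "cmod ((deriv ^^ Suc 1) F x) \<le> 64 * M / r\<^sup>2" using bound[of x] by (simp add: numeral_2_eq_2)
    qed (use z r in auto)
    then show ?thesis by (simp add: G_def power2_eq_square)
  qed
  have "F (\<i> * of_real \<delta>) - F 0 - \<i> * (F (of_real \<delta>) - F 0) = G (\<i> * of_real \<delta>) - \<i> * G (of_real \<delta>)"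
    by (simp add: G_def algebra_simps)
  also have "cmod \<dots> \<le> cmod (G (\<i> * of_real \<delta>)) + cmod (G (of_real \<delta>))"
    by (rule order_trans[OF norm_triangle_ineq4]) (simp add: norm_mult)
  also have "\<dots> \<le> 64 * M / r\<^sup>2 * \<delta>\<^sup>2 + 64 * M / r\<^sup>2 * \<delta>\<^sup>2"
    using G[of "\<i> * of_real \<delta>"] G[of "of_real \<delta>"] d by (intro add_mono) (simp_all add: norm_mult)
  finally show ?thesis by simp
qed

lemma lborel_integral_translate:
  fixes g :: "'a::euclidean_space \<Rightarrow> complex"
  assumes [measurable]: "g \<in> borel_measurable borel"
  shows "(LINT x|lborel. g (x + v)) = (LINT x|lborel. g x)"
proof -
  have "(LINT x|distr lborel borel ((+) v). g x) = (LINT x|lborel. g (v + x))"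
    by (rule integral_distr) auto
  then show ?thesis by (simp add: lborel_distr_plus add.commute)
qed

lemma pos_cone_segment:
  assumes "A \<in> pos_cone" "B \<in> pos_cone" "0 \<le> t" "t \<le> 1"
  shows "A + t *\<^sub>R (B - A) \<in> pos_cone"
  unfolding pos_cone_iff
proof (intro allI impI)
  fix v :: "real^'a" assume v: "v \<noteq> 0"
  have p: "0 < inner A (outer v)" "0 < inner B (outer v)" using assms v by (auto simp: pos_cone_iff)
  have "inner (A + t *\<^sub>R (B - A)) (outer v) = (1 - t) * inner A (outer v) + t * inner B (outer v)"
    by (simp add: inner_add_left inner_diff_left algebra_simps)
  moreover have "0 < (1 - t) * inner A (outer v) + t * inner B (outer v)"
    using p assms(3,4) by (cases "t = 0") (auto intro!: add_nonneg_pos)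
  ultimately show "0 < inner (A + t *\<^sub>R (B - A)) (outer v)" by simp
qed

context siegel
begin

text \<open>Near \<open>Y0\<close> the weight is bounded below, so the norm of \<open>f\<close>
  controls its squared integral over a tube, and translation in \<open>X\<close> does not leave the
  tube. The mean value inequality then bounds \<open>f\<close> uniformly in
  \<open>X\<close>.\<close>

lemma tube_bound:
  assumes f: "matrix_holomorphic_on f siegel_domain" "f \<in> L2 (siegel_measure l)" and Y0: "Y0 \<in> (pos_cone :: 'n symmat set)"
  shows "\<exists>\<rho>>0. \<exists>C\<ge>0. ball Y0 \<rho> \<subseteq> pos_cone \<and> (\<forall>X. \<forall>Y\<in>ball Y0 \<rho>. cmod (f (siegel_point X Y)) \<le> C)"
proof -
  obtain e where e: "e > 0" "cball Y0 e \<subseteq> pos_cone" using open_pos_cone Y0 open_contains_cball by blast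
  \<comment> \<open>Half the radius, so that balls of radius \<rho> about points of the smaller ball
    remain in the compact ball \<open>?K\<close>.\<close>
  define \<rho> where "\<rho> = e / 2"
  have \<rho>: "\<rho> > 0" using e by (simp add: \<rho>_def)
  let ?K = "cball Y0 e"
  define w where "w Y = siegel_const CARD('n) l * sdet (2 *\<^sub>R Y) powr (l - real CARD('n) - 1)" for Y :: "'n symmat"
  have det_pos: "0 < sdet (2 *\<^sub>R Y)" if "Y \<in> ?K" for Y
    by (rule sdet_pos) (use that e(2) in \<open>auto simp: pos_cone_scaleR\<close>)
  have "continuous_on ?K (\<lambda>Y. sdet (2 *\<^sub>R Y))"
    by (rule continuous_on_compose2[OF continuous_on_sdet[of UNIV]]) (auto intro!: continuous_intros)
  then have "continuous_on ?K w"
    unfolding w_def using det_pos by (intro continuous_intros) fastforce+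
  then obtain Ym where Ym: "Ym \<in> ?K" "\<And>Y. Y \<in> ?K \<Longrightarrow> w Ym \<le> w Y"
    using continuous_attains_inf[of ?K w] e(1) by auto
  define m where "m = w Ym"
  have m: "m > 0" unfolding m_def w_def using siegel_const_pos det_pos[OF Ym(1)] by simp
  have fm: "f \<in> borel_measurable (restrict_space borel siegel_domain)"
    using L2_measurable[OF f(2)] by (simp only: borel_measurable_siegel_iff)
  have uL: "(\<lambda>z. f (spt z)) \<in> L2 PN" using L2_siegel(1)[OF fm] f(2) by simp
  define V where "V = L2_norm PN (\<lambda>z. f (spt z))"
  \<comment> \<open>Extended by 0 off the closed tube, so that it can be translated and integrated
    over all pairs.\<close>
  define H where "H z = ennreal ((cmod (indicator (UNIV \<times> ?K) z *\<^sub>R f (siegel_point (fst z) (snd z))))\<^sup>2)" for z :: "'n symmat \<times> 'n symmat"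
  have "continuous_on (UNIV \<times> ?K) (\<lambda>z. f (siegel_point (fst z) (snd z)))"
    by (rule continuous_on_tube[OF f(1)]) (use e(2) in auto)
  then have "(\<lambda>z. indicator (UNIV \<times> ?K) z *\<^sub>R f (siegel_point (fst z) (snd z))) \<in> borel_measurable borel"
    by (intro borel_measurable_continuous_on_indicator borel_closed closed_Times) auto
  then have "(\<lambda>z. indicator (UNIV \<times> ?K) z *\<^sub>R f (siegel_point (fst z) (snd z))) \<in> borel_measurable (borel \<Otimes>\<^sub>M borel)"
    by (simp only: borel_prod)
  then have Hm: "H \<in> borel_measurable (borel \<Otimes>\<^sub>M borel)" unfolding H_def[abs_def] by measurable
  have HmP: "H \<in> borel_measurable plane" using Hm by (simp cong: measurable_cong_sets sets_pair_measure_cong)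
  have HX: "(\<lambda>Y. H (X, Y)) \<in> borel_measurable borel" for X
    by (rule measurable_compose[OF measurable_Pair1' Hm]) simp
  have mH: "ennreal m * (\<integral>\<^sup>+z. H z \<partial>plane) \<le> ennreal (V\<^sup>2)"
  proof -
    have "ennreal m * (\<integral>\<^sup>+z. H z \<partial>plane) = (\<integral>\<^sup>+z. ennreal m * H z \<partial>plane)" by (rule nn_integral_cmult[OF HmP, symmetric])
    also have "\<dots> = (\<integral>\<^sup>+X. \<integral>\<^sup>+Y. ennreal m * H (X, Y) \<partial>lborel \<partial>lborel)"
      by (rule lborel.nn_integral_fst[symmetric]) (use HmP in measurable)
    also have "\<dots> \<le> (\<integral>\<^sup>+X. \<integral>\<^sup>+Y. ennreal ((cmod (f (spt (X, Y))))\<^sup>2) \<partial>N \<partial>lborel)"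
    proof (rule nn_integral_mono)
      fix X :: "'n symmat"
      have "(\<integral>\<^sup>+Y. ennreal m * H (X, Y) \<partial>lborel) \<le> (\<integral>\<^sup>+Y. (if Y \<in> pos_cone then ennreal (w Y) * H (X, Y) else 0) \<partial>lborel)"
      proof (rule nn_integral_mono)
        fix Y :: "'n symmat"
        show "ennreal m * H (X, Y) \<le> (if Y \<in> pos_cone then ennreal (w Y) * H (X, Y) else 0)"
        proof (cases "Y \<in> ?K")
          case True
          then have "Y \<in> pos_cone" "m \<le> w Y" using e(2) Ym(2) by (auto simp: m_def)
          then show ?thesis by (simp add: mult_right_mono ennreal_leI)
        qed (simp add: H_def)
      qed
      also have "\<dots> = (\<integral>\<^sup>+Y. H (X, Y) \<partial>N)" unfolding w_def by (rule nn_integral_N[OF HX, symmetric])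
      also have "\<dots> \<le> (\<integral>\<^sup>+Y. ennreal ((cmod (f (spt (X, Y))))\<^sup>2) \<partial>N)"
        by (intro nn_integral_mono) (auto simp: H_def indicator_def)
      finally show "(\<integral>\<^sup>+Y. ennreal m * H (X, Y) \<partial>lborel) \<le> (\<integral>\<^sup>+Y. ennreal ((cmod (f (spt (X, Y))))\<^sup>2) \<partial>N)" .
    qed
    also have "\<dots> = (\<integral>\<^sup>+z. ennreal ((cmod (f (spt z)))\<^sup>2) \<partial>PN)"
    proof -
      note [measurable] = L2_measurable[OF uL]
      show ?thesis by (rule M2.nn_integral_fst) measurable
    qed
    also have "\<dots> = ennreal (V\<^sup>2)" unfolding V_def by (rule L2_nn_integral[OF uL])
    finally show ?thesis .
  qed
  define v where "v = measure lborel (ball (0 :: 'n symmat \<times> 'n symmat) \<rho>)"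
  have v: "v > 0" "emeasure plane (ball (0 :: 'n symmat \<times> 'n symmat) \<rho>) = ennreal v"
  proof -
    have fin: "emeasure lborel (ball (0 :: 'n symmat \<times> 'n symmat) \<rho>) < \<infinity>"
      by (rule emeasure_bounded_finite[OF bounded_ball])
    show "v > 0" unfolding v_def by (rule content_ball_pos[OF \<rho>])
    show "emeasure plane (ball (0 :: 'n symmat \<times> 'n symmat) \<rho>) = ennreal v"
      unfolding v_def lborel_prod by (rule emeasure_eq_ennreal_measure) (use fin in auto)
  qed
  have bound: "(cmod (f (siegel_point X Y)))\<^sup>2 \<le> V\<^sup>2 / (m * v)" if Y: "Y \<in> ball Y0 \<rho>" for X Y
  proof -
    have near: "Y + B \<in> ?K" if "norm B < \<rho>" for B
    proof -
      have "dist Y0 (Y + B) \<le> dist Y0 Y + norm B" using dist_triangle[of Y0 "Y + B" Y] by (simp add: dist_norm)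
      then show ?thesis using Y that by (simp add: \<rho>_def)
    qed
    have bY: "ball Y \<rho> \<subseteq> pos_cone"
    proof
      fix Z assume "Z \<in> ball Y \<rho>"
      then have "Y + (Z - Y) \<in> ?K" by (intro near) (simp add: dist_norm norm_minus_commute)
      then show "Z \<in> pos_cone" using e(2) by auto
    qed
    have "ennreal ((cmod (f (siegel_point X Y)))\<^sup>2) * ennreal v \<le>
        (\<integral>\<^sup>+z. indicator (ball 0 \<rho>) z * ennreal ((cmod (f (siegel_point (X + fst z) (Y + snd z))))\<^sup>2) \<partial>plane)"
      using mean_value_ball[OF f(1) bY \<rho>, of X] by (simp add: v(2))
    also have "\<dots> \<le> (\<integral>\<^sup>+z. H (fst z + X, snd z + Y) \<partial>plane)"
    proof (rule nn_integral_mono)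
      fix z :: "'n symmat \<times> 'n symmat"
      show "indicator (ball 0 \<rho>) z * ennreal ((cmod (f (siegel_point (X + fst z) (Y + snd z))))\<^sup>2) \<le> H (fst z + X, snd z + Y)"
      proof (cases "z \<in> ball 0 \<rho>")
        case True
        then have "norm (snd z) < \<rho>" using norm_snd_le[of "snd z" "fst z"] by simp
        from near[OF this] show ?thesis using True by (simp add: H_def add.commute)
      qed simp
    qed
    also have "\<dots> = (\<integral>\<^sup>+A. \<integral>\<^sup>+B. H (A + X, B + Y) \<partial>lborel \<partial>lborel)"
    proof -
      have "(\<lambda>z. (fst z + X, snd z + Y)) \<in> plane \<rightarrow>\<^sub>M borel \<Otimes>\<^sub>M borel" by measurable
      from measurable_compose[OF this Hm] show ?thesis by (subst lborel.nn_integral_fst[symmetric]) simp_all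
    qed
    also have "\<dots> = (\<integral>\<^sup>+A. (\<lambda>A. \<integral>\<^sup>+B. H (A, B) \<partial>lborel) (A + X) \<partial>lborel)"
      by (rule nn_integral_cong) (simp only: nn_integral_translate[OF HX])
    also have "\<dots> = (\<integral>\<^sup>+A. \<integral>\<^sup>+B. H (A, B) \<partial>lborel \<partial>lborel)"
      by (rule nn_integral_translate) (use lborel.borel_measurable_nn_integral_fst[OF HmP] in simp)
    also have "\<dots> = (\<integral>\<^sup>+z. H z \<partial>plane)" by (rule lborel.nn_integral_fst[OF HmP])
    finally have "ennreal m * (ennreal ((cmod (f (siegel_point X Y)))\<^sup>2) * ennreal v) \<le> ennreal m * (\<integral>\<^sup>+z. H z \<partial>plane)"
      by (rule mult_left_mono) simp
    also have "\<dots> \<le> ennreal (V\<^sup>2)" by (rule mH)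
    finally have "ennreal (m * ((cmod (f (siegel_point X Y)))\<^sup>2 * v)) \<le> ennreal (V\<^sup>2)"
      using m v(1) by (simp add: ennreal_mult)
    then have "m * ((cmod (f (siegel_point X Y)))\<^sup>2 * v) \<le> V\<^sup>2" by (simp add: ennreal_le_iff)
    then show ?thesis using m v(1) by (simp add: field_simps)
  qed
  have "cmod (f (siegel_point X Y)) \<le> sqrt (V\<^sup>2 / (m * v))" if "Y \<in> ball Y0 \<rho>" for X Y
    by (rule real_le_rsqrt[OF bound[OF that]])
  moreover have "ball Y0 \<rho> \<subseteq> pos_cone" using e by (intro order_trans[OF _ e(2)]) (auto simp: \<rho>_def)
  moreover have "0 \<le> sqrt (V\<^sup>2 / (m * v))" using m v(1) by simp
  ultimately show ?thesis using \<rho> by blast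
qed

subsection \<open>Shifting the contour\<close>

text \<open>\<open>gker\<close> is \<open>exp (- \<i> tr (Z \<xi>) - \<epsilon> tr (Z Z))\<close> at \<open>Z = X + \<i> Y\<close>.\<close>

definition gker :: "real \<Rightarrow> 'n symmat \<Rightarrow> 'n symmat \<Rightarrow> 'n symmat \<Rightarrow> complex" where
  "gker \<epsilon> \<xi> X Y = exp (- \<i> * (of_real (inner X \<xi>) + \<i> * of_real (inner Y \<xi>))
     - of_real \<epsilon> * (of_real (inner X X - inner Y Y) + 2 * \<i> * of_real (inner X Y)))"

lemma cmod_gker: "cmod (gker \<epsilon> \<xi> X Y) = exp (inner Y \<xi> - \<epsilon> * (inner X X - inner Y Y))"
  by (simp add: gker_def)

text \<open>Along a complex line in a real direction the exponent is a polynomial in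
  \<open>z\<close>, which makes the kernel visibly holomorphic.\<close>

lemma gker_line:
  "gker \<epsilon> \<xi> (X + Re z *\<^sub>R E) (Y + Im z *\<^sub>R E) =
   exp (- \<i> * (of_real (inner X \<xi>) + \<i> * of_real (inner Y \<xi>) + z * of_real (inner E \<xi>))
     - of_real \<epsilon> * (of_real (inner X X - inner Y Y) + 2 * \<i> * of_real (inner X Y) + 2 * z * (of_real (inner X E) + \<i> * of_real (inner Y E)) + z\<^sup>2 * of_real (inner E E)))"
proof -
  have c: "inner E X = inner X E" "inner E Y = inner Y E" "inner Y X = inner X Y" by (simp_all add: inner_commute)
  show ?thesis
    unfolding gker_def
    by (rule arg_cong[where f=exp])
      (simp add: complex_eq_iff inner_add_left inner_add_right power2_eq_square c algebra_simps)
qed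

lemma continuous_on_gker: "continuous_on S (\<lambda>X. gker \<epsilon> \<xi> X Y)"
  unfolding gker_def by (intro continuous_intros)

definition shifted :: "(complex^'n^'n \<Rightarrow> complex) \<Rightarrow> real \<Rightarrow> 'n symmat \<Rightarrow> 'n symmat \<Rightarrow> complex" where
  "shifted f \<epsilon> \<xi> Y = (LINT X|lborel. f (siegel_point X Y) * gker \<epsilon> \<xi> X Y)"

lemma tube_slice_measurable:
  assumes f: "matrix_holomorphic_on f siegel_domain" and Y: "Y \<in> (pos_cone :: 'n symmat set)"
  shows "(\<lambda>X. f (siegel_point X Y)) \<in> borel_measurable borel"
proof (rule borel_measurable_continuous_onI)
  show "continuous_on UNIV (\<lambda>X. f (siegel_point X Y))"
  proof -
    have "continuous_on UNIV (\<lambda>X. f (siegel_point (fst (X, Y)) (snd (X, Y))))"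
      by (rule continuous_on_compose2[OF continuous_on_tube[OF f, of "{z. snd z \<in> pos_cone}"], of _ "\<lambda>X. (X, Y)"])
        (auto intro!: continuous_intros simp: Y)
    then show ?thesis by simp
  qed
qed

text \<open>Translation in \<open>X\<close> leaves the integral unchanged, so the increment in the
  real direction \<open>E\<close> integrates to 0. By \<open>cauchy_riemann_estimate\<close> the
  increment in the imaginary direction is then of second order.\<close>

lemma shifted_step:
  assumes f: "matrix_holomorphic_on f siegel_domain" "f \<in> L2 (siegel_measure l)" and Y: "Y \<in> (pos_cone :: 'n symmat set)" and eps: "\<epsilon> > 0"
  shows "\<exists>d>0. \<exists>C. \<forall>\<delta>. \<bar>\<delta>\<bar> < d \<longrightarrow> cmod (shifted f \<epsilon> \<xi> (Y + \<delta> *\<^sub>R E) - shifted f \<epsilon> \<xi> Y) \<le> C * \<delta>\<^sup>2"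
proof -
  obtain \<rho> C0 where \<rho>: "\<rho> > 0" "C0 \<ge> 0" "ball Y \<rho> \<subseteq> pos_cone" "\<And>X Y'. Y' \<in> ball Y \<rho> \<Longrightarrow> cmod (f (siegel_point X Y')) \<le> C0"
    using tube_bound[OF f Y] by blast
  \<comment> \<open>The \<open>+ 1\<close> covers \<open>E = 0\<close>; for
    \<open>cmod z < r\<close> real and imaginary part both move by less than \<rho>.\<close>
  define r where "r = \<rho> / (norm E + 1)"
  have nE: "0 < norm E + 1" using norm_ge_zero[of E] by linarith
  have r: "r > 0" using \<rho>(1) nE by (simp add: r_def)
  have rE: "\<bar>a\<bar> * norm E < \<rho>" if "\<bar>a\<bar> < r" for a
  proof -
    have "\<bar>a\<bar> * norm E \<le> \<bar>a\<bar> * (norm E + 1)" by (intro mult_left_mono) auto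
    also have "\<dots> < r * (norm E + 1)" using that nE by (intro mult_strict_right_mono)
    also have "\<dots> = \<rho>" using nE by (simp add: r_def)
    finally show ?thesis .
  qed
  define kf where "kf X Y' = f (siegel_point X Y') * gker \<epsilon> \<xi> X Y'" for X Y'
  \<comment> \<open>Gives a majorant valid for all small \<open>z\<close> at once;
    \<open>C0 + 1\<close> keeps it strictly positive, as \<open>cauchy_riemann_estimate\<close>
    asks.\<close>
  define C1 where "C1 = (C0 + 1) * exp ((norm Y + \<rho>) * norm \<xi> + \<epsilon> * (norm Y + \<rho>)\<^sup>2 + \<epsilon> * \<rho>\<^sup>2)"
  have C1: "C1 > 0" using \<rho>(2) by (simp add: C1_def)
  define M where "M X = C1 * exp (- \<epsilon> * (norm X)\<^sup>2 / 2)" for X :: "'n symmat"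
  have Mpos: "M X > 0" for X using C1 by (simp add: M_def)
  have Mint: "integrable lborel M"
  proof -
    have "integrable lborel (\<lambda>x :: 'n symmat. complex_of_real (exp (- \<epsilon> * (norm x)\<^sup>2 / 2)))"
      using gaussian_FT(2)[OF eps, of "0 :: 'n symmat"] by simp
    then have "integrable lborel (\<lambda>x :: 'n symmat. exp (- \<epsilon> * (norm x)\<^sup>2 / 2))" by (simp only: complex_of_real_integrable_eq)
    then show ?thesis unfolding M_def by (rule integrable_mult_right)
  qed
  have near: "Y + Im z *\<^sub>R E \<in> ball Y \<rho>" if "cmod z < r" for z
    using rE[of "Im z"] abs_Im_le_cmod[of z] that by (simp add: dist_norm)
  have kf_le: "cmod (kf (X + Re z *\<^sub>R E) (Y + Im z *\<^sub>R E)) \<le> M X" if z: "cmod z < r" for X z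
  proof -
    let ?X = "X + Re z *\<^sub>R E" and ?Y = "Y + Im z *\<^sub>R E"
    have Yn: "norm ?Y \<le> norm Y + \<rho>"
      using norm_triangle_ineq[of Y "Im z *\<^sub>R E"] rE[of "Im z"] abs_Im_le_cmod[of z] z by simp
    have Xn: "norm (Re z *\<^sub>R E) \<le> \<rho>" using rE[of "Re z"] abs_Re_le_cmod[of z] z by simp
    have "norm X \<le> norm ?X + norm (Re z *\<^sub>R E)" using norm_triangle_ineq4[of ?X "Re z *\<^sub>R E"] by simp
    then have "norm X \<le> norm ?X + \<rho>" using Xn by linarith
    then have "(norm X)\<^sup>2 \<le> (norm ?X + \<rho>)\<^sup>2" by (rule power_mono) simp
    \<comment> \<open>Undoing the displacement of \<open>X\<close> costs half of the Gaussian
      exponent, whence the division by 2 in \<open>M\<close>.\<close>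
    also have "\<dots> \<le> 2 * (norm ?X)\<^sup>2 + 2 * \<rho>\<^sup>2" using sum_squares_bound[of "norm ?X" \<rho>] by (simp add: power2_sum)
    finally have X2: "(norm X)\<^sup>2 / 2 - \<rho>\<^sup>2 \<le> inner ?X ?X" by (simp add: power2_norm_eq_inner)
    have "inner ?Y ?Y \<le> (norm Y + \<rho>)\<^sup>2" using power_mono[OF Yn, of 2] by (simp add: power2_norm_eq_inner)
    then have "inner ?Y ?Y - inner ?X ?X \<le> (norm Y + \<rho>)\<^sup>2 + \<rho>\<^sup>2 - (norm X)\<^sup>2 / 2" using X2 by linarith
    then have "\<epsilon> * (inner ?Y ?Y - inner ?X ?X) \<le> \<epsilon> * ((norm Y + \<rho>)\<^sup>2 + \<rho>\<^sup>2 - (norm X)\<^sup>2 / 2)" using eps by (intro mult_left_mono) auto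
    moreover have "inner ?Y \<xi> \<le> (norm Y + \<rho>) * norm \<xi>"
      by (rule order_trans[OF norm_cauchy_schwarz mult_right_mono[OF Yn norm_ge_zero]])
    ultimately have "inner ?Y \<xi> - \<epsilon> * (inner ?X ?X - inner ?Y ?Y) \<le> ((norm Y + \<rho>) * norm \<xi> + \<epsilon> * (norm Y + \<rho>)\<^sup>2 + \<epsilon> * \<rho>\<^sup>2) + (- \<epsilon> * (norm X)\<^sup>2 / 2)"
      by (simp add: algebra_simps)
    then have "cmod (gker \<epsilon> \<xi> ?X ?Y) \<le> exp ((norm Y + \<rho>) * norm \<xi> + \<epsilon> * (norm Y + \<rho>)\<^sup>2 + \<epsilon> * \<rho>\<^sup>2) * exp (- \<epsilon> * (norm X)\<^sup>2 / 2)"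
      unfolding cmod_gker exp_add[symmetric] exp_le_cancel_iff .
    moreover have "cmod (f (siegel_point ?X ?Y)) \<le> C0 + 1" using \<rho>(4)[OF near[OF z], of ?X] by linarith
    ultimately have "cmod (kf ?X ?Y) \<le> (C0 + 1) * (exp ((norm Y + \<rho>) * norm \<xi> + \<epsilon> * (norm Y + \<rho>)\<^sup>2 + \<epsilon> * \<rho>\<^sup>2) * exp (- \<epsilon> * (norm X)\<^sup>2 / 2))"
      unfolding kf_def norm_mult using \<rho>(2) by (intro mult_mono) auto
    then show ?thesis by (simp add: M_def C1_def mult.assoc)
  qed
  have kfm: "(\<lambda>X. kf X Y') \<in> borel_measurable borel" if "Y' \<in> pos_cone" for Y'
    unfolding kf_def using tube_slice_measurable[OF f(1) that] borel_measurable_continuous_onI[OF continuous_on_gker[of UNIV \<epsilon> \<xi> Y']]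
    by (rule borel_measurable_times)
  have kfi: "integrable lborel (\<lambda>X. kf (X + Re z *\<^sub>R E) (Y + Im z *\<^sub>R E))" if z: "cmod z < r" for z
  proof (rule Bochner_Integration.integrable_bound[OF Mint])
    have "(\<lambda>X. X + Re z *\<^sub>R E) \<in> borel \<rightarrow>\<^sub>M borel" by measurable
    from measurable_compose[OF this kfm[of "Y + Im z *\<^sub>R E"]] near[OF z] \<rho>(3)
    show "(\<lambda>X. kf (X + Re z *\<^sub>R E) (Y + Im z *\<^sub>R E)) \<in> borel_measurable lborel" by auto
    show "AE X in lborel. norm (kf (X + Re z *\<^sub>R E) (Y + Im z *\<^sub>R E)) \<le> norm (M X)"
      using kf_le[OF z] Mpos by (intro AE_I2) (simp add: abs_of_pos)
  qed
  have main: "cmod (shifted f \<epsilon> \<xi> (Y + \<delta> *\<^sub>R E) - shifted f \<epsilon> \<xi> Y) \<le> (128 / r\<^sup>2 * (LINT X|lborel. M X)) * \<delta>\<^sup>2" if d: "\<bar>\<delta>\<bar> < r / 2" for \<delta>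
  proof -
    have dr: "\<bar>\<delta>\<bar> < r" using d r by simp
    let ?F = "\<lambda>X z. kf (X + Re z *\<^sub>R E) (Y + Im z *\<^sub>R E)"
    let ?i = "\<i> * complex_of_real \<delta>" and ?d = "complex_of_real \<delta>"
    have i0: "integrable lborel (\<lambda>X. ?F X 0)" by (rule kfi) (use r in simp)
    have ii: "integrable lborel (\<lambda>X. ?F X ?i)" by (rule kfi) (use dr in \<open>simp add: norm_mult\<close>)
    have id: "integrable lborel (\<lambda>X. ?F X ?d)" by (rule kfi) (use dr in simp)
    \<comment> \<open>The real increment integrates to 0, so a multiple of it may be
      subtracted.\<close>
    have "(LINT X|lborel. ?F X ?d) = (LINT X|lborel. ?F X 0)"
      using lborel_integral_translate[OF kfm[OF Y], of "\<delta> *\<^sub>R E"] by simp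
    then have "shifted f \<epsilon> \<xi> (Y + \<delta> *\<^sub>R E) - shifted f \<epsilon> \<xi> Y = (LINT X|lborel. ?F X ?i) - (LINT X|lborel. ?F X 0) - \<i> * ((LINT X|lborel. ?F X ?d) - (LINT X|lborel. ?F X 0))"
      by (simp add: shifted_def kf_def)
    also have "\<dots> = (LINT X|lborel. ?F X ?i - ?F X 0 - \<i> * (?F X ?d - ?F X 0))"
      using i0 ii id by simp
    finally have eq: "shifted f \<epsilon> \<xi> (Y + \<delta> *\<^sub>R E) - shifted f \<epsilon> \<xi> Y = (LINT X|lborel. ?F X ?i - ?F X 0 - \<i> * (?F X ?d - ?F X 0))" .
    have "cmod (shifted f \<epsilon> \<xi> (Y + \<delta> *\<^sub>R E) - shifted f \<epsilon> \<xi> Y) \<le> (LINT X|lborel. cmod (?F X ?i - ?F X 0 - \<i> * (?F X ?d - ?F X 0)))"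
      unfolding eq by (rule integral_norm_bound)
    also have "\<dots> \<le> (LINT X|lborel. (128 / r\<^sup>2 * \<delta>\<^sup>2) * M X)"
    proof (rule integral_mono)
      show "integrable lborel (\<lambda>X. cmod (?F X ?i - ?F X 0 - \<i> * (?F X ?d - ?F X 0)))"
        using i0 ii id by (intro integrable_norm Bochner_Integration.integrable_diff integrable_mult_right)
      show "integrable lborel (\<lambda>X. (128 / r\<^sup>2 * \<delta>\<^sup>2) * M X)" by (intro integrable_mult_right Mint)
      fix X :: "'n symmat"
      have "(\<lambda>z. f (spl X Y E 0 z)) holomorphic_on ball 0 r"
        by (rule holomorphic_on_subset[OF holomorphic_on_line[OF f(1)]]) (use near \<rho>(3) in auto)
      moreover have "(\<lambda>z. gker \<epsilon> \<xi> (X + Re z *\<^sub>R E) (Y + Im z *\<^sub>R E)) holomorphic_on ball 0 r"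
        unfolding gker_line by (intro holomorphic_intros)
      ultimately have "(\<lambda>z. f (spl X Y E 0 z) * gker \<epsilon> \<xi> (X + Re z *\<^sub>R E) (Y + Im z *\<^sub>R E)) holomorphic_on ball 0 r"
        by (rule holomorphic_on_mult)
      then have hol: "?F X holomorphic_on ball 0 r" by (simp add: kf_def spl_def)
      have "cmod (?F X ?i - ?F X 0 - \<i> * (?F X ?d - ?F X 0)) \<le> 128 * M X / r\<^sup>2 * \<delta>\<^sup>2"
        by (rule cauchy_riemann_estimate[OF hol r Mpos kf_le d])
      then show "cmod (?F X ?i - ?F X 0 - \<i> * (?F X ?d - ?F X 0)) \<le> (128 / r\<^sup>2 * \<delta>\<^sup>2) * M X" by (simp add: mult_ac)
    qed
    also have "\<dots> = (128 / r\<^sup>2 * (LINT X|lborel. M X)) * \<delta>\<^sup>2" by simp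
    finally show ?thesis .
  qed
  show ?thesis
    by (rule exI[of _ "r / 2"], rule conjI, use r in simp, rule exI[of _ "128 / r\<^sup>2 * (LINT X|lborel. M X)"]) (use main in blast)
qed

text \<open>Increments of second order mean derivative 0, and the cone is convex, so the segment
  between the two points stays inside.\<close>

lemma shifted_const:
  assumes f: "matrix_holomorphic_on f siegel_domain" "f \<in> L2 (siegel_measure l)" and eps: "\<epsilon> > 0"
    and Y: "Y0 \<in> (pos_cone :: 'n symmat set)" "Y1 \<in> pos_cone"
  shows "shifted f \<epsilon> \<xi> Y0 = shifted f \<epsilon> \<xi> Y1"
proof -
  let ?E = "Y1 - Y0"
  let ?h = "\<lambda>t. shifted f \<epsilon> \<xi> (Y0 + t *\<^sub>R ?E)"
  have "\<exists>c. \<forall>t\<in>{0..1}. ?h t = c"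
  proof (rule has_derivative_zero_constant)
    fix t :: real assume t: "t \<in> {0..1}"
    have "Y0 + t *\<^sub>R ?E \<in> pos_cone" using pos_cone_segment[OF Y] t by simp
    then obtain d C where d: "d > 0" "\<And>\<delta>. \<bar>\<delta>\<bar> < d \<Longrightarrow> cmod (shifted f \<epsilon> \<xi> ((Y0 + t *\<^sub>R ?E) + \<delta> *\<^sub>R ?E) - ?h t) \<le> C * \<delta>\<^sup>2"
      using shifted_step[OF f _ eps, of "Y0 + t *\<^sub>R ?E" \<xi> ?E] by blast
    show "(?h has_derivative (\<lambda>h. 0)) (at t within {0..1})"
    proof (rule has_derivativeI_sandwich[OF d(1)])
      fix s assume s: "s \<in> {0..1}" "s \<noteq> t" "dist s t < d"
      have "cmod (?h s - ?h t) \<le> C * (s - t)\<^sup>2"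
        using d(2)[of "s - t"] s by (simp add: dist_real_def algebra_simps)
      then show "norm (?h s - ?h t - 0) / norm (s - t) \<le> C * \<bar>s - t\<bar>"
        using s by (simp add: pos_divide_le_eq power2_eq_square mult.assoc abs_mult_self_eq)
    next
      have "((\<lambda>s. C * \<bar>s - t\<bar>) \<longlongrightarrow> C * \<bar>t - t\<bar>) (at t within {0..1})" by (intro tendsto_intros)
      then show "((\<lambda>s. C * \<bar>s - t\<bar>) \<longlongrightarrow> 0) (at t within {0..1})" by simp
    qed simp
  qed simp
  then obtain c where c: "\<And>t. t \<in> {0..1} \<Longrightarrow> ?h t = c" by blast
  from c[of 0] c[of 1] show ?thesis by simp
qed

end

subsection \<open>Fourier transforms of the slices\<close>

lemma L2_bounded_mult:
  assumes f: "f \<in> L2 M" and a [measurable]: "a \<in> borel_measurable M" and B: "\<And>x. cmod (a x) \<le> B" "0 \<le> B"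
  shows "(\<lambda>x. a x * f x) \<in> L2 M" "L2_norm M (\<lambda>x. a x * f x) \<le> B * L2_norm M f"
proof -
  note [measurable] = L2_measurable[OF f]
  have m: "(\<lambda>x. a x * f x) \<in> borel_measurable M" by measurable
  have "(\<integral>\<^sup>+x. ennreal ((cmod (a x * f x))\<^sup>2) \<partial>M) \<le> (\<integral>\<^sup>+x. ennreal (B\<^sup>2) * ennreal ((cmod (f x))\<^sup>2) \<partial>M)"
  proof (rule nn_integral_mono)
    fix x
    have "(cmod (a x * f x))\<^sup>2 \<le> B\<^sup>2 * (cmod (f x))\<^sup>2"
      unfolding norm_mult power_mult_distrib by (intro mult_right_mono power_mono B) auto
    then show "ennreal ((cmod (a x * f x))\<^sup>2) \<le> ennreal (B\<^sup>2) * ennreal ((cmod (f x))\<^sup>2)"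
      by (simp add: ennreal_mult[symmetric] ennreal_leI)
  qed
  also have "\<dots> = ennreal (B\<^sup>2) * (\<integral>\<^sup>+x. ennreal ((cmod (f x))\<^sup>2) \<partial>M)"
    by (rule nn_integral_cmult) measurable
  also have "\<dots> = ennreal ((B * L2_norm M f)\<^sup>2)"
    unfolding L2_nn_integral[OF f] by (simp add: ennreal_mult[symmetric] power_mult_distrib)
  finally have le: "(\<integral>\<^sup>+x. ennreal ((cmod (a x * f x))\<^sup>2) \<partial>M) \<le> ennreal ((B * L2_norm M f)\<^sup>2)" .
  have nn: "0 \<le> B * L2_norm M f" using B(2) by simp
  show "(\<lambda>x. a x * f x) \<in> L2 M" by (rule L2_I_nn_le(1)[OF m le nn])
  show "L2_norm M (\<lambda>x. a x * f x) \<le> B * L2_norm M f" by (rule L2_I_nn_le(2)[OF m le nn])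
qed

lemma L2_bounded_mult_tendsto:
  assumes f: "\<And>k. f k \<in> L2 M" "g \<in> L2 M" "(\<lambda>k. L2_norm M (\<lambda>x. f k x - g x)) \<longlonglongrightarrow> 0"
    and a: "a \<in> borel_measurable M" and B: "\<And>x. cmod (a x) \<le> B" "0 \<le> B"
  shows "(\<lambda>k. L2_norm M (\<lambda>x. a x * f k x - a x * g x)) \<longlonglongrightarrow> 0"
proof (rule tendsto_0_le[OF f(3), of _ B])
  have "L2_norm M (\<lambda>x. a x * f k x - a x * g x) \<le> L2_norm M (\<lambda>x. f k x - g x) * B" for k
    using L2_bounded_mult(2)[OF L2_diff[OF f(1)[of k] f(2)] a B] by (simp add: right_diff_distrib mult.commute)
  then show "\<forall>\<^sub>F k in sequentially. norm (L2_norm M (\<lambda>x. a x * f k x - a x * g x)) \<le> norm (L2_norm M (\<lambda>x. f k x - g x)) * B"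
    by simp
qed

context siegel
begin

lemma gker_factor:
  "gker \<epsilon> \<xi> X Y = of_real (exp (inner Y \<xi>)) * (cis (- 1 * (inner \<xi> X)) * gker \<epsilon> 0 X Y)"
  unfolding gker_def cis_conv_exp exp_of_real[symmetric] exp_add[symmetric]
  by (rule arg_cong[where f=exp]) (simp add: complex_eq_iff inner_commute)

lemma gker_L2:
  assumes eps: "\<epsilon> > 0"
  shows "(\<lambda>X. gker \<epsilon> 0 X Y) \<in> L2 lborel"
proof -
  have "integrable lborel (\<lambda>x :: 'n symmat. complex_of_real (exp (- (4 * \<epsilon>) * (norm x)\<^sup>2 / 2)))"
    using gaussian_FT(2)[of "4 * \<epsilon>" "0 :: 'n symmat"] eps by simp
  then have "integrable lborel (\<lambda>x :: 'n symmat. exp (- (4 * \<epsilon>) * (norm x)\<^sup>2 / 2))" by (simp only: complex_of_real_integrable_eq)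
  then have "integrable lborel (\<lambda>x :: 'n symmat. exp (2 * \<epsilon> * inner Y Y) * exp (- (4 * \<epsilon>) * (norm x)\<^sup>2 / 2))"
    by (rule integrable_mult_right)
  also have "(\<lambda>x :: 'n symmat. exp (2 * \<epsilon> * inner Y Y) * exp (- (4 * \<epsilon>) * (norm x)\<^sup>2 / 2)) = (\<lambda>x. (cmod (gker \<epsilon> 0 x Y))\<^sup>2)"
    by (simp add: cmod_gker fun_eq_iff exp_add[symmetric] exp_double[symmetric] power2_norm_eq_inner algebra_simps)
  finally show ?thesis
    unfolding L2_def using borel_measurable_continuous_onI[OF continuous_on_gker[of UNIV \<epsilon> 0 Y]] by simp
qed

text \<open>\<open>shifted\<close> is an integral defined at every \<xi>, whereas
  \<open>fourier_L2\<close> is fixed only almost everywhere. The damped slices are integrable and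
  converge to the slice in norm, so their transforms link the two.\<close>

lemma shifted_tendsto:
  assumes f: "matrix_holomorphic_on f siegel_domain" and Y: "Y \<in> (pos_cone :: 'n symmat set)"
    and u: "(\<lambda>X. f (siegel_point X Y)) \<in> L2 lborel"
  shows "\<exists>h. (\<forall>k. h k \<in> L2 lborel) \<and>
    (\<forall>k \<xi>. shifted f (1 / real (Suc k)) \<xi> Y = of_real (exp (inner Y \<xi>) * (2 * pi) powr (real DIM('n symmat) / 2)) * h k \<xi>) \<and>
    (\<lambda>k. L2_norm lborel (\<lambda>\<xi>. h k \<xi> - fourier_L2 (\<lambda>X. f (siegel_point X Y)) \<xi>)) \<longlonglongrightarrow> 0"
proof -
  define w where "w X = f (siegel_point X Y)" for X
  define v where "v k X = w X * gker (1 / real (Suc k)) 0 X Y" for k X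
  have wL: "w \<in> L2 lborel" using u unfolding w_def .
  have gm: "(\<lambda>X. gker (1 / real (Suc k)) 0 X Y) \<in> borel_measurable lborel" for k
    using L2_measurable[OF gker_L2[of "1 / real (Suc k)" Y]] by simp
  \<comment> \<open>Uniform in \<open>k\<close>, as the damping parameter never exceeds 1.\<close>
  have gb: "cmod (gker (1 / real (Suc k)) 0 X Y) \<le> exp (inner Y Y)" for k X
  proof -
    have "1 / real (Suc k) * inner Y Y \<le> 1 * inner Y Y" by (rule mult_right_mono) auto
    moreover have "0 \<le> 1 / real (Suc k) * inner X X" by simp
    ultimately have "inner Y 0 - 1 / real (Suc k) * (inner X X - inner Y Y) \<le> inner Y Y"
      unfolding right_diff_distrib inner_zero_right by linarith
    then show ?thesis unfolding cmod_gker by (simp only: exp_le_cancel_iff)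
  qed
  have vL: "v k \<in> L2 lborel" for k
    using L2_bounded_mult(1)[OF wL gm[of k] gb] by (simp add: v_def[abs_def] mult.commute)
  have vI: "integrable lborel (v k)" for k
  proof -
    have "(\<lambda>X. cnj (gker (1 / real (Suc k)) 0 X Y)) \<in> L2 lborel"
      using gker_L2[of "1 / real (Suc k)" Y] borel_measurable_continuous_onI[OF continuous_on_cnj[OF continuous_on_gker[of UNIV "1 / real (Suc k)" 0 Y]]]
      unfolding L2_def by simp
    from L2_mult_integrable[OF wL this] show ?thesis by (simp add: v_def[abs_def])
  qed
  have vt: "(\<lambda>k. L2_norm lborel (\<lambda>x. v k x - w x)) \<longlonglongrightarrow> 0"
  proof (rule L2_dominated_convergence(2)[where w="\<lambda>x. exp (inner Y Y) * cmod (w x)"])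
    show "v k \<in> borel_measurable lborel" for k by (rule L2_measurable[OF vL])
    show "w \<in> borel_measurable lborel" by (rule L2_measurable[OF wL])
    show "integrable lborel (\<lambda>x. (exp (inner Y Y) * cmod (w x))\<^sup>2)"
      unfolding power_mult_distrib by (rule integrable_mult_right[OF L2_integrable[OF wL]])
    show "AE x in lborel. cmod (v k x) \<le> exp (inner Y Y) * cmod (w x)" for k
      unfolding v_def norm_mult using gb by (intro AE_I2) (simp add: mult.commute[of "cmod (w _)"] mult_right_mono)
    show "AE x in lborel. (\<lambda>k. v k x) \<longlonglongrightarrow> w x"
    proof (rule AE_I2)
      fix X :: "'n symmat"
      have "(\<lambda>k. w X * gker (1 / real (Suc k)) 0 X Y) \<longlonglongrightarrow> w X * exp (- \<i> * (of_real (inner X 0) + \<i> * of_real (inner Y 0))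
     - of_real 0 * (of_real (inner X X - inner Y Y) + 2 * \<i> * of_real (inner X Y)))"
        unfolding gker_def by (intro tendsto_intros LIMSEQ_Suc[OF lim_1_over_n])
      then show "(\<lambda>k. v k X) \<longlonglongrightarrow> w X" by (simp add: v_def)
    qed
  qed
  define h where "h k = FT (- 1) (v k)" for k
  have hL: "h k \<in> L2 lborel" for k unfolding h_def by (rule FT_contraction(1)[OF vL vI]) simp
  have hs: "shifted f (1 / real (Suc k)) \<xi> Y = of_real (exp (inner Y \<xi>) * (2 * pi) powr (real DIM('n symmat) / 2)) * h k \<xi>" for k \<xi>
  proof -
    have one: "complex_of_real ((2 * pi) powr (real DIM('n symmat) / 2)) * of_real ((2 * pi) powr (- (real DIM('n symmat) / 2))) = 1"
      unfolding of_real_mult[symmetric] powr_add[symmetric] by simp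
    have "shifted f (1 / real (Suc k)) \<xi> Y = (LINT X|lborel. of_real (exp (inner Y \<xi>)) * (cis (- 1 * (inner \<xi> X)) * v k X))"
      unfolding shifted_def gker_factor[of _ \<xi>] v_def w_def by (simp only: mult_ac)
    also have "\<dots> = of_real (exp (inner Y \<xi>)) * (LINT X|lborel. cis (- 1 * (inner \<xi> X)) * v k X)"
      by (rule integral_mult_right_zero)
    also have "\<dots> = of_real (exp (inner Y \<xi>)) * ((complex_of_real ((2 * pi) powr (real DIM('n symmat) / 2)) * of_real ((2 * pi) powr (- (real DIM('n symmat) / 2)))) * (LINT X|lborel. cis (- 1 * (inner \<xi> X)) * v k X))"
      unfolding one mult_1_left ..
    finally show ?thesis unfolding h_def FT_def of_real_mult by (simp only: mult.assoc)
  qed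
  have "L2_norm lborel (\<lambda>\<xi>. fourier_L2 (v k) \<xi> - fourier_L2 w \<xi>) = L2_norm lborel (\<lambda>\<xi>. h k \<xi> - fourier_L2 w \<xi>)" for k
  proof (rule L2_norm_cong_AE)
    have T: "fourier_L2 (v k) \<in> L2 lborel" "fourier_L2 w \<in> L2 lborel"
      by (rule L2_operator_L2[OF FT.op vL], rule L2_operator_L2[OF FT.op wL])
    show "(\<lambda>\<xi>. fourier_L2 (v k) \<xi> - fourier_L2 w \<xi>) \<in> borel_measurable lborel"
      by (rule L2_measurable[OF L2_diff[OF T]])
    show "(\<lambda>\<xi>. h k \<xi> - fourier_L2 w \<xi>) \<in> borel_measurable lborel"
      by (rule L2_measurable[OF L2_diff[OF hL T(2)]])
    show "AE x in lborel. fourier_L2 (v k) x - fourier_L2 w x = h k x - fourier_L2 w x"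
      using FT.FT[OF vL vI] unfolding h_def by eventually_elim simp
  qed
  then have "(\<lambda>k. L2_norm lborel (\<lambda>\<xi>. h k \<xi> - fourier_L2 w \<xi>)) \<longlonglongrightarrow> 0"
    using L2_operator_tendsto[OF FT.op vL wL vt] by simp
  then show ?thesis using hL hs unfolding w_def[symmetric, abs_def] by (intro exI[of _ h]) auto
qed

text \<open>The damped integrals agree by \<open>shifted_const\<close>, and it remains to pass to
  the limit. The factor \<open>exp (inner Y \<xi>)\<close> may be unbounded, so limits in norm are
  taken on balls, countably many of which cover the space.\<close>

lemma slice_FT_eq:
  assumes f: "matrix_holomorphic_on f siegel_domain" "f \<in> L2 (siegel_measure l)"
    and Y: "Y0 \<in> (pos_cone :: 'n symmat set)" "Y1 \<in> pos_cone"
    and u: "(\<lambda>X. f (siegel_point X Y0)) \<in> L2 lborel" "(\<lambda>X. f (siegel_point X Y1)) \<in> L2 lborel"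
  shows "AE \<xi> in lborel. of_real (exp (inner Y0 \<xi>)) * fourier_L2 (\<lambda>X. f (siegel_point X Y0)) \<xi> =
    of_real (exp (inner Y1 \<xi>)) * fourier_L2 (\<lambda>X. f (siegel_point X Y1)) \<xi>"
proof -
  define c where "c = (2 * pi) powr (real DIM('n symmat) / 2)"
  have c: "c > 0" by (simp add: c_def)
  define t where "t Y = fourier_L2 (\<lambda>X. f (siegel_point X Y))" for Y :: "'n symmat"
  have tL: "t Y0 \<in> L2 lborel" "t Y1 \<in> L2 lborel"
    unfolding t_def by (rule L2_operator_L2[OF FT.op u(1)], rule L2_operator_L2[OF FT.op u(2)])
  obtain h0 where h0: "\<And>k. h0 k \<in> L2 lborel" "\<And>k \<xi>. shifted f (1 / real (Suc k)) \<xi> Y0 = of_real (exp (inner Y0 \<xi>) * c) * h0 k \<xi>"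
      "(\<lambda>k. L2_norm lborel (\<lambda>\<xi>. h0 k \<xi> - t Y0 \<xi>)) \<longlonglongrightarrow> 0"
    using shifted_tendsto[OF f(1) Y(1) u(1)] unfolding c_def t_def by blast
  obtain h1 where h1: "\<And>k. h1 k \<in> L2 lborel" "\<And>k \<xi>. shifted f (1 / real (Suc k)) \<xi> Y1 = of_real (exp (inner Y1 \<xi>) * c) * h1 k \<xi>"
      "(\<lambda>k. L2_norm lborel (\<lambda>\<xi>. h1 k \<xi> - t Y1 \<xi>)) \<longlonglongrightarrow> 0"
    using shifted_tendsto[OF f(1) Y(2) u(2)] unfolding c_def t_def by blast
  define a where "a m Y \<xi> = complex_of_real (indicator (cball 0 (real m)) \<xi> * (exp (inner Y \<xi>) * c))" for m :: nat and Y \<xi> :: "'n symmat"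
  have am: "a m Y \<in> borel_measurable lborel" for m Y
  proof -
    have "(\<lambda>\<xi>. exp (inner Y \<xi>) * c) \<in> borel_measurable borel"
      by (intro borel_measurable_continuous_onI continuous_intros)
    then have "(\<lambda>\<xi>. indicator (cball 0 (real m)) \<xi> * (exp (inner Y \<xi>) * c)) \<in> borel_measurable borel"
      by (intro borel_measurable_times borel_measurable_indicator) simp_all
    from measurable_compose[OF this of_real_borel] show ?thesis by (simp add: a_def[abs_def])
  qed
  have ab: "cmod (a m Y \<xi>) \<le> exp (norm Y * real m) * c" for m Y \<xi>
  proof (cases "\<xi> \<in> cball 0 (real m)")
    case True
    have "inner Y \<xi> \<le> norm Y * norm \<xi>" by (rule norm_cauchy_schwarz)
    also have "\<dots> \<le> norm Y * real m" using True by (intro mult_left_mono) auto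
    finally show ?thesis using c True by (simp add: a_def norm_mult)
  qed (use c in \<open>simp add: a_def\<close>)
  have B0: "0 \<le> exp (norm Y * real m) * c" for m and Y :: "'n symmat" using c by simp
  \<comment> \<open>On a ball the factors are bounded, so both families converge in norm; they are
    equal term by term, hence so are the limits.\<close>
  have "AE \<xi> in lborel. a m Y0 \<xi> * t Y0 \<xi> = a m Y1 \<xi> * t Y1 \<xi>" for m
  proof (rule L2_limit_unique)
    show "(\<lambda>\<xi>. a m Y0 \<xi> * h0 k \<xi>) \<in> L2 lborel" for k by (rule L2_bounded_mult(1)[OF h0(1) am ab B0])
    show "(\<lambda>\<xi>. a m Y0 \<xi> * t Y0 \<xi>) \<in> L2 lborel" by (rule L2_bounded_mult(1)[OF tL(1) am ab B0])
    show "(\<lambda>\<xi>. a m Y1 \<xi> * t Y1 \<xi>) \<in> L2 lborel" by (rule L2_bounded_mult(1)[OF tL(2) am ab B0])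
    show "(\<lambda>k. L2_norm lborel (\<lambda>\<xi>. a m Y0 \<xi> * h0 k \<xi> - a m Y0 \<xi> * t Y0 \<xi>)) \<longlonglongrightarrow> 0"
      by (rule L2_bounded_mult_tendsto[OF h0(1) tL(1) h0(3) am ab B0])
    have "a m Y0 \<xi> * h0 k \<xi> = a m Y1 \<xi> * h1 k \<xi>" for k \<xi>
      using h0(2)[of k \<xi>] h1(2)[of k \<xi>] shifted_const[OF f _ Y, of "1 / real (Suc k)" \<xi>]
      by (auto simp: a_def simp del: of_nat_Suc)
    then show "(\<lambda>k. L2_norm lborel (\<lambda>\<xi>. a m Y0 \<xi> * h0 k \<xi> - a m Y1 \<xi> * t Y1 \<xi>)) \<longlonglongrightarrow> 0"
      using L2_bounded_mult_tendsto[OF h1(1) tL(2) h1(3) am ab B0, of m Y1] by simp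
  qed
  then have "AE \<xi> in lborel. \<forall>m. a m Y0 \<xi> * t Y0 \<xi> = a m Y1 \<xi> * t Y1 \<xi>"
    unfolding AE_all_countable by (rule allI)
  then show ?thesis
    unfolding t_def[symmetric]
  proof eventually_elim
    case (elim \<xi>)
    obtain m :: nat where m: "norm \<xi> \<le> real m" using real_arch_simple by blast
    have "a m Y \<xi> = of_real (exp (inner Y \<xi>)) * of_real c" for Y using m by (simp add: a_def)
    then show ?case using elim[rule_format, of m] c by simp
  qed
qed

end

context lborel_pair_measure
begin

lemma L2_inner_slice_measurable:
  assumes u: "u \<in> L2 P" and v: "v \<in> L2 P"
  shows "(\<lambda>y. L2_inner lborel (\<lambda>x. u (x, y)) (\<lambda>x. v (x, y))) \<in> borel_measurable N"
proof -
  have "integrable P (\<lambda>(x, y). u (x, y) * cnj (v (x, y)))"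
    using L2_mult_integrable[OF u v] by (simp add: split_beta')
  from borel_measurable_integrable[OF integrable_snd[OF this]] show ?thesis
    by (simp add: L2_inner_def)
qed

end

section \<open>Recovering a holomorphic function from its slices\<close>

context siegel
begin

lemma pos_cone_nonempty: "(pos_cone :: 'n symmat set) \<noteq> {}"
proof -
  have "mat_of (Symmat (mat 1) :: 'n symmat) = mat 1" by (rule mat_of_Symmat) (rule transpose_mat)
  then have "(Symmat (mat 1) :: 'n symmat) \<in> pos_cone" by (simp add: pos_cone_def pos_def_mat_def)
  then show ?thesis by blast
qed

text \<open>The measure is not zero, since the squared kernel has integral 1 against it.\<close>

lemma AE_N_obtains:
  assumes "AE Y in N. Q Y"
  obtains Y where "Y \<in> (pos_cone :: 'n symmat set)" "Q Y"
proof -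
  have "\<exists>Y\<in>(pos_cone :: 'n symmat set). Q Y"
  proof (rule ccontr)
    assume no: "\<not> ?thesis"
    obtain \<xi> where xi: "\<xi> \<in> (pos_cone :: 'n symmat set)" using pos_cone_nonempty by blast
    have "AE Y in N. ennreal ((S_kernel l \<xi> Y)\<^sup>2) = 0"
      using assms AE_space by eventually_elim (use no in \<open>auto simp: space_cone_weighted\<close>)
    then have "(\<integral>\<^sup>+Y. ennreal ((S_kernel l \<xi> Y)\<^sup>2) \<partial>N) = (\<integral>\<^sup>+Y. 0 \<partial>N)" by (rule nn_integral_cong_AE)
    then show False using S_kernel_integral_N[OF xi] by simp
  qed
  then show ?thesis using that by blast
qed

lemma S_kernel_exp: "S_kernel l \<xi> Y = S_kernel l \<xi> 0 * exp (- inner \<xi> (Y :: 'n symmat))"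
  by (simp add: S_kernel_def)

lemma S_kernel_pos: "\<xi> \<in> (pos_cone :: 'n symmat set) \<Longrightarrow> 0 < S_kernel l \<xi> Y"
  using Gamma_pos(1) sdet_pos[of \<xi>] by (simp add: S_kernel_def)

text \<open>By Tonelli the integral over \<open>Y\<close> is the Laplace transform of the weight,
  which is infinite off the cone, so \<phi> vanishes almost everywhere there. On the cone, \<phi> is
  divided by the kernel at \<open>Y = 0\<close>, which is what the kernel contains besides its
  exponential in \<open>Y\<close>.\<close>

lemma S_op_preimage_of_laplace_L2:
  assumes phi: "\<phi> \<in> borel_measurable borel"
    and le: "(\<integral>\<^sup>+z. ennreal ((cmod (\<phi> (fst z) * of_real (exp (- inner (fst z) (snd z)))))\<^sup>2) \<partial>PN) \<le> ennreal (K\<^sup>2)" and K: "0 \<le> K"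
  shows "\<exists>g\<in>L2 (cone_lborel :: 'n symmat measure). L2_norm cone_lborel g \<le> K \<and>
    (AE \<xi> in lborel. \<forall>Y. S_op l g (\<xi>, Y) = \<phi> \<xi> * of_real (exp (- inner \<xi> Y)))"
proof -
  define E where "E z = ennreal ((cmod (\<phi> (fst z) * of_real (exp (- inner (fst z) (snd z)))))\<^sup>2)" for z :: "'n symmat \<times> 'n symmat"
  have leE: "(\<integral>\<^sup>+z. E z \<partial>PN) \<le> ennreal (K\<^sup>2)" using le by (simp only: E_def[abs_def])
  have exm: "(\<lambda>z :: 'n symmat \<times> 'n symmat. exp (- inner (fst z) (snd z))) \<in> borel_measurable (borel \<Otimes>\<^sub>M borel)"
    by measurable
  have Em: "E \<in> borel_measurable PN"
  proof (rule borel_pair_PN)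
    note [measurable] = phi exm measurable_compose[OF exm of_real_borel]
    show "E \<in> borel_measurable (borel \<Otimes>\<^sub>M borel)" unfolding E_def by measurable
  qed
  have fub: "(\<integral>\<^sup>+\<xi>. \<integral>\<^sup>+Y. E (\<xi>, Y) \<partial>N \<partial>lborel) = (\<integral>\<^sup>+z. E z \<partial>PN)" by (rule M2.nn_integral_fst[OF Em])
  have inner_int: "(\<integral>\<^sup>+Y. E (\<xi>, Y) \<partial>N) = ennreal ((cmod (\<phi> \<xi>))\<^sup>2) * (\<integral>\<^sup>+Y. ennreal (exp (- inner \<xi> (2 *\<^sub>R Y))) \<partial>N)" for \<xi>
  proof -
    have "E (\<xi>, Y) = ennreal ((cmod (\<phi> \<xi>))\<^sup>2) * ennreal (exp (- inner \<xi> (2 *\<^sub>R Y)))" for Y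
      by (simp add: E_def norm_mult power_mult_distrib ennreal_mult exp_double[symmetric])
    moreover have "(\<lambda>Y. ennreal (exp (- inner \<xi> (2 *\<^sub>R Y)))) \<in> borel_measurable N"
      by (rule measurable_cone_weighted) measurable
    ultimately show ?thesis by (simp add: nn_integral_cmult)
  qed
  have "(\<integral>\<^sup>+\<xi>. \<integral>\<^sup>+Y. E (\<xi>, Y) \<partial>N \<partial>lborel) \<noteq> \<infinity>"
    unfolding fub using leE by (auto simp: top_unique)
  then have "AE \<xi> in lborel. (\<integral>\<^sup>+Y. E (\<xi>, Y) \<partial>N) \<noteq> \<infinity>"
    by (rule nn_integral_PInf_AE[rotated]) (rule M2.borel_measurable_nn_integral_fst[OF Em])
  then have van: "AE \<xi> in lborel. \<xi> \<notin> pos_cone \<longrightarrow> \<phi> \<xi> = 0"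
  proof eventually_elim
    case (elim \<xi>)
    then show ?case unfolding inner_int laplace_N by (auto simp: ennreal_mult_eq_top_iff split: if_splits)
  qed
  define g where "g \<xi> = \<phi> \<xi> / of_real (S_kernel l \<xi> 0)" for \<xi>
  have S: "S_op l g (\<xi>, Y) = indicator pos_cone \<xi> * (\<phi> \<xi> * of_real (exp (- inner \<xi> Y)))" for \<xi> Y
  proof (cases "\<xi> \<in> pos_cone")
    case True
    then have "S_kernel l \<xi> 0 \<noteq> 0" using S_kernel_pos[OF True, of 0] by simp
    then show ?thesis using True by (simp add: S_op_eq g_def S_kernel_exp[of \<xi> Y])
  qed (simp add: S_op_eq)
  let ?g = "\<lambda>x. indicator pos_cone x * g x"
  have gm: "?g \<in> borel_measurable lborel"
  proof -
    have "(\<lambda>\<xi> :: 'n symmat. S_kernel l \<xi> 0) \<in> borel_measurable borel" unfolding S_kernel_def by measurable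
    from measurable_compose[OF this of_real_borel] have "(\<lambda>\<xi> :: 'n symmat. complex_of_real (S_kernel l \<xi> 0)) \<in> borel_measurable borel" .
    then have "g \<in> borel_measurable borel" unfolding g_def[abs_def] by (rule borel_measurable_divide[OF phi])
    then have "?g \<in> borel_measurable borel" by (intro borel_measurable_times borel_measurable_indicator pos_cone_borel)
    then show ?thesis by simp
  qed
  have gle: "(\<integral>\<^sup>+x. ennreal ((cmod (?g x))\<^sup>2) \<partial>lborel) \<le> ennreal (K\<^sup>2)"
  proof -
    have "(\<integral>\<^sup>+x. ennreal ((cmod (?g x))\<^sup>2) \<partial>lborel) \<le> (\<integral>\<^sup>+\<xi>. \<integral>\<^sup>+Y. E (\<xi>, Y) \<partial>N \<partial>lborel)"
    proof (rule nn_integral_mono)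
      fix \<xi> :: "'n symmat"
      show "ennreal ((cmod (?g \<xi>))\<^sup>2) \<le> (\<integral>\<^sup>+Y. E (\<xi>, Y) \<partial>N)"
      proof (cases "\<xi> \<in> pos_cone")
        case True
        have "(\<lambda>Y. S_kernel l \<xi> Y) \<in> borel_measurable borel" unfolding S_kernel_def by measurable
        then have Sm: "(\<lambda>Y. ennreal ((S_kernel l \<xi> Y)\<^sup>2)) \<in> borel_measurable N"
          by (intro measurable_cone_weighted) measurable
        have "ennreal ((cmod (?g \<xi>))\<^sup>2) = ennreal ((cmod (g \<xi>))\<^sup>2) * (\<integral>\<^sup>+Y. ennreal ((S_kernel l \<xi> Y)\<^sup>2) \<partial>N)"
          using True by (simp add: S_kernel_integral_N[OF True])
        also have "\<dots> = (\<integral>\<^sup>+Y. ennreal ((cmod (g \<xi>))\<^sup>2) * ennreal ((S_kernel l \<xi> Y)\<^sup>2) \<partial>N)"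
          by (rule nn_integral_cmult[OF Sm, symmetric])
        also have "\<dots> = (\<integral>\<^sup>+Y. E (\<xi>, Y) \<partial>N)"
        proof (rule nn_integral_cong)
          fix Y
          have "g \<xi> * of_real (S_kernel l \<xi> Y) = \<phi> \<xi> * of_real (exp (- inner \<xi> Y))"
            using S[of \<xi> Y] True by (simp add: S_op_eq)
          then have "E (\<xi>, Y) = ennreal ((cmod (g \<xi> * of_real (S_kernel l \<xi> Y)))\<^sup>2)" by (simp only: E_def fst_conv snd_conv)
          then show "ennreal ((cmod (g \<xi>))\<^sup>2) * ennreal ((S_kernel l \<xi> Y)\<^sup>2) = E (\<xi>, Y)"
            by (simp add: norm_mult power_mult_distrib ennreal_mult)
        qed
        finally show ?thesis by simp
      qed simp
    qed
    also have "\<dots> \<le> ennreal (K\<^sup>2)" unfolding fub by (rule leE)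
    finally show ?thesis .
  qed
  have "g \<in> L2 cone_lborel" using L2_I_nn_le(1)[OF gm gle K] by (simp only: L2_cone_lborel_iff(1))
  moreover have "L2_norm cone_lborel g \<le> K" using L2_I_nn_le(2)[OF gm gle K] by (simp only: L2_cone_lborel_iff(2))
  moreover have "AE \<xi> in lborel. \<forall>Y. S_op l g (\<xi>, Y) = \<phi> \<xi> * of_real (exp (- inner \<xi> Y))"
    using van by eventually_elim (auto simp: S indicator_def)
  ultimately show ?thesis by blast
qed

text \<open>Equality is detected by norms: the candidate \<open>J\<close> has norm at most
  \<open>K\<close>, while its inner product with \<open>f\<close> is the square of \<open>K\<close>,
  the norm of \<open>f\<close>. Hence the difference has norm 0.\<close>

lemma holomorphic_in_range:
  assumes f: "matrix_holomorphic_on f siegel_domain" "f \<in> L2 (siegel_measure l)"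
  shows "\<exists>g\<in>L2 (cone_lborel :: 'n symmat measure). AE Z in siegel_measure l. f Z = R_adj_integral l g Z"
proof -
  have fm: "f \<in> borel_measurable (restrict_space borel siegel_domain)"
    using L2_measurable[OF f(2)] by (simp only: borel_measurable_siegel_iff)
  define u where "u z = f (spt z)" for z
  have uL: "u \<in> L2 PN" using L2_siegel(1)[OF fm] f(2) by (simp add: u_def[abs_def])
  define K where "K = L2_norm PN u"
  have fK: "L2_norm (siegel_measure l) f = K" unfolding K_def u_def[abs_def] by (rule L2_siegel(2)[OF fm])
  define uY where "uY Y X = u (X, Y)" for Y X
  have uY: "uY Y = (\<lambda>X. f (siegel_point X Y))" for Y by (simp add: uY_def u_def fun_eq_iff)
  have good: "AE Y in N. Y \<in> pos_cone \<and> uY Y \<in> L2 lborel"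
    using L2_slice[OF uL] AE_space[of N] by eventually_elim (simp add: space_cone_weighted uY_def[abs_def])
  obtain Y0 where Y0: "Y0 \<in> pos_cone" "uY Y0 \<in> L2 lborel" by (rule AE_N_obtains[OF good]) blast
  \<comment> \<open>By \<open>slice_FT_eq\<close> every other square-integrable slice gives the same
    function almost everywhere.\<close>
  define \<phi> where "\<phi> \<xi> = of_real (exp (inner Y0 \<xi>)) * fourier_L2 (uY Y0) \<xi>" for \<xi>
  have expm: "(\<lambda>\<xi>. complex_of_real (exp (inner Y \<xi>))) \<in> borel_measurable borel" for Y :: "'n symmat"
    by (intro borel_measurable_continuous_onI continuous_intros)
  have phim: "\<phi> \<in> borel_measurable borel"
    unfolding \<phi>_def[abs_def] using L2_measurable[OF L2_operator_L2[OF FT.op Y0(2)]] expm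
    by (intro borel_measurable_times) simp_all
  have phiT: "AE \<xi> in lborel. \<phi> \<xi> * of_real (exp (- inner \<xi> Y)) = fourier_L2 (uY Y) \<xi>" if Y: "Y \<in> pos_cone" "uY Y \<in> L2 lborel" for Y
    using slice_FT_eq[OF f Y0(1) Y(1) Y0(2)[unfolded uY] Y(2)[unfolded uY]]
  proof eventually_elim
    case (elim \<xi>)
    have "complex_of_real (exp (inner Y \<xi>)) * of_real (exp (- inner \<xi> Y)) = 1"
      unfolding of_real_mult[symmetric] exp_add[symmetric] by (simp add: inner_commute)
    moreover have "(a * t) * b = t" if "a * b = 1" for a b t :: complex
    proof -
      have "(a * t) * b = (a * b) * t" by (simp only: mult_ac)
      then show ?thesis using that by simp
    qed
    ultimately show ?case unfolding \<phi>_def uY elim by blast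
  qed
  let ?E = "\<lambda>z. ennreal ((cmod (\<phi> (fst z) * of_real (exp (- inner (fst z) (snd z)))))\<^sup>2)"
  have exm: "(\<lambda>z :: 'n symmat \<times> 'n symmat. exp (- inner (fst z) (snd z))) \<in> borel_measurable (borel \<Otimes>\<^sub>M borel)"
    by measurable
  have Em: "?E \<in> borel_measurable PN"
  proof (rule borel_pair_PN)
    note [measurable] = phim measurable_compose[OF exm of_real_borel]
    show "?E \<in> borel_measurable (borel \<Otimes>\<^sub>M borel)" by measurable
  qed
  \<comment> \<open>Plancherel on almost every slice identifies this integral with the squared norm
    of \<open>f\<close>.\<close>
  have "(\<integral>\<^sup>+z. ?E z \<partial>PN) = (\<integral>\<^sup>+Y. \<integral>\<^sup>+\<xi>. ?E (\<xi>, Y) \<partial>lborel \<partial>N)" by (rule nn_integral_snd[OF Em, symmetric])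
  also have "\<dots> = (\<integral>\<^sup>+Y. \<integral>\<^sup>+X. ennreal ((cmod (u (X, Y)))\<^sup>2) \<partial>lborel \<partial>N)"
  proof (rule nn_integral_cong_AE)
    show "AE Y in N. (\<integral>\<^sup>+\<xi>. ?E (\<xi>, Y) \<partial>lborel) = (\<integral>\<^sup>+X. ennreal ((cmod (u (X, Y)))\<^sup>2) \<partial>lborel)"
      using good
    proof eventually_elim
      case (elim Y)
      then have Y: "Y \<in> pos_cone" "uY Y \<in> L2 lborel" by auto
      have "(\<integral>\<^sup>+\<xi>. ?E (\<xi>, Y) \<partial>lborel) = (\<integral>\<^sup>+\<xi>. ennreal ((cmod (fourier_L2 (uY Y) \<xi>))\<^sup>2) \<partial>lborel)"
        by (rule nn_integral_cong_AE) (use phiT[OF Y] in eventually_elim, simp only: fst_conv snd_conv)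
      also have "\<dots> = (\<integral>\<^sup>+X. ennreal ((cmod (uY Y X))\<^sup>2) \<partial>lborel)"
        unfolding L2_nn_integral[OF Y(2)] L2_nn_integral[OF L2_operator_L2[OF FT.op Y(2)]] FT.isometry[OF Y(2)] ..
      finally show ?case by (simp only: uY_def)
    qed
  qed
  also have "\<dots> = (\<integral>\<^sup>+z. ennreal ((cmod (u z))\<^sup>2) \<partial>PN)"
  proof -
    note [measurable] = L2_measurable[OF uL]
    show ?thesis by (rule nn_integral_snd) measurable
  qed
  also have "\<dots> = ennreal (K\<^sup>2)" unfolding K_def by (rule L2_nn_integral[OF uL])
  finally have EK: "(\<integral>\<^sup>+z. ?E z \<partial>PN) \<le> ennreal (K\<^sup>2)" by simp
  have K0: "0 \<le> K" by (simp add: K_def)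
  obtain g where g: "g \<in> L2 (cone_lborel :: 'n symmat measure)" "L2_norm cone_lborel g \<le> K"
      "AE \<xi> in lborel. \<forall>Y. S_op l g (\<xi>, Y) = \<phi> \<xi> * of_real (exp (- inner \<xi> Y))"
    using S_op_preimage_of_laplace_L2[OF phim EK K0] by blast
  define J where "J = R_adj_integral l g"
  have JL: "J \<in> L2 (siegel_measure l)" "L2_norm (siegel_measure l) J \<le> K"
    unfolding J_def R_adj_integral_L2(2)[OF g(1)] by (rule R_adj_integral_L2(1)[OF g(1)], rule g(2))
  have Jm: "J \<in> borel_measurable (restrict_space borel siegel_domain)"
    using L2_measurable[OF JL(1)] by (simp only: borel_measurable_siegel_iff)
  define v where "v z = J (spt z)" for z
  have vL: "v \<in> L2 PN" using L2_siegel(1)[OF Jm] JL(1) by (simp add: v_def[abs_def])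
  have "L2_inner (siegel_measure l) f J = L2_inner PN u v"
    unfolding u_def[abs_def] v_def[abs_def] by (rule L2_inner_siegel[OF fm Jm])
  also have "\<dots> = (LINT Y|N. L2_inner lborel (\<lambda>X. u (X, Y)) (\<lambda>X. v (X, Y)))" by (rule L2_inner_iterated[OF uL vL])
  \<comment> \<open>Slice by slice, the multiplication formula moves the transform from the slice of
    \<open>S_op l g\<close> to the slice of \<open>f\<close>; there the two functions to be paired
    coincide, and isometry returns to \<open>u\<close>.\<close>
  also have "\<dots> = (LINT Y|N. L2_inner lborel (\<lambda>X. u (X, Y)) (\<lambda>X. u (X, Y)))"
  proof (rule integral_cong_AE)
    show "(\<lambda>Y. L2_inner lborel (\<lambda>X. u (X, Y)) (\<lambda>X. v (X, Y))) \<in> borel_measurable N" by (rule L2_inner_slice_measurable[OF uL vL])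
    show "(\<lambda>Y. L2_inner lborel (\<lambda>X. u (X, Y)) (\<lambda>X. u (X, Y))) \<in> borel_measurable N" by (rule L2_inner_slice_measurable[OF uL uL])
    show "AE Y in N. L2_inner lborel (\<lambda>X. u (X, Y)) (\<lambda>X. v (X, Y)) = L2_inner lborel (\<lambda>X. u (X, Y)) (\<lambda>X. u (X, Y))"
      using good
    proof eventually_elim
      case (elim Y)
      then have Y: "Y \<in> pos_cone" "uY Y \<in> L2 lborel" by auto
      define T where "T = fourier_L2 (uY Y)"
      define s where "s \<xi> = S_op l g (\<xi>, Y)" for \<xi>
      have TL: "T \<in> L2 lborel" unfolding T_def by (rule L2_operator_L2[OF FT.op Y(2)])
      have sI: "integrable lborel s" unfolding s_def[abs_def] by (rule S_op_slice_integrable[OF g(1) Y(1)])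
      have Ts: "AE \<xi> in lborel. T \<xi> = s \<xi>"
        using g(3) phiT[OF Y] by eventually_elim (simp add: T_def s_def)
      have sL: "s \<in> L2 lborel" by (rule L2_cong_AE[OF TL borel_measurable_integrable[OF sI] Ts])
      have "L2_inner lborel (uY Y) (FT (- (- 1)) s) = L2_inner lborel T s"
        unfolding T_def by (rule FT.multiplication[OF Y(2) sL sI, symmetric])
      also have "\<dots> = L2_inner lborel s s"
        by (rule L2_inner_cong_AE[OF L2_measurable[OF TL] L2_measurable[OF sL] Ts L2_measurable[OF sL]])
      also have "\<dots> = of_real ((L2_norm lborel T)\<^sup>2)"
        unfolding L2_inner_self L2_norm_cong_AE[OF L2_measurable[OF TL] L2_measurable[OF sL] Ts] ..
      also have "\<dots> = L2_inner lborel (uY Y) (uY Y)" unfolding T_def FT.isometry[OF Y(2)] L2_inner_self ..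
      finally have "L2_inner lborel (uY Y) (FT 1 s) = L2_inner lborel (uY Y) (uY Y)" by simp
      moreover have "(\<lambda>X. v (X, Y)) = FT 1 s"
        by (simp add: fun_eq_iff v_def J_def R_adj_integral_spt(1)[OF Y(1) g(1)] partial_FT_def s_def[abs_def])
      ultimately show ?case by (simp only: uY_def[abs_def])
    qed
  qed
  also have "\<dots> = L2_inner PN u u" by (rule L2_inner_iterated[OF uL uL, symmetric])
  also have "\<dots> = of_real (K\<^sup>2)" unfolding K_def by (rule L2_inner_self)
  finally have inner_fJ: "L2_inner (siegel_measure l) f J = of_real (K\<^sup>2)" .
  have mJ: "(\<lambda>x. - 1 * J x) \<in> L2 (siegel_measure l)" by (rule L2_scale[OF JL(1)])
  have "(L2_norm (siegel_measure l) (\<lambda>x. f x + - 1 * J x))\<^sup>2 =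
      (L2_norm (siegel_measure l) f)\<^sup>2 + (L2_norm (siegel_measure l) (\<lambda>x. - 1 * J x))\<^sup>2 + 2 * Re (L2_inner (siegel_measure l) f (\<lambda>x. - 1 * J x))"
    by (rule L2_norm_add_sq[OF f(2) mJ])
  also have "L2_inner (siegel_measure l) f (\<lambda>x. - 1 * J x) = - of_real (K\<^sup>2)"
    using L2_inner_lincomb_right[OF JL(1) JL(1) f(2), of "- 1" 0] inner_fJ by simp
  also have "L2_norm (siegel_measure l) (\<lambda>x. - 1 * J x) = L2_norm (siegel_measure l) J" unfolding L2_norm_scale by simp
  finally have "(L2_norm (siegel_measure l) (\<lambda>x. f x - J x))\<^sup>2 = (L2_norm (siegel_measure l) J)\<^sup>2 - K\<^sup>2"
    unfolding fK by simp
  also have "\<dots> \<le> 0" using power_mono[OF JL(2) L2_norm_nonneg, of 2] by simp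
  finally have "L2_norm (siegel_measure l) (\<lambda>x. f x - J x) = 0" by simp
  then have "AE Z in siegel_measure l. f Z = J Z" using L2_AE_eq_iff[OF f(2) JL(1)] by simp
  then show ?thesis using g(1) unfolding J_def by blast
qed

end

text \<open>A member of the Bergman space only agrees almost everywhere with a holomorphic function,
  and it is this representative to which \<open>holomorphic_in_range\<close> applies.\<close>

lemma (in siegel) bergman_space_eq:
  "bergman_space l = {f \<in> L2 (siegel_measure l). \<exists>g\<in>L2 (cone_lborel :: 'n symmat measure). AE Z in siegel_measure l. f Z = R_adj_integral l g Z}"
proof (rule set_eqI, rule iffI)
  fix f :: "complex^'n^'n \<Rightarrow> complex"
  assume "f \<in> bergman_space l"
  then obtain h where h: "f \<in> L2 (siegel_measure l)" "matrix_holomorphic_on h siegel_domain" "AE Z in siegel_measure l. f Z = h Z"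
    unfolding bergman_space_def by blast
  have hL: "h \<in> L2 (siegel_measure l)"
  proof (rule L2_cong_AE[OF h(1) _ h(3)])
    show "h \<in> borel_measurable (siegel_measure l)"
      using matrix_holomorphic_measurable(2)[OF h(2)] by (simp only: borel_measurable_siegel_iff)
  qed
  obtain g where g: "g \<in> L2 (cone_lborel :: 'n symmat measure)" "AE Z in siegel_measure l. h Z = R_adj_integral l g Z"
    using holomorphic_in_range[OF h(2) hL] by blast
  have "AE Z in siegel_measure l. f Z = R_adj_integral l g Z"
    using h(3) g(2) by eventually_elim simp
  then show "f \<in> {f \<in> L2 (siegel_measure l). \<exists>g\<in>L2 (cone_lborel :: 'n symmat measure). AE Z in siegel_measure l. f Z = R_adj_integral l g Z}"
    using h(1) g(1) by blast
next
  fix f :: "complex^'n^'n \<Rightarrow> complex"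
  assume "f \<in> {f \<in> L2 (siegel_measure l). \<exists>g\<in>L2 (cone_lborel :: 'n symmat measure). AE Z in siegel_measure l. f Z = R_adj_integral l g Z}"
  then show "f \<in> bergman_space l"
    unfolding bergman_space_def using R_adj_integral_holomorphic by blast
qed

text \<open>As \<open>R_adj l f\<close> is determined only up to null sets, the formula at every
  \<open>Z\<close> takes the form of three facts: convergence of the integral at each point,
  holomorphy, and agreement almost everywhere.\<close>

theorem theorem6p7:
  fixes l :: real
  assumes "l > real CARD('n::finite)"
  shows
    "L2_partial_isometry (siegel_measure l) cone_lborel
       (R_op l :: (complex^'n^'n \<Rightarrow> complex) \<Rightarrow> ('n symmat \<Rightarrow> complex))
       (bergman_space l) (L2 cone_lborel)
     \<and> L2_isometry cone_lborel (siegel_measure l)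
       (R_adj l :: ('n symmat \<Rightarrow> complex) \<Rightarrow> (complex^'n^'n \<Rightarrow> complex))
     \<and> L2_range cone_lborel (siegel_measure l)
       (R_adj l :: ('n symmat \<Rightarrow> complex) \<Rightarrow> (complex^'n^'n \<Rightarrow> complex)) = bergman_space l
     \<and> (\<forall>f \<in> L2 (cone_lborel :: 'n symmat measure).
          (\<forall>Z \<in> siegel_domain. integrable cone_lborel (R_adj_integrand l f Z))
          \<and> matrix_holomorphic_on (R_adj_integral l f) siegel_domain
          \<and> (AE Z in siegel_measure l. R_adj l f Z = R_adj_integral l f Z))"
proof -
  interpret siegel l "TYPE('n)" by (rule siegel.intro) (rule assms)
  let ?J = "R_adj_integral l :: ('n symmat \<Rightarrow> complex) \<Rightarrow> (complex^'n^'n \<Rightarrow> complex)"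
  have lin: "AE Z in siegel_measure l. ?J (\<lambda>x. a * f x + b * g x) Z = a * ?J f Z + b * ?J g Z"
    if "f \<in> L2 cone_lborel" "g \<in> L2 cone_lborel" for f g a b
    by (rule AE_I2, rule R_adj_integral_lincomb[OF that]) (simp add: space_siegel_measure)
  note main = partial_isometry_of_isometric_adjoint[where J="?J" and R="R_op l",
      OF R_adj_integral_L2(1) R_adj_integral_L2(2) lin R_op(1) R_adj_integral_L2(3) bergman_space_eq]
  have "integrable cone_lborel (R_adj_integrand l f Z)"
    if f: "f \<in> L2 (cone_lborel :: 'n symmat measure)" and Z: "Z \<in> siegel_domain" for f Z
  proof -
    obtain X Y where "Z = siegel_point X Y" "Y \<in> (pos_cone :: 'n symmat set)" by (rule siegel_domain_cases[OF Z])
    then show ?thesis using R_adj_integral_spt(2)[OF _ f] by simp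
  qed
  moreover have "matrix_holomorphic_on (?J f) siegel_domain" if "f \<in> L2 cone_lborel" for f
    by (rule R_adj_integral_holomorphic[OF that])
  ultimately show ?thesis
    unfolding R_adj_def using main by blast
qed

end
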